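(* Let $\mu\in\mathbb{R}$, $\sigma>0$, $p\in[1/2,1)$ and $x>0$. Let $X$ be the CEV diffusion with these parameters started at $X_0=x$, and for $\delta>0$ let $X^\delta$ be its piecewise linearly interpolated Euler–Maruyama approximation with time step $\delta$ started at $X^\delta_0=x$ (both defined in the context). Then for any $\beta\in\left(0,\frac{1/2}{1-p}\right)$, the random variables $\tau_{\delta^\beta}(X^\delta)$ converge weakly to $\tau_0(X)$ as $\delta\to0$, i.e. $$\lim_{\delta\to0}\mathsf{E} f\big(\tau_{\delta^\beta}(X^\delta)\big)=\mathsf{E} f\big(\tau_0(X)\big)$$ for every bounded continuous function $f:\bar{\mathbb{R}}_+\to\mathbb{R}$.
   Context: CEV diffusion: $X=(X_t)_{t\ge0}$ is the unique strong solution of the Itô SDE $dX_t=\mu X_t\,dt+\sigma X_t^p\,dB_t$, $X_0=x$, where $B$ is a Brownian motion on a filtered probability space satisfying the usual conditions. It takes values in $[0,\infty)$ and $\{0\}$ is an absorbing boundary. Euler–Maruyama approximation: for $\delta>0$ and grid points $t_j=j\delta$, $j=0,1,2,\dots$, the process $X^\delta$ is defined by $X^\delta_0=x$, $$X^\delta_{t_j}=X^\delta_{t_{j-1}}+\mu\big(X^\delta_{t_{j-1}}\big)^+\delta+\sigma\Big(\big(X^\delta_{t_{j-1}}\big)^+\Big)^p\xi_j\sqrt{\delta},\quad j\ge1,$$ where $y^+=\max(0,y)$ and $(\xi_j)$ are i.i.d. $N(0,1)$ random variables, and between grid points by linear interpolation $$X^\delta_t=\frac{t-t_{j-1}}{\delta}X^\delta_{t_j}+\frac{t_j-t}{\delta}X^\delta_{t_{j-1}},\quad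 t\in[t_{j-1},t_j].$$ Hitting times: for a continuous path $u:[0,\infty)\to\mathbb{R}$ and $\ell\in\mathbb{R}$, $\tau_\ell(u)=\inf\{t\ge0:u_t=\ell\}$ with $\inf\emptyset=\infty$. These take values in $\bar{\mathbb{R}}_+=[0,\infty)\cup\{\infty\}$, endowed with the metric $\rho(s,t)=|\arctan(s)-\arctan(t)|$ (where $\arctan(\infty)=\pi/2$). *)

theory Defs
  imports "HOL-Probability.Probability" "HOL-Probability.Stopping_Time"
begin

text \<open>
  Continuous-time processes are functions \<open>real \<Rightarrow> 'a \<Rightarrow> real\<close>, of which only the times
  \<open>t \<ge> 0\<close> matter. The library's \<open>filtration\<close> is indexed by all reals; its members at
  negative times play no role.
\<close>

definition usual_conditions :: "'a measure \<Rightarrow> (real \<Rightarrow> 'a measure) \<Rightarrow> bool" where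
  "usual_conditions M F \<longleftrightarrow>
     prob_space M \<and> complete_measure M \<and>
     filtration (space M) F \<and> (\<forall>t. sets (F t) \<subseteq> sets M) \<and>
     null_sets M \<subseteq> sets (F 0) \<and>
     (\<forall>t\<ge>0. sets (F t) = (\<Inter>s\<in>{t<..}. sets (F s)))"

definition adapted :: "(real \<Rightarrow> 'a measure) \<Rightarrow> (real \<Rightarrow> 'a \<Rightarrow> real) \<Rightarrow> bool" where
  "adapted F X \<longleftrightarrow> (\<forall>t\<ge>0. X t \<in> borel_measurable (F t))"

definition continuous_paths :: "'a measure \<Rightarrow> (real \<Rightarrow> 'a \<Rightarrow> real) \<Rightarrow> bool" where
  "continuous_paths M X \<longleftrightarrow> (\<forall>\<omega>\<in>space M. continuous_on {0..} (\<lambda>t. X t \<omega>))"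

definition progressive :: "(real \<Rightarrow> 'a measure) \<Rightarrow> (real \<Rightarrow> 'a \<Rightarrow> real) \<Rightarrow> bool" where
  "progressive F H \<longleftrightarrow>
     (\<forall>T\<ge>0. (\<lambda>(t, \<omega>). H t \<omega>) \<in> borel_measurable (restrict_space borel {0..T} \<Otimes>\<^sub>M F T))"

definition brownian_motion ::
  "'a measure \<Rightarrow> (real \<Rightarrow> 'a measure) \<Rightarrow> (real \<Rightarrow> 'a \<Rightarrow> real) \<Rightarrow> bool" where
  "brownian_motion M F B \<longleftrightarrow>
     adapted F B \<and> continuous_paths M B \<and> (AE \<omega> in M. B 0 \<omega> = 0) \<and>
     (\<forall>s t. 0 \<le> s \<and> s < t \<longrightarrow>
        distributed M lborel (\<lambda>\<omega>. B t \<omega> - B s \<omega>) (normal_density 0 (sqrt (t - s))) \<and>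
        prob_space.indep_set M (sets (F s))
          (sets (vimage_algebra (space M) (\<lambda>\<omega>. B t \<omega> - B s \<omega>) borel)))"


text \<open>
  A simple integrand \<open>\<Sum>i<n. \<eta>\<^sub>i 1\<^bsub>(s\<^sub>i, s\<^sub>i\<^sub>+\<^sub>1]\<^esub>\<close> is encoded by the triple \<open>(n, s, \<eta>)\<close>, with \<open>\<eta>\<^sub>i\<close>
  bounded and measurable with respect to the information available at time \<open>s\<^sub>i\<close>.
\<close>

definition simple_integrand ::
  "'a measure \<Rightarrow> (real \<Rightarrow> 'a measure) \<Rightarrow> nat \<Rightarrow> (nat \<Rightarrow> real) \<Rightarrow> (nat \<Rightarrow> 'a \<Rightarrow> real) \<Rightarrow> bool" where
  "simple_integrand M F n s \<eta> \<longleftrightarrow>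
     0 \<le> s 0 \<and> (\<forall>i<n. s i \<le> s (Suc i)) \<and>
     (\<forall>i<n. \<eta> i \<in> borel_measurable (F (s i)) \<and> (\<exists>C. \<forall>\<omega>\<in>space M. \<bar>\<eta> i \<omega>\<bar> \<le> C))"

definition simple_process ::
  "nat \<Rightarrow> (nat \<Rightarrow> real) \<Rightarrow> (nat \<Rightarrow> 'a \<Rightarrow> real) \<Rightarrow> real \<Rightarrow> 'a \<Rightarrow> real" where
  "simple_process n s \<eta> t \<omega> = (\<Sum>i<n. \<eta> i \<omega> * indicator {s i<..s (Suc i)} t)"

definition simple_ito_integral ::
  "(real \<Rightarrow> 'a \<Rightarrow> real) \<Rightarrow> nat \<Rightarrow> (nat \<Rightarrow> real) \<Rightarrow> (nat \<Rightarrow> 'a \<Rightarrow> real) \<Rightarrow> real \<Rightarrow> 'a \<Rightarrow> real" where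
  "simple_ito_integral B n s \<eta> t \<omega> =
     (\<Sum>i<n. \<eta> i \<omega> * (B (min t (s (Suc i))) \<omega> - B (min t (s i)) \<omega>))"

text \<open>
  \<open>I\<close> is a continuous version of the process \<open>\<integral>\<^sub>0\<^sup>t H\<^sub>s dB\<^sub>s\<close>, for progressively measurable \<open>H\<close> with
  locally square-integrable paths: there are simple integrands \<open>H\<^sup>k\<close> such that, for each \<open>T\<close>,
  \<open>\<integral>\<^sub>0\<^sup>T (H - H\<^sup>k)\<^sup>2 dt \<longlongrightarrow> 0\<close> and \<open>sup\<^bsub>t \<le> T\<^esub> \<bar>I\<^sub>t - \<integral>\<^sub>0\<^sup>t H\<^sup>k dB\<bar> \<longlongrightarrow> 0\<close> in probability.
  Up to indistinguishability \<open>I\<close> does not depend on the approximating sequence.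
\<close>

definition is_ito_integral ::
  "'a measure \<Rightarrow> (real \<Rightarrow> 'a measure) \<Rightarrow> (real \<Rightarrow> 'a \<Rightarrow> real) \<Rightarrow> (real \<Rightarrow> 'a \<Rightarrow> real) \<Rightarrow>
   (real \<Rightarrow> 'a \<Rightarrow> real) \<Rightarrow> bool" where
  "is_ito_integral M F B H I \<longleftrightarrow>
     progressive F H \<and>
     (\<forall>T\<ge>0. AE \<omega> in M. (\<integral>\<^sup>+t\<in>{0..T}. ennreal ((H t \<omega>)\<^sup>2) \<partial>lborel) < \<top>) \<and>
     adapted F I \<and> continuous_paths M I \<and>
     (\<exists>n s \<eta>. (\<forall>k. simple_integrand M F (n k) (s k) (\<eta> k)) \<and>
        (\<forall>T\<ge>0. \<forall>\<epsilon>>0.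
          (\<lambda>k. measure M {\<omega>\<in>space M.
             (\<integral>\<^sup>+t\<in>{0..T}. ennreal ((H t \<omega> - simple_process (n k) (s k) (\<eta> k) t \<omega>)\<^sup>2) \<partial>lborel)
               > ennreal \<epsilon>}) \<longlonglongrightarrow> 0) \<and>
        (\<forall>T\<ge>0. \<forall>\<epsilon>>0.
          (\<lambda>k. measure M {\<omega>\<in>space M.
             (SUP t\<in>{0..T}. \<bar>I t \<omega> - simple_ito_integral B (n k) (s k) (\<eta> k) t \<omega>\<bar>) > \<epsilon>})
            \<longlonglongrightarrow> 0))"

text \<open>\<open>X\<close> solves \<open>dX\<^sub>t = b(X\<^sub>t) dt + a(X\<^sub>t) dB\<^sub>t\<close>, \<open>X\<^sub>0 = x\<close>, on the given filtered space.\<close>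

definition sde_solution ::
  "'a measure \<Rightarrow> (real \<Rightarrow> 'a measure) \<Rightarrow> (real \<Rightarrow> 'a \<Rightarrow> real) \<Rightarrow> (real \<Rightarrow> real) \<Rightarrow> (real \<Rightarrow> real) \<Rightarrow>
   real \<Rightarrow> (real \<Rightarrow> 'a \<Rightarrow> real) \<Rightarrow> bool" where
  "sde_solution M F B b a x X \<longleftrightarrow>
     adapted F X \<and> continuous_paths M X \<and> (AE \<omega> in M. X 0 \<omega> = x) \<and>
     (AE \<omega> in M. \<forall>t\<ge>0. set_integrable lborel {0..t} (\<lambda>s. b (X s \<omega>))) \<and>
     (\<exists>I. is_ito_integral M F B (\<lambda>t \<omega>. a (X t \<omega>)) I \<and>
        (AE \<omega> in M. \<forall>t\<ge>0. X t \<omega> = x + (LINT s:{0..t}|lborel. b (X s \<omega>)) + I t \<omega>))"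

text \<open>
  The CEV diffusion, as any \<open>[0,\<infinity>)\<close>-valued solution of its equation. By pathwise
  uniqueness (\<open>p \<ge> 1/2\<close>) there is only one up to indistinguishability, and it is absorbed at 0.
  Note that \<open>0 powr p = 0\<close>.
\<close>

definition cev_diffusion ::
  "'a measure \<Rightarrow> (real \<Rightarrow> 'a measure) \<Rightarrow> (real \<Rightarrow> 'a \<Rightarrow> real) \<Rightarrow> real \<Rightarrow> real \<Rightarrow> real \<Rightarrow> real \<Rightarrow>
   (real \<Rightarrow> 'a \<Rightarrow> real) \<Rightarrow> bool" where
  "cev_diffusion M F B \<mu> \<sigma> p x X \<longleftrightarrow>
     sde_solution M F B (\<lambda>y. \<mu> * y) (\<lambda>y. \<sigma> * y powr p) x X \<and>
     (\<forall>t\<ge>0. \<forall>\<omega>\<in>space M. 0 \<le> X t \<omega>)"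


text \<open>The scheme at the grid points \<open>j \<delta>\<close>, driven by a realisation \<open>z 1, z 2, \<dots>\<close> of the noise.\<close>

primrec em_grid ::
  "real \<Rightarrow> real \<Rightarrow> real \<Rightarrow> real \<Rightarrow> real \<Rightarrow> (nat \<Rightarrow> real) \<Rightarrow> nat \<Rightarrow> real" where
  "em_grid \<mu> \<sigma> p x \<delta> z 0 = x"
| "em_grid \<mu> \<sigma> p x \<delta> z (Suc j) =
     em_grid \<mu> \<sigma> p x \<delta> z j + \<mu> * max 0 (em_grid \<mu> \<sigma> p x \<delta> z j) * \<delta>
       + \<sigma> * (max 0 (em_grid \<mu> \<sigma> p x \<delta> z j)) powr p * z (Suc j) * sqrt \<delta>"

definition em_path ::
  "real \<Rightarrow> real \<Rightarrow> real \<Rightarrow> real \<Rightarrow> real \<Rightarrow> (nat \<Rightarrow> real) \<Rightarrow> real \<Rightarrow> real" where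
  "em_path \<mu> \<sigma> p x \<delta> z t =
     (let j = nat \<lfloor>t / \<delta>\<rfloor> in
        (t - real j * \<delta>) / \<delta> * em_grid \<mu> \<sigma> p x \<delta> z (Suc j)
        + (real (Suc j) * \<delta> - t) / \<delta> * em_grid \<mu> \<sigma> p x \<delta> z j)"

lemma em_path_interpolates:
  assumes \<delta>: "\<delta> > 0" and j: "j \<ge> 1" and t: "t \<in> {real (j - 1) * \<delta>..real j * \<delta>}"
  shows "em_path \<mu> \<sigma> p x \<delta> z t =
     (t - real (j - 1) * \<delta>) / \<delta> * em_grid \<mu> \<sigma> p x \<delta> z j
     + (real j * \<delta> - t) / \<delta> * em_grid \<mu> \<sigma> p x \<delta> z (j - 1)"
proof -
  obtain i where i: "j = Suc i" using j by (cases j) auto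
  show ?thesis
  proof (cases "t = real j * \<delta>")
    case True
    then have "t / \<delta> = real j" using \<delta> by simp
    then have "nat \<lfloor>t / \<delta>\<rfloor> = j" by simp
    then show ?thesis using True \<delta> i by (simp add: em_path_def Let_def field_simps)
  next
    case False
    then have "real i \<le> t / \<delta>" "t / \<delta> < real i + 1"
      using t i \<delta> by (auto simp: field_simps)
    then have "\<lfloor>t / \<delta>\<rfloor> = int i" by (simp add: floor_eq_iff)
    then show ?thesis using i by (simp add: em_path_def Let_def)
  qed
qed


text \<open>\<open>ennreal\<close> serves as \<open>[0,\<infinity>) \<union> {\<infinity>}\<close>; the infimum of the empty set is \<open>\<top> = \<infinity>\<close>.\<close>

definition hitting_time :: "real \<Rightarrow> (real \<Rightarrow> real) \<Rightarrow> ennreal" where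
  "hitting_time l u = Inf {ennreal t | t. 0 \<le> t \<and> u t = l}"

definition arctan_ext :: "ennreal \<Rightarrow> real" where
  "arctan_ext s = (if s = \<top> then pi / 2 else arctan (enn2real s))"

definition rho :: "ennreal \<Rightarrow> ennreal \<Rightarrow> real" where
  "rho s t = \<bar>arctan_ext s - arctan_ext t\<bar>"

lemma arctan_ext_inject: "arctan_ext s = arctan_ext t \<longleftrightarrow> s = t"
proof (cases s; cases t)
qed (use arctan_ubound in \<open>auto simp: arctan_ext_def arctan_eq_iff less_le dest: sym\<close>)

interpretation rho: Metric_space "UNIV :: ennreal set" rho
  by unfold_locales (auto simp: rho_def arctan_ext_inject)

end

theory Submission imports Defs begin

text \<open>
  Weak convergence on \<open>[0, \<infinity>]\<close> is convergence of Laplace transforms: \<open>s \<mapsto> exp (- \<alpha> s)\<close> identifies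
  \<open>[0, \<infinity>]\<close> with \<open>[0, 1]\<close>, and polynomials are uniformly dense in the continuous functions there
  (\<open>weak_convergence_via_discount\<close>). So it suffices to find, for the multiples \<open>\<alpha>\<close> of one positive
  number, a function \<open>\<phi>\<close> with \<open>E exp (- \<alpha> \<tau>\<^sub>0(X)) = \<phi> x\<close> and
  \<open>E exp (- \<alpha> \<tau>(X\<^sup>\<delta>)) \<longlongrightarrow> \<phi> x\<close> as \<open>\<delta> \<longlongrightarrow> 0\<close>.

  The function \<open>\<phi>\<close> is the decreasing solution of \<open>\<mu> x \<phi>' + \<sigma>\<^sup>2 x\<^sup>2\<^sup>p \<phi>'' / 2 = \<alpha> \<phi>\<close> with \<open>\<phi> = 1\<close> at the
  origin, written as a mixture of the stretched exponentials \<open>exp (- x\<^sup>r / W)\<close> where \<open>r = 2 (1 - p)\<close>.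
  The mixture has two virtues. All derivatives of a stretched exponential are, in the relative
  increment \<open>h / x\<close>, bounded functions of \<open>x\<^sup>r / W\<close>, so \<open>\<phi>\<close> has a Taylor expansion that is uniform down to the
  singular point 0 (\<open>\<phi>_Taylor\<close>); and the differential equation is the fundamental theorem of
  calculus in the mixing variable (\<open>\<phi>_ODE\<close>).

  For a recursion driven by independent normal noise, Taylor's formula and the differential equation
  bound by how much \<open>exp (- \<alpha> t) \<phi>\<close> fails to be a martingale in one step (\<open>one_step\<close>). Summation up to a
  stopping index compares the discounted final value with \<open>\<phi> x\<close> (\<open>discounted_Dynkin\<close>).
  For the Euler-Maruyama scheme the recursion runs until it falls to \<open>\<delta>\<^sup>\<beta>\<close> or below. Above that level the
  relative size of one noise term is at most a constant times \<open>\<delta>\<^sup>\<gamma>\<close>, where \<open>\<gamma> = 1/2 - \<beta> (1 - p)\<close>, and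
  the hypothesis on \<open>\<beta>\<close> says that \<open>\<gamma> > 0\<close>. This makes the error of a step \<open>o(\<delta>)\<close> (\<open>em_rate_small\<close>), and
  the discounting leaves only about \<open>1 / \<delta>\<close> steps that count (\<open>em_discount_limit\<close>).

  The diffusion is treated in the same way, which avoids stochastic calculus: the stochastic
  integral in its equation is a limit of sums over a grid (\<open>ito_grid_approximation\<close>), and these sums drive a
  recursion \<open>Z\<close> that stays close to \<open>X\<close>. It is stopped when \<open>Z\<close> falls to \<open>\<epsilon>\<close> or below and, to keep all
  terms bounded, when \<open>Z\<close> exceeds \<open>K + 1\<close>, \<open>X\<close> exceeds \<open>K\<close>, or the accumulated squared noise coefficients
  exceed a constant. Along a path of \<open>X\<close> bounded by \<open>K\<close> only the first passage
  below \<open>\<epsilon>\<close> matters, and this brackets the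
  discounted value between those at the hitting times of \<open>0\<close> and of \<open>2 \<epsilon>\<close> (\<open>path_bracket\<close>). Letting the
  grid become fine, then \<open>K \<longlongrightarrow> \<infinity>\<close>, then \<open>\<epsilon> \<longlongrightarrow> 0\<close> gives \<open>E exp (- \<alpha> \<tau>\<^sub>0(X)) = \<phi> x\<close> (\<open>diffusion_discount\<close>).
\<close>

section \<open>Derivatives of stretched exponentials\<close>

text \<open>
  The derivatives of \<open>exp (- a x\<^sup>r)\<close> multiplied by the matching power of \<open>x\<close>: they depend on \<open>x\<close>
  only through \<open>v = a x\<^sup>r\<close>.
\<close>

definition stretched_exp :: "real \<Rightarrow> real \<Rightarrow> real \<Rightarrow> real" where
  "stretched_exp r a x = exp (- a * (max 0 x) powr r)"

definition scaled_deriv1 :: "real \<Rightarrow> real \<Rightarrow> real" where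
  "scaled_deriv1 r v = - r * v * exp (- v)"

definition scaled_deriv2 :: "real \<Rightarrow> real \<Rightarrow> real" where
  "scaled_deriv2 r v = (r * (1 - r) * v + r\<^sup>2 * v\<^sup>2) * exp (- v)"

definition scaled_deriv3 :: "real \<Rightarrow> real \<Rightarrow> real" where
  "scaled_deriv3 r v =
     (- r * (1 - r) * (2 - r) * v - 3 * r\<^sup>2 * (1 - r) * v\<^sup>2 - r ^ 3 * v ^ 3) * exp (- v)"

lemma stretched_exp_derivs:
  assumes "x > 0"
  shows "(stretched_exp r a has_real_derivative scaled_deriv1 r (a * x powr r) / x) (at x)"
    and "((\<lambda>x. scaled_deriv1 r (a * x powr r) / x) has_real_derivative
            scaled_deriv2 r (a * x powr r) / x\<^sup>2) (at x)"
    and "((\<lambda>x. scaled_deriv2 r (a * x powr r) / x\<^sup>2) has_real_derivative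
            scaled_deriv3 r (a * x powr r) / x ^ 3) (at x)"
proof -
  have pw: "x powr (r - 1) = x powr r / x"
    using assms by (simp add: powr_diff)
  have v: "((\<lambda>x. a * x powr r) has_real_derivative r * (a * x powr r) / x) (at x)"
    using assms by (auto intro!: derivative_eq_intros simp: pw)
  have ev: "eventually (\<lambda>y. y > 0) (nhds x)"
    using assms by (intro eventually_nhds_in_open[of "{0<..}" x, simplified])
  have "((\<lambda>x. exp (- (a * x powr r))) has_real_derivative scaled_deriv1 r (a * x powr r) / x) (at x)"
    by (rule derivative_eq_intros v refl)+ (simp add: scaled_deriv1_def)
  then show "(stretched_exp r a has_real_derivative scaled_deriv1 r (a * x powr r) / x) (at x)"
    by (rule DERIV_cong_ev[THEN iffD1, rotated 3])
      (auto simp: stretched_exp_def max_def intro!: eventually_mono[OF ev])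
  show "((\<lambda>x. scaled_deriv1 r (a * x powr r) / x) has_real_derivative
            scaled_deriv2 r (a * x powr r) / x\<^sup>2) (at x)"
    unfolding scaled_deriv1_def scaled_deriv2_def
    by (rule derivative_eq_intros v refl)+
      (use assms in \<open>simp_all add: field_simps power2_eq_square\<close>)
  show "((\<lambda>x. scaled_deriv2 r (a * x powr r) / x\<^sup>2) has_real_derivative
            scaled_deriv3 r (a * x powr r) / x ^ 3) (at x)"
    unfolding scaled_deriv3_def scaled_deriv2_def
    by (rule derivative_eq_intros v refl)+
      (use assms in \<open>simp_all add: field_simps power2_eq_square power3_eq_cube\<close>)
qed

lemma power_times_exp_minus_le_fact:
  fixes v :: real
  assumes "v \<ge> 0"
  shows "v ^ n * exp (- v) \<le> fact n"
proof -
  have "v ^ n / fact n \<le> (\<Sum>i. v ^ i / fact i)"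
    using sum_le_suminf[of "\<lambda>i. v ^ i / fact i" "{n}"] assms summable_exp[of v]
    by (auto simp: divide_inverse mult.commute)
  also have "\<dots> = exp v"
    by (simp add: exp_def divide_inverse mult.commute)
  finally show ?thesis
    by (simp add: exp_minus field_simps)
qed

text \<open>
  The factor \<open>exp (- v)\<close> absorbs every power of \<open>v\<close>, and a factor \<open>v\<close> can always be split off. The second
  fact is what makes the derivatives small near the origin.
\<close>

lemma scaled_deriv_bounds:
  assumes r: "0 < r" "r \<le> 1" and v: "v \<ge> 0"
  shows "\<bar>scaled_deriv1 r v\<bar> \<le> min 1 v" "\<bar>scaled_deriv2 r v\<bar> \<le> 3 * min 1 v"
    "\<bar>scaled_deriv3 r v\<bar> \<le> 9 * min 1 v"
proof -
  define e where "e = exp (- v)"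
  have e: "0 < e" "e \<le> 1" using v by (auto simp: e_def)
  have p: "v * e \<le> 1" "v\<^sup>2 * e \<le> 2" "v ^ 3 * e \<le> 6"
    using power_times_exp_minus_le_fact[OF v, of 1] power_times_exp_minus_le_fact[OF v, of 2]
      power_times_exp_minus_le_fact[OF v, of 3] by (simp_all add: e_def fact_numeral)
  have q: "v * e \<le> v" "v\<^sup>2 * e \<le> v" "v ^ 3 * e \<le> 2 * v"
    using mult_left_mono[OF e(2) v] mult_left_mono[OF p(1) v] mult_left_mono[OF p(2) v]
    by (simp_all add: power2_eq_square power3_eq_cube mult_ac)
  have nn: "v * e \<ge> 0" "v\<^sup>2 * e \<ge> 0" "v ^ 3 * e \<ge> 0" using v e by auto
  have c1: "r * (1 - r) \<le> 1" "0 \<le> r * (1 - r)" "r\<^sup>2 \<le> 1" "r ^ 3 \<le> 1" "0 \<le> r ^ 3"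
    using r by (auto intro: mult_le_one power_le_one)
  have quarter: "r * (1 - r) \<le> 1 / 4"
    using zero_le_power2[of "r - 1 / 2"] by (simp add: power2_eq_square algebra_simps)
  have c2: "r * (1 - r) * (2 - r) \<le> 1" "0 \<le> r * (1 - r) * (2 - r)"
    using mult_mono[OF quarter, of "2 - r" 2] r c1 by auto
  have c3: "3 * r\<^sup>2 * (1 - r) \<le> 1" "0 \<le> 3 * r\<^sup>2 * (1 - r)"
    using mult_mono[OF quarter, of r 1] r c1 by (auto simp: power2_eq_square algebra_simps)
  have "\<bar>scaled_deriv1 r v\<bar> = r * (v * e)"
    using r v e by (simp add: scaled_deriv1_def e_def abs_mult)
  also have "\<dots> \<le> 1 * (v * e)" using r v e by (intro mult_right_mono) auto
  finally show "\<bar>scaled_deriv1 r v\<bar> \<le> min 1 v" using p q by simp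
  have "\<bar>scaled_deriv2 r v\<bar> = (r * (1 - r)) * (v * e) + r\<^sup>2 * (v\<^sup>2 * e)"
  proof -
    have "scaled_deriv2 r v = (r * (1 - r)) * (v * e) + r\<^sup>2 * (v\<^sup>2 * e)"
      by (simp add: scaled_deriv2_def e_def algebra_simps)
    moreover have "0 \<le> (r * (1 - r)) * (v * e) + r\<^sup>2 * (v\<^sup>2 * e)"
      using mult_nonneg_nonneg[OF c1(2) nn(1)] mult_nonneg_nonneg[OF zero_le_power2[of r] nn(2)] by linarith
    ultimately show ?thesis by simp
  qed
  also have "\<dots> \<le> 1 * (v * e) + 1 * (v\<^sup>2 * e)"
    using c1 nn by (intro add_mono mult_right_mono)
  finally show "\<bar>scaled_deriv2 r v\<bar> \<le> 3 * min 1 v" using p q v by (auto simp: min_def)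
  have "scaled_deriv3 r v = - ((r * (1 - r) * (2 - r)) * (v * e) + (3 * r\<^sup>2 * (1 - r)) * (v\<^sup>2 * e) + r ^ 3 * (v ^ 3 * e))"
    by (simp add: scaled_deriv3_def e_def algebra_simps)
  then have "\<bar>scaled_deriv3 r v\<bar> = (r * (1 - r) * (2 - r)) * (v * e) + (3 * r\<^sup>2 * (1 - r)) * (v\<^sup>2 * e) + r ^ 3 * (v ^ 3 * e)"
    using mult_nonneg_nonneg[OF c2(2) nn(1)] mult_nonneg_nonneg[OF c3(2) nn(2)] mult_nonneg_nonneg[OF c1(5) nn(3)]
    by linarith
  also have "\<dots> \<le> 1 * (v * e) + 1 * (v\<^sup>2 * e) + 1 * (v ^ 3 * e)"
    using c1 c2 c3 nn by (intro add_mono mult_right_mono)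
  finally show "\<bar>scaled_deriv3 r v\<bar> \<le> 9 * min 1 v" using p q v by (auto simp: min_def)
qed

lemma min_one_le_powr: "0 \<le> v \<Longrightarrow> 0 \<le> t \<Longrightarrow> t \<le> 1 \<Longrightarrow> min 1 v \<le> (v::real) powr t"
proof (cases "v \<le> 1")
  case True
  assume a: "0 \<le> v" "0 \<le> t" "t \<le> 1"
  show ?thesis
  proof (cases "v = 0")
    case False
    then have "v powr 1 \<le> v powr t" using a True by (intro powr_mono') auto
    then show ?thesis using a False by simp
  qed (use a in auto)
next
  case False
  assume a: "0 \<le> v" "0 \<le> t" "t \<le> 1"
  then show ?thesis using False ge_one_powr_ge_zero[of v t] by auto
qed

text \<open>The remainder of the second-order expansion is of third order relative to \<open>h / x\<close> while
  \<open>x + h\<close> stays away from 0; far steps are dominated by any higher power of \<open>h / x\<close>.\<close>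

lemma stretched_exp_Taylor:
  assumes r: "0 < r" "r \<le> 1" and a: "a > 0" and x: "x > 0" and k: "k \<ge> 2"
  defines "v \<equiv> a * x powr r"
  shows "\<bar>stretched_exp r a (x + h) - stretched_exp r a x - scaled_deriv1 r v * (h / x)
            - scaled_deriv2 r v * (h / x)\<^sup>2 / 2\<bar>
     \<le> 24 * min 1 v * (\<bar>h\<bar> / x) ^ 3 + 6 * (2 * (\<bar>h\<bar> / x)) ^ k" (is "\<bar>?R\<bar> \<le> ?A + ?B")
proof -
  have v: "v > 0" using a x by (simp add: v_def)
  have nonneg: "?A \<ge> 0" "?B \<ge> 0" using v x by auto
  consider "h = 0" | "h \<noteq> 0" "\<bar>h\<bar> \<le> x / 2" | "\<bar>h\<bar> > x / 2" by linarith
  then show ?thesis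
  proof cases
    case 1
    then show ?thesis using k by simp
  next
    case 2
    define d where "d = (\<lambda>n::nat. if n = 0 then stretched_exp r a
      else if n = 1 then (\<lambda>x. scaled_deriv1 r (a * x powr r) / x)
      else if n = 2 then (\<lambda>x. scaled_deriv2 r (a * x powr r) / x\<^sup>2)
      else (\<lambda>x. scaled_deriv3 r (a * x powr r) / x ^ 3))"
    have "\<exists>t. (if x + h < x then x + h < t \<and> t < x else x < t \<and> t < x + h) \<and>
      stretched_exp r a (x + h) = (\<Sum>m<3. (d m x / fact m) * ((x + h) - x)^m)
        + d 3 t / fact 3 * ((x + h) - x) ^ 3"
    proof (rule Taylor)
      show "\<forall>m t. m < 3 \<and> x / 2 \<le> t \<and> t \<le> 2 * x \<longrightarrow> (d m has_real_derivative d (Suc m) t) (at t)"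
      proof safe
        fix m :: nat and t assume "m < 3" "x / 2 \<le> t"
        then have "m = 0 \<or> m = 1 \<or> m = 2" "t > 0" using x by auto
        then show "(d m has_real_derivative d (Suc m) t) (at t)"
          using stretched_exp_derivs[of t r a] by (auto simp: d_def)
      qed
    qed (use 2 x in \<open>auto simp: d_def\<close>)
    then obtain t where t: "if x + h < x then x + h < t \<and> t < x else x < t \<and> t < x + h"
      and eq: "stretched_exp r a (x + h) = (\<Sum>m<3. (d m x / fact m) * ((x + h) - x)^m)
        + d 3 t / fact 3 * ((x + h) - x) ^ 3" by blast
    have tx: "x / 2 \<le> t" "t \<le> 2 * x" "t > 0" using t 2 x by (auto split: if_splits)
    have "?R = d 3 t / 6 * h ^ 3"
      unfolding eq using x
      by (simp add: d_def numeral_3_eq_3 fact_numeral v_def power_divide)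
        (simp add: field_simps power2_eq_square)
    also have "\<bar>\<dots>\<bar> = \<bar>scaled_deriv3 r (a * t powr r)\<bar> / 6 * (\<bar>h\<bar> / t) ^ 3"
      using tx by (simp add: d_def abs_mult power_abs power_divide)
    also have "\<dots> \<le> (9 * min 1 (2 * v)) / 6 * (2 * (\<bar>h\<bar> / x)) ^ 3"
    proof (intro mult_mono divide_right_mono power_mono)
      have "t powr r \<le> (2 * x) powr r" using tx r by (intro powr_mono2) auto
      also have "\<dots> = 2 powr r * x powr r" using x by (simp add: powr_mult)
      also have "2 powr r \<le> 2 powr (1::real)" using r by (intro powr_mono) auto
      finally have "a * t powr r \<le> 2 * v" using a x by (simp add: v_def mult_right_mono)
      then show "\<bar>scaled_deriv3 r (a * t powr r)\<bar> \<le> 9 * min 1 (2 * v)"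
        using scaled_deriv_bounds(3)[OF r, of "a * t powr r"] a by (auto simp: min_def split: if_splits)
      have "\<bar>h\<bar> / t \<le> \<bar>h\<bar> / (x / 2)" using tx x by (intro divide_left_mono) auto
      then show "\<bar>h\<bar> / t \<le> 2 * (\<bar>h\<bar> / x)" by (simp add: mult.commute)
    qed (use v tx x in auto)
    also have "\<dots> \<le> (9 * (2 * min 1 v)) / 6 * (2 * (\<bar>h\<bar> / x)) ^ 3"
      using v x by (intro mult_right_mono) auto
    also have "\<dots> = ?A" by (simp add: power_mult_distrib power_divide)
    finally show ?thesis using nonneg by linarith
  next
    case 3
    define z where "z = 2 * (\<bar>h\<bar> / x)"
    have z: "z \<ge> 1" using 3 x by (simp add: z_def field_simps)
    have zk: "1 \<le> z ^ k" "z \<le> z ^ k" "z\<^sup>2 \<le> z ^ k"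
      using z k power_increasing[of 0 k z] power_increasing[of 1 k z] power_increasing[of 2 k z] by auto
    have "\<bar>stretched_exp r a (x + h) - stretched_exp r a x\<bar> \<le> 1"
    proof -
      have "0 \<le> stretched_exp r a w \<and> stretched_exp r a w \<le> 1" for w
        using a by (auto simp: stretched_exp_def)
      then show ?thesis by (smt (verit))
    qed
    moreover have "\<bar>scaled_deriv1 r v * (h / x)\<bar> \<le> 1 * z"
    proof -
      have "\<bar>h / x\<bar> = \<bar>h\<bar> / x" "\<bar>h\<bar> / x \<ge> 0" using x by auto
      then have "\<bar>h / x\<bar> \<le> z" unfolding z_def by linarith
      then show ?thesis
        unfolding abs_mult using scaled_deriv_bounds(1)[OF r, of v] v by (intro mult_mono) auto
    qed
    moreover have "\<bar>scaled_deriv2 r v * (h / x)\<^sup>2 / 2\<bar> \<le> 3 * z\<^sup>2"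
    proof -
      have "\<bar>scaled_deriv2 r v * (h / x)\<^sup>2 / 2\<bar> = \<bar>scaled_deriv2 r v\<bar> * ((h / x)\<^sup>2 / 2)"
        by (simp add: abs_mult)
      also have "\<dots> \<le> 3 * z\<^sup>2"
      proof (intro mult_mono)
        show "(h / x)\<^sup>2 / 2 \<le> z\<^sup>2"
        proof -
          have "z\<^sup>2 = 4 * (h / x)\<^sup>2"
            unfolding z_def power_mult_distrib by (simp add: power_divide)
          then show ?thesis using zero_le_power2[of "h / x"] by linarith
        qed
      qed (use scaled_deriv_bounds(2)[OF r, of v] v in auto)
      finally show ?thesis .
    qed
    ultimately have "\<bar>?R\<bar> \<le> 1 + z + 3 * z\<^sup>2" by linarith
    also have "\<dots> \<le> 6 * z ^ k" using zk z by linarith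
    finally show ?thesis using nonneg by (simp add: z_def)
  qed
qed

section \<open>The Laplace transform of the hitting time of 0\<close>

text \<open>
  The lower bound on \<open>\<alpha>\<close> lets the discounting \<open>exp (- \<alpha> s)\<close> dominate the growth of \<open>W\<close> and of the
  density by a factor \<open>exp (- s)\<close> to spare, whatever the sign of \<open>\<mu>\<close>.
\<close>

locale cev_laplace =
  fixes \<mu> \<sigma> p \<alpha> :: real
  assumes \<sigma>: "\<sigma> > 0" and p: "1 / 2 \<le> p" "p < 1" and \<alpha>: "\<alpha> \<ge> 1 + 2 * \<bar>\<mu>\<bar>"
begin

definition r where "r = 2 * (1 - p)"
definition growth where "growth = \<mu> * r"
definition \<kappa> where "\<kappa> = \<sigma>\<^sup>2 * r\<^sup>2 / 2"

text \<open>
  The solution of \<open>W' = \<kappa> - growth * W\<close> with \<open>W 0 = 0\<close>. For \<open>\<mu> = 0\<close> it is \<open>\<kappa> s\<close>, and \<open>\<phi>\<close> becomes the classical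
  integral for a multiple of \<open>sqrt x * K\<^sub>\<nu> (c * x powr (r / 2))\<close>, a modified Bessel function of order \<open>\<nu> = 1 / r\<close>.
\<close>

definition W :: "real \<Rightarrow> real" where
  "W s = (if growth = 0 then \<kappa> * s else \<kappa> * (1 - exp (- growth * s)) / growth)"

definition dens :: "real \<Rightarrow> real" where
  "dens s = indicator {0<..} s * exp (- \<alpha> * s) * (exp (growth * s) * W s) powr (1 / r - 1)"

definition mass where "mass = (\<integral>s. dens s \<partial>lborel)"

definition \<phi> :: "real \<Rightarrow> real" where
  "\<phi> x = (\<integral>s. dens s * stretched_exp r (1 / W s) x \<partial>lborel) / mass"

text \<open>
  The integrals that represent \<open>x \<phi>' x\<close> and \<open>x\<^sup>2 \<phi>'' x\<close>. The Taylor formula for \<open>\<phi>\<close> is proved for them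
  directly, by integrating the one for stretched exponentials, without differentiation under the integral.
\<close>

definition \<phi>1 :: "real \<Rightarrow> real" where
  "\<phi>1 x = (\<integral>s. dens s * scaled_deriv1 r (x powr r / W s) \<partial>lborel) / mass"

definition \<phi>2 :: "real \<Rightarrow> real" where
  "\<phi>2 x = (\<integral>s. dens s * scaled_deriv2 r (x powr r / W s) \<partial>lborel) / mass"

lemma r: "0 < r" "r \<le> 1" using p by (auto simp: r_def)
lemma \<kappa>: "\<kappa> > 0" using \<sigma> r by (auto simp: \<kappa>_def)
lemma r_inv: "1 / r \<ge> 1" using r by simp

lemma exp_slope_bounds:
  fixes u :: real
  assumes "u \<noteq> 0"
  shows "exp (- \<bar>u\<bar>) \<le> (1 - exp (- u)) / u" "(1 - exp (- u)) / u \<le> exp \<bar>u\<bar>"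
proof -
  have "\<exists>z. \<bar>z\<bar> \<le> \<bar>u\<bar> \<and> 1 - exp (- u) = u * exp (- z)"
  proof (cases "u > 0")
    case True
    have "\<exists>z>0. z < u \<and> - exp (- u) - (- exp (- 0)) = (u - 0) * exp (- z)"
      using True by (intro MVT2) (auto intro!: derivative_eq_intros)
    then obtain z where "0 < z" "z < u" "1 - exp (- u) = u * exp (- z)" by auto
    then show ?thesis by (intro exI[of _ z]) auto
  next
    case False
    have "\<exists>z>u. z < 0 \<and> - exp (- 0) - (- exp (- u)) = (0 - u) * exp (- z)"
      using False assms by (intro MVT2) (auto intro!: derivative_eq_intros)
    then obtain z where "u < z" "z < 0" "exp (- u) - 1 = - u * exp (- z)" by auto
    then show ?thesis by (intro exI[of _ z]) auto
  qed
  then obtain z where z: "\<bar>z\<bar> \<le> \<bar>u\<bar>" "1 - exp (- u) = u * exp (- z)" by blast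
  then have "(1 - exp (- u)) / u = exp (- z)" using assms by simp
  then show "exp (- \<bar>u\<bar>) \<le> (1 - exp (- u)) / u" "(1 - exp (- u)) / u \<le> exp \<bar>u\<bar>"
    using z by auto
qed

lemma W_bounds:
  assumes "s > 0"
  shows "\<kappa> * s * exp (- \<bar>growth\<bar> * s) \<le> W s" "W s \<le> \<kappa> * s * exp (\<bar>growth\<bar> * s)"
proof -
  have ms: "\<bar>growth * s\<bar> = \<bar>growth\<bar> * s" using assms by (simp add: abs_mult)
  have "exp (- \<bar>growth\<bar> * s) \<le> W s / (\<kappa> * s) \<and> W s / (\<kappa> * s) \<le> exp (\<bar>growth\<bar> * s)"
  proof (cases "growth = 0")
    case True
    then show ?thesis using assms \<kappa> by (simp add: W_def)
  next
    case False
    then have "W s / (\<kappa> * s) = (1 - exp (- (growth * s))) / (growth * s)"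
      using assms \<kappa> by (simp add: W_def)
    then show ?thesis using exp_slope_bounds[of "growth * s"] False assms ms by simp
  qed
  moreover have "0 < \<kappa> * s" using \<kappa> assms by simp
  ultimately show "\<kappa> * s * exp (- \<bar>growth\<bar> * s) \<le> W s" "W s \<le> \<kappa> * s * exp (\<bar>growth\<bar> * s)"
    by (simp_all add: pos_le_divide_eq pos_divide_le_eq mult.commute)
qed

lemma W_pos: "s > 0 \<Longrightarrow> W s > 0"
  using W_bounds(1)[of s] \<kappa> by (smt (verit) exp_gt_zero mult_pos_pos)

lemma W_deriv: "(W has_real_derivative (\<kappa> - growth * W s)) (at s)"
proof (cases "growth = 0")
  case True
  then have "W = (\<lambda>s. \<kappa> * s)" by (auto simp: W_def fun_eq_iff)
  then show ?thesis using True by (auto intro!: derivative_eq_intros)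
next
  case False
  then have "W = (\<lambda>s. \<kappa> * (1 - exp (- growth * s)) / growth)" by (auto simp: W_def fun_eq_iff)
  then show ?thesis using False by (auto intro!: derivative_eq_intros simp: field_simps)
qed

lemma W_measurable [measurable]: "W \<in> borel_measurable borel"
  by (intro borel_measurable_continuous_onI continuous_at_imp_continuous_on ballI
      DERIV_isCont[OF W_deriv])

lemma dens_measurable [measurable]: "dens \<in> borel_measurable borel"
  unfolding dens_def by measurable

lemma dens_nonneg: "dens s \<ge> 0"
  by (auto simp: dens_def)

lemma dens_pos: "s > 0 \<Longrightarrow> dens s > 0"
  using W_pos[of s] by (auto simp: dens_def)

lemma dens_0: "s \<le> 0 \<Longrightarrow> dens s = 0"
  by (auto simp: dens_def)

lemma W_powr_le:
  assumes "s > 0"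
  shows "W s powr a \<le> (\<kappa> * s) powr a * exp (\<bar>a\<bar> * (\<bar>growth\<bar> * s))"
proof (cases "a \<ge> 0")
  case True
  have "W s powr a \<le> (\<kappa> * s * exp (\<bar>growth\<bar> * s)) powr a"
    using True W_bounds[OF assms] W_pos[OF assms] by (intro powr_mono2) auto
  also have "\<dots> = (\<kappa> * s) powr a * exp (\<bar>a\<bar> * (\<bar>growth\<bar> * s))"
    using True \<kappa> assms by (simp add: powr_mult exp_powr_real mult.commute)
  finally show ?thesis .
next
  case False
  have "W s powr a \<le> (\<kappa> * s * exp (- \<bar>growth\<bar> * s)) powr a"
    using False W_bounds[OF assms] \<kappa> assms by (intro powr_mono2') auto
  also have "\<dots> = (\<kappa> * s) powr a * exp (\<bar>a\<bar> * (\<bar>growth\<bar> * s))"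
    using False \<kappa> assms by (simp add: powr_mult exp_powr_real mult_ac)
  finally show ?thesis .
qed

text \<open>
  Near \<open>s = 0\<close> the density behaves like \<open>s powr (1 / r - 1)\<close>, which leaves room for every power
  \<open>W powr a\<close> with \<open>a > - 1\<close>, since \<open>1 / r \<ge> 1\<close>.
\<close>

lemma dens_W_le:
  assumes s: "s > 0" and a: "- 1 \<le> a" "a \<le> 1"
  shows "dens s * W s powr a \<le> (\<kappa> * s) powr (1 / r - 1 + a) * exp (- s)"
proof -
  define n where "n = 1 / r - 1"
  have n: "n \<ge> 0" using r_inv by (simp add: n_def)
  have "dens s * W s powr a = exp (- \<alpha> * s + n * (growth * s)) * W s powr (n + a)"
    using s W_pos[OF s]
    by (simp add: dens_def n_def powr_mult exp_powr_real exp_add powr_add exp_diff exp_minus divide_inverse mult_ac)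
  also have "\<dots> \<le> exp (- \<alpha> * s + n * (\<bar>growth\<bar> * s)) *
      ((\<kappa> * s) powr (n + a) * exp (\<bar>n + a\<bar> * (\<bar>growth\<bar> * s)))"
    using W_powr_le[OF s, of "n + a"] n s
    by (intro mult_mono) (auto intro!: mult_left_mono mult_right_mono)
  also have "\<dots> = (\<kappa> * s) powr (n + a) * exp ((- \<alpha> + (n + \<bar>n + a\<bar>) * \<bar>growth\<bar>) * s)"
    by (simp add: exp_add[symmetric] algebra_simps)
  also have "\<dots> \<le> (\<kappa> * s) powr (n + a) * exp (- 1 * s)"
  proof -
    have "(n + \<bar>n + a\<bar>) * \<bar>growth\<bar> \<le> (2 * (1 / r)) * \<bar>growth\<bar>"
      using n a by (intro mult_right_mono) (auto simp: n_def)
    also have "\<dots> = 2 * \<bar>\<mu>\<bar>" using r by (simp add: growth_def abs_mult)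
    finally have "- \<alpha> + (n + \<bar>n + a\<bar>) * \<bar>growth\<bar> \<le> - 1" using \<alpha> by simp
    then have "(- \<alpha> + (n + \<bar>n + a\<bar>) * \<bar>growth\<bar>) * s \<le> - 1 * s"
      using s by (intro mult_right_mono) auto
    then show ?thesis by (intro mult_left_mono) auto
  qed
  finally show ?thesis by (simp add: n_def)
qed

lemma Gamma_integrable:
  fixes b :: real
  assumes "b > 0"
  shows "integrable lborel (\<lambda>s. indicator {0<..} s * (s powr (b - 1) * exp (- s)))"
proof -
  have "(\<lambda>t. t powr (b - 1) / exp t) absolutely_integrable_on {0<..}"
  proof (rule nonnegative_absolutely_integrable_1)
    have "((\<lambda>t. if t \<in> {0<..} then t powr (b - 1) / exp t else 0) has_integral Gamma b) {0..}"
      using Gamma_integral_real[OF assms]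
      by (rule has_integral_spike[of "{0}", rotated 2]) auto
    then show "(\<lambda>t. t powr (b - 1) / exp t) integrable_on {0<..}"
      by (subst (asm) has_integral_restrict) auto
  qed auto
  then have "integrable lebesgue (\<lambda>s. indicator {0<..} s * (s powr (b - 1) * exp (- s)))"
    by (simp add: set_integrable_def exp_minus divide_inverse)
  then show ?thesis by (subst (asm) integrable_completion) auto
qed

lemma dens_W_integrable:
  assumes a: "- 1 < a" "a \<le> 0"
  shows "integrable lborel (\<lambda>s. dens s * W s powr a)"
proof (rule Bochner_Integration.integrable_bound)
  show "integrable lborel (\<lambda>s. \<kappa> powr (1 / r - 1 + a) *
      (indicator {0<..} s * (s powr (1 / r + a - 1) * exp (- s))))"
    using r_inv a by (intro integrable_mult_right Gamma_integrable) auto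
  show "AE s in lborel. norm (dens s * W s powr a) \<le> norm (\<kappa> powr (1 / r - 1 + a) *
      (indicator {0<..} s * (s powr (1 / r + a - 1) * exp (- s))))"
  proof (intro AE_I2)
    fix s :: real
    show "norm (dens s * W s powr a) \<le> norm (\<kappa> powr (1 / r - 1 + a) *
      (indicator {0<..} s * (s powr (1 / r + a - 1) * exp (- s))))"
    proof (cases "s > 0")
      case True
      have "norm (dens s * W s powr a) = dens s * W s powr a"
        using dens_nonneg[of s] by simp
      also have "\<dots> \<le> (\<kappa> * s) powr (1 / r - 1 + a) * exp (- s)"
        using dens_W_le[OF True, of a] a by simp
      also have "(\<kappa> * s) powr (1 / r - 1 + a) = \<kappa> powr (1 / r - 1 + a) * s powr (1 / r + a - 1)"
        using True \<kappa> by (simp add: powr_mult diff_add_eq)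
      finally show ?thesis using True by simp
    qed (simp add: dens_0)
  qed
qed measurable

lemma dens_integrable: "integrable lborel dens"
proof -
  have "integrable lborel (\<lambda>s. dens s * W s powr 0)" by (rule dens_W_integrable) auto
  moreover have "(\<lambda>s. dens s * W s powr 0) = dens"
  proof
    fix s show "dens s * W s powr 0 = dens s"
      using W_pos[of s] by (cases "s > 0") (auto simp: dens_0)
  qed
  ultimately show ?thesis by simp
qed

lemma mass_pos: "mass > 0"
proof -
  have "mass \<ge> 0" by (simp add: mass_def dens_nonneg)
  moreover have "mass \<noteq> 0"
  proof
    assume "mass = 0"
    then have "AE s in lborel. dens s = 0"
      using integral_nonneg_eq_0_iff_AE[OF dens_integrable] dens_nonneg by (simp add: mass_def)
    then have "AE s in lborel. s \<notin> {0<..<1::real}"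
      by eventually_elim (use dens_pos in force)
    then have "emeasure lborel {0<..<1::real} = 0"
      by (subst (asm) AE_iff_measurable[of "{0<..<1}"]) auto
    then show False by simp
  qed
  ultimately show ?thesis by simp
qed

lemma dens_mult_integrable:
  assumes [measurable]: "g \<in> borel_measurable borel" and "\<And>s. s > 0 \<Longrightarrow> \<bar>g s\<bar> \<le> C"
  shows "integrable lborel (\<lambda>s. dens s * g s)"
proof (rule Bochner_Integration.integrable_bound)
  show "integrable lborel (\<lambda>s. C * dens s)" using dens_integrable by simp
  show "AE s in lborel. norm (dens s * g s) \<le> norm (C * dens s)"
  proof (intro AE_I2)
    fix s show "norm (dens s * g s) \<le> norm (C * dens s)"
    proof (cases "s > 0")
      case True
      then have "dens s * \<bar>g s\<bar> \<le> dens s * \<bar>C\<bar>"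
        using assms(2)[OF True] dens_nonneg[of s] by (intro mult_left_mono) auto
      then show ?thesis using dens_nonneg[of s] by (simp add: abs_mult mult.commute)
    qed (simp add: dens_0)
  qed
qed measurable

lemma dens_integral_le:
  assumes "g \<in> borel_measurable borel" "\<And>s. s > 0 \<Longrightarrow> \<bar>g s\<bar> \<le> C"
  shows "\<bar>(\<integral>s. dens s * g s \<partial>lborel) / mass\<bar> \<le> C"
proof -
  have "\<bar>\<integral>s. dens s * g s \<partial>lborel\<bar> \<le> (\<integral>s. dens s * C \<partial>lborel)"
  proof (rule integral_abs_bound[THEN order_trans], rule integral_mono)
    show "integrable lborel (\<lambda>s. \<bar>dens s * g s\<bar>)"
      by (intro integrable_abs dens_mult_integrable) (use assms in auto)
    show "integrable lborel (\<lambda>s. dens s * C)" using dens_integrable by simp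
    show "\<bar>dens s * g s\<bar> \<le> dens s * C" for s
      using assms(2)[of s] dens_nonneg[of s]
      by (cases "s > 0") (auto simp: abs_mult dens_0 intro!: mult_left_mono)
  qed
  also have "\<dots> = C * mass" by (simp add: mass_def)
  finally show ?thesis using mass_pos by (simp add: field_simps)
qed

lemma [measurable]: "(\<lambda>s. stretched_exp r (1 / W s) x) \<in> borel_measurable borel"
  unfolding stretched_exp_def by measurable
lemma [measurable]: "(\<lambda>s. scaled_deriv1 r (x powr r / W s)) \<in> borel_measurable borel"
  unfolding scaled_deriv1_def by measurable
lemma [measurable]: "(\<lambda>s. scaled_deriv2 r (x powr r / W s)) \<in> borel_measurable borel"
  unfolding scaled_deriv2_def by measurable

lemma stretched_exp_abs_le: "s > 0 \<Longrightarrow> \<bar>stretched_exp r (1 / W s) x\<bar> \<le> 1"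
  using W_pos[of s] by (auto simp: stretched_exp_def)

lemma scaled_deriv_abs_le:
  assumes "s > 0"
  shows "\<bar>scaled_deriv1 r (x powr r / W s)\<bar> \<le> 1" "\<bar>scaled_deriv2 r (x powr r / W s)\<bar> \<le> 3"
  using scaled_deriv_bounds(1,2)[OF r, of "x powr r / W s"] W_pos[OF assms] by auto

lemma stretched_exp_bounds:
  "s > 0 \<Longrightarrow> 0 \<le> stretched_exp r (1 / W s) x \<and> stretched_exp r (1 / W s) x \<le> 1"
  using W_pos[of s] by (auto simp: stretched_exp_def)

lemma \<phi>_integrable: "integrable lborel (\<lambda>s. dens s * stretched_exp r (1 / W s) x)"
  by (rule dens_mult_integrable[where C = 1]) (use stretched_exp_abs_le in auto)

lemma \<phi>1_integrable: "x > 0 \<Longrightarrow> integrable lborel (\<lambda>s. dens s * scaled_deriv1 r (x powr r / W s))"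
  by (rule dens_mult_integrable[where C = 1])
    (use scaled_deriv_abs_le in auto)

lemma \<phi>2_integrable: "x > 0 \<Longrightarrow> integrable lborel (\<lambda>s. dens s * scaled_deriv2 r (x powr r / W s))"
  by (rule dens_mult_integrable[where C = 3])
    (use scaled_deriv_abs_le in auto)

lemma \<phi>1_bound: "\<bar>\<phi>1 x\<bar> \<le> 1"
  unfolding \<phi>1_def
  by (rule dens_integral_le) (use scaled_deriv_abs_le in auto)

lemma \<phi>2_bound: "\<bar>\<phi>2 x\<bar> \<le> 3"
  unfolding \<phi>2_def
  by (rule dens_integral_le) (use scaled_deriv_abs_le in auto)

lemma \<phi>_nonneg: "0 \<le> \<phi> x"
proof -
  have "0 \<le> dens s * stretched_exp r (1 / W s) x" for s
    using dens_nonneg[of s] stretched_exp_bounds[of s x] by (cases "s > 0") (auto simp: dens_0)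
  then show ?thesis
    unfolding \<phi>_def using mass_pos by (intro divide_nonneg_pos integral_nonneg) auto
qed

lemma \<phi>_le_1: "\<phi> x \<le> 1"
proof -
  have "\<bar>\<phi> x\<bar> \<le> 1" unfolding \<phi>_def
    by (rule dens_integral_le) (use stretched_exp_abs_le in auto)
  then show ?thesis by simp
qed

lemma \<phi>_antimono: "x \<le> y \<Longrightarrow> \<phi> y \<le> \<phi> x"
  unfolding \<phi>_def
proof (intro divide_right_mono integral_mono \<phi>_integrable)
  fix s assume "x \<le> y"
  then have "stretched_exp r (1 / W s) y \<le> stretched_exp r (1 / W s) x" if "s > 0"
    using W_pos[OF that] r by (auto simp: stretched_exp_def intro!: divide_right_mono powr_mono2)
  then show "dens s * stretched_exp r (1 / W s) y \<le> dens s * stretched_exp r (1 / W s) x"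
    using dens_nonneg[of s] by (cases "s > 0") (auto intro: mult_left_mono simp: dens_0)
qed (use mass_pos in auto)

lemma \<phi>_measurable [measurable]: "\<phi> \<in> borel_measurable borel"
  unfolding \<phi>_def stretched_exp_def by measurable
lemma \<phi>1_measurable [measurable]: "\<phi>1 \<in> borel_measurable borel"
  unfolding \<phi>1_def scaled_deriv1_def by measurable
lemma \<phi>2_measurable [measurable]: "\<phi>2 \<in> borel_measurable borel"
  unfolding \<phi>2_def scaled_deriv2_def by measurable

lemma min_abs_le:
  assumes "s > 0" shows "\<bar>min 1 (x powr r / W s)\<bar> \<le> 1"
proof -
  have "0 \<le> x powr r / W s" using W_pos[OF assms] by simp
  then show ?thesis by linarith
qed

text \<open>
  Integrability of \<open>W powr (- t)\<close> requires \<open>t < 1\<close>, so the decay at the origin is almost, but not quite, of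
  the order \<open>x powr r\<close> that the pointwise bound suggests.
\<close>

lemma min_moment_bound:
  assumes t: "0 \<le> t" "t < 1"
  shows "\<exists>C\<ge>0. \<forall>x>0. (\<integral>s. dens s * min 1 (x powr r / W s) \<partial>lborel) / mass \<le> C * x powr (r * t)"
proof (intro exI conjI allI impI)
  define C where "C = (\<integral>s. dens s * W s powr (- t) \<partial>lborel) / mass"
  show "0 \<le> C" using mass_pos dens_nonneg by (auto simp: C_def intro!: divide_nonneg_pos integral_nonneg)
  fix x :: real assume x: "x > 0"
  have "(\<integral>s. dens s * min 1 (x powr r / W s) \<partial>lborel)
      \<le> (\<integral>s. x powr (r * t) * (dens s * W s powr (- t)) \<partial>lborel)"
  proof (rule integral_mono)
    show "integrable lborel (\<lambda>s. dens s * min 1 (x powr r / W s))"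
      by (rule dens_mult_integrable[where C = 1]) (use min_abs_le in auto)
    show "integrable lborel (\<lambda>s. x powr (r * t) * (dens s * W s powr (- t)))"
      using t by (intro integrable_mult_right dens_W_integrable) auto
    fix s :: real
    have le: "min 1 (x powr r / W s) \<le> x powr (r * t) * W s powr (- t)" if "s > 0"
    proof -
      have "min 1 (x powr r / W s) \<le> (x powr r / W s) powr t"
        using t x W_pos[OF that] by (intro min_one_le_powr) auto
      also have "\<dots> = x powr (r * t) * W s powr (- t)"
        using x W_pos[OF that] by (simp add: powr_divide powr_powr powr_minus_divide)
      finally show ?thesis .
    qed
    show "dens s * min 1 (x powr r / W s) \<le> x powr (r * t) * (dens s * W s powr (- t))"
    proof (cases "s > 0")
      case True
      then have "dens s * min 1 (x powr r / W s) \<le> dens s * (x powr (r * t) * W s powr (- t))"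
        using le dens_nonneg[of s] by (intro mult_left_mono) auto
      then show ?thesis by (simp only: mult.left_commute)
    qed (simp add: dens_0)
  qed
  then show "(\<integral>s. dens s * min 1 (x powr r / W s) \<partial>lborel) / mass \<le> C * x powr (r * t)"
    unfolding integral_mult_right_zero using mass_pos
    by (simp add: C_def pos_divide_le_eq mult.commute)
qed

lemma \<phi>_near_0: "\<exists>C\<ge>0. \<forall>x>0. 1 - \<phi> x \<le> C * x powr (r / 2)"
proof -
  obtain C where C: "C \<ge> 0" "\<And>x. x > 0 \<Longrightarrow>
      (\<integral>s. dens s * min 1 (x powr r / W s) \<partial>lborel) / mass \<le> C * x powr (r * (1 / 2))"
    using min_moment_bound[of "1 / 2"] by auto
  have "1 - \<phi> x \<le> C * x powr (r / 2)" if x: "x > 0" for x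
  proof -
    have "1 - \<phi> x = (\<integral>s. dens s - dens s * stretched_exp r (1 / W s) x \<partial>lborel) / mass"
      using mass_pos
      by (simp add: \<phi>_def mass_def[symmetric] Bochner_Integration.integral_diff[OF dens_integrable \<phi>_integrable] field_simps)
    also have "\<dots> \<le> (\<integral>s. dens s * min 1 (x powr r / W s) \<partial>lborel) / mass"
    proof (intro divide_right_mono integral_mono)
      show "integrable lborel (\<lambda>s. dens s - dens s * stretched_exp r (1 / W s) x)"
        by (intro Bochner_Integration.integrable_diff dens_integrable \<phi>_integrable)
      show "integrable lborel (\<lambda>s. dens s * min 1 (x powr r / W s))"
        by (rule dens_mult_integrable[where C = 1]) (use min_abs_le in auto)
      fix s
      have "1 - stretched_exp r (1 / W s) x \<le> min 1 (x powr r / W s)" if "s > 0"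
        using x W_pos[OF that] exp_ge_add_one_self[of "- (x powr r / W s)"]
        by (auto simp: stretched_exp_def min_def max_def)
      then show "dens s - dens s * stretched_exp r (1 / W s) x \<le> dens s * min 1 (x powr r / W s)"
        using dens_nonneg[of s] mult_left_mono[of "1 - stretched_exp r (1 / W s) x" _ "dens s"]
        by (cases "s > 0") (auto simp: dens_0 right_diff_distrib)
    qed (use mass_pos in auto)
    also have "\<dots> \<le> C * x powr (r / 2)" using C(2)[OF x] by simp
    finally show ?thesis .
  qed
  then show ?thesis using C(1) by blast
qed

end

context cev_laplace begin

lemma \<phi>_has_integral:
    "has_bochner_integral lborel (\<lambda>s. dens s * stretched_exp r (1 / W s) x) (mass * \<phi> x)"
  and \<phi>1_has_integral: "x > 0 \<Longrightarrow>
    has_bochner_integral lborel (\<lambda>s. dens s * scaled_deriv1 r (x powr r / W s)) (mass * \<phi>1 x)"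
  and \<phi>2_has_integral: "x > 0 \<Longrightarrow>
    has_bochner_integral lborel (\<lambda>s. dens s * scaled_deriv2 r (x powr r / W s)) (mass * \<phi>2 x)"
  using mass_pos \<phi>_integrable \<phi>1_integrable \<phi>2_integrable
  by (auto simp: has_bochner_integral_iff \<phi>_def \<phi>1_def \<phi>2_def)

text \<open>
  The weight \<open>x powr (r * t)\<close> in front of the cubic term matters near the origin. There the
  increments of the schemes are not small enough relative to \<open>x\<close> for a bare cubic remainder to be
  summable. The power \<open>k\<close>, which can be chosen freely, accounts for increments of the order of \<open>x\<close>.
\<close>

definition Taylor_constant :: "real \<Rightarrow> nat \<Rightarrow> real \<Rightarrow> bool" where
  "Taylor_constant t k C \<longleftrightarrow> C \<ge> 0 \<and>
     (\<forall>x>0. \<forall>h. \<bar>\<phi> (x + h) - \<phi> x - \<phi>1 x * (h / x) - \<phi>2 x * (h / x)\<^sup>2 / 2\<bar>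
        \<le> C * (min 1 (x powr (r * t)) * (\<bar>h\<bar> / x) ^ 3 + (\<bar>h\<bar> / x) ^ k))"

lemma \<phi>_Taylor:
  assumes t: "0 \<le> t" "t < 1" and k: "k \<ge> 2"
  shows "\<exists>C. Taylor_constant t k C"
proof -
  obtain C0 where C0: "C0 \<ge> 0" "\<And>x. x > 0 \<Longrightarrow>
      (\<integral>s. dens s * min 1 (x powr r / W s) \<partial>lborel) / mass \<le> C0 * x powr (r * t)"
    using min_moment_bound[OF t] by auto
  define C where "C = max (24 * max 1 C0) (6 * 2 ^ k)"
  show ?thesis
    unfolding Taylor_constant_def
  proof (intro exI[of _ C] conjI allI impI)
    show "C \<ge> 0" by (simp add: C_def)
    fix x h :: real assume x: "x > 0"
    define u where "u = \<bar>h\<bar> / x"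
    have u: "u \<ge> 0" using x by (simp add: u_def)
    define R where "R = (\<lambda>s. stretched_exp r (1 / W s) (x + h) - stretched_exp r (1 / W s) x
      - scaled_deriv1 r (x powr r / W s) * (h / x) - scaled_deriv2 r (x powr r / W s) * (h / x)\<^sup>2 / 2)"
    define v where "v = (\<lambda>s. min 1 (x powr r / W s))"
    have v_int: "integrable lborel (\<lambda>s. dens s * v s)"
      unfolding v_def by (rule dens_mult_integrable[where C = 1]) (use min_abs_le in auto)
    have R_split: "dens s * R s = dens s * stretched_exp r (1 / W s) (x + h) - dens s * stretched_exp r (1 / W s) x
       - (dens s * scaled_deriv1 r (x powr r / W s)) * (h / x)
       - (dens s * scaled_deriv2 r (x powr r / W s)) * ((h / x)\<^sup>2 / 2)" for s
      by (simp add: R_def algebra_simps)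
    have "has_bochner_integral lborel (\<lambda>s. dens s * R s) (mass * \<phi> (x + h) - mass * \<phi> x
       - mass * \<phi>1 x * (h / x) - mass * \<phi>2 x * ((h / x)\<^sup>2 / 2))"
      unfolding R_split
      by (intro has_bochner_integral_diff has_bochner_integral_mult_left
          \<phi>_has_integral \<phi>1_has_integral[OF x] \<phi>2_has_integral[OF x])
    then have R_int: "integrable lborel (\<lambda>s. dens s * R s)"
      and R_eq: "(\<integral>s. dens s * R s \<partial>lborel) = mass * \<phi> (x + h) - mass * \<phi> x
       - mass * \<phi>1 x * (h / x) - mass * \<phi>2 x * ((h / x)\<^sup>2 / 2)"
      by (auto simp: has_bochner_integral_iff)
    have R_le: "\<bar>R s\<bar> \<le> 24 * u ^ 3 * v s + 6 * 2 ^ k * u ^ k" if "s > 0" for s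
    proof -
      have "\<bar>R s\<bar> \<le> 24 * min 1 (1 / W s * x powr r) * (\<bar>h\<bar> / x) ^ 3 + 6 * (2 * (\<bar>h\<bar> / x)) ^ k"
        using stretched_exp_Taylor[OF r _ x k, of "1 / W s" h] W_pos[OF that] by (simp add: R_def)
      moreover have "(2 * (\<bar>h\<bar> / x)) ^ k = 2 ^ k * u ^ k"
        by (simp only: u_def power_mult_distrib)
      ultimately show ?thesis by (simp add: u_def v_def mult_ac)
    qed
    have "(\<integral>s. dens s * R s \<partial>lborel) = mass * (\<phi> (x + h) - \<phi> x - \<phi>1 x * (h / x) - \<phi>2 x * (h / x)\<^sup>2 / 2)"
      unfolding R_eq by (simp add: algebra_simps)
    then have 1: "\<bar>\<phi> (x + h) - \<phi> x - \<phi>1 x * (h / x) - \<phi>2 x * (h / x)\<^sup>2 / 2\<bar>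
        = \<bar>\<integral>s. dens s * R s \<partial>lborel\<bar> / mass"
      using mass_pos by (simp add: abs_mult)
    have "\<bar>\<integral>s. dens s * R s \<partial>lborel\<bar>
        \<le> (\<integral>s. 24 * u ^ 3 * (dens s * v s) + 6 * 2 ^ k * u ^ k * dens s \<partial>lborel)"
    proof (rule integral_abs_bound[THEN order_trans], rule integral_mono)
      show "integrable lborel (\<lambda>s. \<bar>dens s * R s\<bar>)" using R_int by (rule integrable_abs)
      show "integrable lborel (\<lambda>s. 24 * u ^ 3 * (dens s * v s) + 6 * 2 ^ k * u ^ k * dens s)"
        by (intro Bochner_Integration.integrable_add integrable_mult_right v_int dens_integrable)
      fix s show "\<bar>dens s * R s\<bar> \<le> 24 * u ^ 3 * (dens s * v s) + 6 * 2 ^ k * u ^ k * dens s"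
      proof (cases "s > 0")
        case True
        have "\<bar>dens s * R s\<bar> = dens s * \<bar>R s\<bar>" using dens_nonneg[of s] by (simp add: abs_mult)
        also have "\<dots> \<le> dens s * (24 * u ^ 3 * v s + 6 * 2 ^ k * u ^ k)"
          using R_le[OF True] dens_nonneg[of s] by (rule mult_left_mono)
        finally show ?thesis by (simp add: algebra_simps)
      qed (simp add: dens_0)
    qed
    also have "\<dots> = 24 * u ^ 3 * (\<integral>s. dens s * v s \<partial>lborel) + 6 * 2 ^ k * u ^ k * mass"
      using v_int dens_integrable by (simp add: mass_def)
    finally have 2: "\<bar>\<integral>s. dens s * R s \<partial>lborel\<bar> / mass
        \<le> 24 * u ^ 3 * ((\<integral>s. dens s * v s \<partial>lborel) / mass) + 6 * 2 ^ k * u ^ k"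
      using mass_pos by (simp add: field_simps)
    have 3: "(\<integral>s. dens s * v s \<partial>lborel) / mass \<le> max 1 C0 * min 1 (x powr (r * t))"
    proof -
      have "(\<integral>s. dens s * v s \<partial>lborel) / mass \<le> 1"
        unfolding v_def by (rule abs_le_D1, rule dens_integral_le) (use min_abs_le in auto)
      moreover have "(\<integral>s. dens s * v s \<partial>lborel) / mass \<le> C0 * x powr (r * t)"
        using C0(2)[OF x] by (simp add: v_def)
      moreover have "C0 * x powr (r * t) \<le> max 1 C0 * x powr (r * t)" by (intro mult_right_mono) auto
      ultimately show ?thesis by (cases "1 \<le> x powr (r * t)") (auto simp: min_def max_def)
    qed
    have "24 * u ^ 3 * ((\<integral>s. dens s * v s \<partial>lborel) / mass)
        \<le> 24 * u ^ 3 * (max 1 C0 * min 1 (x powr (r * t)))"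
      using u by (intro mult_left_mono 3) auto
    with 1 2 have "\<bar>\<phi> (x + h) - \<phi> x - \<phi>1 x * (h / x) - \<phi>2 x * (h / x)\<^sup>2 / 2\<bar>
        \<le> 24 * u ^ 3 * (max 1 C0 * min 1 (x powr (r * t))) + 6 * 2 ^ k * u ^ k"
      by linarith
    also have "\<dots> = (24 * max 1 C0) * (min 1 (x powr (r * t)) * u ^ 3) + (6 * 2 ^ k) * u ^ k"
      by (simp add: mult_ac)
    also have "\<dots> \<le> C * (min 1 (x powr (r * t)) * u ^ 3) + C * u ^ k"
      using u by (intro add_mono mult_right_mono) (auto simp: C_def)
    finally show "\<bar>\<phi> (x + h) - \<phi> x - \<phi>1 x * (h / x) - \<phi>2 x * (h / x)\<^sup>2 / 2\<bar>
        \<le> C * (min 1 (x powr (r * t)) * (\<bar>h\<bar> / x) ^ 3 + (\<bar>h\<bar> / x) ^ k)"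
      by (simp add: u_def algebra_simps)
  qed
qed

text \<open>
  Applied to the integrand of \<open>\<phi>\<close>, the operator \<open>\<mu> x d/dx + (\<sigma>\<^sup>2 / 2) x\<^sup>2\<^sup>p d\<^sup>2/dx\<^sup>2 - \<alpha>\<close> is a derivative
  with respect to the mixing variable \<open>s\<close>: this is the reason for the equation that \<open>W\<close> satisfies and for the
  form of \<open>dens\<close>. The primitive vanishes at both ends, at \<open>s = 0\<close> because of \<open>exp (- x\<^sup>r / W s)\<close>
  and at infinity because of the discounting.
\<close>

lemma \<phi>_ODE:
  assumes x: "x > 0"
  shows "\<mu> * \<phi>1 x + \<sigma>\<^sup>2 / 2 * x powr (- r) * \<phi>2 x = \<alpha> * \<phi> x"
proof -
  define y where "y = x powr r"
  have y: "y > 0" using x by (simp add: y_def)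
  define F where "F = (\<lambda>s. exp (- \<alpha> * s) * (exp (growth * s) * W s) powr (1 / r - 1) * exp (- y / W s))"
  define G where "G = (\<lambda>s. \<mu> * scaled_deriv1 r (y / W s) + \<sigma>\<^sup>2 / 2 / y * scaled_deriv2 r (y / W s)
      - \<alpha> * exp (- y / W s))"
  define f where "f = (\<lambda>s. exp (- \<alpha> * s) * (exp (growth * s) * W s) powr (1 / r - 1) * G s)"
  have F_deriv: "(F has_real_derivative f s) (at s)" if "s > 0" for s
  proof -
    note Wp = W_pos[OF that]
    define n where "n = 1 / r - 1"
    define E where "E = (exp (growth * s) * W s) powr n"
    have 1: "((\<lambda>s. exp (growth * s) * W s) has_real_derivative exp (growth * s) * \<kappa>) (at s)"
      by (rule derivative_eq_intros W_deriv refl)+ (simp add: algebra_simps)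
    have 2: "((\<lambda>s. (exp (growth * s) * W s) powr n) has_real_derivative E * (n * \<kappa> / W s)) (at s)"
      using DERIV_fun_powr[OF 1, of n] Wp by (simp add: E_def powr_diff field_simps)
    have 3: "((\<lambda>s. exp (- y / W s)) has_real_derivative
        exp (- y / W s) * (y / (W s)\<^sup>2 * (\<kappa> - growth * W s))) (at s)"
    proof -
      have "((\<lambda>s. - y * inverse (W s)) has_real_derivative
          - y * - (inverse (W s) * (\<kappa> - growth * W s) * inverse (W s))) (at s)"
        using Wp by (intro DERIV_cmult DERIV_inverse' W_deriv) auto
      from DERIV_fun_exp[OF this] show ?thesis
        by (simp add: divide_inverse power2_eq_square mult_ac)
    qed
    have 4: "(F has_real_derivative exp (- \<alpha> * s) * E * exp (- y / W s) *
        (- \<alpha> + n * \<kappa> / W s + y / (W s)\<^sup>2 * (\<kappa> - growth * W s))) (at s)"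
      unfolding F_def n_def[symmetric]
      by (rule derivative_eq_intros 2 3 refl)+ (simp add: E_def algebra_simps)
    have "- \<alpha> + n * \<kappa> / W s + y / (W s)\<^sup>2 * (\<kappa> - growth * W s) =
        - \<mu> * r * (y / W s) + \<sigma>\<^sup>2 / 2 / y * (r * (1 - r) * (y / W s) + r\<^sup>2 * (y / W s)\<^sup>2) - \<alpha>"
      using Wp y r by (simp add: n_def \<kappa>_def growth_def field_simps power2_eq_square)
    moreover have "\<mu> * scaled_deriv1 r v + c * scaled_deriv2 r v - \<alpha> * exp (- v) =
        exp (- v) * (- \<mu> * r * v + c * (r * (1 - r) * v + r\<^sup>2 * v\<^sup>2) - \<alpha>)" for v c
      by (simp add: scaled_deriv1_def scaled_deriv2_def algebra_simps)
    from this[of "y / W s" "\<sigma>\<^sup>2 / 2 / y"] have "G s = exp (- y / W s) *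
        (- \<mu> * r * (y / W s) + \<sigma>\<^sup>2 / 2 / y * (r * (1 - r) * (y / W s) + r\<^sup>2 * (y / W s)\<^sup>2) - \<alpha>)"
      by (simp only: G_def minus_divide_left)
    ultimately have "exp (- \<alpha> * s) * E * exp (- y / W s) *
        (- \<alpha> + n * \<kappa> / W s + y / (W s)\<^sup>2 * (\<kappa> - growth * W s)) = f s"
      by (simp only: f_def E_def n_def mult.assoc)
    then show ?thesis using 4 by simp
  qed
  have f_cont: "isCont f s" if "s > 0" for s
    unfolding f_def G_def scaled_deriv1_def scaled_deriv2_def using W_pos[OF that]
    by (intro continuous_intros DERIV_isCont[OF W_deriv]) auto
  have eqs: "dens s = exp (- \<alpha> * s) * (exp (growth * s) * W s) powr (1 / r - 1)"
     "stretched_exp r (1 / W s) x = exp (- y / W s)" if "s > 0" for s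
    using that x by (auto simp: dens_def stretched_exp_def y_def)
  have f_eq: "indicator {0<..} s *\<^sub>R f s = \<mu> * (dens s * scaled_deriv1 r (x powr r / W s))
      + \<sigma>\<^sup>2 / 2 / y * (dens s * scaled_deriv2 r (x powr r / W s))
      - \<alpha> * (dens s * stretched_exp r (1 / W s) x)" for s
  proof (cases "s > 0")
    case True
    then show ?thesis unfolding f_def G_def eqs(1)[OF True, symmetric] eqs(2)[OF True, symmetric]
      by (simp add: y_def algebra_simps)
  qed (simp add: dens_0)
  have f_bochner: "has_bochner_integral lborel (\<lambda>s. indicator {0<..} s *\<^sub>R f s)
      (\<mu> * (mass * \<phi>1 x) + \<sigma>\<^sup>2 / 2 / y * (mass * \<phi>2 x) - \<alpha> * (mass * \<phi> x))"
    unfolding f_eq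
    by (intro has_bochner_integral_add has_bochner_integral_diff has_bochner_integral_mult_right
        \<phi>_has_integral \<phi>1_has_integral[OF x] \<phi>2_has_integral[OF x])
  have einterval_eq: "einterval 0 \<infinity> = {0::real<..}" by (auto simp: einterval_def)
  have f_int: "set_integrable lborel (einterval 0 \<infinity>) f"
    using f_bochner by (simp add: einterval_eq set_integrable_def has_bochner_integral_iff)
  define K where "K = \<kappa> powr (1 / r) / y"
  have F_le: "F s \<le> K * (s powr (1 / r) * exp (- s))" and F_nonneg: "0 \<le> F s" if "s > 0" for s
  proof -
    note Wp = W_pos[OF that]
    have "y / W s \<le> exp (y / W s)" using exp_ge_add_one_self[of "y / W s"] by linarith
    then have "exp (- y / W s) \<le> W s / y" using y Wp by (simp add: exp_minus field_simps)
    then have "F s \<le> dens s * (W s / y)"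
      unfolding F_def eqs(1)[OF that, symmetric] by (intro mult_left_mono dens_nonneg)
    also have "\<dots> = dens s * W s powr 1 / y" using Wp by simp
    also have "\<dots> \<le> (\<kappa> * s) powr (1 / r - 1 + 1) * exp (- s) / y"
      using y by (intro divide_right_mono dens_W_le that) auto
    also have "\<dots> = K * (s powr (1 / r) * exp (- s))"
      using that \<kappa> by (simp add: K_def powr_mult)
    finally show "F s \<le> K * (s powr (1 / r) * exp (- s))" .
    show "0 \<le> F s" by (simp add: F_def)
  qed
  have pos_r: "1 / r > 0" using r by simp
  have lim0: "((\<lambda>s. K * (s powr (1 / r) * exp (- s))) \<longlongrightarrow> 0) (at_right 0)"
  proof -
    have "((\<lambda>s. s powr (1 / r)) \<longlongrightarrow> 0) (at_right 0)"
      using pos_r by real_asymp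
    then have "((\<lambda>s. K * (s powr (1 / r) * exp (- s))) \<longlongrightarrow> K * (0 * exp (- 0))) (at_right 0)"
      by (intro tendsto_intros)
    then show ?thesis by simp
  qed
  have liminf: "((\<lambda>s. K * (s powr (1 / r) * exp (- s))) \<longlongrightarrow> 0) at_top"
  proof -
    have "((\<lambda>s::real. s powr (1 / r) * exp (- s)) \<longlongrightarrow> 0) at_top"
      using pos_r by real_asymp
    then have "((\<lambda>s. K * (s powr (1 / r) * exp (- s))) \<longlongrightarrow> K * 0) at_top"
      by (intro tendsto_intros)
    then show ?thesis by simp
  qed
  have "(F \<longlongrightarrow> 0) (at_right 0)"
    by (rule tendsto_sandwich[OF _ _ tendsto_const lim0])
      (auto intro!: eventually_mono[OF eventually_at_right_less[of 0]] F_le F_nonneg)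
  moreover have "(F \<longlongrightarrow> 0) at_top"
    by (rule tendsto_sandwich[OF _ _ tendsto_const liminf])
      (auto intro!: eventually_mono[OF eventually_gt_at_top[of 0]] F_le F_nonneg)
  ultimately have "(LBINT s=0..\<infinity>. f s) = 0 - 0"
    by (intro interval_integral_FTC_integrable[of 0 \<infinity> F f])
      (auto simp: F_deriv f_cont f_int[unfolded einterval_eq] ereal_tendsto_simps zero_ereal_def
        has_real_derivative_iff_has_vector_derivative[symmetric])
  then have "(\<integral>s. indicator {0<..} s *\<^sub>R f s \<partial>lborel) = 0"
    by (simp add: interval_lebesgue_integral_0_infty set_lebesgue_integral_def)
  then have "\<mu> * (mass * \<phi>1 x) + \<sigma>\<^sup>2 / 2 / y * (mass * \<phi>2 x) - \<alpha> * (mass * \<phi> x) = 0"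
    using f_bochner by (auto simp: has_bochner_integral_iff)
  then have "mass * (\<mu> * \<phi>1 x + \<sigma>\<^sup>2 / 2 / y * \<phi>2 x - \<alpha> * \<phi> x) = 0"
    by (simp add: algebra_simps)
  then show ?thesis using mass_pos by (simp add: y_def powr_minus_divide)
qed

end

section \<open>Discount factors determine weak limits\<close>

definition discount :: "real \<Rightarrow> ennreal \<Rightarrow> real" where
  "discount \<alpha> s = (if s = \<top> then 0 else exp (- \<alpha> * enn2real s))"

lemma discount_ennreal: "t \<ge> 0 \<Longrightarrow> discount \<alpha> (ennreal t) = exp (- \<alpha> * t)"
  by (simp add: discount_def)

lemma discount_top [simp]: "discount \<alpha> \<top> = 0"
  by (simp add: discount_def)

lemma discount_nonneg: "0 \<le> discount \<alpha> s"
  by (simp add: discount_def)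

lemma discount_le_1: "\<alpha> \<ge> 0 \<Longrightarrow> discount \<alpha> s \<le> 1"
  by (simp add: discount_def)

lemma discount_power: "n \<ge> 1 \<Longrightarrow> discount (real n * \<alpha>) s = discount \<alpha> s ^ n"
  by (auto simp: discount_def exp_of_nat_mult[symmetric] mult_ac)

lemma discount_antimono:
  assumes "\<alpha> \<ge> 0" "s \<le> t"
  shows "discount \<alpha> t \<le> discount \<alpha> s"
proof (cases "t = \<top>")
  case False
  then have "t < \<top>" by (simp add: top.not_eq_extremum)
  then have "enn2real s \<le> enn2real t" using assms by (intro enn2real_mono) auto
  moreover have "s \<noteq> \<top>" using assms \<open>t < \<top>\<close> by auto
  ultimately show ?thesis using False assms by (auto simp: discount_def intro: mult_left_mono)
qed (simp add: discount_nonneg)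

lemma discount_measurable [measurable]: "discount \<alpha> \<in> borel_measurable borel"
  unfolding discount_def by measurable

text \<open>The discount factor identifies \<open>[0, \<infinity>]\<close> with the compact interval \<open>[0, 1]\<close>.\<close>

lemma continuous_via_discount:
  assumes \<alpha>: "\<alpha> > 0" and f: "continuous_map rho.mtopology euclideanreal f"
  obtains g where "continuous_on {0..1} g" "\<And>s. f s = g (discount \<alpha> s)"
proof -
  define J where "J = (\<lambda>v::real. if v = 0 then \<top> else ennreal (- ln v / \<alpha>))"
  have J_discount: "J (discount \<alpha> s) = s" for s
    using \<alpha> by (cases s) (auto simp: J_def discount_def)
  have arctan_J: "arctan_ext (J v) = (if v = 0 then pi / 2 else arctan (- ln v / \<alpha>))"
    if "v \<in> {0..1}" for v
    using that \<alpha> by (auto simp: J_def arctan_ext_def enn2real_ennreal divide_nonpos_nonneg)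
  have cont_arctan: "continuous_on {0..1} (\<lambda>v. arctan_ext (J v))"
  proof (rule continuous_on_cong[THEN iffD1, OF refl arctan_J[symmetric]])
    show "continuous_on {0..1} (\<lambda>v. if v = 0 then pi / 2 else arctan (- ln v / \<alpha>))"
      unfolding continuous_on_def
    proof
      fix v :: real assume v: "v \<in> {0..1}"
      show "((\<lambda>v. if v = 0 then pi / 2 else arctan (- ln v / \<alpha>)) \<longlongrightarrow>
          (if v = 0 then pi / 2 else arctan (- ln v / \<alpha>))) (at v within {0..1})"
      proof (cases "v = 0")
        case True
        have "((\<lambda>v. arctan (- ln v / \<alpha>)) \<longlongrightarrow> pi / 2) (at_right 0)"
          using \<alpha> by (intro filterlim_compose[OF tendsto_arctan_at_top]) real_asymp
        then have "((\<lambda>v. if v = 0 then pi / 2 else arctan (- ln v / \<alpha>)) \<longlongrightarrow> pi / 2) (at_right 0)"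
          by (rule tendsto_cong[THEN iffD1, rotated])
            (auto intro!: eventually_mono[OF eventually_at_right_less[of 0]])
        then have "((\<lambda>v. if v = 0 then pi / 2 else arctan (- ln v / \<alpha>)) \<longlongrightarrow> pi / 2) (at 0 within {0..1})"
          by (simp add: at_within_Icc_at_right)
        then show ?thesis using True by simp
      next
        case False
        then have "((\<lambda>v. arctan (- ln v / \<alpha>)) \<longlongrightarrow> arctan (- ln v / \<alpha>)) (at v within {0..1})"
          using v \<alpha> by (intro tendsto_intros) auto
        then have "((\<lambda>v. if v = 0 then pi / 2 else arctan (- ln v / \<alpha>)) \<longlongrightarrow> arctan (- ln v / \<alpha>)) (at v within {0..1})"
        proof (rule tendsto_cong[THEN iffD1, rotated])
          show "\<forall>\<^sub>F w in at v within {0..1}. arctan (- ln w / \<alpha>) = (if w = 0 then pi / 2 else arctan (- ln w / \<alpha>))"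
            using eventually_neq_at_within[of 0 v "{0..1}"] by eventually_elim auto
        qed
        then show ?thesis using False by simp
      qed
    qed
  qed
  have "continuous_on {0..1} (\<lambda>v. f (J v))"
    unfolding continuous_on_iff
  proof (intro ballI allI impI)
    fix v e :: real assume v: "v \<in> {0..1}" and e: "e > 0"
    have "continuous_map rho.mtopology Met_TC.mtopology f"
      using f by simp
    then have "\<forall>a \<epsilon>. 0 < \<epsilon> \<longrightarrow> (\<exists>\<delta>>0. \<forall>x. rho a x < \<delta> \<longrightarrow> dist (f a) (f x) < \<epsilon>)"
      unfolding rho.metric_continuous_map[OF Met_TC.Metric_space_axioms] by simp
    from this[rule_format, OF e, of "J v"]
    obtain d where d: "d > 0" "\<And>s. rho (J v) s < d \<Longrightarrow> dist (f (J v)) (f s) < e"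
      by blast
    obtain d' where d': "d' > 0"
      "\<And>w. w \<in> {0..1} \<Longrightarrow> dist w v < d' \<Longrightarrow> dist (arctan_ext (J w)) (arctan_ext (J v)) < d"
      using cont_arctan[unfolded continuous_on_iff, rule_format, OF v d(1)] by blast
    show "\<exists>d>0. \<forall>w\<in>{0..1}. dist w v < d \<longrightarrow> dist (f (J w)) (f (J v)) < e"
    proof (intro exI[of _ d'] conjI ballI impI d'(1))
      fix w :: real assume w: "w \<in> {0..1}" "dist w v < d'"
      have "rho (J v) (J w) = dist (arctan_ext (J w)) (arctan_ext (J v))"
        unfolding rho_def dist_real_def by (rule abs_minus_commute)
      with d'(2)[OF w] d(2)[of "J w"] show "dist (f (J w)) (f (J v)) < e"
        by (simp only: dist_commute)
    qed
  qed
  then show thesis by (rule that) (simp add: J_discount)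
qed

text \<open>Polynomials in the discount factor are uniformly dense, so the moments determine the limit.\<close>

lemma weak_convergence_via_discount:
  fixes \<tau> :: "real \<Rightarrow> 'b \<Rightarrow> ennreal" and \<tau>0 :: "'a \<Rightarrow> ennreal"
  assumes "prob_space N" "prob_space M"
    and [measurable]: "\<And>\<delta>. \<tau> \<delta> \<in> borel_measurable N" "\<tau>0 \<in> borel_measurable M"
    and \<alpha>: "\<alpha> > 0"
    and lim: "\<And>n. n \<ge> 1 \<Longrightarrow> ((\<lambda>\<delta>. \<integral>\<omega>. discount (real n * \<alpha>) (\<tau> \<delta> \<omega>) \<partial>N) \<longlongrightarrow>
        (\<integral>\<omega>. discount (real n * \<alpha>) (\<tau>0 \<omega>) \<partial>M)) L"
    and f: "continuous_map rho.mtopology euclideanreal f"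
  shows "((\<lambda>\<delta>. \<integral>\<omega>. f (\<tau> \<delta> \<omega>) \<partial>N) \<longlongrightarrow> (\<integral>\<omega>. f (\<tau>0 \<omega>) \<partial>M)) L"
proof -
  interpret N: prob_space N by fact
  interpret M: prob_space M by fact
  obtain g where g: "continuous_on {0..1} g" and fg: "\<And>s. f s = g (discount \<alpha> s)"
    using continuous_via_discount[OF \<alpha> f] by metis
  have range: "discount \<alpha> s \<in> {0..1}" for s
    using discount_nonneg[of \<alpha> s] discount_le_1[of \<alpha> s] \<alpha> by auto
  have "(\<lambda>s. g (discount \<alpha> s)) \<in> borel_measurable borel"
  proof -
    have "g \<in> borel_measurable (restrict_space borel {0..1})"
      by (rule borel_measurable_continuous_on_restrict[OF g])
    moreover have "discount \<alpha> \<in> measurable borel (restrict_space borel {0..1})"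
      using range by (intro measurable_restrict_space2) auto
    ultimately show ?thesis by (rule measurable_compose_rev)
  qed
  moreover have "f = (\<lambda>s. g (discount \<alpha> s))"
    by (rule ext) (rule fg)
  ultimately have f_meas [measurable]: "f \<in> borel_measurable borel"
    by simp
  have bounded: "\<exists>B. \<forall>v\<in>{0..1}. \<bar>g v\<bar> \<le> B"
    using compact_imp_bounded[OF compact_continuous_image[OF g]] by (auto simp: bounded_iff)
  then obtain B where B: "\<And>v. v \<in> {0..1} \<Longrightarrow> \<bar>g v\<bar> \<le> B" by blast
  have f_le: "\<bar>f s\<bar> \<le> B" for s
    using B[OF range[of s]] by (simp add: fg)
  have int_f: "integrable N (\<lambda>\<omega>. f (\<tau> \<delta> \<omega>))" for \<delta>
    by (rule N.integrable_const_bound[where B = B]) (auto simp: f_le)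
  have int_f0: "integrable M (\<lambda>\<omega>. f (\<tau>0 \<omega>))"
    by (rule M.integrable_const_bound[where B = B]) (auto simp: f_le)
  have int_p: "integrable N (\<lambda>\<omega>. discount \<alpha> (\<tau> \<delta> \<omega>) ^ n)" for \<delta> n
    using range by (intro N.integrable_const_bound[where B = 1]) (auto intro!: power_le_one)
  have int_p0: "integrable M (\<lambda>\<omega>. discount \<alpha> (\<tau>0 \<omega>) ^ n)" for n
    using range by (intro M.integrable_const_bound[where B = 1]) (auto intro!: power_le_one)
  show ?thesis
  proof (rule tendstoI)
    fix e :: real assume e: "e > 0"
    obtain q where q: "real_polynomial_function q" "\<And>v. v \<in> {0..1} \<Longrightarrow> \<bar>g v - q v\<bar> < e / 3"
      using Stone_Weierstrass_real_polynomial_function[OF compact_Icc g, of "e / 3"] e by auto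
    obtain a n where q_eq: "q = (\<lambda>v. \<Sum>i\<le>n. a i * v ^ i)"
      using q(1) real_polynomial_function_iff_sum by blast
    define Q where "Q = (\<lambda>s. \<Sum>i\<le>n. a i * discount \<alpha> s ^ i)"
    have close: "\<bar>f s - Q s\<bar> < e / 3" for s
      using q(2)[OF range[of s]] by (simp add: fg Q_def q_eq)
    have moment: "((\<lambda>\<delta>. \<integral>\<omega>. discount \<alpha> (\<tau> \<delta> \<omega>) ^ i \<partial>N) \<longlongrightarrow> (\<integral>\<omega>. discount \<alpha> (\<tau>0 \<omega>) ^ i \<partial>M)) L" for i
      using lim[of i] discount_power[of i \<alpha>] by (cases "i = 0") (simp_all add: N.prob_space M.prob_space)
    have "((\<lambda>\<delta>. \<Sum>i\<le>n. a i * (\<integral>\<omega>. discount \<alpha> (\<tau> \<delta> \<omega>) ^ i \<partial>N)) \<longlongrightarrow>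
        (\<Sum>i\<le>n. a i * (\<integral>\<omega>. discount \<alpha> (\<tau>0 \<omega>) ^ i \<partial>M))) L"
      by (intro tendsto_sum tendsto_mult tendsto_const moment)
    then have Q_lim: "((\<lambda>\<delta>. \<integral>\<omega>. Q (\<tau> \<delta> \<omega>) \<partial>N) \<longlongrightarrow> (\<integral>\<omega>. Q (\<tau>0 \<omega>) \<partial>M)) L"
      unfolding Q_def using int_p int_p0 by simp
    have Q_int: "integrable N (\<lambda>\<omega>. Q (\<tau> \<delta> \<omega>))" "integrable M (\<lambda>\<omega>. Q (\<tau>0 \<omega>))" for \<delta>
      unfolding Q_def using int_p int_p0 by auto
    have 1: "\<bar>(\<integral>\<omega>. f (\<tau> \<delta> \<omega>) \<partial>N) - (\<integral>\<omega>. Q (\<tau> \<delta> \<omega>) \<partial>N)\<bar> \<le> e / 3" for \<delta>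
    proof -
      have "\<bar>(\<integral>\<omega>. f (\<tau> \<delta> \<omega>) - Q (\<tau> \<delta> \<omega>) \<partial>N)\<bar> \<le> (\<integral>\<omega>. e / 3 \<partial>N)"
        using int_f Q_int close
        by (intro integral_abs_bound[THEN order_trans] integral_mono) (auto intro: less_imp_le)
      then show ?thesis using int_f Q_int by (simp add: N.prob_space)
    qed
    have 2: "\<bar>(\<integral>\<omega>. f (\<tau>0 \<omega>) \<partial>M) - (\<integral>\<omega>. Q (\<tau>0 \<omega>) \<partial>M)\<bar> \<le> e / 3"
    proof -
      have "\<bar>(\<integral>\<omega>. f (\<tau>0 \<omega>) - Q (\<tau>0 \<omega>) \<partial>M)\<bar> \<le> (\<integral>\<omega>. e / 3 \<partial>M)"
        using int_f0 Q_int close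
        by (intro integral_abs_bound[THEN order_trans] integral_mono) (auto intro: less_imp_le)
      then show ?thesis using int_f0 Q_int by (simp add: M.prob_space)
    qed
    have "\<forall>\<^sub>F \<delta> in L. dist (\<integral>\<omega>. Q (\<tau> \<delta> \<omega>) \<partial>N) (\<integral>\<omega>. Q (\<tau>0 \<omega>) \<partial>M) < e / 3"
      using tendstoD[OF Q_lim, of "e / 3"] e by simp
    then show "\<forall>\<^sub>F \<delta> in L. dist (\<integral>\<omega>. f (\<tau> \<delta> \<omega>) \<partial>N) (\<integral>\<omega>. f (\<tau>0 \<omega>) \<partial>M) < e"
    proof eventually_elim
      case (elim \<delta>)
      then show ?case using 1[of \<delta>] 2 unfolding dist_real_def by linarith
    qed
  qed
qed

section \<open>Hitting times of continuous paths\<close>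

text \<open>A countable set of times that suffices to observe a continuous path on \<open>[0, t]\<close>.\<close>

definition test_times :: "real \<Rightarrow> real set" where
  "test_times t = insert t ({0..t} \<inter> \<rat>)"

lemma countable_test_times [simp]: "countable (test_times t)"
  by (simp add: test_times_def countable_rat countable_Int2)

lemma test_times_subset: "t \<ge> 0 \<Longrightarrow> test_times t \<subseteq> {0..t}"
  by (auto simp: test_times_def)

lemma exceeds_at_test_time:
  fixes h :: "real \<Rightarrow> real"
  assumes h: "continuous_on {0..t} h" and s: "s \<in> {0..t}" and "h s > c"
  shows "\<exists>q\<in>test_times t. h q > c"
proof (cases "s = t")
  case False
  obtain d where d: "d > 0" "\<And>q. q \<in> {0..t} \<Longrightarrow> dist q s < d \<Longrightarrow> dist (h q) (h s) < h s - c"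
    using h s \<open>h s > c\<close> unfolding continuous_on_iff by (metis diff_gt_0_iff_gt)
  have "s < min t (s + d)" using False s d by auto
  then obtain q where q: "q \<in> \<rat>" "s < q" "q < min t (s + d)"
    using Rats_dense_in_real by blast
  then have "q \<in> {0..t}" "dist q s < d" using s by (auto simp: dist_real_def)
  from d(2)[OF this] have "h q > c" by (simp add: dist_real_def)
  then show ?thesis using q \<open>q \<in> {0..t}\<close> by (auto simp: test_times_def)
qed (use assms in \<open>auto simp: test_times_def\<close>)

lemma hitting_time_le: "0 \<le> s \<Longrightarrow> u s = l \<Longrightarrow> hitting_time l u \<le> ennreal s"
  unfolding hitting_time_def by (rule Inf_lower) auto

lemma hitting_time_ge: "(\<And>s. 0 \<le> s \<Longrightarrow> s < T \<Longrightarrow> u s \<noteq> l) \<Longrightarrow> ennreal T \<le> hitting_time l u"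
  unfolding hitting_time_def
proof (rule Inf_greatest, safe)
  fix t assume "\<And>s. 0 \<le> s \<Longrightarrow> s < T \<Longrightarrow> u s \<noteq> u t" "0 \<le> t"
  from this(1)[of t] this(2) have "T \<le> t" by (meson not_le)
  then show "ennreal T \<le> ennreal t" by (rule ennreal_leI)
qed

lemma hitting_time_le_IVT:
  assumes "continuous_on {0..} u" "u 0 \<ge> l" "t \<ge> 0" "u t \<le> l"
  shows "hitting_time l u \<le> ennreal t"
proof -
  have "continuous_on {0..t} u" using assms(1) by (rule continuous_on_subset) auto
  then obtain s where "0 \<le> s" "s \<le> t" "u s = l"
    using IVT2'[of u t l 0] assms by auto
  then have "hitting_time l u \<le> ennreal s" by (intro hitting_time_le)
  also have "\<dots> \<le> ennreal t" using \<open>s \<le> t\<close> by (rule ennreal_leI)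
  finally show ?thesis .
qed

lemma hitting_time_le_iff:
  assumes u: "continuous_on {0..} u" and t: "t \<ge> 0"
  shows "hitting_time l u \<le> ennreal t \<longleftrightarrow> (\<exists>s\<in>{0..t}. u s = l)"
proof
  assume le: "hitting_time l u \<le> ennreal t"
  show "\<exists>s\<in>{0..t}. u s = l"
  proof (rule ccontr)
    assume none: "\<not> (\<exists>s\<in>{0..t}. u s = l)"
    define S where "S = {s \<in> {0..}. u s = l}"
    have S_closed: "closed S"
      unfolding S_def using u by (intro continuous_closed_preimage_constant) auto
    have S_bdd: "bdd_below S" by (rule bdd_belowI[of _ 0]) (auto simp: S_def)
    show False
    proof (cases "S = {}")
      case True
      then have "hitting_time l u = \<top>"
        by (auto simp: hitting_time_def S_def intro!: Inf_eqI)
      then show False using le by (simp add: top_unique)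
    next
      case False
      then have "Inf S \<in> S" using S_closed S_bdd closed_contains_Inf by blast
      then have "t < Inf S" "0 \<le> Inf S" using none by (force simp: S_def)+
      moreover have "ennreal (Inf S) \<le> hitting_time l u"
        by (rule hitting_time_ge) (metis (mono_tags, lifting) S_bdd S_def atLeast_iff cInf_lower mem_Collect_eq not_le)
      ultimately have "ennreal (Inf S) \<le> ennreal t" using le by (metis order_trans)
      then show False using \<open>t < Inf S\<close> t by (simp add: ennreal_le_iff)
    qed
  qed
next
  assume "\<exists>s\<in>{0..t}. u s = l"
  then obtain s where "0 \<le> s" "s \<le> t" "u s = l" by auto
  then have "hitting_time l u \<le> ennreal s" by (intro hitting_time_le)
  also have "\<dots> \<le> ennreal t" using \<open>s \<le> t\<close> by (rule ennreal_leI)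
  finally show "hitting_time l u \<le> ennreal t" .
qed

text \<open>
  By compactness an approximate hit at every precision is a hit; this turns hitting within \<open>[0, t]\<close> into a
  countable condition.
\<close>

lemma hits_iff_approaches:
  fixes u :: "real \<Rightarrow> real"
  assumes u: "continuous_on {0..t} u" and t: "t \<ge> 0"
  shows "(\<exists>s\<in>{0..t}. u s = l) \<longleftrightarrow> (\<forall>n. \<exists>q\<in>test_times t. \<bar>u q - l\<bar> < 1 / real (Suc n))"
proof
  assume "\<exists>s\<in>{0..t}. u s = l"
  then obtain s where s: "s \<in> {0..t}" "u s = l" by auto
  have "continuous_on {0..t} (\<lambda>q. - \<bar>u q - l\<bar>)" by (intro continuous_intros u)
  from exceeds_at_test_time[OF this s(1), of "- (1 / real (Suc n))" for n] s(2)
  show "\<forall>n. \<exists>q\<in>test_times t. \<bar>u q - l\<bar> < 1 / real (Suc n)" by simp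
next
  assume near: "\<forall>n. \<exists>q\<in>test_times t. \<bar>u q - l\<bar> < 1 / real (Suc n)"
  have "continuous_on {0..t} (\<lambda>q. \<bar>u q - l\<bar>)" by (intro continuous_intros u)
  then obtain s where s: "s \<in> {0..t}" "\<And>q. q \<in> {0..t} \<Longrightarrow> \<bar>u s - l\<bar> \<le> \<bar>u q - l\<bar>"
    using continuous_attains_inf[of "{0..t}" "\<lambda>q. \<bar>u q - l\<bar>"] t by auto
  have less: "\<bar>u s - l\<bar> < 1 / real (Suc n)" for n
    using near s(2) test_times_subset[OF t] by (meson le_less_trans subsetD)
  have "u s = l"
  proof (rule ccontr)
    assume "u s \<noteq> l"
    then obtain n where "inverse (real (Suc n)) < \<bar>u s - l\<bar>"
      using reals_Archimedean[of "\<bar>u s - l\<bar>"] by auto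
    with less[of n] show False by (simp add: inverse_eq_divide)
  qed
  with s(1) show "\<exists>s\<in>{0..t}. u s = l" by auto
qed

lemma hitting_time_measurable:
  assumes meas: "\<And>t. t \<ge> 0 \<Longrightarrow> Y t \<in> borel_measurable M"
    and cont: "\<And>\<omega>. \<omega> \<in> space M \<Longrightarrow> continuous_on {0..} (\<lambda>t. Y t \<omega>)"
  shows "(\<lambda>\<omega>. hitting_time l (\<lambda>t. Y t \<omega>)) \<in> borel_measurable M"
proof (rule borel_measurableI_le)
  fix y :: ennreal
  show "{\<omega> \<in> space M. hitting_time l (\<lambda>t. Y t \<omega>) \<le> y} \<in> sets M"
  proof (cases y)
    case (real t)
    have [measurable]: "q \<in> test_times t \<Longrightarrow> Y q \<in> borel_measurable M" for q
      using test_times_subset[OF real(1)] by (intro meas) auto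
    have "{\<omega> \<in> space M. hitting_time l (\<lambda>t. Y t \<omega>) \<le> y}
        = {\<omega> \<in> space M. \<forall>n. \<exists>q\<in>test_times t. \<bar>Y q \<omega> - l\<bar> < 1 / real (Suc n)}"
    proof (rule Collect_cong, rule conj_cong[OF refl])
      fix \<omega> assume "\<omega> \<in> space M"
      then have c: "continuous_on {0..} (\<lambda>t. Y t \<omega>)" by (rule cont)
      then have "continuous_on {0..t} (\<lambda>t. Y t \<omega>)" by (rule continuous_on_subset) auto
      with c real show "hitting_time l (\<lambda>t. Y t \<omega>) \<le> y \<longleftrightarrow>
          (\<forall>n. \<exists>q\<in>test_times t. \<bar>Y q \<omega> - l\<bar> < 1 / real (Suc n))"
        by (simp only: hitting_time_le_iff hits_iff_approaches)
    qed
    also have "\<dots> = (\<Inter>n. \<Union>q\<in>test_times t. {\<omega> \<in> space M. \<bar>Y q \<omega> - l\<bar> < 1 / real (Suc n)})"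
      by (auto)
    also have "\<dots> \<in> sets M"
    proof (rule sets.countable_INT')
      have "(\<Union>q\<in>test_times t. {\<omega> \<in> space M. \<bar>Y q \<omega> - l\<bar> < 1 / real (Suc n)}) \<in> sets M" for n
      proof (rule sets.countable_UN')
        show "(\<lambda>q. {\<omega> \<in> space M. \<bar>Y q \<omega> - l\<bar> < 1 / real (Suc n)}) ` test_times t \<subseteq> sets M"
        proof safe
          fix q assume [measurable]: "q \<in> test_times t"
          show "{\<omega> \<in> space M. \<bar>Y q \<omega> - l\<bar> < 1 / real (Suc n)} \<in> sets M" by measurable
        qed
      qed simp
      then show "range (\<lambda>n. \<Union>q\<in>test_times t. {\<omega> \<in> space M. \<bar>Y q \<omega> - l\<bar> < 1 / real (Suc n)}) \<subseteq> sets M"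
        by auto
    qed auto
    finally show ?thesis .
  qed auto
qed

lemma adapted_measurable:
  assumes "usual_conditions M F" "adapted F X" "t \<ge> 0"
  shows "X t \<in> borel_measurable M"
proof (rule measurable_from_subalg)
  show "subalgebra M (F t)"
    using assms(1) filtration.space_F[of "space M" F t] by (auto simp: subalgebra_def usual_conditions_def)
qed (use assms(2,3) in \<open>simp add: adapted_def\<close>)

lemma continuous_on_half_line:
  fixes u :: "real \<Rightarrow> real"
  assumes "\<And>T. T \<ge> 0 \<Longrightarrow> continuous_on {0..T} u"
  shows "continuous_on {0..} u"
  unfolding continuous_on_eq_continuous_within
proof
  fix t :: real assume t: "t \<in> {0..}"
  have "continuous (at t within {0..t + 1}) u"
    using assms[of "t + 1"] t by (auto simp: continuous_on_eq_continuous_within)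
  moreover have "at t within {0..} = at t within {0..t + 1}"
    by (rule at_within_nhd[of _ "{..<t + 1}"]) auto
  ultimately show "continuous (at t within {0..}) u" by simp
qed

lemma hitting_time_ge_stays_positive:
  fixes u :: "real \<Rightarrow> real"
  assumes u: "continuous_on {0..} u" "u 0 > 0" "\<And>t. t \<ge> 0 \<Longrightarrow> u t \<ge> 0" and e: "e \<longlonglongrightarrow> (0::real)"
    and T: "T \<ge> 0" "ennreal T < hitting_time 0 u"
  shows "\<forall>\<^sub>F n in sequentially. ennreal T \<le> hitting_time (e n) u"
proof -
  have "continuous_on {0..T} u" using u(1) by (rule continuous_on_subset) auto
  then obtain s where s: "s \<in> {0..T}" "\<And>q. q \<in> {0..T} \<Longrightarrow> u s \<le> u q"
    using continuous_attains_inf[of "{0..T}" u] T by auto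
  have "u s \<noteq> 0"
    using T s(1) hitting_time_le_iff[OF u(1) T(1), of 0] by (meson leD)
  then have "u s > 0" using u(3)[of s] s(1) by auto
  with e have "\<forall>\<^sub>F n in sequentially. e n < u s" by (rule order_tendstoD(2))
  then show ?thesis
  proof eventually_elim
    case (elim n)
    show ?case
    proof (rule hitting_time_ge)
      fix q assume "0 \<le> q" "q < T"
      then have "u s \<le> u q" by (intro s(2)) auto
      then show "u q \<noteq> e n" using elim by simp
    qed
  qed
qed

text \<open>
  A path that starts above 0 has to pass through every small level before it reaches 0, and on an interval
  on which it does not vanish it stays away from 0. So the hitting times of the levels increase to that of 0.
\<close>

lemma discount_hitting_time_tendsto:
  fixes u :: "real \<Rightarrow> real"
  assumes u: "continuous_on {0..} u" "u 0 > 0" "\<And>t. t \<ge> 0 \<Longrightarrow> u t \<ge> 0" and \<alpha>: "\<alpha> > 0"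
    and e: "e \<longlonglongrightarrow> (0::real)" "\<And>n. 0 \<le> e n"
  shows "(\<lambda>n. discount \<alpha> (hitting_time (e n) u)) \<longlonglongrightarrow> discount \<alpha> (hitting_time 0 u)"
proof (rule order_tendstoI)
  fix c assume c: "c < discount \<alpha> (hitting_time 0 u)"
  have "\<forall>\<^sub>F n in sequentially. e n < u 0" using e(1) u(2) by (rule order_tendstoD(2))
  then show "\<forall>\<^sub>F n in sequentially. c < discount \<alpha> (hitting_time (e n) u)"
  proof eventually_elim
    case (elim n)
    have "hitting_time (e n) u \<le> hitting_time 0 u"
    proof (cases "hitting_time 0 u")
      case (real t)
      then have "\<exists>s\<in>{0..t}. u s = 0" using hitting_time_le_iff[OF u(1) real(1), of 0] by simp
      then obtain s where "0 \<le> s" "s \<le> t" "u s = 0" by auto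
      then have "hitting_time (e n) u \<le> ennreal s"
        using e(2)[of n] elim by (intro hitting_time_le_IVT[OF u(1)]) auto
      also have "\<dots> \<le> ennreal t" using \<open>s \<le> t\<close> by (rule ennreal_leI)
      finally show ?thesis using real by simp
    qed simp
    then have "discount \<alpha> (hitting_time 0 u) \<le> discount \<alpha> (hitting_time (e n) u)"
      using \<alpha> by (intro discount_antimono) auto
    with c show ?case by simp
  qed
next
  fix c assume c: "discount \<alpha> (hitting_time 0 u) < c"
  then have c0: "c > 0" using discount_nonneg[of \<alpha> "hitting_time 0 u"] by simp
  have "\<exists>T\<ge>0. ennreal T < hitting_time 0 u \<and> exp (- \<alpha> * T) < c"
  proof (cases "hitting_time 0 u")
    case top
    define T where "T = max 0 (- ln c / \<alpha> + 1)"
    have "- ln c / \<alpha> < T" by (simp add: T_def)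
    then have "exp (- \<alpha> * T) < exp (ln c)" using \<alpha> by (simp add: field_simps)
    then show ?thesis using c0 top by (intro exI[of _ T]) (auto simp: T_def)
  next
    case (real t)
    have "\<exists>s\<in>{0..t}. u s = 0" using real hitting_time_le_iff[OF u(1) real(1), of 0] by simp
    then have "t > 0" using u(2) real(1) by (cases "t = 0") auto
    have "exp (- \<alpha> * t) < exp (ln c)" using c c0 real by (simp add: discount_ennreal)
    define b where "b = - ln c / \<alpha>"
    have "- ln c < t * \<alpha>" using \<open>exp (- \<alpha> * t) < exp (ln c)\<close> by (simp add: mult.commute)
    then have lt: "b < t" unfolding b_def using \<alpha> by (subst pos_divide_less_eq) auto
    define T where "T = (max 0 b + t) / 2"
    have "b < T" "T < t" "0 \<le> T" using lt \<open>t > 0\<close> by (auto simp: T_def max_def)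
    then have "- ln c / \<alpha> < T" by (simp add: b_def)
    then have "exp (- \<alpha> * T) < exp (ln c)" using \<alpha> by (simp add: field_simps)
    then show ?thesis using c0 real \<open>T < t\<close> \<open>0 \<le> T\<close>
      by (intro exI[of _ T]) (auto intro!: ennreal_lessI)
  qed
  then obtain T where T: "T \<ge> 0" "ennreal T < hitting_time 0 u" "exp (- \<alpha> * T) < c" by blast
  have "\<forall>\<^sub>F n in sequentially. ennreal T \<le> hitting_time (e n) u"
    by (rule hitting_time_ge_stays_positive[OF u(1,2) _ e(1) T(1,2)]) (rule u(3))
  then show "\<forall>\<^sub>F n in sequentially. discount \<alpha> (hitting_time (e n) u) < c"
  proof eventually_elim
    case (elim n)
    then have "discount \<alpha> (hitting_time (e n) u) \<le> discount \<alpha> (ennreal T)"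
      using \<alpha> by (intro discount_antimono) auto
    then show ?case using T by (simp add: discount_ennreal)
  qed
qed

section \<open>Independent normal noise\<close>

lemma (in prob_space) indep_var_past_noise:
  assumes sub: "subalgebra M G" and ind: "indep_set (sets G) (sets (vimage_algebra (space M) \<xi> borel))"
    and g: "g \<in> borel_measurable G" and \<xi>: "\<xi> \<in> borel_measurable M" and q: "q \<in> borel_measurable borel"
  shows "indep_var borel g borel (\<lambda>\<omega>. q (\<xi> \<omega>) :: real)"
proof -
  have spG: "space G = space M" and GM: "sets G \<subseteq> sets M" using sub by (auto simp: subalgebra_def)
  have 1: "sigma_sets (space M) {g -` A \<inter> space M |A. A \<in> sets borel} \<subseteq> sets G"
    unfolding spG[symmetric] by (rule sets.sigma_sets_subset) (use g in \<open>auto intro: measurable_sets\<close>)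
  have spV: "space (vimage_algebra (space M) \<xi> borel) = space M" by simp
  have "\<xi> \<in> borel_measurable (vimage_algebra (space M) \<xi> borel)"
    by (rule measurable_vimage_algebra1) simp
  then have q\<xi>: "(\<lambda>\<omega>. q (\<xi> \<omega>)) \<in> borel_measurable (vimage_algebra (space M) \<xi> borel)"
    using q by (rule measurable_compose)
  have 2: "sigma_sets (space M) {(\<lambda>\<omega>. q (\<xi> \<omega>)) -` A \<inter> space M |A. A \<in> sets borel}
      \<subseteq> sets (vimage_algebra (space M) \<xi> borel)"
  proof -
    have "sigma_sets (space (vimage_algebra (space M) \<xi> borel))
        {(\<lambda>\<omega>. q (\<xi> \<omega>)) -` A \<inter> space (vimage_algebra (space M) \<xi> borel) |A. A \<in> sets borel}
      \<subseteq> sets (vimage_algebra (space M) \<xi> borel)"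
      by (rule sets.sigma_sets_subset) (use measurable_sets[OF q\<xi>] in auto)
    then show ?thesis by simp
  qed
  have "g \<in> borel_measurable M" using g sub by (rule measurable_from_subalg[rotated])
  moreover have "(\<lambda>\<omega>. q (\<xi> \<omega>)) \<in> borel_measurable M" using \<xi> q by simp
  ultimately show ?thesis
    unfolding indep_var_eq using ind 1 2 unfolding indep_sets2_eq by blast
qed

lemma std_normal_moments:
  assumes "prob_space M" and d: "distributed M lborel \<xi> std_normal_density"
  shows "integrable M (\<lambda>\<omega>. \<bar>\<xi> \<omega>\<bar> ^ k)" "integrable M \<xi>" "integrable M (\<lambda>\<omega>. (\<xi> \<omega>)\<^sup>2)"
    "(\<integral>\<omega>. \<xi> \<omega> \<partial>M) = 0" "(\<integral>\<omega>. (\<xi> \<omega>)\<^sup>2 \<partial>M) = 1"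
    "(\<integral>\<omega>. \<bar>\<xi> \<omega>\<bar> ^ k \<partial>M) = (\<integral>y. std_normal_density y * \<bar>y\<bar> ^ k \<partial>lborel)"
proof -
  have m: "integrable lborel (\<lambda>y. std_normal_density y * y ^ j)" for j by (rule integrable_std_normal_moment)
  have ma: "integrable lborel (\<lambda>y. std_normal_density y * \<bar>y\<bar> ^ j)" for j by (rule integrable_std_normal_moment_abs)
  note di = distributed_integrable[OF d] and de = distributed_integral[OF d, symmetric]
  show "integrable M (\<lambda>\<omega>. \<bar>\<xi> \<omega>\<bar> ^ k)" using ma[of k] by (subst di[symmetric]) auto
  show "integrable M \<xi>" using m[of 1] by (subst di[of "\<lambda>x. x", symmetric]) auto
  show "integrable M (\<lambda>\<omega>. (\<xi> \<omega>)\<^sup>2)" using m[of 2] by (subst di[symmetric]) auto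
  show "(\<integral>\<omega>. \<xi> \<omega> \<partial>M) = 0" using integral_std_normal_moment_odd[of 0] de[of "\<lambda>x. x"] by simp
  show "(\<integral>\<omega>. (\<xi> \<omega>)\<^sup>2 \<partial>M) = 1"
    using integral_std_normal_moment_even[of 1] de[of "\<lambda>x. x\<^sup>2"] by (simp add: fact_numeral)
  show "(\<integral>\<omega>. \<bar>\<xi> \<omega>\<bar> ^ k \<partial>M) = (\<integral>y. std_normal_density y * \<bar>y\<bar> ^ k \<partial>lborel)"
    using de[of "\<lambda>x. \<bar>x\<bar> ^ k"] by simp
qed

definition abs_moment :: "nat \<Rightarrow> real" where
  "abs_moment k = (\<integral>y. std_normal_density y * \<bar>y\<bar> ^ k \<partial>lborel)"

lemma abs_moment_nonneg: "0 \<le> abs_moment k"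
  by (auto simp: abs_moment_def intro!: integral_nonneg)

text \<open>A noise term independent of the past \<open>G\<close> averages out against bounded \<open>G\<close>-measurable factors.\<close>

lemma (in prob_space) noise_expectations:
  assumes sub: "subalgebra M G" and ind: "indep_set (sets G) (sets (vimage_algebra (space M) \<xi> borel))"
    and d: "distributed M lborel \<xi> std_normal_density"
    and g: "g \<in> borel_measurable G" and bdd: "\<And>\<omega>. \<omega> \<in> space M \<Longrightarrow> \<bar>g \<omega>\<bar> \<le> C"
  shows "integrable M (\<lambda>\<omega>. g \<omega> * \<xi> \<omega>)" "(\<integral>\<omega>. g \<omega> * \<xi> \<omega> \<partial>M) = 0"
    "integrable M (\<lambda>\<omega>. g \<omega> * ((\<xi> \<omega>)\<^sup>2 - 1))" "(\<integral>\<omega>. g \<omega> * ((\<xi> \<omega>)\<^sup>2 - 1) \<partial>M) = 0"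
    "integrable M (\<lambda>\<omega>. g \<omega> * \<bar>\<xi> \<omega>\<bar> ^ k)" "(\<integral>\<omega>. g \<omega> * \<bar>\<xi> \<omega>\<bar> ^ k \<partial>M) = (\<integral>\<omega>. g \<omega> \<partial>M) * abs_moment k"
    "integrable M g"
proof -
  have gM: "g \<in> borel_measurable M" using g sub by (rule measurable_from_subalg[rotated])
  have \<xi>: "\<xi> \<in> borel_measurable M" using distributed_measurable[OF d] by simp
  show gi: "integrable M g" by (rule integrable_const_bound[where B = C]) (use gM bdd in auto)
  note mom = std_normal_moments[OF prob_space_axioms d]
  have iv: "indep_var borel g borel (\<lambda>\<omega>. q (\<xi> \<omega>))" if "q \<in> borel_measurable borel" for q :: "real \<Rightarrow> real"
    by (rule indep_var_past_noise[OF sub ind g \<xi> that])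
  show "integrable M (\<lambda>\<omega>. g \<omega> * \<xi> \<omega>)" "(\<integral>\<omega>. g \<omega> * \<xi> \<omega> \<partial>M) = 0"
    using indep_var_integrable[OF iv[of "\<lambda>x. x"] gi mom(2)]
      indep_var_lebesgue_integral[OF iv[of "\<lambda>x. x"] gi mom(2)] mom(4) by auto
  have i2: "integrable M (\<lambda>\<omega>. (\<xi> \<omega>)\<^sup>2 - 1)" using mom(3) by simp
  show "integrable M (\<lambda>\<omega>. g \<omega> * ((\<xi> \<omega>)\<^sup>2 - 1))" "(\<integral>\<omega>. g \<omega> * ((\<xi> \<omega>)\<^sup>2 - 1) \<partial>M) = 0"
    using indep_var_integrable[OF iv[of "\<lambda>x. x\<^sup>2 - 1"] gi i2]
      indep_var_lebesgue_integral[OF iv[of "\<lambda>x. x\<^sup>2 - 1"] gi i2] mom(3,5) by (auto simp: prob_space)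
  show "integrable M (\<lambda>\<omega>. g \<omega> * \<bar>\<xi> \<omega>\<bar> ^ k)" "(\<integral>\<omega>. g \<omega> * \<bar>\<xi> \<omega>\<bar> ^ k \<partial>M) = (\<integral>\<omega>. g \<omega> \<partial>M) * abs_moment k"
    using indep_var_integrable[OF iv[of "\<lambda>x. \<bar>x\<bar> ^ k"] gi mom(1)]
      indep_var_lebesgue_integral[OF iv[of "\<lambda>x. \<bar>x\<bar> ^ k"] gi mom(1)] mom(6) by (auto simp: abs_moment_def)
qed

section \<open>A discounted Dynkin estimate for recursions\<close>

lemma power_add_le:
  fixes a b :: real
  assumes "0 \<le> a" "0 \<le> b"
  shows "(a + b) ^ k \<le> 2 ^ k * (a ^ k + b ^ k)"
proof -
  have "(a + b) ^ k \<le> (2 * max a b) ^ k"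
    using assms by (intro power_mono) auto
  also have "\<dots> = 2 ^ k * max a b ^ k" by (simp add: power_mult_distrib)
  also have "max a b ^ k \<le> a ^ k + b ^ k"
    using assms by (auto simp: max_def)
  finally show ?thesis by simp
qed

lemma exp_minus_first_order: 
  fixes x :: real
  assumes "x \<ge> 0"
  shows "\<bar>exp (- x) * (1 + x) - 1\<bar> \<le> x\<^sup>2"
proof -
  have "(1 + x) * exp (- x) \<le> exp x * exp (- x)"
    by (intro mult_right_mono exp_ge_add_one_self) auto
  then have 1: "exp (- x) * (1 + x) \<le> 1" by (simp add: mult.commute exp_minus_inverse)
  have "(1 - x) * (1 + x) \<le> exp (- x) * (1 + x)"
    using exp_ge_add_one_self[of "- x"] assms by (intro mult_right_mono) auto
  then have "1 - x\<^sup>2 \<le> exp (- x) * (1 + x)" by (simp add: power2_eq_square algebra_simps)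
  with 1 show ?thesis by simp
qed

text \<open>
  The factor by which a remainder bounded by \<open>C (\<bar>u\<bar>\<^sup>3 + \<bar>u\<bar>\<^sup>k)\<close> grows when \<open>u\<close> is a sum of a drift
  term and a normal noise term: \<open>(a + b)\<^sup>k \<le> 2\<^sup>k (a\<^sup>k + b\<^sup>k)\<close>, and the noise contributes its moments.
\<close>

definition error_constant :: "nat \<Rightarrow> real \<Rightarrow> real" where
  "error_constant k C = C * (8 * (1 + abs_moment 3) + 2 ^ k * (1 + abs_moment k))"

lemma error_constant_nonneg: "0 \<le> C \<Longrightarrow> 0 \<le> error_constant k C"
  unfolding error_constant_def using abs_moment_nonneg[of 3] abs_moment_nonneg[of k]
  by (intro mult_nonneg_nonneg add_nonneg_nonneg) auto

context cev_laplace begin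

text \<open>
  For a step \<open>z \<mapsto> z + z (B \<Delta> + H sqrt \<Delta> \<xi>)\<close>: the first two terms are the deviations of the coefficients
  from those in the differential equation for \<open>\<phi>\<close>, the third the square of the drift, the fourth the
  Taylor remainder, and the last the error in \<open>exp (- \<alpha> \<Delta>) \<approx> 1 - \<alpha> \<Delta>\<close>.
\<close>

definition step_error :: "real \<Rightarrow> real \<Rightarrow> nat \<Rightarrow> real \<Rightarrow> real \<Rightarrow> real \<Rightarrow> real \<Rightarrow> real" where
  "step_error K t k \<Delta> z B H =
     \<Delta> * \<bar>B - \<mu>\<bar> + 2 * \<Delta> * \<bar>H\<^sup>2 - \<sigma>\<^sup>2 * z powr (- r)\<bar> + 2 * \<Delta>\<^sup>2 * B\<^sup>2
     + K * (min 1 (z powr (r * t)) * ((\<bar>B\<bar> * \<Delta>) ^ 3 + (\<bar>H\<bar> * sqrt \<Delta>) ^ 3)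
            + (\<bar>B\<bar> * \<Delta>) ^ k + (\<bar>H\<bar> * sqrt \<Delta>) ^ k)
     + (\<alpha> * \<Delta>)\<^sup>2"

lemma \<alpha>_pos: "\<alpha> > 0" using \<alpha> by (smt (verit))

text \<open>
  Expand \<open>\<phi>\<close> to second order. The terms with \<open>\<xi>\<close> and \<open>\<xi>\<^sup>2 - 1\<close> average out, because the noise is independent of
  the past, and what remains of first order in \<open>\<Delta>\<close> cancels by the differential equation.
\<close>

lemma one_step:
  fixes M :: "'a measure" and C t :: real and k :: nat
  defines "K \<equiv> error_constant k C"
  assumes Taylor: "Taylor_constant t k C"
    and M: "prob_space M" and sub: "subalgebra M G"
    and ind: "prob_space.indep_set M (sets G) (sets (vimage_algebra (space M) \<xi> borel))"
    and d: "distributed M lborel \<xi> std_normal_density"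
    and A: "A \<in> sets G" and ZG: "Z \<in> borel_measurable G" and BG: "B \<in> borel_measurable G"
    and HG: "H \<in> borel_measurable G"
    and bdd: "\<And>\<omega>. \<omega> \<in> A \<Longrightarrow> Z \<omega> > 0 \<and> Z \<omega> powr (- r) \<le> D \<and> \<bar>B \<omega>\<bar> \<le> D \<and> \<bar>H \<omega>\<bar> \<le> D"
    and \<Delta>: "\<Delta> > 0"
  shows "\<bar>\<integral>\<omega>. indicator A \<omega> * (exp (- \<alpha> * \<Delta>) * \<phi> (Z \<omega> + Z \<omega> * (B \<omega> * \<Delta> + H \<omega> * sqrt \<Delta> * \<xi> \<omega>)) - \<phi> (Z \<omega>)) \<partial>M\<bar>
     \<le> (\<integral>\<omega>. indicator A \<omega> * step_error K t k \<Delta> (Z \<omega>) (B \<omega>) (H \<omega>) \<partial>M)"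
    and "integrable M (\<lambda>\<omega>. indicator A \<omega> * (exp (- \<alpha> * \<Delta>) * \<phi> (Z \<omega> + Z \<omega> * (B \<omega> * \<Delta> + H \<omega> * sqrt \<Delta> * \<xi> \<omega>)) - \<phi> (Z \<omega>)))"
proof -
  have C: "C \<ge> 0" "x > 0 \<Longrightarrow> \<bar>\<phi> (x + h) - \<phi> x - \<phi>1 x * (h / x) - \<phi>2 x * (h / x)\<^sup>2 / 2\<bar>
     \<le> C * (min 1 (x powr (r * t)) * (\<bar>h\<bar> / x) ^ 3 + (\<bar>h\<bar> / x) ^ k)" for x h
    using Taylor by (auto simp: Taylor_constant_def)
  interpret M: prob_space M by fact
  have AM [measurable]: "A \<in> sets M" using A sub by (auto simp: subalgebra_def)
  note GM = measurable_from_subalg[OF sub]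
  note [measurable] = GM[OF ZG] GM[OF BG] GM[OF HG]
  have [measurable]: "\<xi> \<in> borel_measurable M" using distributed_measurable[OF d] by simp
  define a where "a = exp (- \<alpha> * \<Delta>)"
  have a: "0 < a" "a \<le> 1" using \<alpha>_pos \<Delta> by (auto simp: a_def)
  define s where "s = sqrt \<Delta>"
  have s: "s > 0" "s * s = \<Delta>" using \<Delta> by (auto simp: s_def)
  define m3 where "m3 = abs_moment 3"
  define mk where "mk = abs_moment k"
  have m: "m3 \<ge> 0" "mk \<ge> 0" by (auto simp: m3_def mk_def abs_moment_nonneg)
  define E where "E = (\<lambda>\<omega>. \<bar>H \<omega> * H \<omega> - \<sigma>\<^sup>2 * Z \<omega> powr (- r)\<bar>)"
  define w where "w = (\<lambda>\<omega>. min 1 (Z \<omega> powr (r * t)))"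
  have w: "0 \<le> w \<omega>" "w \<omega> \<le> 1" for \<omega> by (auto simp: w_def)
  define U where "U = (\<lambda>\<omega>. B \<omega> * \<Delta> + H \<omega> * s * \<xi> \<omega>)"
  define R where "R = (\<lambda>\<omega>. \<phi> (Z \<omega> + Z \<omega> * U \<omega>) - \<phi> (Z \<omega>) - \<phi>1 (Z \<omega>) * U \<omega> - \<phi>2 (Z \<omega>) * (U \<omega>)\<^sup>2 / 2)"
  (* c1 and c2 multiply the two centred noise terms. V is what remains: the deviations of the
     coefficients, the squared drift, the Taylor remainder R and the discretised discount.
     Q, g3 and gk bound V by powers of the noise. *)
  define V where "V = (\<lambda>\<omega>. a * (\<Delta> * \<phi>1 (Z \<omega>) * (B \<omega> - \<mu>)
      + \<Delta> / 2 * \<phi>2 (Z \<omega>) * (H \<omega> * H \<omega> - \<sigma>\<^sup>2 * Z \<omega> powr (- r))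
      + \<phi>2 (Z \<omega>) / 2 * (B \<omega> * \<Delta>)\<^sup>2 + R \<omega>) + (a * (1 + \<alpha> * \<Delta>) - 1) * \<phi> (Z \<omega>))"
  define c1 where "c1 = (\<lambda>\<omega>. indicator A \<omega> * (a * (\<phi>1 (Z \<omega>) * (H \<omega> * s) + \<phi>2 (Z \<omega>) * (B \<omega> * \<Delta>) * (H \<omega> * s))))"
  define c2 where "c2 = (\<lambda>\<omega>. indicator A \<omega> * (a / 2 * \<phi>2 (Z \<omega>) * (H \<omega> * H \<omega> * \<Delta>)))"
  define L where "L = (\<lambda>\<omega>. indicator A \<omega> * (a * \<phi> (Z \<omega> + Z \<omega> * U \<omega>) - \<phi> (Z \<omega>)))"
  define Q where "Q = (\<lambda>\<omega>. indicator A \<omega> * (\<Delta> * \<bar>B \<omega> - \<mu>\<bar> + 3 / 2 * \<Delta> * E \<omega> + 3 / 2 * (B \<omega> * \<Delta>)\<^sup>2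
      + C * (w \<omega> * (8 * (\<bar>B \<omega>\<bar> * \<Delta>) ^ 3) + 2 ^ k * (\<bar>B \<omega>\<bar> * \<Delta>) ^ k) + (\<alpha> * \<Delta>)\<^sup>2))"
  define g3 where "g3 = (\<lambda>\<omega>. indicator A \<omega> * (C * w \<omega> * 8 * (\<bar>H \<omega>\<bar> * s) ^ 3))"
  define gk where "gk = (\<lambda>\<omega>. indicator A \<omega> * (C * 2 ^ k * (\<bar>H \<omega>\<bar> * s) ^ k))"
  have [measurable]: "A \<in> sets G" "Z \<in> borel_measurable G" "B \<in> borel_measurable G" "H \<in> borel_measurable G"
    by fact+
  have D: "\<omega> \<in> A \<Longrightarrow> D \<ge> 0" for \<omega> using bdd[of \<omega>] by auto
  have c1G: "c1 \<in> borel_measurable G" and c2G: "c2 \<in> borel_measurable G" and QG: "Q \<in> borel_measurable G"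
    and g3G: "g3 \<in> borel_measurable G" and gkG: "gk \<in> borel_measurable G"
    unfolding c1_def c2_def Q_def E_def w_def g3_def gk_def by measurable
  have Ebdd: "\<omega> \<in> A \<Longrightarrow> E \<omega> \<le> D * D + \<sigma>\<^sup>2 * D" for \<omega>
  proof -
    assume A: "\<omega> \<in> A"
    have "E \<omega> \<le> \<bar>H \<omega>\<bar> * \<bar>H \<omega>\<bar> + \<sigma>\<^sup>2 * Z \<omega> powr (- r)"     proof -
      have "0 \<le> H \<omega> * H \<omega>" "0 \<le> \<sigma>\<^sup>2 * Z \<omega> powr (- r)" by auto
      then show ?thesis unfolding E_def abs_mult_self_eq by linarith
    qed
    also have "\<dots> \<le> D * D + \<sigma>\<^sup>2 * D" using bdd[OF A] D[OF A] by (intro add_mono mult_mono) auto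
    finally show ?thesis .
  qed
  have c1_bdd: "\<bar>c1 \<omega>\<bar> \<le> D * s + 3 * (D * \<Delta>) * (D * s)" if "\<omega> \<in> A" for \<omega>
  proof -
    have "\<bar>c1 \<omega>\<bar> = a * \<bar>\<phi>1 (Z \<omega>) * (H \<omega> * s) + \<phi>2 (Z \<omega>) * (B \<omega> * \<Delta>) * (H \<omega> * s)\<bar>"
      using that a by (simp add: c1_def abs_mult)
    also have "\<dots> \<le> 1 * (\<bar>\<phi>1 (Z \<omega>)\<bar> * (\<bar>H \<omega>\<bar> * s) + \<bar>\<phi>2 (Z \<omega>)\<bar> * (\<bar>B \<omega>\<bar> * \<Delta>) * (\<bar>H \<omega>\<bar> * s))"
      using a s \<Delta> by (intro mult_mono abs_triangle_ineq[THEN order_trans]) (auto simp: abs_mult)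
    also have "\<dots> \<le> 1 * (1 * (D * s) + 3 * (D * \<Delta>) * (D * s))"
      using bdd[OF that] D[OF that] s \<Delta> \<phi>1_bound[of "Z \<omega>"] \<phi>2_bound[of "Z \<omega>"]
      by (intro mult_mono add_mono) auto
    finally show ?thesis by simp
  qed
  have c2_bdd: "\<bar>c2 \<omega>\<bar> \<le> 3 * (D * D * \<Delta>)" if "\<omega> \<in> A" for \<omega>
  proof -
    have "\<bar>c2 \<omega>\<bar> = a / 2 * \<bar>\<phi>2 (Z \<omega>)\<bar> * (\<bar>H \<omega>\<bar> * \<bar>H \<omega>\<bar> * \<Delta>)"
      using that a \<Delta> by (simp add: c2_def abs_mult)
    also have "\<dots> \<le> 1 * 3 * (D * D * \<Delta>)"
      using bdd[OF that] D[OF that] a \<Delta> \<phi>2_bound[of "Z \<omega>"] by (intro mult_mono) auto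
    finally show ?thesis by simp
  qed
  have g3_bdd: "\<bar>g3 \<omega>\<bar> \<le> C * 1 * 8 * (D * s) ^ 3" if "\<omega> \<in> A" for \<omega>
  proof -
    have "\<bar>g3 \<omega>\<bar> = C * w \<omega> * 8 * (\<bar>H \<omega>\<bar> * s) ^ 3" using that C w[of \<omega>] s by (simp add: g3_def abs_mult)
    also have "\<dots> \<le> C * 1 * 8 * (D * s) ^ 3"
      using C w[of \<omega>] s bdd[OF that] by (intro mult_mono power_mono) auto
    finally show ?thesis .
  qed
  have gk_bdd: "\<bar>gk \<omega>\<bar> \<le> C * 2 ^ k * (D * s) ^ k" if "\<omega> \<in> A" for \<omega>
  proof -
    have "\<bar>gk \<omega>\<bar> = C * 2 ^ k * (\<bar>H \<omega>\<bar> * s) ^ k" using that C s by (simp add: gk_def abs_mult power_abs)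
    also have "\<dots> \<le> C * 2 ^ k * (D * s) ^ k"
      using C s bdd[OF that] by (intro mult_mono power_mono) auto
    finally show ?thesis .
  qed
  define q where "q = \<Delta> * (D + \<bar>\<mu>\<bar>) + 3 / 2 * \<Delta> * (D * D + \<sigma>\<^sup>2 * D) + 3 / 2 * (D * \<Delta>)\<^sup>2
      + C * (1 * (8 * (D * \<Delta>) ^ 3) + 2 ^ k * (D * \<Delta>) ^ k) + (\<alpha> * \<Delta>)\<^sup>2"
  have Q_nonneg: "0 \<le> Q \<omega>" for \<omega>
    unfolding Q_def E_def using C w[of \<omega>] \<Delta>
    by (intro mult_nonneg_nonneg add_nonneg_nonneg zero_le_power zero_le_power2) auto
  have pB: "(\<bar>B \<omega>\<bar> * \<Delta>) ^ j \<le> (D * \<Delta>) ^ j" and pH: "(\<bar>H \<omega>\<bar> * s) ^ j \<le> (D * s) ^ j"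
    and pdrift: "\<Delta> * \<bar>B \<omega> - \<mu>\<bar> \<le> \<Delta> * (D + \<bar>\<mu>\<bar>)"
    and pE: "\<Delta> * E \<omega> \<le> \<Delta> * (D * D + \<sigma>\<^sup>2 * D)" if "\<omega> \<in> A" for \<omega> j
  proof -
    show "(\<bar>B \<omega>\<bar> * \<Delta>) ^ j \<le> (D * \<Delta>) ^ j"
      using bdd[OF that] \<Delta> by (intro power_mono mult_right_mono) auto
    show "(\<bar>H \<omega>\<bar> * s) ^ j \<le> (D * s) ^ j"
      using bdd[OF that] s by (intro power_mono mult_right_mono) auto
    have "\<bar>B \<omega> - \<mu>\<bar> \<le> D + \<bar>\<mu>\<bar>" using bdd[OF that] by linarith
    then show "\<Delta> * \<bar>B \<omega> - \<mu>\<bar> \<le> \<Delta> * (D + \<bar>\<mu>\<bar>)" using \<Delta> by (intro mult_left_mono) auto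
    show "\<Delta> * E \<omega> \<le> \<Delta> * (D * D + \<sigma>\<^sup>2 * D)" using Ebdd[OF that] \<Delta> by (intro mult_left_mono) auto
  qed
  have Q_bdd: "\<bar>Q \<omega>\<bar> \<le> q" if "\<omega> \<in> A" for \<omega>
  proof -
    have B2: "(B \<omega> * \<Delta>)\<^sup>2 \<le> (D * \<Delta>)\<^sup>2"
      using bdd[OF that] \<Delta> D[OF that] by (intro abs_le_square_iff[THEN iffD1]) (auto simp: abs_mult)
    have "Q \<omega> = \<Delta> * \<bar>B \<omega> - \<mu>\<bar> + 3 / 2 * \<Delta> * E \<omega> + 3 / 2 * (B \<omega> * \<Delta>)\<^sup>2
      + C * (w \<omega> * (8 * (\<bar>B \<omega>\<bar> * \<Delta>) ^ 3) + 2 ^ k * (\<bar>B \<omega>\<bar> * \<Delta>) ^ k) + (\<alpha> * \<Delta>)\<^sup>2"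
      using that by (simp add: Q_def)
    also have "\<dots> \<le> q"
    proof -
      have "w \<omega> * (8 * (\<bar>B \<omega>\<bar> * \<Delta>) ^ 3) \<le> 1 * (8 * (D * \<Delta>) ^ 3)"
        using w[of \<omega>] pB[OF that, of 3] \<Delta> by (intro mult_mono) auto
      moreover have "2 ^ k * (\<bar>B \<omega>\<bar> * \<Delta>) ^ k \<le> 2 ^ k * (D * \<Delta>) ^ k"
        using pB[OF that, of k] by (intro mult_left_mono) auto
      ultimately have "C * (w \<omega> * (8 * (\<bar>B \<omega>\<bar> * \<Delta>) ^ 3) + 2 ^ k * (\<bar>B \<omega>\<bar> * \<Delta>) ^ k)
          \<le> C * (1 * (8 * (D * \<Delta>) ^ 3) + 2 ^ k * (D * \<Delta>) ^ k)"
        by (rule mult_left_mono[OF add_mono C(1)])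
      then show ?thesis unfolding q_def using pdrift[OF that] pE[OF that] B2 by linarith
    qed
    finally show ?thesis using Q_nonneg[of \<omega>] by simp
  qed
  have off: "\<omega> \<notin> A \<Longrightarrow> c1 \<omega> = 0 \<and> c2 \<omega> = 0 \<and> g3 \<omega> = 0 \<and> gk \<omega> = 0 \<and> Q \<omega> = 0" for \<omega>
    by (simp add: c1_def c2_def g3_def gk_def Q_def)
  have glob: "\<bar>f \<omega>\<bar> \<le> \<bar>b\<bar>" if "\<And>\<omega>. \<omega> \<in> A \<Longrightarrow> \<bar>f \<omega>\<bar> \<le> b" "\<omega> \<notin> A \<Longrightarrow> f \<omega> = 0" for f :: "'a \<Rightarrow> real" and b \<omega>
  proof (cases "\<omega> \<in> A")
    case True
    have "\<bar>f \<omega>\<bar> \<le> b" by (rule that(1)[OF True])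
    then show ?thesis by linarith
  qed (simp add: that(2))
  note ne = M.noise_expectations[OF sub ind d]
  obtain b1 b2 b3 bk bQ where gb: "\<And>\<omega>. \<bar>c1 \<omega>\<bar> \<le> b1" "\<And>\<omega>. \<bar>c2 \<omega>\<bar> \<le> b2" "\<And>\<omega>. \<bar>g3 \<omega>\<bar> \<le> b3"
      "\<And>\<omega>. \<bar>gk \<omega>\<bar> \<le> bk" "\<And>\<omega>. \<bar>Q \<omega>\<bar> \<le> bQ"
  proof
    fix \<omega>
    show "\<bar>c1 \<omega>\<bar> \<le> \<bar>D * s + 3 * (D * \<Delta>) * (D * s)\<bar>" by (rule glob[of c1]) (use c1_bdd off in auto)
    show "\<bar>c2 \<omega>\<bar> \<le> \<bar>3 * (D * D * \<Delta>)\<bar>" by (rule glob[of c2]) (use c2_bdd off in auto)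
    show "\<bar>g3 \<omega>\<bar> \<le> \<bar>C * 1 * 8 * (D * s) ^ 3\<bar>" by (rule glob[of g3]) (use g3_bdd off in auto)
    show "\<bar>gk \<omega>\<bar> \<le> \<bar>C * 2 ^ k * (D * s) ^ k\<bar>" by (rule glob[of gk]) (use gk_bdd off in auto)
    show "\<bar>Q \<omega>\<bar> \<le> \<bar>q\<bar>" by (rule glob[of Q]) (use Q_bdd off in auto)
  qed
  note n1 = ne[OF c1G gb(1)] and n2 = ne[OF c2G gb(2)] and n3 = ne(5,6)[OF g3G gb(3), where k = 3] ne(7)[OF g3G gb(3)]
    and nk = ne(5,6)[OF gkG gb(4), where k = k] ne(7)[OF gkG gb(4)] and nQ = ne[OF QG gb(5)]
  have L_int: "integrable M L"
  proof (rule M.integrable_const_bound[where B = 1])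
    show "AE \<omega> in M. norm (L \<omega>) \<le> 1"
    proof (intro AE_I2)
      fix \<omega>
      have "0 \<le> a * \<phi> (Z \<omega> + Z \<omega> * U \<omega>)" "a * \<phi> (Z \<omega> + Z \<omega> * U \<omega>) \<le> 1"
        using a \<phi>_nonneg[of "Z \<omega> + Z \<omega> * U \<omega>"] \<phi>_le_1[of "Z \<omega> + Z \<omega> * U \<omega>"] by (auto intro: mult_le_one)
      then show "norm (L \<omega>) \<le> 1"
        using \<phi>_nonneg[of "Z \<omega>"] \<phi>_le_1[of "Z \<omega>"] by (auto simp: L_def indicator_def)
    qed
    show "L \<in> borel_measurable M" unfolding L_def U_def by measurable
  qed
  have split: "L \<omega> = indicator A \<omega> * V \<omega> + c1 \<omega> * \<xi> \<omega> + c2 \<omega> * ((\<xi> \<omega>)\<^sup>2 - 1)" for \<omega>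
  proof (cases "\<omega> \<in> A")
    case True
    have ode: "\<alpha> * \<phi> (Z \<omega>) = \<mu> * \<phi>1 (Z \<omega>) + \<sigma>\<^sup>2 / 2 * Z \<omega> powr (- r) * \<phi>2 (Z \<omega>)"
      using \<phi>_ODE[of "Z \<omega>"] bdd[OF True] by simp
    have U2: "(U \<omega>)\<^sup>2 = (B \<omega> * \<Delta>)\<^sup>2 + 2 * (B \<omega> * \<Delta>) * (H \<omega> * s) * \<xi> \<omega> + H \<omega> * H \<omega> * \<Delta> * (\<xi> \<omega>)\<^sup>2"
      unfolding U_def s(2)[symmetric] by (simp add: power2_eq_square algebra_simps)
    have phi: "\<phi> (Z \<omega> + Z \<omega> * U \<omega>) = \<phi> (Z \<omega>) + \<phi>1 (Z \<omega>) * U \<omega> + \<phi>2 (Z \<omega>) * (U \<omega>)\<^sup>2 / 2 + R \<omega>"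
      by (simp add: R_def)
    have e1: "a * (1 + \<alpha> * \<Delta>) * \<phi> (Z \<omega>) = a * \<phi> (Z \<omega>) + a * \<Delta> * (\<mu> * \<phi>1 (Z \<omega>) + \<sigma>\<^sup>2 / 2 * Z \<omega> powr (- r) * \<phi>2 (Z \<omega>))"
      unfolding ode[symmetric] by (simp add: algebra_simps)
    have "V \<omega> = a * (\<Delta> * \<phi>1 (Z \<omega>) * (B \<omega> - \<mu>)
      + \<Delta> / 2 * \<phi>2 (Z \<omega>) * (H \<omega> * H \<omega> - \<sigma>\<^sup>2 * Z \<omega> powr (- r))
      + \<phi>2 (Z \<omega>) / 2 * (B \<omega> * \<Delta>)\<^sup>2 + R \<omega>) + a * \<phi> (Z \<omega>) + a * \<Delta> * (\<mu> * \<phi>1 (Z \<omega>) + \<sigma>\<^sup>2 / 2 * Z \<omega> powr (- r) * \<phi>2 (Z \<omega>)) - \<phi> (Z \<omega>)"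
      unfolding V_def left_diff_distrib e1 by simp
    then show ?thesis
      using True unfolding L_def c1_def c2_def phi U2 by (simp add: U_def) (simp add: field_simps)
  qed (simp add: L_def c1_def c2_def)
  have V_bound: "indicator A \<omega> * \<bar>V \<omega>\<bar> \<le> Q \<omega> + g3 \<omega> * \<bar>\<xi> \<omega>\<bar> ^ 3 + gk \<omega> * \<bar>\<xi> \<omega>\<bar> ^ k" for \<omega>
  proof (cases "\<omega> \<in> A")
    case True
    note b = bdd[OF True]
    have U_le: "\<bar>U \<omega>\<bar> ^ j \<le> 2 ^ j * ((\<bar>B \<omega>\<bar> * \<Delta>) ^ j + (\<bar>H \<omega>\<bar> * s) ^ j * \<bar>\<xi> \<omega>\<bar> ^ j)" for j
    proof -
      have "\<bar>U \<omega>\<bar> \<le> \<bar>B \<omega>\<bar> * \<Delta> + \<bar>H \<omega>\<bar> * s * \<bar>\<xi> \<omega>\<bar>"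
        unfolding U_def using \<Delta> s by (intro abs_triangle_ineq[THEN order_trans]) (simp add: abs_mult)
      then have "\<bar>U \<omega>\<bar> ^ j \<le> (\<bar>B \<omega>\<bar> * \<Delta> + \<bar>H \<omega>\<bar> * s * \<bar>\<xi> \<omega>\<bar>) ^ j" by (intro power_mono) auto
      also have "\<dots> \<le> 2 ^ j * ((\<bar>B \<omega>\<bar> * \<Delta>) ^ j + (\<bar>H \<omega>\<bar> * s * \<bar>\<xi> \<omega>\<bar>) ^ j)"
        using \<Delta> s by (intro power_add_le) auto
      finally show ?thesis by (simp only: power_mult_distrib)
    qed
    have "\<bar>R \<omega>\<bar> \<le> C * (w \<omega> * \<bar>U \<omega>\<bar> ^ 3 + \<bar>U \<omega>\<bar> ^ k)"
      using C(2)[of "Z \<omega>" "Z \<omega> * U \<omega>"] b by (simp add: R_def w_def abs_mult)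
    also have "\<dots> \<le> C * (w \<omega> * (2 ^ 3 * ((\<bar>B \<omega>\<bar> * \<Delta>) ^ 3 + (\<bar>H \<omega>\<bar> * s) ^ 3 * \<bar>\<xi> \<omega>\<bar> ^ 3))
        + 2 ^ k * ((\<bar>B \<omega>\<bar> * \<Delta>) ^ k + (\<bar>H \<omega>\<bar> * s) ^ k * \<bar>\<xi> \<omega>\<bar> ^ k))"
      by (intro mult_left_mono add_mono U_le C(1) w(1))
    also have "\<dots> = C * (w \<omega> * (8 * (\<bar>B \<omega>\<bar> * \<Delta>) ^ 3) + 2 ^ k * (\<bar>B \<omega>\<bar> * \<Delta>) ^ k)
        + g3 \<omega> * \<bar>\<xi> \<omega>\<bar> ^ 3 + gk \<omega> * \<bar>\<xi> \<omega>\<bar> ^ k"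
      using True by (simp add: g3_def gk_def algebra_simps)
    finally have R_le: "\<bar>R \<omega>\<bar> \<le> \<dots>" .
    have v1: "\<bar>\<Delta> * \<phi>1 (Z \<omega>) * (B \<omega> - \<mu>)\<bar> \<le> \<Delta> * \<bar>B \<omega> - \<mu>\<bar>"
      using mult_right_mono[OF \<phi>1_bound[of "Z \<omega>"], of "\<Delta> * \<bar>B \<omega> - \<mu>\<bar>"] \<Delta> by (simp add: abs_mult mult_ac)
    have v2: "\<bar>\<Delta> / 2 * \<phi>2 (Z \<omega>) * (H \<omega> * H \<omega> - \<sigma>\<^sup>2 * Z \<omega> powr (- r))\<bar> \<le> 3 / 2 * \<Delta> * E \<omega>"
      using mult_right_mono[OF \<phi>2_bound[of "Z \<omega>"], of "\<Delta> / 2 * E \<omega>"] \<Delta>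
      by (simp add: abs_mult mult_ac E_def)
    have v3: "\<bar>\<phi>2 (Z \<omega>) / 2 * (B \<omega> * \<Delta>)\<^sup>2\<bar> \<le> 3 / 2 * (B \<omega> * \<Delta>)\<^sup>2"
      using mult_right_mono[OF \<phi>2_bound[of "Z \<omega>"], of "(B \<omega> * \<Delta>)\<^sup>2 / 2"] by (simp add: abs_mult)
    have v4: "\<bar>(a * (1 + \<alpha> * \<Delta>) - 1) * \<phi> (Z \<omega>)\<bar> \<le> (\<alpha> * \<Delta>)\<^sup>2"
    proof -
      have "\<bar>a * (1 + \<alpha> * \<Delta>) - 1\<bar> * \<bar>\<phi> (Z \<omega>)\<bar> \<le> (\<alpha> * \<Delta>)\<^sup>2 * 1"
        using exp_minus_first_order[of "\<alpha> * \<Delta>"] \<alpha>_pos \<Delta> \<phi>_nonneg[of "Z \<omega>"] \<phi>_le_1[of "Z \<omega>"]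
        by (intro mult_mono) (auto simp: a_def)
      then show ?thesis by (simp add: abs_mult)
    qed
    define S where "S = \<Delta> * \<phi>1 (Z \<omega>) * (B \<omega> - \<mu>)
      + \<Delta> / 2 * \<phi>2 (Z \<omega>) * (H \<omega> * H \<omega> - \<sigma>\<^sup>2 * Z \<omega> powr (- r))
      + \<phi>2 (Z \<omega>) / 2 * (B \<omega> * \<Delta>)\<^sup>2 + R \<omega>"
    have "\<bar>S\<bar> \<le> \<Delta> * \<bar>B \<omega> - \<mu>\<bar> + 3 / 2 * \<Delta> * E \<omega> + 3 / 2 * (B \<omega> * \<Delta>)\<^sup>2 + \<bar>R \<omega>\<bar>"
      unfolding S_def using v1 v2 v3 by linarith
    moreover have "\<bar>a * S\<bar> \<le> \<bar>S\<bar>"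
      using mult_right_mono[OF a(2), of "\<bar>S\<bar>"] a by (simp add: abs_mult)
    moreover have "V \<omega> = a * S + (a * (1 + \<alpha> * \<Delta>) - 1) * \<phi> (Z \<omega>)"
      by (simp add: V_def S_def)
    ultimately have "\<bar>V \<omega>\<bar> \<le> \<Delta> * \<bar>B \<omega> - \<mu>\<bar> + 3 / 2 * \<Delta> * E \<omega> + 3 / 2 * (B \<omega> * \<Delta>)\<^sup>2 + \<bar>R \<omega>\<bar> + (\<alpha> * \<Delta>)\<^sup>2"
      using v4 by linarith
    then show ?thesis using R_le True by (simp add: Q_def)
  qed (simp add: Q_def g3_def gk_def)
  have V_int: "integrable M (\<lambda>\<omega>. indicator A \<omega> * V \<omega>)"
  proof -
    have "integrable M (\<lambda>\<omega>. L \<omega> - c1 \<omega> * \<xi> \<omega> - c2 \<omega> * ((\<xi> \<omega>)\<^sup>2 - 1))"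
      using L_int n1(1) n2(3) off by (intro Bochner_Integration.integrable_diff) auto
    then show ?thesis by (simp add: split)
  qed
  have err_eq: "indicator A \<omega> * step_error K t k \<Delta> (Z \<omega>) (B \<omega>) (H \<omega>) = indicator A \<omega> *
      (\<Delta> * \<bar>B \<omega> - \<mu>\<bar> + 2 * \<Delta> * E \<omega> + 2 * (B \<omega> * \<Delta>)\<^sup>2
     + K * (w \<omega> * ((\<bar>B \<omega>\<bar> * \<Delta>) ^ 3 + (\<bar>H \<omega>\<bar> * s) ^ 3)
            + (\<bar>B \<omega>\<bar> * \<Delta>) ^ k + (\<bar>H \<omega>\<bar> * s) ^ k) + (\<alpha> * \<Delta>)\<^sup>2)" for \<omega>
    by (simp add: step_error_def E_def w_def s_def power2_eq_square mult_ac)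
  have K: "K \<ge> 0" "C * 8 \<le> K" "C * 2 ^ k \<le> K" "C * 8 * m3 \<le> K" "C * 2 ^ k * mk \<le> K"
  proof -
    have "K = C * 8 + C * 8 * m3 + C * 2 ^ k + C * 2 ^ k * mk"
      by (simp add: K_def error_constant_def m3_def mk_def algebra_simps)
    moreover have "0 \<le> C * 8" "0 \<le> C * 8 * m3" "0 \<le> C * 2 ^ k" "0 \<le> C * 2 ^ k * mk" using C m by auto
    ultimately show "K \<ge> 0" "C * 8 \<le> K" "C * 2 ^ k \<le> K" "C * 8 * m3 \<le> K" "C * 2 ^ k * mk \<le> K" by linarith+
  qed
  define e where "e = (\<lambda>\<omega>. indicator A \<omega> *
      (\<Delta> * \<bar>B \<omega> - \<mu>\<bar> + 2 * \<Delta> * E \<omega> + 2 * (B \<omega> * \<Delta>)\<^sup>2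
     + K * (w \<omega> * ((\<bar>B \<omega>\<bar> * \<Delta>) ^ 3 + (\<bar>H \<omega>\<bar> * s) ^ 3)
            + (\<bar>B \<omega>\<bar> * \<Delta>) ^ k + (\<bar>H \<omega>\<bar> * s) ^ k) + (\<alpha> * \<Delta>)\<^sup>2))"
  have e_nonneg: "0 \<le> e \<omega>" for \<omega>
    unfolding e_def E_def using K w[of \<omega>] \<Delta> s
    by (intro mult_nonneg_nonneg add_nonneg_nonneg zero_le_power zero_le_power2) auto
  have e_int: "integrable M e"
  proof (rule M.integrable_const_bound)
    show "e \<in> borel_measurable M" unfolding e_def E_def w_def by measurable
    show "AE \<omega> in M. norm (e \<omega>) \<le> \<bar>\<Delta> * (D + \<bar>\<mu>\<bar>) + 2 * \<Delta> * (D * D + \<sigma>\<^sup>2 * D) + 2 * (D * \<Delta>)\<^sup>2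
     + K * (1 * ((D * \<Delta>) ^ 3 + (D * s) ^ 3) + (D * \<Delta>) ^ k + (D * s) ^ k) + (\<alpha> * \<Delta>)\<^sup>2\<bar>"
    proof (intro AE_I2, unfold real_norm_def, rule glob)
      fix \<omega> assume \<omega>: "\<omega> \<in> A"
      have B2: "(B \<omega> * \<Delta>)\<^sup>2 \<le> (D * \<Delta>)\<^sup>2"
        using bdd[OF \<omega>] \<Delta> D[OF \<omega>] by (intro abs_le_square_iff[THEN iffD1]) (auto simp: abs_mult)
      have "e \<omega> \<le> \<Delta> * (D + \<bar>\<mu>\<bar>) + 2 * \<Delta> * (D * D + \<sigma>\<^sup>2 * D) + 2 * (D * \<Delta>)\<^sup>2
         + K * (1 * ((D * \<Delta>) ^ 3 + (D * s) ^ 3) + (D * \<Delta>) ^ k + (D * s) ^ k) + (\<alpha> * \<Delta>)\<^sup>2"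
      proof -
        have "w \<omega> * ((\<bar>B \<omega>\<bar> * \<Delta>) ^ 3 + (\<bar>H \<omega>\<bar> * s) ^ 3) \<le> 1 * ((D * \<Delta>) ^ 3 + (D * s) ^ 3)"
          using w[of \<omega>] \<Delta> s by (intro mult_mono add_mono pB pH \<omega>) auto
        then have "K * (w \<omega> * ((\<bar>B \<omega>\<bar> * \<Delta>) ^ 3 + (\<bar>H \<omega>\<bar> * s) ^ 3) + (\<bar>B \<omega>\<bar> * \<Delta>) ^ k + (\<bar>H \<omega>\<bar> * s) ^ k)
           \<le> K * (1 * ((D * \<Delta>) ^ 3 + (D * s) ^ 3) + (D * \<Delta>) ^ k + (D * s) ^ k)"
          by (rule mult_left_mono[OF add_mono[OF add_mono[OF _ pB[OF \<omega>]] pH[OF \<omega>]] K(1)])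
        moreover have "e \<omega> = \<Delta> * \<bar>B \<omega> - \<mu>\<bar> + 2 * \<Delta> * E \<omega> + 2 * (B \<omega> * \<Delta>)\<^sup>2
           + K * (w \<omega> * ((\<bar>B \<omega>\<bar> * \<Delta>) ^ 3 + (\<bar>H \<omega>\<bar> * s) ^ 3)
            + (\<bar>B \<omega>\<bar> * \<Delta>) ^ k + (\<bar>H \<omega>\<bar> * s) ^ k) + (\<alpha> * \<Delta>)\<^sup>2"
          using \<omega> by (simp add: e_def)
        ultimately show ?thesis using pdrift[OF \<omega>] pE[OF \<omega>] B2 by linarith
      qed
      then show "\<bar>e \<omega>\<bar> \<le> \<Delta> * (D + \<bar>\<mu>\<bar>) + 2 * \<Delta> * (D * D + \<sigma>\<^sup>2 * D) + 2 * (D * \<Delta>)\<^sup>2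
         + K * (1 * ((D * \<Delta>) ^ 3 + (D * s) ^ 3) + (D * \<Delta>) ^ k + (D * s) ^ k) + (\<alpha> * \<Delta>)\<^sup>2"
        using e_nonneg[of \<omega>] by simp
    qed (simp add: e_def)
  qed
  have Q_e: "Q \<omega> + g3 \<omega> * m3 + gk \<omega> * mk \<le> e \<omega>" for \<omega>
  proof (cases "\<omega> \<in> A")
    case True
    define b3 where "b3 = w \<omega> * (\<bar>B \<omega>\<bar> * \<Delta>) ^ 3"
    define bk where "bk = (\<bar>B \<omega>\<bar> * \<Delta>) ^ k"
    define h3 where "h3 = w \<omega> * (\<bar>H \<omega>\<bar> * s) ^ 3"
    define hk where "hk = (\<bar>H \<omega>\<bar> * s) ^ k"
    have nn: "b3 \<ge> 0" "bk \<ge> 0" "h3 \<ge> 0" "hk \<ge> 0" "\<Delta> * E \<omega> \<ge> 0" "(B \<omega> * \<Delta>)\<^sup>2 \<ge> 0"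
      using w[of \<omega>] s \<Delta> by (auto simp: b3_def bk_def h3_def hk_def E_def)
    have "C * 8 * b3 \<le> K * b3" "C * 2 ^ k * bk \<le> K * bk" "C * 8 * m3 * h3 \<le> K * h3" "C * 2 ^ k * mk * hk \<le> K * hk"
      using K nn by (intro mult_right_mono; simp)+
    moreover have "Q \<omega> = \<Delta> * \<bar>B \<omega> - \<mu>\<bar> + 3 / 2 * (\<Delta> * E \<omega>) + 3 / 2 * (B \<omega> * \<Delta>)\<^sup>2 + C * 8 * b3 + C * 2 ^ k * bk + (\<alpha> * \<Delta>)\<^sup>2"
      using True by (simp add: Q_def b3_def bk_def algebra_simps)
    moreover have "g3 \<omega> * m3 = C * 8 * m3 * h3" "gk \<omega> * mk = C * 2 ^ k * mk * hk"
      using True by (auto simp: g3_def gk_def h3_def hk_def mult_ac)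
    moreover have "e \<omega> = \<Delta> * \<bar>B \<omega> - \<mu>\<bar> + 2 * (\<Delta> * E \<omega>) + 2 * (B \<omega> * \<Delta>)\<^sup>2 + K * b3 + K * h3 + K * bk + K * hk + (\<alpha> * \<Delta>)\<^sup>2"
      using True by (simp add: e_def b3_def bk_def h3_def hk_def algebra_simps)
    ultimately show ?thesis using nn by linarith
  qed (simp add: e_def Q_def g3_def gk_def)
  have "(\<integral>\<omega>. L \<omega> \<partial>M) = (\<integral>\<omega>. indicator A \<omega> * V \<omega> \<partial>M)"
    unfolding split using V_int n1(1,2) n2(3,4) off by simp
  also have "\<bar>\<dots>\<bar> \<le> (\<integral>\<omega>. indicator A \<omega> * \<bar>V \<omega>\<bar> \<partial>M)"
    by (rule integral_abs_bound[THEN order_trans]) (simp add: abs_mult)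
  also have "\<dots> \<le> (\<integral>\<omega>. Q \<omega> + g3 \<omega> * \<bar>\<xi> \<omega>\<bar> ^ 3 + gk \<omega> * \<bar>\<xi> \<omega>\<bar> ^ k \<partial>M)"
  proof (rule integral_mono)
    show "integrable M (\<lambda>\<omega>. indicator A \<omega> * \<bar>V \<omega>\<bar>)" using integrable_abs[OF V_int] by (simp add: abs_mult)
    show "integrable M (\<lambda>\<omega>. Q \<omega> + g3 \<omega> * \<bar>\<xi> \<omega>\<bar> ^ 3 + gk \<omega> * \<bar>\<xi> \<omega>\<bar> ^ k)"
      using n3(1) nk(1) nQ(7) off by auto
  qed (rule V_bound)
  also have "\<dots> = (\<integral>\<omega>. Q \<omega> + g3 \<omega> * m3 + gk \<omega> * mk \<partial>M)"
    using n3 nk nQ(7) off by (simp add: m3_def mk_def)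
  also have "\<dots> \<le> (\<integral>\<omega>. e \<omega> \<partial>M)"
    using n3(3) nk(3) nQ(7) off by (intro integral_mono e_int Q_e) auto
  finally show "\<bar>\<integral>\<omega>. indicator A \<omega> * (exp (- \<alpha> * \<Delta>) * \<phi> (Z \<omega> + Z \<omega> * (B \<omega> * \<Delta> + H \<omega> * sqrt \<Delta> * \<xi> \<omega>)) - \<phi> (Z \<omega>)) \<partial>M\<bar>
     \<le> (\<integral>\<omega>. indicator A \<omega> * step_error K t k \<Delta> (Z \<omega>) (B \<omega>) (H \<omega>) \<partial>M)"
    unfolding err_eq by (simp only: L_def U_def s_def[symmetric] a_def e_def)
  show "integrable M (\<lambda>\<omega>. indicator A \<omega> * (exp (- \<alpha> * \<Delta>) * \<phi> (Z \<omega> + Z \<omega> * (B \<omega> * \<Delta> + H \<omega> * sqrt \<Delta> * \<xi> \<omega>)) - \<phi> (Z \<omega>)))"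
    using L_int by (simp only: L_def U_def s_def[symmetric] a_def)
qed


text \<open>
  The increments of \<open>exp (- \<alpha> \<Delta> i) \<phi> (Z i)\<close> telescope along each path up to the stopping index, and each of
  them is bounded in expectation by the one-step estimate, since \<open>A i\<close>, the event of not having stopped at \<open>i\<close>,
  belongs to the past.
\<close>

lemma discounted_Dynkin:
  fixes M :: "'a measure" and C t :: real and k n :: nat
  defines "K \<equiv> error_constant k C"
  assumes C: "Taylor_constant t k C"
    and M: "prob_space M" and sub: "\<And>i. i < n \<Longrightarrow> subalgebra M (G i)"
    and ind: "\<And>i. i < n \<Longrightarrow>
      prob_space.indep_set M (sets (G i)) (sets (vimage_algebra (space M) (\<xi> i) borel))"
    and d: "\<And>i. i < n \<Longrightarrow> distributed M lborel (\<xi> i) std_normal_density"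
    and A: "\<And>i. i < n \<Longrightarrow> A i \<in> sets (G i)"
    and Z: "\<And>i. i < n \<Longrightarrow> Z i \<in> borel_measurable (G i)"
    and B: "\<And>i. i < n \<Longrightarrow> B i \<in> borel_measurable (G i)"
    and H: "\<And>i. i < n \<Longrightarrow> H i \<in> borel_measurable (G i)"
    and bdd: "\<And>i \<omega>. i < n \<Longrightarrow> \<omega> \<in> A i \<Longrightarrow>
      Z i \<omega> > 0 \<and> Z i \<omega> powr (- r) \<le> D \<and> \<bar>B i \<omega>\<bar> \<le> D \<and> \<bar>H i \<omega>\<bar> \<le> D"
    and \<Delta>: "\<Delta> > 0"
    and decr: "\<And>i j. i \<le> j \<Longrightarrow> j < n \<Longrightarrow> A j \<subseteq> A i"
    and Z0: "\<And>\<omega>. Z 0 \<omega> = x"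
    and step: "\<And>i \<omega>. i < n \<Longrightarrow> \<omega> \<in> A i \<Longrightarrow>
      Z (Suc i) \<omega> = Z i \<omega> + Z i \<omega> * (B i \<omega> * \<Delta> + H i \<omega> * sqrt \<Delta> * \<xi> i \<omega>)"
  defines "stop \<equiv> \<lambda>\<omega>. LEAST i. i = n \<or> \<omega> \<notin> A i"
  shows "\<bar>(\<integral>\<omega>. exp (- \<alpha> * \<Delta> * real (stop \<omega>)) * \<phi> (Z (stop \<omega>) \<omega>) \<partial>M) - \<phi> x\<bar>
     \<le> (\<Sum>i<n. exp (- \<alpha> * \<Delta> * real i) *
          (\<integral>\<omega>. indicator (A i) \<omega> * step_error K t k \<Delta> (Z i \<omega>) (B i \<omega>) (H i \<omega>) \<partial>M))"
    and "integrable M (\<lambda>\<omega>. exp (- \<alpha> * \<Delta> * real (stop \<omega>)) * \<phi> (Z (stop \<omega>) \<omega>))"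
proof -
  interpret M: prob_space M by fact
  define L where "L = (\<lambda>i \<omega>. indicator (A i) \<omega> * (exp (- \<alpha> * \<Delta>) *
      \<phi> (Z i \<omega> + Z i \<omega> * (B i \<omega> * \<Delta> + H i \<omega> * sqrt \<Delta> * \<xi> i \<omega>)) - \<phi> (Z i \<omega>)))"
  have one: "\<bar>\<integral>\<omega>. L i \<omega> \<partial>M\<bar> \<le>
      (\<integral>\<omega>. indicator (A i) \<omega> * step_error K t k \<Delta> (Z i \<omega>) (B i \<omega>) (H i \<omega>) \<partial>M)"
    and L_int: "integrable M (L i)" if "i < n" for i
    using one_step[OF C M sub[OF that] ind[OF that] d[OF that] A[OF that] Z[OF that] B[OF that] H[OF that] bdd[OF that] \<Delta>]
    by (simp_all only: L_def K_def)
  have path: "exp (- \<alpha> * \<Delta> * real (stop \<omega>)) * \<phi> (Z (stop \<omega>) \<omega>)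
      = \<phi> x + (\<Sum>i<n. exp (- \<alpha> * \<Delta> * real i) * L i \<omega>)" for \<omega>
  proof -
    define y where "y = (\<lambda>i. exp (- \<alpha> * \<Delta> * real i) * \<phi> (Z i \<omega>))"
    have stop_le: "stop \<omega> \<le> n" unfolding stop_def by (rule Least_le) simp
    have stop: "stop \<omega> = n \<or> \<omega> \<notin> A (stop \<omega>)"
      unfolding stop_def by (rule LeastI[of _ n]) simp
    have iff: "\<omega> \<in> A i \<longleftrightarrow> i < stop \<omega>" if "i < n" for i
    proof
      assume "i < stop \<omega>"
      then have "\<not> (i = n \<or> \<omega> \<notin> A i)" unfolding stop_def by (rule not_less_Least)
      then show "\<omega> \<in> A i" by simp
    next
      assume i: "\<omega> \<in> A i"
      show "i < stop \<omega>"
      proof (rule ccontr)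
        assume "\<not> i < stop \<omega>"
        then have "\<omega> \<in> A (stop \<omega>)" "stop \<omega> \<noteq> n" using decr[of "stop \<omega>" i] that i by auto
        then show False using stop by simp
      qed
    qed
    have "(\<Sum>i<n. exp (- \<alpha> * \<Delta> * real i) * L i \<omega>) = (\<Sum>i<n. if i < stop \<omega> then y (Suc i) - y i else 0)"
    proof (rule sum.cong[OF refl])
      fix i assume i: "i \<in> {..<n}"
      have ex: "exp (- \<alpha> * \<Delta> * real (Suc i)) = exp (- \<alpha> * \<Delta> * real i) * exp (- \<alpha> * \<Delta>)"
        by (simp add: exp_add[symmetric] algebra_simps)
      show "exp (- \<alpha> * \<Delta> * real i) * L i \<omega> = (if i < stop \<omega> then y (Suc i) - y i else 0)"
      proof (cases "\<omega> \<in> A i")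
        case True
        then show ?thesis using i iff[of i] step[of i \<omega>]
          unfolding L_def y_def ex by (simp add: right_diff_distrib)
      next
        case False
        then show ?thesis using i iff[of i] by (simp add: L_def)
      qed
    qed
    also have "\<dots> = (\<Sum>i\<in>{..<n} \<inter> {i. i < stop \<omega>}. y (Suc i) - y i)"
      by (subst sum.inter_restrict) auto
    also have "{..<n} \<inter> {i. i < stop \<omega>} = {..<stop \<omega>}" using stop_le by auto
    also have "(\<Sum>i<stop \<omega>. y (Suc i) - y i) = y (stop \<omega>) - y 0" by (rule sum_lessThan_telescope)
    finally show ?thesis by (simp add: y_def Z0)
  qed
  have int: "integrable M (\<lambda>\<omega>. exp (- \<alpha> * \<Delta> * real i) * L i \<omega>)" if "i < n" for i
    using L_int[OF that] by simp
  then show "integrable M (\<lambda>\<omega>. exp (- \<alpha> * \<Delta> * real (stop \<omega>)) * \<phi> (Z (stop \<omega>) \<omega>))"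
    unfolding path by (intro Bochner_Integration.integrable_add Bochner_Integration.integrable_sum) auto
  have "(\<integral>\<omega>. exp (- \<alpha> * \<Delta> * real (stop \<omega>)) * \<phi> (Z (stop \<omega>) \<omega>) \<partial>M)
      = \<phi> x + (\<Sum>i<n. exp (- \<alpha> * \<Delta> * real i) * (\<integral>\<omega>. L i \<omega> \<partial>M))"
    unfolding path using int
    by (subst Bochner_Integration.integral_add) (auto simp: M.prob_space Bochner_Integration.integral_sum)
  then have "\<bar>(\<integral>\<omega>. exp (- \<alpha> * \<Delta> * real (stop \<omega>)) * \<phi> (Z (stop \<omega>) \<omega>) \<partial>M) - \<phi> x\<bar>
      = \<bar>\<Sum>i<n. exp (- \<alpha> * \<Delta> * real i) * (\<integral>\<omega>. L i \<omega> \<partial>M)\<bar>" by simp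
  also have "\<dots> \<le> (\<Sum>i<n. exp (- \<alpha> * \<Delta> * real i) * \<bar>\<integral>\<omega>. L i \<omega> \<partial>M\<bar>)"
    by (rule sum_abs[THEN order_trans]) (simp add: abs_mult)
  also have "\<dots> \<le> (\<Sum>i<n. exp (- \<alpha> * \<Delta> * real i) *
          (\<integral>\<omega>. indicator (A i) \<omega> * step_error K t k \<Delta> (Z i \<omega>) (B i \<omega>) (H i \<omega>) \<partial>M))"
    by (intro sum_mono mult_left_mono one) auto
  finally show "\<bar>(\<integral>\<omega>. exp (- \<alpha> * \<Delta> * real (stop \<omega>)) * \<phi> (Z (stop \<omega>) \<omega>) \<partial>M) - \<phi> x\<bar>
     \<le> (\<Sum>i<n. exp (- \<alpha> * \<Delta> * real i) *
          (\<integral>\<omega>. indicator (A i) \<omega> * step_error K t k \<Delta> (Z i \<omega>) (B i \<omega>) (H i \<omega>) \<partial>M))" .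
qed

end

section \<open>The Euler-Maruyama scheme\<close>

lemma em_path_at_grid: "\<delta> > 0 \<Longrightarrow> em_path \<mu> \<sigma> p x \<delta> z (real j * \<delta>) = em_grid \<mu> \<sigma> p x \<delta> z j"
proof -
  assume \<delta>: "\<delta> > 0"
  have "nat \<lfloor>real j * \<delta> / \<delta>\<rfloor> = j" using \<delta> by simp
  moreover have "(real (Suc j) * \<delta> - real j * \<delta>) / \<delta> = 1" using \<delta> by (simp add: field_simps)
  ultimately show ?thesis by (simp only: em_path_def Let_def) simp
qed

lemma em_path_continuous:
  assumes \<delta>: "\<delta> > 0"
  shows "continuous_on {0..} (em_path \<mu> \<sigma> p x \<delta> z)"
proof (rule continuous_on_half_line)
  fix T :: real assume "T \<ge> 0"
  have "continuous_on {0..real n * \<delta>} (em_path \<mu> \<sigma> p x \<delta> z)" for n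
  proof (induction n)
    case (Suc n)
    have "continuous_on {real n * \<delta>..real (Suc n) * \<delta>} (em_path \<mu> \<sigma> p x \<delta> z)"
    proof (rule continuous_on_cong[THEN iffD1, OF refl])
      fix t assume "t \<in> {real n * \<delta>..real (Suc n) * \<delta>}"
      then show "(t - real n * \<delta>) / \<delta> * em_grid \<mu> \<sigma> p x \<delta> z (Suc n)
          + (real (Suc n) * \<delta> - t) / \<delta> * em_grid \<mu> \<sigma> p x \<delta> z n = em_path \<mu> \<sigma> p x \<delta> z t"
        using em_path_interpolates[OF \<delta>, of "Suc n" t] by simp
    next
      show "continuous_on {real n * \<delta>..real (Suc n) * \<delta>} (\<lambda>t. (t - real n * \<delta>) / \<delta> * em_grid \<mu> \<sigma> p x \<delta> z (Suc n)
          + (real (Suc n) * \<delta> - t) / \<delta> * em_grid \<mu> \<sigma> p x \<delta> z n)"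
        using \<delta> by (intro continuous_intros) auto
    qed
    then have "continuous_on ({0..real n * \<delta>} \<union> {real n * \<delta>..real (Suc n) * \<delta>}) (em_path \<mu> \<sigma> p x \<delta> z)"
      using Suc by (intro continuous_on_closed_Un) auto
    moreover have "{0..real n * \<delta>} \<union> {real n * \<delta>..real (Suc n) * \<delta>} = {0..real (Suc n) * \<delta>}"
      using \<delta> by (intro ivl_disj_un_two_touch) auto
    ultimately show ?case by simp
  qed simp
  moreover obtain n where "T / \<delta> \<le> real n" using real_arch_simple by blast
  then have "{0..T} \<subseteq> {0..real n * \<delta>}" using \<delta> by (auto simp: field_simps)
  ultimately show "continuous_on {0..T} (em_path \<mu> \<sigma> p x \<delta> z)"
    by (meson continuous_on_subset)
qed

text \<open>
  A convex combination of two values above the level is above it, so the interpolated path cannot reach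
  the level before the scheme does.
\<close>

lemma em_path_above:
  assumes \<delta>: "\<delta> > 0" and above: "\<And>i. i \<le> m \<Longrightarrow> em_grid \<mu> \<sigma> p x \<delta> z i > l"
    and s: "0 \<le> s" "s < real m * \<delta>"
  shows "em_path \<mu> \<sigma> p x \<delta> z s > l"
proof -
  define j where "j = nat \<lfloor>s / \<delta>\<rfloor>"
  have "0 \<le> s / \<delta>" "s / \<delta> < real m" using s \<delta> by (auto simp: field_simps)
  then have j: "real j \<le> s / \<delta>" "s / \<delta> < real j + 1" "j < m"
    unfolding j_def by (auto simp: le_nat_floor floor_less_iff nat_less_iff)
  define w where "w = s / \<delta> - real j"
  have w: "0 \<le> w" "w < 1" using j by (auto simp: w_def)
  have "em_path \<mu> \<sigma> p x \<delta> z s = w * em_grid \<mu> \<sigma> p x \<delta> z (Suc j) + (1 - w) * em_grid \<mu> \<sigma> p x \<delta> z j"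
  proof -
    have "(s - real j * \<delta>) / \<delta> = w" "(real (Suc j) * \<delta> - s) / \<delta> = 1 - w"
      using \<delta> by (simp_all add: w_def diff_divide_distrib)
    then show ?thesis unfolding em_path_def Let_def j_def[symmetric] by simp
  qed
  also have "\<dots> > l"
  proof -
    have a: "em_grid \<mu> \<sigma> p x \<delta> z (Suc j) > l" "em_grid \<mu> \<sigma> p x \<delta> z j > l"
      using above[of "Suc j"] above[of j] j by auto
    have "w * l \<le> w * em_grid \<mu> \<sigma> p x \<delta> z (Suc j)" using a w by (intro mult_left_mono) auto
    moreover have "(1 - w) * l < (1 - w) * em_grid \<mu> \<sigma> p x \<delta> z j"
      using a w by (intro mult_strict_left_mono) auto
    moreover have "w * l + (1 - w) * l = l" by (simp add: algebra_simps)
    ultimately show ?thesis by linarith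
  qed
  finally show ?thesis .
qed

lemma em_hitting_time_ge:
  assumes "\<delta> > 0" "\<And>i. i \<le> m \<Longrightarrow> em_grid \<mu> \<sigma> p x \<delta> z i > l"
  shows "ennreal (real m * \<delta>) \<le> hitting_time l (em_path \<mu> \<sigma> p x \<delta> z)"
proof (rule hitting_time_ge)
  fix s assume "0 \<le> s" "s < real m * \<delta>"
  then have "em_path \<mu> \<sigma> p x \<delta> z s > l" using assms by (intro em_path_above[where m = m])
  then show "em_path \<mu> \<sigma> p x \<delta> z s \<noteq> l" by simp
qed

lemma em_hitting_time_le:
  assumes "\<delta> > 0" "l \<le> x" "em_grid \<mu> \<sigma> p x \<delta> z j \<le> l"
  shows "hitting_time l (em_path \<mu> \<sigma> p x \<delta> z) \<le> ennreal (real j * \<delta>)"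
  using assms em_path_at_grid[OF assms(1), of \<mu> \<sigma> p x z 0] em_path_at_grid[OF assms(1), of \<mu> \<sigma> p x z j]
  by (intro hitting_time_le_IVT em_path_continuous) auto

lemma em_grid_measurable:
  assumes "\<And>j. 1 \<le> j \<Longrightarrow> j \<le> i \<Longrightarrow> \<xi> j \<in> borel_measurable G"
  shows "(\<lambda>\<omega>. em_grid \<mu> \<sigma> p x \<delta> (\<lambda>j. \<xi> j \<omega>) i) \<in> borel_measurable G"
  using assms
proof (induction i)
  case (Suc i)
  then have [measurable]: "(\<lambda>\<omega>. em_grid \<mu> \<sigma> p x \<delta> (\<lambda>j. \<xi> j \<omega>) i) \<in> borel_measurable G"
    "\<xi> (Suc i) \<in> borel_measurable G" by auto
  show ?case by simp
qed simp

lemma em_hitting_time_measurable: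
  assumes \<delta>: "\<delta> > 0" and \<xi>: "\<And>j. j \<ge> 1 \<Longrightarrow> \<xi> j \<in> borel_measurable N"
  shows "(\<lambda>\<omega>. hitting_time l (em_path \<mu> \<sigma> p x \<delta> (\<lambda>j. \<xi> j \<omega>))) \<in> borel_measurable N"
proof (rule hitting_time_measurable)
  fix t :: real
  have [measurable]: "(\<lambda>\<omega>. em_grid \<mu> \<sigma> p x \<delta> (\<lambda>j. \<xi> j \<omega>) i) \<in> borel_measurable N" for i
    by (rule em_grid_measurable) (use \<xi> in auto)
  show "(\<lambda>\<omega>. em_path \<mu> \<sigma> p x \<delta> (\<lambda>j. \<xi> j \<omega>) t) \<in> borel_measurable N"
    unfolding em_path_def Let_def by measurable
qed (rule em_path_continuous[OF \<delta>])

definition noise_algebra :: "'b measure \<Rightarrow> (nat \<Rightarrow> 'b \<Rightarrow> real) \<Rightarrow> nat \<Rightarrow> 'b measure" where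
  "noise_algebra N \<xi> i = vimage_algebra (space N) (\<lambda>\<omega>. restrict (\<lambda>j. \<xi> j \<omega>) {1..i}) (PiM {1..i} (\<lambda>_. borel))"

lemma (in prob_space) noise_algebra:
  assumes ind: "indep_vars (\<lambda>_. borel) \<xi> {1..}"
  shows "subalgebra M (noise_algebra M \<xi> i)"
    and "1 \<le> j \<Longrightarrow> j \<le> i \<Longrightarrow> \<xi> j \<in> borel_measurable (noise_algebra M \<xi> i)"
    and "indep_set (sets (noise_algebra M \<xi> i)) (sets (vimage_algebra (space M) (\<xi> (Suc i)) borel))"
proof -
  have rv: "\<xi> j \<in> borel_measurable M" if "j \<ge> 1" for j
    using ind that by (auto simp: indep_vars_def)
  define R where "R = (\<lambda>\<omega>. restrict (\<lambda>j. \<xi> j \<omega>) {1..i})"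
  have RM: "R \<in> measurable M (PiM {1..i} (\<lambda>_. borel))"
    unfolding R_def using rv by (intro measurable_restrict) auto
  then have Rsp: "R \<in> space M \<rightarrow> space (PiM {1..i} (\<lambda>_. borel))" by (auto dest: measurable_space)
  have na: "noise_algebra M \<xi> i = vimage_algebra (space M) R (PiM {1..i} (\<lambda>_. borel))"
    by (simp add: noise_algebra_def R_def)
  have sets_na: "sets (noise_algebra M \<xi> i) = {R -` A \<inter> space M | A. A \<in> sets (PiM {1..i} (\<lambda>_. borel))}"
    unfolding na using Rsp by (rule sets_vimage_algebra2)
  show "subalgebra M (noise_algebra M \<xi> i)"
    unfolding subalgebra_def sets_na using measurable_sets[OF RM] by (auto simp: na)
  show "\<xi> j \<in> borel_measurable (noise_algebra M \<xi> i)" if "1 \<le> j" "j \<le> i"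
  proof -
    have "R \<in> measurable (noise_algebra M \<xi> i) (PiM {1..i} (\<lambda>_. borel))"
      unfolding na using Rsp by (rule measurable_vimage_algebra1)
    moreover have "(\<lambda>x. x j) \<in> measurable (PiM {1..i} (\<lambda>_. borel)) (borel :: real measure)"
      using that by (intro measurable_component_singleton[of j "{1..i}" "\<lambda>_. borel"]) auto
    ultimately have "(\<lambda>\<omega>. R \<omega> j) \<in> borel_measurable (noise_algebra M \<xi> i)"
      by (rule measurable_compose)
    then show ?thesis using that by (simp add: R_def)
  qed
  define S where "S = (\<lambda>\<omega>. restrict (\<lambda>j. \<xi> j \<omega>) {Suc i})"
  let ?P = "\<lambda>I. PiM I (\<lambda>_. borel) :: (nat \<Rightarrow> real) measure"
  have "indep_var (?P {1..i}) R (?P {Suc i}) S"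
    unfolding R_def S_def by (rule indep_var_restrict[OF ind]) auto
  then have ind_RS: "indep_set (sigma_sets (space M) {R -` A \<inter> space M |A. A \<in> sets (?P {1..i})})
      (sigma_sets (space M) {S -` A \<inter> space M |A. A \<in> sets (?P {Suc i})})"
    by (simp add: indep_var_eq)
  have "{\<xi> (Suc i) -` A \<inter> space M |A. A \<in> sets borel}
      \<subseteq> sigma_sets (space M) {S -` A \<inter> space M |A. A \<in> sets (?P {Suc i})}"
  proof safe
    fix A :: "real set" assume A: "A \<in> sets borel"
    have "(\<lambda>x. x (Suc i)) \<in> measurable (?P {Suc i}) borel"
      by (rule measurable_component_singleton[of "Suc i" "{Suc i}" "\<lambda>_. borel"]) simp
    then have "(\<lambda>x. x (Suc i)) -` A \<inter> space (?P {Suc i}) \<in> sets (?P {Suc i})"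
      using A by (rule measurable_sets)
    moreover have "\<xi> (Suc i) -` A \<inter> space M = S -` ((\<lambda>x. x (Suc i)) -` A \<inter> space (?P {Suc i})) \<inter> space M"
      by (auto simp: S_def space_PiM)
    ultimately show "\<xi> (Suc i) -` A \<inter> space M \<in> sigma_sets (space M) {S -` A \<inter> space M |A. A \<in> sets (?P {Suc i})}"
      by (intro sigma_sets.Basic) blast
  qed
  then have "sigma_sets (space M) {\<xi> (Suc i) -` A \<inter> space M |A. A \<in> sets borel}
      \<subseteq> sigma_sets (space M) {S -` A \<inter> space M |A. A \<in> sets (?P {Suc i})}"
    by (intro sigma_sets_mono) auto
  with ind_RS have "indep_set (sigma_sets (space M) {R -` A \<inter> space M |A. A \<in> sets (?P {1..i})})
      (sigma_sets (space M) {\<xi> (Suc i) -` A \<inter> space M |A. A \<in> sets borel})"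
    unfolding indep_sets2_eq by blast
  moreover have "sets (noise_algebra M \<xi> i) = sigma_sets (space M) {R -` A \<inter> space M |A. A \<in> sets (PiM {1..i} (\<lambda>_. borel))}"
    unfolding na by (rule sets_vimage_algebra)
  ultimately show "indep_set (sets (noise_algebra M \<xi> i)) (sets (vimage_algebra (space M) (\<xi> (Suc i)) borel))"
    by (simp add: sets_vimage_algebra)
qed

context cev_laplace begin

definition em_rate :: "real \<Rightarrow> real \<Rightarrow> nat \<Rightarrow> real \<Rightarrow> real" where
  "em_rate K \<gamma> k \<delta> = 2 * \<delta>\<^sup>2 * \<mu>\<^sup>2 + K * ((\<bar>\<mu>\<bar> * \<delta>) ^ 3 + \<sigma> ^ 3 * \<delta> powr (1 + 2 * \<gamma>\<^sup>2)
     + (\<bar>\<mu>\<bar> * \<delta>) ^ k + \<sigma> ^ k * \<delta> powr (\<gamma> * k)) + (\<alpha> * \<delta>)\<^sup>2"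

text \<open>
  With \<open>q = z powr (p - 1) * sqrt \<delta>\<close>, the relative size of the noise, one has \<open>z powr r = \<delta> / q\<^sup>2\<close>. So the weight
  \<open>z powr (r (1 - \<gamma>))\<close> turns \<open>q\<^sup>3\<close> into \<open>\<delta> powr (1 - \<gamma>) * q powr (1 + 2 \<gamma>)\<close>, which is at most
  \<open>\<delta> powr (1 + 2 \<gamma>\<^sup>2)\<close> because \<open>q \<le> \<delta> powr \<gamma>\<close> above the level \<open>\<delta> powr \<beta>\<close>.
  Without the weight the bound would only be \<open>\<delta> powr (3 \<gamma>)\<close>.
\<close>

lemma step_error_em:
  assumes \<delta>: "0 < \<delta>" and z: "z > \<delta> powr \<beta>" and \<beta>: "0 < \<beta>" and K: "K \<ge> 0"
    and \<gamma>: "\<gamma> = 1 / 2 - \<beta> * (1 - p)" "0 < \<gamma>"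
  shows "step_error K (1 - \<gamma>) k \<delta> z \<mu> (\<sigma> * z powr (p - 1)) \<le> em_rate K \<gamma> k \<delta>"
proof -
  have \<gamma>2: "\<gamma> < 1 / 2" using \<gamma>(1) \<beta> p by (simp add: mult_pos_pos)
  have "\<delta> powr \<beta> > 0" using \<delta> by simp
  then have zp: "z > 0" using z by linarith
  define q where "q = z powr (p - 1) * sqrt \<delta>"
  have q: "q > 0" using zp \<delta> by (simp add: q_def)
  have "z powr (p - 1) \<le> (\<delta> powr \<beta>) powr (p - 1)"
    using z p \<delta> by (intro powr_mono2') auto
  then have "q \<le> (\<delta> powr \<beta>) powr (p - 1) * sqrt \<delta>"
    unfolding q_def using \<delta> by (intro mult_right_mono) auto
  also have "\<dots> = \<delta> powr \<gamma>"
    using \<delta> by (simp add: powr_powr powr_half_sqrt[symmetric] powr_add[symmetric] \<gamma>(1) algebra_simps)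
  finally have q_le: "q \<le> \<delta> powr \<gamma>" .
  have H2: "(\<sigma> * z powr (p - 1))\<^sup>2 = \<sigma>\<^sup>2 * z powr (- r)"
    using zp by (simp add: power_mult_distrib power2_eq_square[of "z powr _"] powr_add[symmetric] r_def algebra_simps)
  have Hs: "\<bar>\<sigma> * z powr (p - 1)\<bar> * sqrt \<delta> = \<sigma> * q" using \<sigma> by (simp add: q_def abs_mult)
  have cube: "min 1 (z powr (r * (1 - \<gamma>))) * (\<sigma> * q) ^ 3 \<le> \<sigma> ^ 3 * \<delta> powr (1 + 2 * \<gamma>\<^sup>2)"
  proof -
    have "min 1 (z powr (r * (1 - \<gamma>))) * (\<sigma> * q) ^ 3 \<le> z powr (r * (1 - \<gamma>)) * (\<sigma> * q) ^ 3"
      using q \<sigma> by (intro mult_right_mono) auto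
    also have "z powr (r * (1 - \<gamma>)) * (\<sigma> * q) ^ 3 = \<sigma> ^ 3 * (\<delta> powr (1 - \<gamma>) * q powr (1 + 2 * \<gamma>))"
    proof -
      have "ln q = (p - 1) * ln z + ln \<delta> / 2" using zp \<delta> by (simp add: q_def ln_mult ln_powr ln_sqrt)
      then have lz: "2 * (1 - p) * ln z = ln \<delta> - 2 * ln q" by (simp add: algebra_simps)
      have "r * (1 - \<gamma>) * ln z + 3 * ln q = (1 - \<gamma>) * (2 * (1 - p) * ln z) + 3 * ln q"
        by (simp add: r_def algebra_simps)
      also have "\<dots> = (1 - \<gamma>) * ln \<delta> + (1 + 2 * \<gamma>) * ln q" unfolding lz by (simp add: algebra_simps)
      finally have "exp (r * (1 - \<gamma>) * ln z + 3 * ln q) = exp ((1 - \<gamma>) * ln \<delta> + (1 + 2 * \<gamma>) * ln q)" by simp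
      then have "z powr (r * (1 - \<gamma>)) * q powr 3 = \<delta> powr (1 - \<gamma>) * q powr (1 + 2 * \<gamma>)"
        using zp \<delta> q by (simp add: powr_def exp_add)
      then show ?thesis using q by (simp add: power_mult_distrib)
    qed
    also have "\<delta> powr (1 - \<gamma>) * q powr (1 + 2 * \<gamma>) \<le> \<delta> powr (1 - \<gamma>) * (\<delta> powr \<gamma>) powr (1 + 2 * \<gamma>)"
      using q q_le \<gamma>(2) by (intro mult_left_mono powr_mono2) auto
    also have "\<dots> = \<delta> powr (1 + 2 * \<gamma>\<^sup>2)"
      using \<delta> by (simp add: powr_powr powr_add[symmetric] power2_eq_square algebra_simps)
    finally show ?thesis using \<sigma> by (simp add: mult_left_mono)
  qed
  have kth: "(\<sigma> * q) ^ k \<le> \<sigma> ^ k * \<delta> powr (\<gamma> * k)"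
  proof -
    have "(\<sigma> * q) ^ k \<le> (\<sigma> * \<delta> powr \<gamma>) ^ k" using q q_le \<sigma> by (intro power_mono mult_left_mono) auto
    also have "\<dots> = \<sigma> ^ k * \<delta> powr (\<gamma> * k)" using \<delta> by (simp add: power_mult_distrib powr_powr flip: powr_realpow)
    finally show ?thesis .
  qed
  have drift: "min 1 (z powr (r * (1 - \<gamma>))) * (\<bar>\<mu>\<bar> * \<delta>) ^ 3 \<le> 1 * (\<bar>\<mu>\<bar> * \<delta>) ^ 3"
    using \<delta> by (intro mult_right_mono) auto
  have "min 1 (z powr (r * (1 - \<gamma>))) * ((\<bar>\<mu>\<bar> * \<delta>) ^ 3 + (\<sigma> * q) ^ 3) + (\<bar>\<mu>\<bar> * \<delta>) ^ k + (\<sigma> * q) ^ k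
    \<le> (\<bar>\<mu>\<bar> * \<delta>) ^ 3 + \<sigma> ^ 3 * \<delta> powr (1 + 2 * \<gamma>\<^sup>2) + (\<bar>\<mu>\<bar> * \<delta>) ^ k + \<sigma> ^ k * \<delta> powr (\<gamma> * k)"
    using cube kth drift by (simp add: distrib_left)
  from mult_left_mono[OF this K] show ?thesis
    unfolding step_error_def em_rate_def H2 Hs by simp
qed

lemma em_rate_small:
  assumes \<gamma>: "0 < \<gamma>" and k: "k \<ge> 2" "\<gamma> * real k > 1"
  shows "((\<lambda>\<delta>. em_rate K \<gamma> k \<delta> / (1 - exp (- \<alpha> * \<delta>))) \<longlongrightarrow> 0) (at_right 0)"
proof -
  have pw: "((\<lambda>\<delta>. \<delta> powr a) \<longlongrightarrow> 0) (at_right 0)" if "a > 0" for a :: real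
    using that by real_asymp
  have pn: "((\<lambda>\<delta>::real. \<delta> ^ j) \<longlongrightarrow> 0) (at_right 0)" if "j > 0" for j
    using that by (intro tendsto_eq_intros) (auto simp: filterlim_at)
  have ratio: "((\<lambda>\<delta>. \<delta> / (1 - exp (- \<alpha> * \<delta>))) \<longlongrightarrow> inverse \<alpha>) (at_right 0)"
    using \<alpha>_pos by real_asymp
  have "((\<lambda>\<delta>. 2 * \<mu>\<^sup>2 * \<delta> ^ 1 + K * (\<bar>\<mu>\<bar> ^ 3 * \<delta> ^ 2 + \<sigma> ^ 3 * \<delta> powr (2 * \<gamma>\<^sup>2)
     + \<bar>\<mu>\<bar> ^ k * \<delta> ^ (k - 1) + \<sigma> ^ k * \<delta> powr (\<gamma> * k - 1)) + \<alpha>\<^sup>2 * \<delta> ^ 1) \<longlongrightarrow>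
     2 * \<mu>\<^sup>2 * 0 + K * (\<bar>\<mu>\<bar> ^ 3 * 0 + \<sigma> ^ 3 * 0 + \<bar>\<mu>\<bar> ^ k * 0 + \<sigma> ^ k * 0) + \<alpha>\<^sup>2 * 0) (at_right 0)"
    using \<gamma> k by (intro tendsto_intros pw pn) auto
  from tendsto_mult[OF this ratio]
  have "((\<lambda>\<delta>. (2 * \<mu>\<^sup>2 * \<delta> ^ 1 + K * (\<bar>\<mu>\<bar> ^ 3 * \<delta> ^ 2 + \<sigma> ^ 3 * \<delta> powr (2 * \<gamma>\<^sup>2)
     + \<bar>\<mu>\<bar> ^ k * \<delta> ^ (k - 1) + \<sigma> ^ k * \<delta> powr (\<gamma> * k - 1)) + \<alpha>\<^sup>2 * \<delta> ^ 1) * (\<delta> / (1 - exp (- \<alpha> * \<delta>)))) \<longlongrightarrow> 0) (at_right 0)"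
    by simp
  then show ?thesis
  proof (rule tendsto_cong[THEN iffD1, rotated])
    show "\<forall>\<^sub>F \<delta> in at_right 0. (2 * \<mu>\<^sup>2 * \<delta> ^ 1 + K * (\<bar>\<mu>\<bar> ^ 3 * \<delta> ^ 2 + \<sigma> ^ 3 * \<delta> powr (2 * \<gamma>\<^sup>2)
     + \<bar>\<mu>\<bar> ^ k * \<delta> ^ (k - 1) + \<sigma> ^ k * \<delta> powr (\<gamma> * k - 1)) + \<alpha>\<^sup>2 * \<delta> ^ 1) * (\<delta> / (1 - exp (- \<alpha> * \<delta>)))
       = em_rate K \<gamma> k \<delta> / (1 - exp (- \<alpha> * \<delta>))"
      using eventually_at_right_less[of "0::real"]
    proof eventually_elim
      case (elim \<delta>)
      have "\<delta> ^ k = \<delta> ^ (k - 1) * \<delta>" using k by (cases k) auto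
      moreover have "\<delta> powr (1 + 2 * \<gamma>\<^sup>2) = \<delta> powr (2 * \<gamma>\<^sup>2) * \<delta>" using elim by (simp add: powr_add)
      moreover have "\<delta> powr (\<gamma> * k) = \<delta> powr (\<gamma> * k - 1) * \<delta>" using elim by (simp add: powr_diff)
      ultimately have "(2 * \<mu>\<^sup>2 * \<delta> ^ 1 + K * (\<bar>\<mu>\<bar> ^ 3 * \<delta> ^ 2 + \<sigma> ^ 3 * \<delta> powr (2 * \<gamma>\<^sup>2)
     + \<bar>\<mu>\<bar> ^ k * \<delta> ^ (k - 1) + \<sigma> ^ k * \<delta> powr (\<gamma> * k - 1)) + \<alpha>\<^sup>2 * \<delta> ^ 1) * \<delta> = em_rate K \<gamma> k \<delta>"
        unfolding em_rate_def
        by (simp add: power_mult_distrib power2_eq_square power3_eq_cube algebra_simps)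
      then show ?case by simp
    qed
  qed
qed

end

context cev_laplace begin

text \<open>
  The four terms are: the overshoot of the hitting time within one step, the value of \<open>\<phi>\<close> at
  the target level instead of 1, the truncation after finitely many steps, and the accumulated
  one-step errors.
\<close>

lemma em_discount_error:
  fixes N :: "'b measure" and C :: real and k n :: nat
  defines "K \<equiv> error_constant k C"
  assumes C: "Taylor_constant (1 - \<gamma>) k C"
    and N: "prob_space N" and ind: "prob_space.indep_vars N (\<lambda>_. borel) \<xi> {1..}"
    and d: "\<And>j. j \<ge> 1 \<Longrightarrow> distributed N lborel (\<xi> j) std_normal_density"
    and \<delta>: "\<delta> > 0" and \<beta>: "\<beta> > 0" and x: "\<delta> powr \<beta> < x"
    and \<gamma>: "\<gamma> = 1 / 2 - \<beta> * (1 - p)" "0 < \<gamma>"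
  defines "T \<equiv> \<lambda>\<omega>. hitting_time (\<delta> powr \<beta>) (em_path \<mu> \<sigma> p x \<delta> (\<lambda>j. \<xi> j \<omega>))"
  shows "\<bar>(\<integral>\<omega>. discount \<alpha> (T \<omega>) \<partial>N) - \<phi> x\<bar>
     \<le> (exp (\<alpha> * \<delta>) - 1) + (1 - \<phi> (\<delta> powr \<beta>)) + exp (- \<alpha> * \<delta> * real n) + em_rate K \<gamma> k \<delta> / (1 - exp (- \<alpha> * \<delta>))"
proof -
  interpret N: prob_space N by fact
  define l where "l = \<delta> powr \<beta>"
  have l: "l > 0" "l < x" using \<delta> x by (auto simp: l_def)
  define Z where "Z = (\<lambda>i \<omega>. em_grid \<mu> \<sigma> p x \<delta> (\<lambda>j. \<xi> j \<omega>) i)"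
  define G where "G = noise_algebra N \<xi>"
  define A where "A = (\<lambda>i. {\<omega> \<in> space N. \<forall>j\<le>i. Z j \<omega> > l})"
  define m where "m = Suc n"
  define stop where "stop = (\<lambda>\<omega>. LEAST i. i = m \<or> \<omega> \<notin> A i)"
  have rv: "\<xi> j \<in> borel_measurable N" if "j \<ge> 1" for j
    using ind that by (auto simp: N.indep_vars_def)
  have ZG: "Z j \<in> borel_measurable (G i)" if "j \<le> i" for i j
    unfolding Z_def G_def using that by (intro em_grid_measurable N.noise_algebra(2)[OF ind]) auto
  have spG: "space (G i) = space N" for i
    using N.noise_algebra(1)[OF ind, of i] by (simp add: subalgebra_def G_def)
  have AG: "A i \<in> sets (G i)" for i
  proof -
    have [measurable]: "j \<in> {..i} \<Longrightarrow> Z j \<in> borel_measurable (G i)" for j using ZG by auto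
    have "A i = {\<omega> \<in> space (G i). \<forall>j\<in>{..i}. Z j \<omega> > l}" by (auto simp: A_def spG)
    also have "\<dots> \<in> sets (G i)" by measurable
    finally show ?thesis .
  qed
  have T_meas: "T \<in> borel_measurable N"
    unfolding T_def by (rule em_hitting_time_measurable[OF \<delta> rv])
  define D where "D = max (l powr (- r)) (max \<bar>\<mu>\<bar> (\<sigma> * l powr (p - 1)))"
  have bdd: "Z i \<omega> > 0 \<and> Z i \<omega> powr (- r) \<le> D \<and> \<bar>\<mu>\<bar> \<le> D \<and> \<bar>\<sigma> * Z i \<omega> powr (p - 1)\<bar> \<le> D"
    if "\<omega> \<in> A i" for i \<omega>
  proof -
    have Zl: "Z i \<omega> > l" using that by (auto simp: A_def)
    have "Z i \<omega> powr (- r) \<le> l powr (- r)" "Z i \<omega> powr (p - 1) \<le> l powr (p - 1)"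
      using Zl l r p by (intro powr_mono2'; simp)+
    then show ?thesis using Zl l \<sigma> by (auto simp: D_def abs_mult le_max_iff_disj)
  qed
  have step: "Z (Suc i) \<omega> = Z i \<omega> + Z i \<omega> * (\<mu> * \<delta> + \<sigma> * Z i \<omega> powr (p - 1) * sqrt \<delta> * \<xi> (Suc i) \<omega>)"
    if "\<omega> \<in> A i" for i \<omega>
  proof -
    have Zl: "Z i \<omega> > 0" using bdd[OF that] by simp
    then have "Z i \<omega> powr p = Z i \<omega> * Z i \<omega> powr (p - 1)" by (simp add: powr_diff)
    then show ?thesis using Zl by (simp add: Z_def algebra_simps)
  qed
  have Kn: "K \<ge> 0" unfolding K_def using C by (intro error_constant_nonneg) (simp add: Taylor_constant_def)
  have G_sub: "subalgebra N (G i)"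
    and G_ind: "N.indep_set (sets (G i)) (sets (vimage_algebra (space N) (\<xi> (Suc i)) borel))" for i
    using N.noise_algebra[OF ind, of i] by (auto simp: G_def)
  have noise: "distributed N lborel (\<xi> (Suc i)) std_normal_density" for i by (rule d) simp
  have HG: "(\<lambda>\<omega>. \<sigma> * Z i \<omega> powr (p - 1)) \<in> borel_measurable (G i)" for i
    using ZG[of i i] by measurable
  have decr: "i \<le> j \<Longrightarrow> A j \<subseteq> A i" for i j by (auto simp: A_def)
  have Z0: "Z 0 \<omega> = x" for \<omega> by (simp add: Z_def)
  have Dyn: "\<bar>(\<integral>\<omega>. exp (- \<alpha> * \<delta> * real (stop \<omega>)) * \<phi> (Z (stop \<omega>) \<omega>) \<partial>N) - \<phi> x\<bar>
     \<le> (\<Sum>i<m. exp (- \<alpha> * \<delta> * real i) *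
          (\<integral>\<omega>. indicator (A i) \<omega> * step_error K (1 - \<gamma>) k \<delta> (Z i \<omega>) \<mu> (\<sigma> * Z i \<omega> powr (p - 1)) \<partial>N))"
    and Y_int: "integrable N (\<lambda>\<omega>. exp (- \<alpha> * \<delta> * real (stop \<omega>)) * \<phi> (Z (stop \<omega>) \<omega>))"
    unfolding K_def stop_def
    by (rule discounted_Dynkin[OF C N, where \<xi> = "\<lambda>i. \<xi> (Suc i)" and G = G and D = D and A = A and Z = Z
          and B = "\<lambda>i \<omega>. \<mu>" and H = "\<lambda>i \<omega>. \<sigma> * Z i \<omega> powr (p - 1)" and n = m and \<Delta> = \<delta> and x = x];
        (rule G_sub G_ind noise AG ZG[OF order_refl] borel_measurable_const HG bdd \<delta> decr Z0 step | assumption)+)+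
  have rate_sum: "(\<Sum>i<m. exp (- \<alpha> * \<delta> * real i) *
          (\<integral>\<omega>. indicator (A i) \<omega> * step_error K (1 - \<gamma>) k \<delta> (Z i \<omega>) \<mu> (\<sigma> * Z i \<omega> powr (p - 1)) \<partial>N))
     \<le> em_rate K \<gamma> k \<delta> / (1 - exp (- \<alpha> * \<delta>))"
  proof -
    have rate_nn: "0 \<le> em_rate K \<gamma> k \<delta>" unfolding em_rate_def using Kn \<delta> \<sigma> by auto
    have one: "(\<integral>\<omega>. indicator (A i) \<omega> * step_error K (1 - \<gamma>) k \<delta> (Z i \<omega>) \<mu> (\<sigma> * Z i \<omega> powr (p - 1)) \<partial>N)
        \<le> em_rate K \<gamma> k \<delta>" for i
    proof -
      have "(\<integral>\<omega>. indicator (A i) \<omega> * step_error K (1 - \<gamma>) k \<delta> (Z i \<omega>) \<mu> (\<sigma> * Z i \<omega> powr (p - 1)) \<partial>N)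
          \<le> (\<integral>\<omega>. em_rate K \<gamma> k \<delta> \<partial>N)"
      proof (rule integral_mono')
        fix \<omega>
        show "indicator (A i) \<omega> * step_error K (1 - \<gamma>) k \<delta> (Z i \<omega>) \<mu> (\<sigma> * Z i \<omega> powr (p - 1)) \<le> em_rate K \<gamma> k \<delta>"
        proof (cases "\<omega> \<in> A i")
          case True
          then have "Z i \<omega> > \<delta> powr \<beta>" by (auto simp: A_def l_def)
          from step_error_em[OF \<delta> this \<beta> Kn \<gamma>] show ?thesis using True by simp
        qed (use rate_nn in simp)
      qed (use rate_nn in auto)
      then show ?thesis by (simp add: N.prob_space)
    qed
    have ex: "exp (- \<alpha> * \<delta>) < 1" using \<alpha>_pos \<delta> by simp
    have "(\<Sum>i<m. exp (- \<alpha> * \<delta> * real i) *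
          (\<integral>\<omega>. indicator (A i) \<omega> * step_error K (1 - \<gamma>) k \<delta> (Z i \<omega>) \<mu> (\<sigma> * Z i \<omega> powr (p - 1)) \<partial>N))
       \<le> (\<Sum>i<m. exp (- \<alpha> * \<delta>) ^ i * em_rate K \<gamma> k \<delta>)"
    proof (intro sum_mono)
      fix i
      have "exp (- \<alpha> * \<delta>) ^ i = exp (- \<alpha> * \<delta> * real i)"
        by (simp add: exp_of_nat_mult[symmetric] mult_ac)
      then show "exp (- \<alpha> * \<delta> * real i) *
          (\<integral>\<omega>. indicator (A i) \<omega> * step_error K (1 - \<gamma>) k \<delta> (Z i \<omega>) \<mu> (\<sigma> * Z i \<omega> powr (p - 1)) \<partial>N)
        \<le> exp (- \<alpha> * \<delta>) ^ i * em_rate K \<gamma> k \<delta>"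
        using one[of i] by (simp only: mult_left_mono exp_ge_zero)
    qed
    also have "\<dots> = em_rate K \<gamma> k \<delta> * (\<Sum>i<m. exp (- \<alpha> * \<delta>) ^ i)"
      by (simp add: sum_distrib_left mult.commute)
    also have "\<dots> \<le> em_rate K \<gamma> k \<delta> * (1 / (1 - exp (- \<alpha> * \<delta>)))"
    proof (intro mult_left_mono rate_nn)
      have "(\<Sum>i<m. exp (- \<alpha> * \<delta>) ^ i) \<le> (\<Sum>i. exp (- \<alpha> * \<delta>) ^ i)"
        using ex by (intro sum_le_suminf summable_geometric) auto
      then show "(\<Sum>i<m. exp (- \<alpha> * \<delta>) ^ i) \<le> 1 / (1 - exp (- \<alpha> * \<delta>))"
        using ex by (simp add: suminf_geometric)
    qed
    finally show ?thesis by simp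
  qed
  have close: "\<bar>discount \<alpha> (T \<omega>) - exp (- \<alpha> * \<delta> * real (stop \<omega>)) * \<phi> (Z (stop \<omega>) \<omega>)\<bar>
      \<le> (exp (\<alpha> * \<delta>) - 1) + (1 - \<phi> l) + exp (- \<alpha> * \<delta> * real n)" if \<omega>: "\<omega> \<in> space N" for \<omega>
  proof -
    define j where "j = stop \<omega>"
    have j_le: "j \<le> m" unfolding j_def stop_def by (rule Least_le) simp
    have j: "j = m \<or> \<omega> \<notin> A j" unfolding j_def stop_def by (rule LeastI[of _ m]) simp
    have before: "i < j \<Longrightarrow> \<omega> \<in> A i" for i
      unfolding j_def stop_def using not_less_Least[of i "\<lambda>i. i = m \<or> \<omega> \<notin> A i"] by blast
    (* m = Suc n and x > l rule out stopping at once, so there is a last index i above the level. *)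
    have j0: "j > 0"
    proof (rule ccontr)
      assume "\<not> j > 0"
      then have "\<omega> \<notin> A 0" using j by (simp add: m_def)
      then show False using \<omega> l by (auto simp: A_def Z_def)
    qed
    define i where "i = j - 1"
    have ji: "j = Suc i" using j0 by (simp add: i_def)
    have above: "Z h \<omega> > l" if "h \<le> i" for h using before[of i] that ji by (auto simp: A_def)
    have pos: "1 - \<phi> l \<ge> 0" "exp (\<alpha> * \<delta>) - 1 \<ge> 0" using \<phi>_le_1[of l] \<alpha>_pos \<delta> by auto
    have ge: "ennreal (real i * \<delta>) \<le> T \<omega>"
      unfolding T_def l_def[symmetric] using above \<delta> by (intro em_hitting_time_ge) (auto simp: Z_def)
    have T_up: "discount \<alpha> (T \<omega>) \<le> exp (- \<alpha> * (real i * \<delta>))"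
      using discount_antimono[OF _ ge, of \<alpha>] \<alpha>_pos \<delta> by (simp add: discount_ennreal)
    have phi: "0 \<le> \<phi> (Z j \<omega>)" "\<phi> (Z j \<omega>) \<le> 1" by (auto simp: \<phi>_nonneg \<phi>_le_1)
    have exp_i: "exp (- \<alpha> * (real i * \<delta>)) = exp (- \<alpha> * \<delta> * real j) * exp (\<alpha> * \<delta>)"
      unfolding exp_add[symmetric] ji by (simp add: algebra_simps)
    have exp_j: "exp (- \<alpha> * \<delta> * real j) \<le> 1" using \<alpha>_pos \<delta> by (simp add: mult_nonneg_nonneg)
    define y where "y = exp (- \<alpha> * \<delta> * real j)"
    have y: "0 < y" "y \<le> 1" using exp_j by (auto simp: y_def)
    show ?thesis
    proof (cases "\<omega> \<in> A j")
      case False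
      then have "\<exists>h\<le>j. Z h \<omega> \<le> l" using \<omega> by (auto simp: A_def not_less)
      then have Zj: "Z j \<omega> \<le> l" using above ji by (metis le_SucE not_less)
      then have "T \<omega> \<le> ennreal (real j * \<delta>)"
        unfolding T_def l_def[symmetric] using l \<delta> by (intro em_hitting_time_le) (auto simp: Z_def)
      from discount_antimono[OF _ this, of \<alpha>] have T_low: "y \<le> discount \<alpha> (T \<omega>)"
        using \<alpha>_pos \<delta> by (simp add: discount_ennreal y_def mult_ac)
      have up: "discount \<alpha> (T \<omega>) \<le> y * exp (\<alpha> * \<delta>)" using T_up unfolding exp_i y_def .
      have "y * (exp (\<alpha> * \<delta>) - 1) \<le> 1 * (exp (\<alpha> * \<delta>) - 1)"
        using y pos by (intro mult_right_mono) auto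
      then have d1: "discount \<alpha> (T \<omega>) - y \<le> exp (\<alpha> * \<delta>) - 1" using up by (simp add: algebra_simps)
      have "\<phi> l \<le> \<phi> (Z j \<omega>)" using Zj by (rule \<phi>_antimono)
      then have "y * (1 - \<phi> (Z j \<omega>)) \<le> 1 * (1 - \<phi> l)" using y phi by (intro mult_mono) auto
      moreover have "0 \<le> y * (1 - \<phi> (Z j \<omega>))" using y phi by simp
      ultimately have "0 \<le> y - y * \<phi> (Z j \<omega>)" "y - y * \<phi> (Z j \<omega>) \<le> 1 - \<phi> l" by (auto simp: algebra_simps)
      then have "\<bar>discount \<alpha> (T \<omega>) - y * \<phi> (Z j \<omega>)\<bar> \<le> (exp (\<alpha> * \<delta>) - 1) + (1 - \<phi> l)"
        using d1 T_low by linarith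
      then show ?thesis unfolding j_def y_def using exp_ge_zero[of "- \<alpha> * \<delta> * real n"] by linarith
    next
      case True
      then have "i = n" using j ji by (simp add: m_def)
      then have "discount \<alpha> (T \<omega>) \<le> exp (- \<alpha> * \<delta> * real n)" using T_up by (simp add: mult_ac)
      moreover have "y * \<phi> (Z j \<omega>) \<le> exp (- \<alpha> * \<delta> * real n)"
      proof -
        have "y * \<phi> (Z j \<omega>) \<le> y * 1" using y phi by (intro mult_left_mono) auto
        also have "y \<le> exp (- \<alpha> * \<delta> * real n)"
          using \<alpha>_pos \<delta> ji \<open>i = n\<close> by (simp add: y_def)
        finally show ?thesis by simp
      qed
      moreover have "0 \<le> discount \<alpha> (T \<omega>)" "0 \<le> y * \<phi> (Z j \<omega>)"
        using y phi by (auto simp: discount_nonneg)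
      ultimately have "\<bar>discount \<alpha> (T \<omega>) - y * \<phi> (Z j \<omega>)\<bar> \<le> exp (- \<alpha> * \<delta> * real n)" by linarith
      then show ?thesis unfolding j_def y_def using pos by linarith
    qed
  qed
  have T_int: "integrable N (\<lambda>\<omega>. discount \<alpha> (T \<omega>))"
    using T_meas \<alpha>_pos by (intro N.integrable_const_bound[where B = 1]) (auto simp: discount_nonneg discount_le_1)
  have "\<bar>(\<integral>\<omega>. discount \<alpha> (T \<omega>) \<partial>N) - (\<integral>\<omega>. exp (- \<alpha> * \<delta> * real (stop \<omega>)) * \<phi> (Z (stop \<omega>) \<omega>) \<partial>N)\<bar>
      \<le> (exp (\<alpha> * \<delta>) - 1) + (1 - \<phi> l) + exp (- \<alpha> * \<delta> * real n)"
  proof -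
    have "\<bar>\<integral>\<omega>. discount \<alpha> (T \<omega>) - exp (- \<alpha> * \<delta> * real (stop \<omega>)) * \<phi> (Z (stop \<omega>) \<omega>) \<partial>N\<bar>
       \<le> (\<integral>\<omega>. (exp (\<alpha> * \<delta>) - 1) + (1 - \<phi> l) + exp (- \<alpha> * \<delta> * real n) \<partial>N)"
    proof (rule integral_abs_bound[THEN order_trans], rule integral_mono)
      show "integrable N (\<lambda>\<omega>. \<bar>discount \<alpha> (T \<omega>) - exp (- \<alpha> * \<delta> * real (stop \<omega>)) * \<phi> (Z (stop \<omega>) \<omega>)\<bar>)"
        by (intro integrable_abs Bochner_Integration.integrable_diff T_int Y_int)
    qed (simp_all only: close N.integrable_const)
    then show ?thesis using T_int Y_int by (simp add: N.prob_space)
  qed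
  then show "\<bar>(\<integral>\<omega>. discount \<alpha> (T \<omega>) \<partial>N) - \<phi> x\<bar>
     \<le> (exp (\<alpha> * \<delta>) - 1) + (1 - \<phi> (\<delta> powr \<beta>)) + exp (- \<alpha> * \<delta> * real n) + em_rate K \<gamma> k \<delta> / (1 - exp (- \<alpha> * \<delta>))"
    using order_trans[OF Dyn rate_sum] by (simp add: l_def)
qed

lemma em_discount_limit:
  assumes N: "prob_space N" and ind: "prob_space.indep_vars N (\<lambda>_. borel) \<xi> {1..}"
    and d: "\<And>j. j \<ge> 1 \<Longrightarrow> distributed N lborel (\<xi> j) std_normal_density"
    and x: "x > 0" and \<beta>: "0 < \<beta>" "\<beta> < (1 / 2) / (1 - p)"
  shows "((\<lambda>\<delta>. \<integral>\<omega>. discount \<alpha> (hitting_time (\<delta> powr \<beta>) (em_path \<mu> \<sigma> p x \<delta> (\<lambda>j. \<xi> j \<omega>))) \<partial>N)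
     \<longlongrightarrow> \<phi> x) (at_right 0)"
proof -
  define \<gamma> where "\<gamma> = 1 / 2 - \<beta> * (1 - p)"
  have "\<beta> * (1 - p) < 1 / 2" using \<beta>(2) p by (subst (asm) pos_less_divide_eq) auto
  moreover have "0 < \<beta> * (1 - p)" using \<beta>(1) p by simp
  ultimately have \<gamma>: "0 < \<gamma>" "\<gamma> < 1" by (auto simp: \<gamma>_def)
  (* The error for increments of the order of x is delta powr (gamma * k), which has to be o(delta). *)
  obtain k0 :: nat where k0: "2 / \<gamma> < real k0" using reals_Archimedean2 by blast
  define k where "k = k0 + 2"
  have k: "k \<ge> 2" "\<gamma> * real k > 1"
  proof -
    have "2 < \<gamma> * real k0" using k0 \<gamma> by (simp add: field_simps)
    then show "\<gamma> * real k > 1" using \<gamma> by (simp add: k_def algebra_simps)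
  qed (simp add: k_def)
  obtain C where C: "Taylor_constant (1 - \<gamma>) k C"
    using \<phi>_Taylor[of "1 - \<gamma>" k] \<gamma> k by auto
  define K where "K = error_constant k C"
  define E where "E = (\<lambda>\<delta>. (exp (\<alpha> * \<delta>) - 1) + (1 - \<phi> (\<delta> powr \<beta>)) + em_rate K \<gamma> k \<delta> / (1 - exp (- \<alpha> * \<delta>)))"
  have level: "((\<lambda>\<delta>. \<delta> powr \<beta>) \<longlongrightarrow> 0) (at_right 0)" using \<beta>(1) by real_asymp
  have E_lim: "(E \<longlongrightarrow> 0) (at_right 0)"
  proof -
    have 1: "((\<lambda>\<delta>. exp (\<alpha> * \<delta>) - 1) \<longlongrightarrow> 0) (at_right 0)" by real_asymp
    obtain c where c: "c \<ge> 0" "\<And>x. x > 0 \<Longrightarrow> 1 - \<phi> x \<le> c * x powr (r / 2)" using \<phi>_near_0 by auto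
    have "((\<lambda>\<delta>. \<delta> powr (\<beta> * (r / 2))) \<longlongrightarrow> 0) (at_right 0)"
    proof -
      have "\<beta> * (r / 2) > 0" using \<beta> r by simp
      then show ?thesis by real_asymp
    qed
    from tendsto_mult[OF tendsto_const this, of c]
    have up: "((\<lambda>\<delta>. c * \<delta> powr (\<beta> * (r / 2))) \<longlongrightarrow> 0) (at_right 0)" by simp
    have 2: "((\<lambda>\<delta>. 1 - \<phi> (\<delta> powr \<beta>)) \<longlongrightarrow> 0) (at_right 0)"
    proof (rule tendsto_sandwich[OF _ _ tendsto_const up])
      show "\<forall>\<^sub>F \<delta> in at_right 0. 0 \<le> 1 - \<phi> (\<delta> powr \<beta>)" by (simp add: \<phi>_le_1)
      show "\<forall>\<^sub>F \<delta> in at_right 0. 1 - \<phi> (\<delta> powr \<beta>) \<le> c * \<delta> powr (\<beta> * (r / 2))"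
        using eventually_at_right_less[of "0::real"]
      proof eventually_elim
        case (elim \<delta>)
        then show ?case using c(2)[of "\<delta> powr \<beta>"] by (simp add: powr_powr)
      qed
    qed
    from tendsto_add[OF tendsto_add[OF 1 2] em_rate_small[OF \<gamma>(1) k, of K]]
    show ?thesis by (simp add: E_def)
  qed
  have "\<forall>\<^sub>F \<delta> in at_right 0. \<delta> powr \<beta> < x" using level x by (rule order_tendstoD(2))
  then have bound: "\<forall>\<^sub>F \<delta> in at_right 0.
      \<bar>(\<integral>\<omega>. discount \<alpha> (hitting_time (\<delta> powr \<beta>) (em_path \<mu> \<sigma> p x \<delta> (\<lambda>j. \<xi> j \<omega>))) \<partial>N) - \<phi> x\<bar> \<le> E \<delta>"
    using eventually_at_right_less[of "0::real"]
  proof eventually_elim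
    case (elim \<delta>)
    let ?L = "\<bar>(\<integral>\<omega>. discount \<alpha> (hitting_time (\<delta> powr \<beta>) (em_path \<mu> \<sigma> p x \<delta> (\<lambda>j. \<xi> j \<omega>))) \<partial>N) - \<phi> x\<bar>"
    have le: "?L \<le> E \<delta> + exp (- \<alpha> * \<delta> * real n)" for n
      using em_discount_error[OF C N ind d elim(2) \<beta>(1) elim(1) \<gamma>_def \<gamma>(1), of n]
      by (simp add: E_def K_def)
    have "(\<lambda>n. exp (- \<alpha> * \<delta> * real n)) \<longlonglongrightarrow> 0"
      using \<alpha>_pos elim(2) by real_asymp
    from tendsto_add[OF tendsto_const this, of "E \<delta>"]
    have "(\<lambda>n. E \<delta> + exp (- \<alpha> * \<delta> * real n)) \<longlonglongrightarrow> E \<delta>" by simp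
    then show ?case by (rule LIMSEQ_le_const) (use le in auto)
  qed
  have "((\<lambda>\<delta>. (\<integral>\<omega>. discount \<alpha> (hitting_time (\<delta> powr \<beta>) (em_path \<mu> \<sigma> p x \<delta> (\<lambda>j. \<xi> j \<omega>))) \<partial>N) - \<phi> x) \<longlongrightarrow> 0) (at_right 0)"
    by (rule tendsto_rabs_zero_cancel, rule tendsto_sandwich[OF _ bound tendsto_const E_lim]) auto
  then show ?thesis by (simp add: LIM_zero_iff)
qed

end

section \<open>Riemann sums\<close>

definition grid_floor :: "real \<Rightarrow> nat \<Rightarrow> real \<Rightarrow> real" where
  "grid_floor T m t = real (nat \<lfloor>t * m / T\<rfloor>) * (T / m)"

lemma grid_floor_bounds:
  assumes T: "T > 0" and m: "m > 0" and t: "0 \<le> t"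
  shows "grid_floor T m t \<le> t" "t < grid_floor T m t + T / m" "0 \<le> grid_floor T m t"
proof -
  define i where "i = nat \<lfloor>t * m / T\<rfloor>"
  have "0 \<le> t * m / T" using T t by simp
  then have i: "real i \<le> t * m / T" "t * m / T < real i + 1" by (auto simp: i_def)
  have "real i * (T / m) \<le> t" "t < real i * (T / m) + T / m"
    using i T m by (auto simp: field_simps)
  then show "grid_floor T m t \<le> t" "t < grid_floor T m t + T / m" by (auto simp: grid_floor_def i_def)
  show "0 \<le> grid_floor T m t" using T by (simp add: grid_floor_def)
qed

lemma grid_floor_tendsto:
  assumes T: "T > 0" and t: "0 \<le> t"
  shows "(\<lambda>m. grid_floor T (Suc m) t) \<longlonglongrightarrow> t"
proof (rule tendsto_sandwich)
  show "\<forall>\<^sub>F m in sequentially. t - T / real (Suc m) \<le> grid_floor T (Suc m) t"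
    using grid_floor_bounds[OF T _ t] by (intro always_eventually allI) (smt (verit) zero_less_Suc)
  show "\<forall>\<^sub>F m in sequentially. grid_floor T (Suc m) t \<le> t"
    using grid_floor_bounds[OF T _ t] by (intro always_eventually allI) auto
  have "(\<lambda>m. t - T * (1 / real (Suc m))) \<longlonglongrightarrow> t - T * 0"
    by (intro tendsto_intros LIMSEQ_Suc[OF lim_1_over_n])
  then show "(\<lambda>m. t - T / real (Suc m)) \<longlonglongrightarrow> t" by simp
qed simp

lemma grid_step_eq:
  fixes g :: "real \<Rightarrow> real"
  assumes T: "T > 0" and m: "m > 0"
  shows "indicator {0..<T} t * g (grid_floor T m t)
    = (\<Sum>i<m. g (real i * (T / m)) * indicator {real i * (T / m)..<real (Suc i) * (T / m)} t)"
proof -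
  define d where "d = T / m"
  have d: "d > 0" "real m * d = T" using T m by (auto simp: d_def)
  show ?thesis
  proof (cases "t \<in> {0..<T}")
    case True
    define i where "i = nat \<lfloor>t * m / T\<rfloor>"
    have gf: "grid_floor T m t = real i * d" by (simp add: grid_floor_def i_def d_def)
    then have i: "real i * d \<le> t" "t < real (Suc i) * d"
      using grid_floor_bounds[OF T m, of t] True unfolding d_def[symmetric] gf by (auto simp: distrib_right)
    have "real i * d < real m * d" using i True d by auto
    then have im: "i < m" using d(1) by (simp only: mult_less_cancel_right_disj) auto
    have "indicator {real j * d..<real (Suc j) * d} t = (if j = i then 1 else (0::real))" for j
    proof (cases j i rule: linorder_cases)
      case less
      then have "real (Suc j) * d \<le> real i * d" using d by (intro mult_right_mono) auto
      then show ?thesis using i less by auto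
    next
      case greater
      then have "real (Suc i) * d \<le> real j * d" using d by (intro mult_right_mono) auto
      then show ?thesis using i greater by auto
    qed (use i in auto)
    then have "(\<Sum>j<m. g (real j * d) * indicator {real j * d..<real (Suc j) * d} t)
        = (\<Sum>j<m. if j = i then g (real i * d) else 0)" by (intro sum.cong) auto
    also have "\<dots> = g (real i * d)" using im by simp
    finally show ?thesis using True gf by (simp add: d_def)
  next
    case False
    have "indicator {real j * d..<real (Suc j) * d} t = (0::real)" if "j < m" for j
    proof -
      have "real (Suc j) * d \<le> real m * d" using that d by (intro mult_right_mono) auto
      moreover have "0 \<le> real j * d" using d by simp
      ultimately have "t \<notin> {real j * d..<real (Suc j) * d}" using False d(2) by (auto simp del: of_nat_Suc)
      then show ?thesis by simp
    qed
    then show ?thesis using False by (simp add: d_def)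
  qed
qed

lemma Riemann_sum_integral:
  fixes g :: "real \<Rightarrow> real"
  assumes T: "T > 0" and m: "m > 0"
  shows "has_bochner_integral lborel (\<lambda>t. indicator {0..<T} t * g (grid_floor T m t))
    (\<Sum>i<m. T / m * g (real i * (T / m)))"
proof -
  have cell: "has_bochner_integral lborel (\<lambda>t. c * indicator {real i * (T / m)..<real (Suc i) * (T / m)} t) (T / m * c)"
    for i c
  proof -
    have "real i * (T / m) \<le> real (Suc i) * (T / m)" using T m by (intro mult_right_mono) auto
    then have "measure lborel {real i * (T / m)..<real (Suc i) * (T / m)} = T / m"
      by (simp add: distrib_right add_divide_distrib)
    moreover have "has_bochner_integral lborel (indicator {real i * (T / m)..<real (Suc i) * (T / m)} :: real \<Rightarrow> real)
        (measure lborel {real i * (T / m)..<real (Suc i) * (T / m)})"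
    proof (rule has_bochner_integral_real_indicator)
      show "emeasure lborel {real i * (T / m)..<real (Suc i) * (T / m)} < \<infinity>"
        by (subst emeasure_lborel_Ico[OF \<open>real i * (T / m) \<le> real (Suc i) * (T / m)\<close>]) simp
    qed simp
    ultimately have "has_bochner_integral lborel (indicator {real i * (T / m)..<real (Suc i) * (T / m)} :: real \<Rightarrow> real) (T / m)"
      by (simp only:)
    from has_bochner_integral_mult_right[OF this, of c] show ?thesis by (simp only: mult.commute)
  qed
  show ?thesis unfolding grid_step_eq[OF T m] by (intro has_bochner_integral_sum cell)
qed

lemma Riemann_sums_tendsto:
  fixes g :: "real \<Rightarrow> real"
  assumes T: "T > 0" and S: "finite S"
    and cont: "\<And>t. t \<in> {0..<T} \<Longrightarrow> t \<notin> S \<Longrightarrow> continuous (at t within {0..<T}) g"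
    and bdd: "\<And>t. t \<in> {0..<T} \<Longrightarrow> \<bar>g t\<bar> \<le> c"
    and meas: "(\<lambda>t. indicator {0..<T} t * g t) \<in> borel_measurable borel"
  shows "(\<lambda>m. \<Sum>i<Suc m. T / Suc m * g (real i * (T / Suc m))) \<longlonglongrightarrow> (\<integral>t. indicator {0..<T} t * g t \<partial>lborel)"
proof -
  have "(\<lambda>m. \<integral>t. indicator {0..<T} t * g (grid_floor T (Suc m) t) \<partial>lborel)
      \<longlonglongrightarrow> (\<integral>t. indicator {0..<T} t * g t \<partial>lborel)"
  proof (rule integral_dominated_convergence[where w = "\<lambda>t. c * indicator {0..<T} t"])
    show "integrable lborel (\<lambda>t. c * indicator {0..<T} t)"
      using T by (intro integrable_mult_right integrable_real_indicator) auto
    show "AE t in lborel. (\<lambda>m. indicator {0..<T} t * g (grid_floor T (Suc m) t)) \<longlonglongrightarrow> indicator {0..<T} t * g t"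
    proof -
      have "AE t in lborel. t \<notin> S" using S by (intro AE_not_in) (simp add: finite_imp_null_set_lborel)
      then show ?thesis
      proof eventually_elim
        case (elim t)
        show ?case
        proof (cases "t \<in> {0..<T}")
          case True
          have "(g \<longlongrightarrow> g t) (at t within {0..<T})" using cont[OF True elim] by (simp add: continuous_within)
          moreover have "(\<lambda>m. grid_floor T (Suc m) t) \<longlonglongrightarrow> t" using grid_floor_tendsto[OF T] True by simp
          moreover have "grid_floor T (Suc m) t \<in> {0..<T}" for m
            using grid_floor_bounds[OF T, of "Suc m" t] True by auto
          ultimately have "(\<lambda>m. g (grid_floor T (Suc m) t)) \<longlonglongrightarrow> g t"
            by (intro continuous_within_tendsto_compose'[OF cont[OF True elim]])
          then show ?thesis using True by simp
        qed simp
      qed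
    qed
    fix m
    show "AE t in lborel. norm (indicator {0..<T} t * g (grid_floor T (Suc m) t)) \<le> c * indicator {0..<T} t"
    proof (intro AE_I2)
      fix t
      show "norm (indicator {0..<T} t * g (grid_floor T (Suc m) t)) \<le> c * indicator {0..<T} t"
        using grid_floor_bounds[OF T, of "Suc m" t] bdd[of "grid_floor T (Suc m) t"]
        by (cases "t \<in> {0..<T}") auto
    qed
    show "(\<lambda>t. indicator {0..<T} t * g (grid_floor T (Suc m) t)) \<in> borel_measurable lborel"
      using Riemann_sum_integral[OF T, of "Suc m" g] by (auto simp: has_bochner_integral_iff)
  qed (use meas in simp)
  then show ?thesis
    using Riemann_sum_integral[OF T, of "Suc _" g] by (simp add: has_bochner_integral_iff)
qed

section \<open>Sampling an integrator on a grid\<close>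

text \<open>
  The increments whose left end lies before \<open>a\<close> telescope to the first grid point at or after \<open>a\<close>.
\<close>

lemma threshold_sum:
  fixes w :: "real \<Rightarrow> real"
  assumes h: "h > 0" and a: "a \<ge> 0"
  shows "\<exists>u. 0 \<le> u \<and> u \<le> real l * h \<and> \<bar>u - min (real l * h) a\<bar> \<le> h \<and>
    (\<Sum>i<l. of_bool (real i * h < a) * (w (real (Suc i) * h) - w (real i * h))) = w u - w 0"
proof -
  define c where "c = nat \<lceil>a / h\<rceil>"
  have ah: "a / h \<ge> 0" using a h by simp
  have less_c: "real i * h < a \<longleftrightarrow> i < c" for i
  proof -
    have "real i * h < a \<longleftrightarrow> real i < a / h" using h by (simp add: field_simps)
    also have "\<dots> \<longleftrightarrow> i < c" by (simp add: c_def less_ceiling_iff zless_nat_eq_int_zless)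
    finally show ?thesis .
  qed
  have c_bounds: "a \<le> real c * h" "real c * h < a + h"
  proof -
    have "a / h \<le> real c" "real c < a / h + 1" using ah unfolding c_def by linarith+
    then show "a \<le> real c * h" "real c * h < a + h" using h by (auto simp: field_simps)
  qed
  define u where "u = real (min l c) * h"
  have "(\<Sum>i<l. of_bool (real i * h < a) * (w (real (Suc i) * h) - w (real i * h)))
      = (\<Sum>i<l. if i < c then w (real (Suc i) * h) - w (real i * h) else 0)"
    by (intro sum.cong) (auto simp: less_c)
  also have "\<dots> = (\<Sum>i\<in>{..<l} \<inter> {i. i < c}. w (real (Suc i) * h) - w (real i * h))"
    by (subst sum.inter_restrict) auto
  also have "{..<l} \<inter> {i. i < c} = {..<min l c}" by auto
  also have "(\<Sum>i<min l c. w (real (Suc i) * h) - w (real i * h)) = w u - w 0"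
    using sum_lessThan_telescope[of "\<lambda>i. w (real i * h)" "min l c"] by (simp add: u_def)
  finally have sum: "(\<Sum>i<l. of_bool (real i * h < a) * (w (real (Suc i) * h) - w (real i * h))) = w u - w 0" .
  have "u \<le> real l * h" unfolding u_def using h by (intro mult_right_mono) auto
  moreover have "\<bar>u - min (real l * h) a\<bar> \<le> h"
  proof (cases "l \<le> c")
    case True
    then have "real l * h \<le> real c * h" using h by (intro mult_right_mono) auto
    then have "real l * h - a \<le> h" using c_bounds by linarith
    moreover have "u = real l * h" using True by (simp add: u_def min_absorb1)
    ultimately show ?thesis using h by (cases "real l * h \<le> a") (simp_all add: min_def)
  next
    case False
    then have "real c * h \<le> real l * h" using h by (intro mult_right_mono) auto
    then show ?thesis using False c_bounds h by (auto simp: u_def min_def)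
  qed
  moreover have "0 \<le> u" using h by (simp add: u_def)
  ultimately show ?thesis using sum by blast
qed

text \<open>
  The simple integrand with its intervals closed on the left instead of on the right. Its value at a grid
  point is then the factor of the increment that starts there, and it is known at that time.
\<close>

definition step_value :: "nat \<Rightarrow> (nat \<Rightarrow> real) \<Rightarrow> (nat \<Rightarrow> 'a \<Rightarrow> real) \<Rightarrow> real \<Rightarrow> 'a \<Rightarrow> real" where
  "step_value n s \<eta> t \<omega> = (\<Sum>j<n. \<eta> j \<omega> * indicator {s j..<s (Suc j)} t)"

lemma grid_sampling_error:
  fixes w :: "real \<Rightarrow> real"
  assumes h: "h > 0" and s: "0 \<le> s 0" "\<And>j. j < n \<Longrightarrow> s j \<le> s (Suc j)"
    and mod: "\<And>u v. 0 \<le> u \<Longrightarrow> u \<le> real l * h \<Longrightarrow> 0 \<le> v \<Longrightarrow> v \<le> real l * h \<Longrightarrow> \<bar>u - v\<bar> \<le> h \<Longrightarrow> \<bar>w u - w v\<bar> \<le> e"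
  shows "\<bar>(\<Sum>i<l. step_value n s \<eta> (real i * h) \<omega> * (w (real (Suc i) * h) - w (real i * h)))
     - (\<Sum>j<n. \<eta> j \<omega> * (w (min (real l * h) (s (Suc j))) - w (min (real l * h) (s j))))\<bar>
     \<le> (\<Sum>j<n. \<bar>\<eta> j \<omega>\<bar>) * (2 * e)"
proof -
  have s_nn: "j \<le> n \<Longrightarrow> 0 \<le> s j" for j
    by (induction j) (use s in \<open>auto intro: order_trans\<close>)
  define S where "S = (\<lambda>a. \<Sum>i<l. of_bool (real i * h < a) * (w (real (Suc i) * h) - w (real i * h)))"
  have S_close: "\<bar>S a - (w (min (real l * h) a) - w 0)\<bar> \<le> e" if a: "a \<ge> 0" for a
  proof -
    obtain u where u: "0 \<le> u" "u \<le> real l * h" "\<bar>u - min (real l * h) a\<bar> \<le> h" "S a = w u - w 0"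
      using threshold_sum[OF h a, where l = l and w = w] unfolding S_def by blast
    have "\<bar>w u - w (min (real l * h) a)\<bar> \<le> e"
      using u a h by (intro mod) auto
    then show ?thesis using u by simp
  qed
  have one: "(\<Sum>i<l. indicator {s j..<s (Suc j)} (real i * h) * (w (real (Suc i) * h) - w (real i * h)))
      = S (s (Suc j)) - S (s j)" if "j < n" for j
  proof -
    have "indicator {s j..<s (Suc j)} t = of_bool (t < s (Suc j)) - (of_bool (t < s j) :: real)" for t
      using s(2)[OF that] by (auto simp: indicator_def)
    then show ?thesis unfolding S_def by (simp add: left_diff_distrib sum_subtractf)
  qed
  have "(\<Sum>i<l. step_value n s \<eta> (real i * h) \<omega> * (w (real (Suc i) * h) - w (real i * h)))
      = (\<Sum>i<l. \<Sum>j<n. \<eta> j \<omega> * (indicator {s j..<s (Suc j)} (real i * h) * (w (real (Suc i) * h) - w (real i * h))))"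
    by (simp only: step_value_def sum_distrib_right mult.assoc)
  also have "\<dots> = (\<Sum>j<n. \<Sum>i<l. \<eta> j \<omega> * (indicator {s j..<s (Suc j)} (real i * h) * (w (real (Suc i) * h) - w (real i * h))))"
    by (rule sum.swap)
  also have "\<dots> = (\<Sum>j<n. \<eta> j \<omega> * (S (s (Suc j)) - S (s j)))"
    by (intro sum.cong refl) (simp only: sum_distrib_left[symmetric] one lessThan_iff)
  finally have "(\<Sum>i<l. step_value n s \<eta> (real i * h) \<omega> * (w (real (Suc i) * h) - w (real i * h)))
     - (\<Sum>j<n. \<eta> j \<omega> * (w (min (real l * h) (s (Suc j))) - w (min (real l * h) (s j))))
     = (\<Sum>j<n. \<eta> j \<omega> * ((S (s (Suc j)) - S (s j)) - (w (min (real l * h) (s (Suc j))) - w (min (real l * h) (s j)))))"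
    by (simp add: sum_subtractf right_diff_distrib)
  also have "\<bar>\<dots>\<bar> \<le> (\<Sum>j<n. \<bar>\<eta> j \<omega>\<bar> * (2 * e))"
  proof (rule sum_abs[THEN order_trans], intro sum_mono)
    fix j assume "j \<in> {..<n}"
    then have "0 \<le> s j" "0 \<le> s (Suc j)" using s_nn by auto
    from S_close[OF this(1)] S_close[OF this(2)]
    have "\<bar>(S (s (Suc j)) - S (s j)) - (w (min (real l * h) (s (Suc j))) - w (min (real l * h) (s j)))\<bar> \<le> 2 * e"
      by linarith
    then show "\<bar>\<eta> j \<omega> * ((S (s (Suc j)) - S (s j)) - (w (min (real l * h) (s (Suc j))) - w (min (real l * h) (s j))))\<bar>
        \<le> \<bar>\<eta> j \<omega>\<bar> * (2 * e)" unfolding abs_mult by (rule mult_left_mono) simp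
  qed
  finally show ?thesis by (simp add: sum_distrib_right)
qed

section \<open>Ito integrals as sums over a grid\<close>

lemma (in prob_space) prob_eventually_good:
  assumes meas: "\<And>m. Bad m \<in> events"
    and good: "\<And>\<omega>. \<omega> \<in> space M \<Longrightarrow> \<forall>\<^sub>F m in sequentially. \<omega> \<notin> Bad m"
  shows "(\<lambda>m::nat. prob (Bad m)) \<longlonglongrightarrow> 0"
proof -
  have "(\<lambda>m. \<integral>\<omega>. indicator (Bad m) \<omega> \<partial>M) \<longlonglongrightarrow> (\<integral>\<omega>. (0::real) \<partial>M)"
  proof (rule integral_dominated_convergence[where w = "\<lambda>_. 1"])
    show "AE \<omega> in M. (\<lambda>m. indicator (Bad m) \<omega> :: real) \<longlonglongrightarrow> 0"
    proof (intro AE_I2)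
      fix \<omega> assume "\<omega> \<in> space M"
      from good[OF this] have "\<forall>\<^sub>F m in sequentially. (indicator (Bad m) \<omega> :: real) = 0"
        by eventually_elim simp
      then show "(\<lambda>m. indicator (Bad m) \<omega> :: real) \<longlonglongrightarrow> 0" by (rule tendsto_eventually)
    qed
  qed (use meas in auto)
  then show ?thesis using meas by (simp add: Int_absorb2 sets.sets_into_space)
qed

lemma isCont_indicator_Ico:
  fixes a b :: real
  assumes "t \<noteq> a" "t \<noteq> b"
  shows "isCont (indicator {a..<b} :: real \<Rightarrow> real) t"
proof -
  have "frontier {a..<b} \<subseteq> {a, b}"
    by (cases "a < b") (auto simp: frontier_def)
  then show ?thesis using assms by (subst isCont_indicator) auto
qed

lemma SUP_exceeds_iff:
  fixes h :: "real \<Rightarrow> real"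
  assumes T: "T \<ge> 0" and h: "continuous_on {0..T} h"
  shows "(SUP t\<in>{0..T}. h t) > e \<longleftrightarrow> (\<exists>q\<in>test_times T. h q > e)"
proof -
  have "bdd_above (h ` {0..T})"
    using compact_imp_bounded[OF compact_continuous_image[OF h]] by (auto intro: bounded_imp_bdd_above)
  then have "(SUP t\<in>{0..T}. h t) > e \<longleftrightarrow> (\<exists>t\<in>{0..T}. h t > e)"
    using T by (intro less_cSUP_iff) auto
  also have "\<dots> \<longleftrightarrow> (\<exists>q\<in>test_times T. h q > e)"
    using exceeds_at_test_time[OF h] test_times_subset[OF T] by blast
  finally show ?thesis .
qed

text \<open>
  On the grid of mesh \<open>T / n\<close> the integral \<open>I\<close> of \<open>H\<close> is, off a small exceptional event, the sum of an adapted
  bounded \<open>v\<close> against the increments of \<open>B\<close>, and \<open>v\<close> is close to \<open>H\<close> in mean square. The bound \<open>c\<close> of \<open>v\<close>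
  is not controlled by \<open>e\<close>; but the mesh is so fine that single noise terms are small all the same.
\<close>

definition grid_approx ::
  "'a measure \<Rightarrow> (real \<Rightarrow> 'a measure) \<Rightarrow> (real \<Rightarrow> 'a \<Rightarrow> real) \<Rightarrow> (real \<Rightarrow> 'a \<Rightarrow> real) \<Rightarrow>
   (real \<Rightarrow> 'a \<Rightarrow> real) \<Rightarrow> real \<Rightarrow> real \<Rightarrow> nat \<Rightarrow> real \<Rightarrow> (nat \<Rightarrow> 'a \<Rightarrow> real) \<Rightarrow> 'a set \<Rightarrow> bool" where
  "grid_approx M F B H I T e n c v Bad \<longleftrightarrow>
     n > 0 \<and> T / n \<le> e \<and> c * sqrt (T / n) \<le> e \<and>
     (\<forall>i. v i \<in> borel_measurable (F (real i * (T / n)))) \<and> (\<forall>i. \<forall>\<omega>\<in>space M. \<bar>v i \<omega>\<bar> \<le> c) \<and>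
     Bad \<in> sets M \<and> measure M Bad < e \<and>
     (\<forall>\<omega>\<in>space M - Bad.
        (\<forall>l\<le>n. \<bar>I (real l * (T / n)) \<omega>
           - (\<Sum>i<l. v i \<omega> * (B (real (Suc i) * (T / n)) \<omega> - B (real i * (T / n)) \<omega>))\<bar> \<le> e) \<and>
        (\<Sum>i<n. T / n * (v i \<omega> - H (real i * (T / n)) \<omega>)\<^sup>2) \<le> e)"

text \<open>
  Take a simple integrand close to \<open>H\<close>, and only then a grid so fine that sampling the integrand on it
  changes neither its integral nor its square distance to \<open>H\<close> by much. Continuity of \<open>H\<close> enters through
  the convergence of Riemann sums.
\<close>

lemma ito_grid_approximation:
  fixes M :: "'a measure"
  assumes uc: "usual_conditions M F"
    and B: "adapted F B" "continuous_paths M B" and H: "adapted F H" "continuous_paths M H"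
    and I: "is_ito_integral M F B H I" and T: "T > 0" and e: "e > 0"
  shows "\<exists>n c v Bad. grid_approx M F B H I T e n c v Bad"
proof -
  interpret prob_space M using uc by (simp add: usual_conditions_def)
  have filt: "filtration (space M) F" and FM: "sets (F t) \<subseteq> sets M" for t
    using uc by (auto simp: usual_conditions_def)
  interpret filtration "space M" F by (rule filt)
  have to_M: "f \<in> borel_measurable (F t) \<Longrightarrow> f \<in> borel_measurable M" for f :: "'a \<Rightarrow> real" and t
    using FM[of t] space_F[of t] by (auto simp: measurable_def)
  have mono_F: "f \<in> borel_measurable (F t) \<Longrightarrow> t \<le> t' \<Longrightarrow> f \<in> borel_measurable (F t')" for f :: "'a \<Rightarrow> real" and t t'
    using sets_F_mono[of t t'] space_F[of t] space_F[of t'] by (auto simp: measurable_def)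
  have B_meas: "t \<ge> 0 \<Longrightarrow> B t \<in> borel_measurable M" and H_meas: "t \<ge> 0 \<Longrightarrow> H t \<in> borel_measurable M"
    and I_meas: "t \<ge> 0 \<Longrightarrow> I t \<in> borel_measurable M" for t
    using B(1) H(1) I by (auto simp: adapted_def is_ito_integral_def intro: to_M)
  have B_cont: "continuous_on {0..} (\<lambda>t. B t \<omega>)" and H_cont: "continuous_on {0..} (\<lambda>t. H t \<omega>)"
    and I_cont: "continuous_on {0..} (\<lambda>t. I t \<omega>)" if "\<omega> \<in> space M" for \<omega>
    using B(2) H(2) I that by (auto simp: continuous_paths_def is_ito_integral_def)
  obtain ns ss \<eta>s where simple: "\<And>k. simple_integrand M F (ns k) (ss k) (\<eta>s k)"
    and conv1: "\<And>T \<epsilon>. T \<ge> 0 \<Longrightarrow> \<epsilon> > 0 \<Longrightarrow> (\<lambda>k. measure M {\<omega>\<in>space M.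
             (\<integral>\<^sup>+t\<in>{0..T}. ennreal ((H t \<omega> - simple_process (ns k) (ss k) (\<eta>s k) t \<omega>)\<^sup>2) \<partial>lborel)
               > ennreal \<epsilon>}) \<longlonglongrightarrow> 0"
    and conv2: "\<And>T \<epsilon>. T \<ge> 0 \<Longrightarrow> \<epsilon> > 0 \<Longrightarrow> (\<lambda>k. measure M {\<omega>\<in>space M.
             (SUP t\<in>{0..T}. \<bar>I t \<omega> - simple_ito_integral B (ns k) (ss k) (\<eta>s k) t \<omega>\<bar>) > \<epsilon>})
            \<longlonglongrightarrow> 0"
    using I unfolding is_ito_integral_def by blast
  have "\<forall>\<^sub>F k in sequentially. measure M {\<omega>\<in>space M.
             (\<integral>\<^sup>+t\<in>{0..T}. ennreal ((H t \<omega> - simple_process (ns k) (ss k) (\<eta>s k) t \<omega>)\<^sup>2) \<partial>lborel)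
               > ennreal (e / 2)} < e / 4"
    using conv1[of T "e / 2"] T e by (intro order_tendstoD(2)[where y = 0]) auto
  moreover have "\<forall>\<^sub>F k in sequentially. measure M {\<omega>\<in>space M.
             (SUP t\<in>{0..T}. \<bar>I t \<omega> - simple_ito_integral B (ns k) (ss k) (\<eta>s k) t \<omega>\<bar>) > e / 2} < e / 4"
    using conv2[of T "e / 2"] T e by (intro order_tendstoD(2)[where y = 0]) auto
  ultimately have "\<forall>\<^sub>F k in sequentially. measure M {\<omega>\<in>space M.
             (\<integral>\<^sup>+t\<in>{0..T}. ennreal ((H t \<omega> - simple_process (ns k) (ss k) (\<eta>s k) t \<omega>)\<^sup>2) \<partial>lborel)
               > ennreal (e / 2)} < e / 4 \<and> measure M {\<omega>\<in>space M.
             (SUP t\<in>{0..T}. \<bar>I t \<omega> - simple_ito_integral B (ns k) (ss k) (\<eta>s k) t \<omega>\<bar>) > e / 2} < e / 4"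
    by (rule eventually_conj)
  then obtain k where k1: "measure M {\<omega>\<in>space M.
             (\<integral>\<^sup>+t\<in>{0..T}. ennreal ((H t \<omega> - simple_process (ns k) (ss k) (\<eta>s k) t \<omega>)\<^sup>2) \<partial>lborel)
               > ennreal (e / 2)} < e / 4"
    and k2: "measure M {\<omega>\<in>space M.
             (SUP t\<in>{0..T}. \<bar>I t \<omega> - simple_ito_integral B (ns k) (ss k) (\<eta>s k) t \<omega>\<bar>) > e / 2} < e / 4"
    by (auto simp: eventually_sequentially)
  define n where "n = ns k"
  define s where "s = ss k"
  define \<eta> where "\<eta> = \<eta>s k"
  define S where "S = simple_ito_integral B n s \<eta>"
  define V where "V = step_value n s \<eta>"
  have s0: "0 \<le> s 0" and s_mono: "\<And>j. j < n \<Longrightarrow> s j \<le> s (Suc j)"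
    and \<eta>F: "\<And>j. j < n \<Longrightarrow> \<eta> j \<in> borel_measurable (F (s j))"
    and \<eta>_bdd: "\<And>j. j < n \<Longrightarrow> \<exists>C. \<forall>\<omega>\<in>space M. \<bar>\<eta> j \<omega>\<bar> \<le> C"
    using simple[of k] by (auto simp: simple_integrand_def n_def s_def \<eta>_def)
  have s_nn: "j \<le> n \<Longrightarrow> 0 \<le> s j" for j
    by (induction j) (use s0 s_mono in \<open>auto intro: order_trans\<close>)
  have \<eta>M: "j < n \<Longrightarrow> \<eta> j \<in> borel_measurable M" for j using \<eta>F to_M by blast
  obtain C where C: "\<And>j \<omega>. j < n \<Longrightarrow> \<omega> \<in> space M \<Longrightarrow> \<bar>\<eta> j \<omega>\<bar> \<le> C j"
    using \<eta>_bdd by metis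
  define c where "c = (\<Sum>j<n. \<bar>C j\<bar>)"
  have c: "(\<Sum>j<n. \<bar>\<eta> j \<omega>\<bar>) \<le> c" if "\<omega> \<in> space M" for \<omega>
    unfolding c_def by (intro sum_mono) (use C that in \<open>force intro: order_trans\<close>)
  have c_nn: "c \<ge> 0" by (simp add: c_def sum_nonneg)
  have V_le: "\<bar>V t \<omega>\<bar> \<le> c" if "\<omega> \<in> space M" for t \<omega>
  proof -
    have "\<bar>V t \<omega>\<bar> \<le> (\<Sum>j<n. \<bar>\<eta> j \<omega> * indicator {s j..<s (Suc j)} t\<bar>)"
      unfolding V_def step_value_def by (rule sum_abs)
    also have "\<dots> \<le> (\<Sum>j<n. \<bar>\<eta> j \<omega>\<bar>)" by (intro sum_mono) (auto simp: indicator_def)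
    finally show ?thesis using c[OF that] by simp
  qed
  have VF: "V t \<in> borel_measurable (F t)" for t
    unfolding V_def step_value_def
  proof (intro borel_measurable_sum)
    fix j assume j: "j \<in> {..<n}"
    show "(\<lambda>\<omega>. \<eta> j \<omega> * indicator {s j..<s (Suc j)} t) \<in> borel_measurable (F t)"
    proof (cases "s j \<le> t")
      case True
      then have "\<eta> j \<in> borel_measurable (F t)" using mono_F[OF \<eta>F] j by auto
      then show ?thesis by simp
    qed simp
  qed
  note VM = to_M[OF VF]
  define g where "g = (\<lambda>\<omega> t. (V t \<omega> - H t \<omega>)\<^sup>2)"
  (* The square distance between H and the simple integrand, from which its variant V differs at
     finitely many times only. *)
  define J where "J = (\<lambda>\<omega>. \<integral>t. indicator {0..<T} t * g \<omega> t \<partial>lborel)"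
  have gM: "t \<ge> 0 \<Longrightarrow> (\<lambda>\<omega>. g \<omega> t) \<in> borel_measurable M" for t
    unfolding g_def using VM H_meas by measurable
  have g_bdd: "\<exists>b. \<forall>t\<in>{0..<T}. \<bar>g \<omega> t\<bar> \<le> b" if \<omega>: "\<omega> \<in> space M" for \<omega>
  proof -
    have "continuous_on {0..T} (\<lambda>t. H t \<omega>)" using H_cont[OF \<omega>] by (rule continuous_on_subset) auto
    then have "bounded ((\<lambda>t. H t \<omega>) ` {0..T})" by (intro compact_imp_bounded compact_continuous_image) auto
    then obtain h where "\<forall>t\<in>{0..T}. \<bar>H t \<omega>\<bar> \<le> h" unfolding bounded_iff by auto
    then have h: "\<And>t. t \<in> {0..T} \<Longrightarrow> \<bar>H t \<omega>\<bar> \<le> h" by blast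
    have "\<bar>g \<omega> t\<bar> \<le> (c + h)\<^sup>2" if "t \<in> {0..<T}" for t
    proof -
      have "\<bar>V t \<omega> - H t \<omega>\<bar> \<le> c + h" using V_le[OF \<omega>, of t] h[of t] that by auto
      then show ?thesis by (simp add: g_def abs_le_square_iff[symmetric])
    qed
    then show ?thesis by blast
  qed
  have V_borel: "(\<lambda>t. V t \<omega>) \<in> borel_measurable borel" for \<omega>
    unfolding V_def step_value_def by measurable
  have g_meas: "(\<lambda>t. indicator {0..<T} t * g \<omega> t) \<in> borel_measurable borel" if \<omega>: "\<omega> \<in> space M" for \<omega>
  proof -
    have "continuous_on {0..<T} (\<lambda>t. H t \<omega>)" using H_cont[OF \<omega>] by (rule continuous_on_subset) auto
    then have [measurable]: "(\<lambda>t. indicator {0..<T} t *\<^sub>R H t \<omega>) \<in> borel_measurable borel"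
      by (intro borel_measurable_continuous_on_indicator) auto
    note V_borel[measurable]
    have eq: "(\<lambda>t. indicator {0..<T} t * g \<omega> t) = (\<lambda>t. indicator {0..<T} t * (V t \<omega> - indicator {0..<T} t *\<^sub>R H t \<omega>)\<^sup>2)"
      by (auto simp: g_def indicator_def)
    show ?thesis unfolding eq by measurable
  qed
  have g_cont: "continuous (at t within {0..<T}) (g \<omega>)" if \<omega>: "\<omega> \<in> space M" and t: "t \<in> {0..<T}" "t \<notin> s ` {..n}" for \<omega> t
  proof -
    have "isCont (\<lambda>t. V t \<omega>) t"
      unfolding V_def step_value_def
      using t by (intro continuous_sum continuous_mult continuous_const isCont_indicator_Ico) auto
    then have "continuous (at t within {0..<T}) (\<lambda>t. V t \<omega>)" by (rule continuous_at_imp_continuous_at_within)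
    moreover have "continuous (at t within {0..<T}) (\<lambda>t. H t \<omega>)"
    proof -
      have "continuous (at t within {0..}) (\<lambda>t. H t \<omega>)"
        using H_cont[OF \<omega>] t by (auto simp: continuous_on_eq_continuous_within)
      then show ?thesis by (rule continuous_within_subset) auto
    qed
    ultimately show ?thesis unfolding g_def by (intro continuous_intros)
  qed
  have Riemann: "(\<lambda>m. \<Sum>i<Suc m. T / Suc m * g \<omega> (real i * (T / Suc m))) \<longlonglongrightarrow> J \<omega>" if \<omega>: "\<omega> \<in> space M" for \<omega>
  proof -
    obtain b where "\<And>t. t \<in> {0..<T} \<Longrightarrow> \<bar>g \<omega> t\<bar> \<le> b" using g_bdd[OF \<omega>] by blast
    then show ?thesis
      unfolding J_def using g_cont[OF \<omega>] g_meas[OF \<omega>]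
      by (intro Riemann_sums_tendsto[OF T, where S = "s ` {..n}" and c = b]) auto
  qed
  have gridM: "(\<lambda>\<omega>. \<Sum>i<Suc m. T / Suc m * g \<omega> (real i * (T / Suc m))) \<in> borel_measurable M" for m
    using T by (intro borel_measurable_sum borel_measurable_times borel_measurable_const gM) auto
  have JM [measurable]: "J \<in> borel_measurable M"
    by (rule borel_measurable_LIMSEQ_real[OF Riemann gridM])
  have J_eq: "(\<integral>\<^sup>+t\<in>{0..T}. ennreal ((H t \<omega> - simple_process n s \<eta> t \<omega>)\<^sup>2) \<partial>lborel) = ennreal (J \<omega>)"
    if \<omega>: "\<omega> \<in> space M" for \<omega>
  proof -
    have "AE t in lborel. t \<notin> insert T (s ` {..n})"
      by (intro AE_not_in) (simp add: finite_imp_null_set_lborel)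
    then have "(\<integral>\<^sup>+t\<in>{0..T}. ennreal ((H t \<omega> - simple_process n s \<eta> t \<omega>)\<^sup>2) \<partial>lborel)
        = (\<integral>\<^sup>+t. ennreal (indicator {0..<T} t * g \<omega> t) \<partial>lborel)"
    proof (intro nn_integral_cong_AE, eventually_elim)
      case (elim t)
      have "indicator {s j..<s (Suc j)} t = (indicator {s j<..s (Suc j)} t :: real)" if "j < n" for j
      proof -
        have "t \<noteq> s j" "t \<noteq> s (Suc j)" using elim that by auto
        then show ?thesis by (auto simp: indicator_def)
      qed
      then have "simple_process n s \<eta> t \<omega> = V t \<omega>"
        unfolding simple_process_def V_def step_value_def by (intro sum.cong) auto
      then show ?case using elim by (auto simp: g_def indicator_def power2_commute)
    qed
    also have "\<dots> = ennreal (J \<omega>)"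
      unfolding J_def
    proof (rule nn_integral_eq_integral)
      obtain b where b: "\<And>t. t \<in> {0..<T} \<Longrightarrow> \<bar>g \<omega> t\<bar> \<le> b" using g_bdd[OF \<omega>] by blast
      show "integrable lborel (\<lambda>t. indicator {0..<T} t * g \<omega> t)"
      proof (rule Bochner_Integration.integrable_bound)
        show "integrable lborel (\<lambda>t. b * indicator {0..<T} t)"
          using T by (intro integrable_mult_right integrable_real_indicator) auto
        show "AE t in lborel. norm (indicator {0..<T} t * g \<omega> t) \<le> norm (b * indicator {0..<T} t)"
          using b by (intro AE_I2) (force simp: indicator_def)
      qed (use g_meas[OF \<omega>] in simp)
    qed (simp add: g_def)
    finally show ?thesis .
  qed
  have J_nn: "J \<omega> \<ge> 0" for \<omega> by (simp add: J_def g_def)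
  define E2 where "E2 = {\<omega> \<in> space M. J \<omega> > e / 2}"
  have E2: "E2 \<in> sets M" "measure M E2 < e / 4"
  proof -
    show "E2 \<in> sets M" unfolding E2_def by measurable
    have "E2 = {\<omega>\<in>space M.
             (\<integral>\<^sup>+t\<in>{0..T}. ennreal ((H t \<omega> - simple_process n s \<eta> t \<omega>)\<^sup>2) \<partial>lborel) > ennreal (e / 2)}"
      unfolding E2_def using J_eq e by (intro Collect_cong conj_cong) (auto simp: ennreal_less_iff)
    then show "measure M E2 < e / 4" using k1 by (simp add: n_def s_def \<eta>_def)
  qed
  have S_cont: "continuous_on {0..T} (\<lambda>t. \<bar>I t \<omega> - S t \<omega>\<bar>)" if \<omega>: "\<omega> \<in> space M" for \<omega>
  proof -
    have I0: "continuous_on {0..T} (\<lambda>t. I t \<omega>)" using I_cont[OF \<omega>] by (rule continuous_on_subset) auto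
    have Bm: "continuous_on {0..T} (\<lambda>t. B (min t a) \<omega>)" if "a \<ge> 0" for a
    proof -
      have "continuous_on {0..T} (\<lambda>t. min t a)" by (intro continuous_intros)
      then show ?thesis using that by (intro continuous_on_compose2[OF B_cont[OF \<omega>]]) auto
    qed
    show ?thesis
      unfolding S_def simple_ito_integral_def using s_nn
      by (intro continuous_intros I0 Bm) auto
  qed
  have SM: "t \<ge> 0 \<Longrightarrow> S t \<in> borel_measurable M" for t
    unfolding S_def simple_ito_integral_def using s_nn
    by (intro borel_measurable_sum borel_measurable_times borel_measurable_diff \<eta>M B_meas) auto
  define E1 where "E1 = {\<omega> \<in> space M. \<exists>q\<in>test_times T. \<bar>I q \<omega> - S q \<omega>\<bar> > e / 2}"
  have E1: "E1 \<in> sets M" "measure M E1 < e / 4"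
  proof -
    have [measurable]: "q \<in> test_times T \<Longrightarrow> I q \<in> borel_measurable M"
      "q \<in> test_times T \<Longrightarrow> S q \<in> borel_measurable M" for q
      using test_times_subset[of T] T by (auto intro!: I_meas SM)
    have "E1 = (\<Union>q\<in>test_times T. {\<omega> \<in> space M. \<bar>I q \<omega> - S q \<omega>\<bar> > e / 2})" by (auto simp: E1_def)
    also have "\<dots> \<in> sets M"
    proof (rule sets.countable_UN')
      show "(\<lambda>q. {\<omega> \<in> space M. \<bar>I q \<omega> - S q \<omega>\<bar> > e / 2}) ` test_times T \<subseteq> sets M"
      proof safe
        fix q assume [measurable]: "q \<in> test_times T"
        show "{\<omega> \<in> space M. \<bar>I q \<omega> - S q \<omega>\<bar> > e / 2} \<in> sets M" by measurable
      qed
    qed simp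
    finally show "E1 \<in> sets M" .
    have "E1 = {\<omega>\<in>space M. (SUP t\<in>{0..T}. \<bar>I t \<omega> - S t \<omega>\<bar>) > e / 2}"
      unfolding E1_def
      by (intro Collect_cong conj_cong refl SUP_exceeds_iff[OF less_imp_le[OF T] S_cont, symmetric])
    then show "measure M E1 < e / 4" using k2 by (simp add: n_def s_def \<eta>_def S_def)
  qed
  define h where "h = (\<lambda>m. T / real (Suc m))"
  have h: "h m > 0" "real (Suc m) * h m = T" for m using T by (auto simp: h_def)
  have h_lim: "h \<longlonglongrightarrow> 0"
  proof -
    have "(\<lambda>m. T * (1 / real (Suc m))) \<longlonglongrightarrow> T * 0" by (intro tendsto_intros LIMSEQ_Suc[OF lim_1_over_n])
    then show ?thesis by (simp add: h_def)
  qed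
  define P where "P = (\<lambda>m l \<omega>. \<Sum>i<l. V (real i * h m) \<omega> * (B (real (Suc i) * h m) \<omega> - B (real i * h m) \<omega>))"
  define Bd where "Bd = (\<lambda>m. {\<omega> \<in> space M. (\<exists>l\<in>{..Suc m}. \<bar>P m l \<omega> - S (real l * h m) \<omega>\<bar> > e / 2)
      \<or> (\<Sum>i<Suc m. h m * g \<omega> (real i * h m)) > J \<omega> + e / 2})"
  have BdM: "Bd m \<in> sets M" for m
  proof -
    have t_nn: "0 \<le> real i * h m" for i using h[of m] by simp
    have [measurable]: "P m l \<in> borel_measurable M" for l
      unfolding P_def using t_nn
      by (intro borel_measurable_sum borel_measurable_times borel_measurable_diff VM B_meas)
    have [measurable]: "S (real l * h m) \<in> borel_measurable M" for l using SM t_nn by blast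
    have [measurable]: "(\<lambda>\<omega>. \<Sum>i<Suc m. h m * g \<omega> (real i * h m)) \<in> borel_measurable M"
      using gridM[of m] by (simp add: h_def)
    show ?thesis unfolding Bd_def by measurable
  qed
  have "(\<lambda>m. prob (Bd m)) \<longlonglongrightarrow> 0"
  proof (rule prob_eventually_good[OF BdM])
    fix \<omega> assume \<omega>: "\<omega> \<in> space M"
    define e' where "e' = e / (8 * (c + 1))"
    have e': "e' > 0" using e c_nn by (simp add: e'_def)
    have "uniformly_continuous_on {0..T} (\<lambda>t. B t \<omega>)"
      using B_cont[OF \<omega>] by (intro compact_uniformly_continuous continuous_on_subset[OF B_cont[OF \<omega>]]) auto
    then obtain d where d: "d > 0" "\<And>u v. u \<in> {0..T} \<Longrightarrow> v \<in> {0..T} \<Longrightarrow> dist v u < d \<Longrightarrow> dist (B v \<omega>) (B u \<omega>) < e'"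
      using e' unfolding uniformly_continuous_on_def by meson
    have ev1: "\<forall>\<^sub>F m in sequentially. h m < d" using h_lim d(1) by (rule order_tendstoD(2))
    have "(\<lambda>m. \<Sum>i<Suc m. h m * g \<omega> (real i * h m)) \<longlonglongrightarrow> J \<omega>"
      using Riemann[OF \<omega>] by (simp add: h_def)
    then have ev2: "\<forall>\<^sub>F m in sequentially. (\<Sum>i<Suc m. h m * g \<omega> (real i * h m)) < J \<omega> + e / 2"
      using e by (intro order_tendstoD(2)) auto
    show "\<forall>\<^sub>F m in sequentially. \<omega> \<notin> Bd m"
      using ev1 ev2
    proof eventually_elim
      case (elim m)
      have "\<bar>P m l \<omega> - S (real l * h m) \<omega>\<bar> \<le> e / 2" if l: "l \<le> Suc m" for l
      proof -
        have lT: "real l * h m \<le> T"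
          unfolding h(2)[of m, symmetric] using l h(1)[of m] by (intro mult_right_mono) auto
        have "\<bar>P m l \<omega> - S (real l * h m) \<omega>\<bar> \<le> (\<Sum>j<n. \<bar>\<eta> j \<omega>\<bar>) * (2 * e')"
          unfolding P_def V_def S_def simple_ito_integral_def
        proof (rule grid_sampling_error[where w = "\<lambda>t. B t \<omega>", OF h(1) s0 s_mono])
          fix u v assume "0 \<le> u" "u \<le> real l * h m" "0 \<le> v" "v \<le> real l * h m" "\<bar>u - v\<bar> \<le> h m"
          then have "dist (B u \<omega>) (B v \<omega>) < e'" using lT elim(1) by (intro d(2)) (auto simp: dist_real_def)
          then show "\<bar>B u \<omega> - B v \<omega>\<bar> \<le> e'" by (simp add: dist_real_def)
        qed
        also have "\<dots> \<le> (c + 1) * (2 * e')" using c[OF \<omega>] e' by (intro mult_right_mono) auto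
        also have "\<dots> = e / 4" using c_nn by (simp add: e'_def field_simps)
        finally show ?thesis using e by simp
      qed
      then show ?case using elim(2) by (force simp: Bd_def not_less)
    qed
  qed
  then have ev1: "\<forall>\<^sub>F m in sequentially. prob (Bd m) < e / 4" using e by (intro order_tendstoD(2)) auto
  have ev2: "\<forall>\<^sub>F m in sequentially. h m < e" using h_lim e by (rule order_tendstoD(2))
  have "(\<lambda>m. c * sqrt (h m)) \<longlonglongrightarrow> c * sqrt 0" by (intro tendsto_intros h_lim)
  then have ev3: "\<forall>\<^sub>F m in sequentially. c * sqrt (h m) < e" using e by (intro order_tendstoD(2)) auto
  obtain m where m: "prob (Bd m) < e / 4" "h m < e" "c * sqrt (h m) < e"
    using eventually_happens[OF eventually_conj[OF ev1 eventually_conj[OF ev2 ev3]]] by auto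
  define Bad where "Bad = Bd m \<union> E1 \<union> E2"
  have Bad_events: "Bad \<in> sets M" unfolding Bad_def using BdM E1 E2 by auto
  have "prob Bad \<le> prob (Bd m) + prob E1 + prob E2"
    unfolding Bad_def
    using measure_Un_le[OF sets.Un[OF BdM[of m] E1(1)] E2(1)] measure_Un_le[OF BdM[of m] E1(1)] by linarith
  then have Bad_small: "measure M Bad < e" using m(1) E1 E2 e by linarith
  have good: "(\<forall>l\<le>Suc m. \<bar>I (real l * h m) \<omega> - P m l \<omega>\<bar> \<le> e)
      \<and> (\<Sum>i<Suc m. h m * (V (real i * h m) \<omega> - H (real i * h m) \<omega>)\<^sup>2) \<le> e"
    if \<omega>: "\<omega> \<in> space M - Bad" for \<omega>
  proof (intro conjI allI impI)
    have off: "\<And>l. l \<le> Suc m \<Longrightarrow> \<bar>P m l \<omega> - S (real l * h m) \<omega>\<bar> \<le> e / 2"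
      "(\<Sum>i<Suc m. h m * g \<omega> (real i * h m)) \<le> J \<omega> + e / 2"
      "\<And>q. q \<in> test_times T \<Longrightarrow> \<bar>I q \<omega> - S q \<omega>\<bar> \<le> e / 2" "J \<omega> \<le> e / 2"
      using \<omega> by (auto simp: Bad_def Bd_def E1_def E2_def not_less)
    show "(\<Sum>i<Suc m. h m * (V (real i * h m) \<omega> - H (real i * h m) \<omega>)\<^sup>2) \<le> e"
      using off(2,4) unfolding g_def by linarith
    fix l assume l: "l \<le> Suc m"
    have lT: "real l * h m \<in> {0..T}"
    proof -
      have "real l * h m \<le> T"
        unfolding h(2)[of m, symmetric] using l h(1)[of m] by (intro mult_right_mono) auto
      then show ?thesis using h(1)[of m] by simp
    qed
    have \<omega>M: "\<omega> \<in> space M" using \<omega> by simp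
    have "\<not> (\<bar>I (real l * h m) \<omega> - S (real l * h m) \<omega>\<bar> > e / 2)"
      using exceeds_at_test_time[OF S_cont[OF \<omega>M] lT] off(3) by (meson not_less)
    then show "\<bar>I (real l * h m) \<omega> - P m l \<omega>\<bar> \<le> e" using off(1)[OF l] by linarith
  qed
  have hm: "T / real (Suc m) = h m" by (simp add: h_def)
  have "grid_approx M F B H I T e (Suc m) c (\<lambda>i. V (real i * h m)) Bad"
    unfolding grid_approx_def hm
  proof (intro conjI)
    show "\<forall>\<omega>\<in>space M - Bad. (\<forall>l\<le>Suc m. \<bar>I (real l * h m) \<omega> - (\<Sum>i<l. V (real i * h m) \<omega> *
        (B (real (Suc i) * h m) \<omega> - B (real i * h m) \<omega>))\<bar> \<le> e) \<and>
        (\<Sum>i<Suc m. h m * (V (real i * h m) \<omega> - H (real i * h m) \<omega>)\<^sup>2) \<le> e"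
      using good unfolding P_def by blast
  qed (use m VF V_le Bad_events Bad_small in auto)
  then show ?thesis by blast
qed

section \<open>Passing to the limit along paths\<close>

lemma left_Riemann_error:
  fixes u :: "real \<Rightarrow> real"
  assumes h: "h > 0" and u: "continuous_on {0..real i * h} u"
    and osc: "\<And>s t. 0 \<le> s \<Longrightarrow> s \<le> real i * h \<Longrightarrow> 0 \<le> t \<Longrightarrow> t \<le> real i * h \<Longrightarrow> \<bar>s - t\<bar> \<le> h \<Longrightarrow> \<bar>u s - u t\<bar> \<le> d"
  shows "\<bar>(LINT s:{0..real i * h}|lborel. u s) - (\<Sum>l<i. h * u (real l * h))\<bar> \<le> real i * h * d"
proof (cases "i = 0")
  case True
  have "(LINT s:{0..0::real}|lborel. u s) = 0"
    by (simp add: set_lebesgue_integral_def indicator_def if_distrib cong: if_cong)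
      (rule integral_eq_zero_AE, rule AE_mp[OF AE_lborel_singleton[of 0]], auto)
  then show ?thesis using True by simp
next
  case False
  define T where "T = real i * h"
  have T: "T > 0" "T / i = h" using h False by (auto simp: T_def)
  have R: "has_bochner_integral lborel (\<lambda>t. indicator {0..<T} t * u (grid_floor T i t)) (\<Sum>l<i. h * u (real l * h))"
    using Riemann_sum_integral[OF T(1), of i u] False T(2) by simp
  have int0: "set_integrable lborel {0..T} u"
    unfolding set_integrable_def using u by (intro borel_integrable_compact) (auto simp: T_def)
  have eq: "(LINT s:{0..T}|lborel. u s) = (\<integral>s. indicator {0..<T} s * u s \<partial>lborel)"
    unfolding set_lebesgue_integral_def
  proof (rule integral_cong_AE)
    show "(\<lambda>s. indicator {0..T} s *\<^sub>R u s) \<in> borel_measurable lborel"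
      using int0 by (auto simp: set_integrable_def)
    have "set_integrable lborel {0..<T} u" by (rule set_integrable_subset[OF int0]) auto
    then show "(\<lambda>s. indicator {0..<T} s * u s) \<in> borel_measurable lborel"
      by (auto simp: set_integrable_def)
    show "AE s in lborel. indicator {0..T} s *\<^sub>R u s = indicator {0..<T} s * u s"
      using AE_lborel_singleton[of T] by eventually_elim (auto simp: indicator_def)
  qed
  have int1: "integrable lborel (\<lambda>s. indicator {0..<T} s * u s)"
  proof -
    have "set_integrable lborel {0..<T} u" by (rule set_integrable_subset[OF int0]) auto
    then show ?thesis by (simp add: set_integrable_def)
  qed
  have "(LINT s:{0..T}|lborel. u s) - (\<Sum>l<i. h * u (real l * h))
      = (\<integral>s. indicator {0..<T} s * u s - indicator {0..<T} s * u (grid_floor T i s) \<partial>lborel)"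
    using R int1 by (simp add: eq has_bochner_integral_iff)
  also have "\<bar>\<dots>\<bar> \<le> (\<integral>s. d * indicator {0..<T} s \<partial>lborel)"
  proof (rule integral_abs_bound[THEN order_trans], rule integral_mono)
    show "integrable lborel (\<lambda>s. \<bar>indicator {0..<T} s * u s - indicator {0..<T} s * u (grid_floor T i s)\<bar>)"
      using R int1 by (intro integrable_abs Bochner_Integration.integrable_diff) (auto simp: has_bochner_integral_iff)
    show "integrable lborel (\<lambda>s. d * indicator {0..<T} s)"
      using T by (intro integrable_mult_right integrable_real_indicator) auto
    fix s
    show "\<bar>indicator {0..<T} s * u s - indicator {0..<T} s * u (grid_floor T i s)\<bar> \<le> d * indicator {0..<T} s"
    proof (cases "s \<in> {0..<T}")
      case True
      then show ?thesis
        using osc[of s "grid_floor T i s"] grid_floor_bounds[OF T(1), of i s] False T(2)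
        by (auto simp: T_def)
    qed simp
  qed
  also have "\<dots> = T * d" using T by simp
  finally show ?thesis by (simp add: T_def)
qed

lemma powr_diff_le:
  fixes a b q R :: real
  assumes q: "1 \<le> q" and a: "0 \<le> a" "a \<le> R" and b: "0 \<le> b" "b \<le> R"
  shows "\<bar>b powr q - a powr q\<bar> \<le> q * R powr (q - 1) * \<bar>b - a\<bar>"
proof -
  have main: "b powr q - a powr q \<le> q * R powr (q - 1) * (b - a)" if "0 \<le> a" "a < b" "b \<le> R" for a b
  proof (cases "a = 0")
    case True
    have "b powr q = b powr (q - 1) * b" using that True by (simp add: powr_diff)
    also have "\<dots> \<le> R powr (q - 1) * b" using that True q by (intro mult_right_mono powr_mono2) auto
    also have "\<dots> \<le> q * (R powr (q - 1) * b)"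
      using mult_right_mono[OF q, of "R powr (q - 1) * b"] that True by simp
    finally show ?thesis using True by simp
  next
    case False
    have "\<exists>z>a. z < b \<and> b powr q - a powr q = (b - a) * (q * z powr (q - 1))"
      using that False by (intro MVT2) (auto intro!: derivative_eq_intros)
    then obtain z where z: "a < z" "z < b" "b powr q - a powr q = (b - a) * (q * z powr (q - 1))" by blast
    have "z powr (q - 1) \<le> R powr (q - 1)" using z that False q by (intro powr_mono2) auto
    then have "(b - a) * (q * z powr (q - 1)) \<le> (b - a) * (q * R powr (q - 1))"
      using that q by (intro mult_left_mono) auto
    then show ?thesis using z(3) by (simp add: mult_ac)
  qed
  have mono: "a powr q \<le> b powr q" if "0 \<le> a" "a \<le> b" for a b using that q by (intro powr_mono2) auto
  show ?thesis
  proof (cases a b rule: linorder_cases)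
    case less
    then show ?thesis using main[of a b] mono[of a b] a b by simp
  next
    case greater
    then show ?thesis using main[of b a] mono[of b a] a b by simp
  qed simp
qed

text \<open>
  The violations of the two bounds on \<open>E\<close> tend to 0 along almost every path and are bounded, hence so do their
  expectations. Off \<open>E\<close> the crude bounds cost at most the probability.
\<close>

lemma (in prob_space) expectation_limit_bounds:
  fixes Y :: "nat \<Rightarrow> 'a \<Rightarrow> real"
  assumes Y [measurable]: "\<And>j. Y j \<in> borel_measurable M" and Y01: "\<And>j \<omega>. 0 \<le> Y j \<omega> \<and> Y j \<omega> \<le> 1"
    and lim: "(\<lambda>j. expectation (Y j)) \<longlonglongrightarrow> y"
    and [measurable]: "L \<in> borel_measurable M" "U \<in> borel_measurable M"
    and LU: "\<And>\<omega>. -1 \<le> L \<omega> \<and> L \<omega> \<le> 1 \<and> 0 \<le> U \<omega> \<and> U \<omega> \<le> 2"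
    and E [measurable]: "E \<in> events"
    and ev: "AE \<omega> in M. \<omega> \<in> E \<longrightarrow> (\<forall>\<^sub>F j in sequentially. L \<omega> \<le> Y j \<omega> \<and> Y j \<omega> \<le> U \<omega>)"
  shows "expectation L - prob (space M - E) \<le> y" "y \<le> expectation U + prob (space M - E)"
proof -
  have intY: "integrable M (Y j)" for j
    by (rule integrable_const_bound[where B = 1]) (use Y01 in auto)
  have intL: "integrable M L"
    by (rule integrable_const_bound[where B = 1]) (use LU in \<open>auto simp: abs_le_iff\<close>)
  have intU: "integrable M U"
    by (rule integrable_const_bound[where B = 2]) (use LU in \<open>auto simp: abs_le_iff\<close>)
  have Ec [measurable]: "space M - E \<in> events" by measurable
  define f where "f = (\<lambda>j \<omega>. indicator E \<omega> * (max 0 (L \<omega> - Y j \<omega>) + max 0 (Y j \<omega> - U \<omega>)))"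
  have f_meas [measurable]: "f j \<in> borel_measurable M" for j unfolding f_def by measurable
  have f_bdd: "0 \<le> f j \<omega> \<and> f j \<omega> \<le> 3" for j \<omega>
    using Y01[of j \<omega>] LU[of \<omega>] by (auto simp: f_def indicator_def max_def)
  have intf: "integrable M (f j)" for j
    by (rule integrable_const_bound[where B = 3]) (use f_bdd in auto)
  have "(\<lambda>j. expectation (f j)) \<longlonglongrightarrow> expectation (\<lambda>_. 0)"
  proof (rule integral_dominated_convergence[where w = "\<lambda>_. 3"])
    show "AE \<omega> in M. (\<lambda>j. f j \<omega>) \<longlonglongrightarrow> 0"
      using ev
    proof eventually_elim
      case (elim \<omega>)
      show ?case
      proof (cases "\<omega> \<in> E")
        case True
        with elim have "\<forall>\<^sub>F j in sequentially. L \<omega> \<le> Y j \<omega> \<and> Y j \<omega> \<le> U \<omega>" by simp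
        then have "\<forall>\<^sub>F j in sequentially. f j \<omega> = 0" by eventually_elim (simp add: f_def)
        then show ?thesis by (rule tendsto_eventually)
      qed (simp add: f_def)
    qed
  qed (use f_bdd in auto)
  then have f_lim: "(\<lambda>j. expectation (f j)) \<longlonglongrightarrow> 0" by simp
  have int_ind: "integrable M (indicator (space M - E) :: 'a \<Rightarrow> real)"
    by (rule integrable_real_indicator) (auto simp: emeasure_eq_measure)
  have lower: "expectation L - prob (space M - E) - expectation (f j) \<le> expectation (Y j)" for j
  proof -
    have "expectation (\<lambda>\<omega>. L \<omega> - indicator (space M - E) \<omega> - f j \<omega>) \<le> expectation (Y j)"
    proof (rule integral_mono)
      show "integrable M (\<lambda>\<omega>. L \<omega> - indicator (space M - E) \<omega> - f j \<omega>)"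
        by (intro Bochner_Integration.integrable_diff intL intf int_ind)
      fix \<omega> assume "\<omega> \<in> space M"
      then show "L \<omega> - indicator (space M - E) \<omega> - f j \<omega> \<le> Y j \<omega>"
        using Y01[of j \<omega>] LU[of \<omega>] by (cases "\<omega> \<in> E") (auto simp: f_def max_def)
    qed (rule intY)
    then show ?thesis using intL intf int_ind by simp
  qed
  have upper: "expectation (Y j) \<le> expectation U + prob (space M - E) + expectation (f j)" for j
  proof -
    have "expectation (Y j) \<le> expectation (\<lambda>\<omega>. U \<omega> + indicator (space M - E) \<omega> + f j \<omega>)"
    proof (rule integral_mono)
      show "integrable M (\<lambda>\<omega>. U \<omega> + indicator (space M - E) \<omega> + f j \<omega>)"
        by (intro Bochner_Integration.integrable_add intU intf int_ind)
      fix \<omega> assume "\<omega> \<in> space M"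
      then show "Y j \<omega> \<le> U \<omega> + indicator (space M - E) \<omega> + f j \<omega>"
        using Y01[of j \<omega>] LU[of \<omega>] by (cases "\<omega> \<in> E") (auto simp: f_def max_def)
    qed (rule intY)
    then show ?thesis using intU intf int_ind by simp
  qed
  have "(\<lambda>j. expectation L - prob (space M - E) - expectation (f j)) \<longlonglongrightarrow> expectation L - prob (space M - E) - 0"
    by (intro tendsto_intros f_lim)
  from LIMSEQ_le[OF this lim] lower show "expectation L - prob (space M - E) \<le> y" by auto
  have "(\<lambda>j. expectation U + prob (space M - E) + expectation (f j)) \<longlonglongrightarrow> expectation U + prob (space M - E) + 0"
    by (intro tendsto_intros f_lim)
  from LIMSEQ_le[OF lim this] upper show "y \<le> expectation U + prob (space M - E)" by auto
qed

context cev_laplace begin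

text \<open>
  \<open>z\<close> stands for a sequence that follows the path \<open>u\<close> on the grid and stops at \<open>n\<close>, the first index at which
  it is at or below \<open>\<epsilon>\<close>, if there is one. Before that \<open>u\<close> has not reached 0, and at that index it has passed
  \<open>2 \<epsilon>\<close>. If \<open>z\<close> never stops early, the final discount factor is negligible.
\<close>

lemma path_bracket:
  fixes u :: "real \<Rightarrow> real" and z :: "nat \<Rightarrow> real" and k :: nat
  assumes u: "continuous_on {0..} u" and x: "u 0 = x" and \<epsilon>: "0 < \<epsilon>" "2 * \<epsilon> < x"
    and h: "h > 0" and T: "real k * h = T" and n: "n \<le> k"
    and close: "\<And>i. i \<le> k \<Longrightarrow> \<bar>u (real i * h) - z i\<bar> \<le> \<epsilon> / 4"
    and osc: "\<And>s t. 0 \<le> s \<Longrightarrow> s \<le> T \<Longrightarrow> 0 \<le> t \<Longrightarrow> t \<le> T \<Longrightarrow> \<bar>s - t\<bar> \<le> h \<Longrightarrow> \<bar>u s - u t\<bar> \<le> \<epsilon> / 4"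
    and above: "\<And>i. i < n \<Longrightarrow> z i > \<epsilon>" and stop: "n = k \<or> z n \<le> \<epsilon>"
  shows "\<phi> \<epsilon> * discount \<alpha> (hitting_time 0 u) - exp (- \<alpha> * T) \<le> exp (- \<alpha> * h * real n) * \<phi> (z n)"
    and "exp (- \<alpha> * h * real n) * \<phi> (z n) \<le> discount \<alpha> (hitting_time (2 * \<epsilon>) u) + exp (- \<alpha> * T)"
proof -
  define y where "y = exp (- \<alpha> * h * real n)"
  have y_eq: "discount \<alpha> (ennreal (real n * h)) = y" using h by (simp add: discount_ennreal y_def mult_ac)
  have nT: "real n * h \<le> T" unfolding T[symmetric] using n h by (intro mult_right_mono) auto
  have pos: "u s \<noteq> 0" if s: "0 \<le> s" "s < real n * h" for s
  proof -
    define i where "i = nat \<lfloor>s / h\<rfloor>"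
    have "0 \<le> s / h" using s h by simp
    then have "real i \<le> s / h" "s / h < real i + 1" by (auto simp: i_def)
    then have i: "real i * h \<le> s" "s < real i * h + h" using h by (auto simp: field_simps)
    have "real i * h < real n * h" using i s by linarith
    then have "i < n" using h by (simp only: mult_less_cancel_right_disj) auto
    then have "z i > \<epsilon>" "\<bar>u (real i * h) - z i\<bar> \<le> \<epsilon> / 4" using above close n by auto
    moreover have "\<bar>u s - u (real i * h)\<bar> \<le> \<epsilon> / 4"
      using s i nT h by (intro osc) auto
    ultimately show ?thesis using \<epsilon> by linarith
  qed
  have "ennreal (real n * h) \<le> hitting_time 0 u" by (rule hitting_time_ge) (use pos in auto)
  from discount_antimono[OF _ this, of \<alpha>] have d0: "discount \<alpha> (hitting_time 0 u) \<le> y"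
    using \<alpha>_pos y_eq by simp
  have phi: "0 \<le> \<phi> w" "\<phi> w \<le> 1" for w by (auto simp: \<phi>_nonneg \<phi>_le_1)
  have y: "0 < y" by (simp add: y_def)
  show "\<phi> \<epsilon> * discount \<alpha> (hitting_time 0 u) - exp (- \<alpha> * T) \<le> exp (- \<alpha> * h * real n) * \<phi> (z n)"
  proof (cases "z n \<le> \<epsilon>")
    case True
    then have "\<phi> \<epsilon> \<le> \<phi> (z n)" by (rule \<phi>_antimono)
    then have "\<phi> \<epsilon> * discount \<alpha> (hitting_time 0 u) \<le> \<phi> (z n) * y"
      using d0 phi by (intro mult_mono) (auto simp: discount_nonneg)
    then show ?thesis unfolding y_def[symmetric] using exp_ge_zero[of "- \<alpha> * T"] by (simp only: mult.commute)
  next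
    case False
    then have "n = k" using stop by simp
    then have "y = exp (- \<alpha> * T)" by (simp add: y_def T[symmetric] mult_ac)
    moreover have "\<phi> \<epsilon> * discount \<alpha> (hitting_time 0 u) \<le> 1 * y"
      using d0 phi y by (intro mult_mono) (auto simp: discount_nonneg)
    moreover have "0 \<le> y * \<phi> (z n)" using y phi by simp
    ultimately show ?thesis unfolding y_def[symmetric] by linarith
  qed
  have y_phi: "y * \<phi> (z n) \<le> y" using y phi[of "z n"] by (simp add: mult_left_le)
  show "exp (- \<alpha> * h * real n) * \<phi> (z n) \<le> discount \<alpha> (hitting_time (2 * \<epsilon>) u) + exp (- \<alpha> * T)"
  proof (cases "z n \<le> \<epsilon>")
    case True
    have "u (real n * h) \<le> 2 * \<epsilon>" using close[of n] n True \<epsilon> by linarith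
    then have "hitting_time (2 * \<epsilon>) u \<le> ennreal (real n * h)"
      using \<epsilon> x h by (intro hitting_time_le_IVT[OF u]) auto
    from discount_antimono[OF _ this, of \<alpha>] have "y \<le> discount \<alpha> (hitting_time (2 * \<epsilon>) u)"
      using \<alpha>_pos y_eq by simp
    then show ?thesis unfolding y_def[symmetric] using y_phi exp_ge_zero[of "- \<alpha> * T"] by linarith
  next
    case False
    then have "n = k" using stop by simp
    then have "y = exp (- \<alpha> * T)" by (simp add: y_def T[symmetric] mult_ac)
    then show ?thesis unfolding y_def[symmetric] using y_phi discount_nonneg[of \<alpha> "hitting_time (2 * \<epsilon>) u"] by linarith
  qed
qed

end

section \<open>A recursion that follows the diffusion\<close>

text \<open>
  A nonnegative sum that is stopped as soon as it exceeds \<open>Q\<close>, without the term that causes the excess.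
\<close>

lemma stopped_sum_le:
  fixes a :: "nat \<Rightarrow> real"
  assumes a: "\<And>i. 0 \<le> a i" and Q: "0 \<le> Q"
    and bnd: "\<And>i. P i \<Longrightarrow> (\<Sum>l\<le>i. a l) \<le> Q" and decr: "\<And>i j. P j \<Longrightarrow> i \<le> j \<Longrightarrow> P i"
  shows "(\<Sum>i<n. of_bool (P i) * a i) \<le> Q"
proof (induction n)
  case (Suc n)
  show ?case
  proof (cases "P n")
    case True
    have all: "P i" if "i \<le> n" for i by (rule decr[OF True that])
    have "(\<Sum>i<Suc n. of_bool (P i) * a i) = (\<Sum>l\<le>n. a l)"
      unfolding lessThan_Suc_atMost by (intro sum.cong refl) (simp add: all)
    then show ?thesis using bnd[OF True] by simp
  next
    case False
    then show ?thesis using Suc.IH by simp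
  qed
qed (use Q in simp)

text \<open>
  The recursion takes its drift from the diffusion and its noise from the approximate integrand \<open>v\<close>.
  Driving it by \<open>v\<close> rather than by a function of its own position keeps it close to \<open>X\<close> without any
  Gronwall argument, which would have to face the non-Lipschitz coefficient; the
  price is that its coefficients are only approximately right.
\<close>

locale cev_scheme = cev_laplace +
  fixes M :: "'a measure" and F :: "real \<Rightarrow> 'a measure" and B X I :: "real \<Rightarrow> 'a \<Rightarrow> real"
    and x T \<epsilon> K e :: real and n :: nat and c :: real and v :: "nat \<Rightarrow> 'a \<Rightarrow> real" and Bad :: "'a set"
  assumes uc: "usual_conditions M F" and bm: "brownian_motion M F B"
    and X_adapted: "adapted F X" and X_cont: "continuous_paths M X"
    and X_nonneg: "\<And>t \<omega>. t \<ge> 0 \<Longrightarrow> \<omega> \<in> space M \<Longrightarrow> 0 \<le> X t \<omega>"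
    and T: "T > 0" and \<epsilon>: "0 < \<epsilon>" and K: "K > 0" and e: "0 < e" "e \<le> 1"
    and approx: "grid_approx M F B (\<lambda>t \<omega>. \<sigma> * X t \<omega> powr p) I T e n c v Bad"
begin

definition h where "h = T / real n"
definition Z :: "nat \<Rightarrow> 'a \<Rightarrow> real" where
  "Z i \<omega> = x + (\<Sum>l<i. \<mu> * X (real l * h) \<omega> * h + v l \<omega> * (B (real (Suc l) * h) \<omega> - B (real l * h) \<omega>))"
text \<open>
  If \<open>X\<close> stays below \<open>K\<close>, the sum in \<open>ok\<close> cannot exceed \<open>Q\<close> outside \<open>Bad\<close>. Stopping at \<open>Q\<close> bounds the sum on all
  paths, including those on which nothing is known about \<open>v\<close>.
\<close>

definition Q where "Q = 2 + 2 * T * (\<sigma>\<^sup>2 * K powr (2 * p))"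
definition ok :: "nat \<Rightarrow> 'a \<Rightarrow> bool" where
  "ok i \<omega> \<longleftrightarrow> Z i \<omega> > \<epsilon> \<and> Z i \<omega> \<le> K + 1 \<and> X (real i * h) \<omega> \<le> K \<and> (\<Sum>l\<le>i. h * (v l \<omega>)\<^sup>2) \<le> Q"
definition A :: "nat \<Rightarrow> 'a set" where
  "A i = {\<omega> \<in> space M. \<forall>l\<in>{..i}. ok l \<omega>}"
definition stop :: "'a \<Rightarrow> nat" where
  "stop \<omega> = (LEAST i. i = n \<or> \<omega> \<notin> A i)"
definition Y :: "'a \<Rightarrow> real" where
  "Y \<omega> = exp (- \<alpha> * h * real (stop \<omega>)) * \<phi> (Z (stop \<omega>) \<omega>)"

text \<open>The parts of the one-step errors that measure how well the scheme follows the diffusion.\<close>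

definition defect :: "nat \<Rightarrow> 'a \<Rightarrow> real" where
  "defect i \<omega> = h * (\<bar>\<mu>\<bar> * \<bar>X (real i * h) \<omega> - Z i \<omega>\<bar> / \<epsilon>
     + 2 * \<bar>(v i \<omega>)\<^sup>2 - \<sigma>\<^sup>2 * Z i \<omega> powr (2 * p)\<bar> / \<epsilon>\<^sup>2)"

definition total_defect :: "'a \<Rightarrow> real" where
  "total_defect \<omega> = (\<Sum>i<n. of_bool (\<omega> \<in> A i) * defect i \<omega>)"

sublocale prob_space M
  using uc by (simp add: usual_conditions_def)

sublocale filtration "space M" F
  using uc by (simp add: usual_conditions_def)

lemma sub: "subalgebra M (F t)"
  using uc space_F[of t] by (auto simp: subalgebra_def usual_conditions_def)

lemma to_M: "f \<in> borel_measurable (F t) \<Longrightarrow> f \<in> borel_measurable M" for f :: "'a \<Rightarrow> real"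
  by (rule measurable_from_subalg[OF sub])

lemma mono_F: "f \<in> borel_measurable (F t) \<Longrightarrow> t \<le> t' \<Longrightarrow> f \<in> borel_measurable (F t')" for f :: "'a \<Rightarrow> real"
  using sets_F_mono[of t t'] space_F[of t] space_F[of t'] by (auto simp: measurable_def)

lemma n_pos: "n > 0" and h_le: "h \<le> e" and c_h: "c * sqrt h \<le> e"
  and v_F: "v i \<in> borel_measurable (F (real i * h))" and v_le: "\<omega> \<in> space M \<Longrightarrow> \<bar>v i \<omega>\<bar> \<le> c"
  and Bad_events: "Bad \<in> events" and Bad_prob: "prob Bad < e"
  and I_close: "\<omega> \<in> space M \<Longrightarrow> \<omega> \<notin> Bad \<Longrightarrow> l \<le> n \<Longrightarrow>
    \<bar>I (real l * h) \<omega> - (\<Sum>i<l. v i \<omega> * (B (real (Suc i) * h) \<omega> - B (real i * h) \<omega>))\<bar> \<le> e"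
  and v_close: "\<omega> \<in> space M \<Longrightarrow> \<omega> \<notin> Bad \<Longrightarrow>
    (\<Sum>i<n. h * (v i \<omega> - \<sigma> * X (real i * h) \<omega> powr p)\<^sup>2) \<le> e"
  using approx[unfolded grid_approx_def, folded h_def] by blast+

lemma h_pos: "h > 0" and nh: "real n * h = T"
  using T n_pos by (auto simp: h_def)

lemma h_le_1: "h \<le> 1" using h_le e by linarith

lemma grid_nonneg: "0 \<le> real i * h" using h_pos by simp

lemma grid_mono: "i \<le> j \<Longrightarrow> real i * h \<le> real j * h"
  using h_pos by (intro mult_right_mono) auto

lemma X_F: "X (real i * h) \<in> borel_measurable (F (real i * h))"
  and B_F: "B (real i * h) \<in> borel_measurable (F (real i * h))"
  using X_adapted bm grid_nonneg[of i] by (auto simp: adapted_def brownian_motion_def)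

lemma Z_F: "Z i \<in> borel_measurable (F (real i * h))"
  unfolding Z_def
proof (intro borel_measurable_add borel_measurable_const borel_measurable_sum borel_measurable_times borel_measurable_diff)
  fix l assume l: "l \<in> {..<i}"
  have le: "real l * h \<le> real i * h" "real (Suc l) * h \<le> real i * h"
    using l by (auto intro: grid_mono simp del: of_nat_Suc)
  show "X (real l * h) \<in> borel_measurable (F (real i * h))" "v l \<in> borel_measurable (F (real i * h))"
    "B (real l * h) \<in> borel_measurable (F (real i * h))"
    "B (real (Suc l) * h) \<in> borel_measurable (F (real i * h))"
    by (rule mono_F[OF X_F le(1)] mono_F[OF v_F le(1)] mono_F[OF B_F le(1)] mono_F[OF B_F le(2)])+
qed

lemma ok_F: "l \<le> i \<Longrightarrow> {\<omega> \<in> space (F (real i * h)). ok l \<omega>} \<in> sets (F (real i * h))"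
proof -
  assume l: "l \<le> i"
  have [measurable]: "Z l \<in> borel_measurable (F (real i * h))" "X (real l * h) \<in> borel_measurable (F (real i * h))"
    using mono_F[OF Z_F grid_mono[OF l]] mono_F[OF X_F grid_mono[OF l]] by auto
  have [measurable]: "j \<in> {..l} \<Longrightarrow> v j \<in> borel_measurable (F (real i * h))" for j
    using mono_F[OF v_F grid_mono[of j i]] l by auto
  show ?thesis unfolding ok_def by measurable
qed

lemma A_F: "A i \<in> sets (F (real i * h))"
proof -
  have "A i = (\<Inter>l\<in>{..i}. {\<omega> \<in> space (F (real i * h)). ok l \<omega>})"
    by (auto simp: A_def space_F)
  also have "\<dots> \<in> sets (F (real i * h))"
    by (intro sets.finite_INT) (auto intro: ok_F)
  finally show ?thesis .
qed

lemma A_M [measurable]: "A i \<in> events"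
  using A_F[of i] sub[of "real i * h"] by (auto simp: subalgebra_def)

lemma Z_M [measurable]: "Z i \<in> borel_measurable M" by (rule to_M[OF Z_F])
lemma X_M [measurable]: "X (real i * h) \<in> borel_measurable M" by (rule to_M[OF X_F])
lemma v_M [measurable]: "v i \<in> borel_measurable M" by (rule to_M[OF v_F])

lemma A_decr: "i \<le> j \<Longrightarrow> A j \<subseteq> A i" by (auto simp: A_def)

lemma A_bounds:
  assumes "\<omega> \<in> A i"
  shows "\<omega> \<in> space M" "\<epsilon> < Z i \<omega>" "Z i \<omega> \<le> K + 1" "0 \<le> X (real i * h) \<omega>" "X (real i * h) \<omega> \<le> K"
    "(\<Sum>l\<le>i. h * (v l \<omega>)\<^sup>2) \<le> Q"
  using assms X_nonneg[OF grid_nonneg] by (auto simp: A_def ok_def)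

lemma Q_nonneg: "Q \<ge> 0" using T K by (auto simp: Q_def intro!: mult_nonneg_nonneg add_nonneg_nonneg)

lemma stopped_v_sum: "(\<Sum>i<n. of_bool (\<omega> \<in> A i) * (h * (v i \<omega>)\<^sup>2)) \<le> Q"
proof (rule stopped_sum_le)
  show "\<omega> \<in> A j \<Longrightarrow> i \<le> j \<Longrightarrow> \<omega> \<in> A i" for i j using A_decr by blast
qed (use h_pos Q_nonneg A_bounds(6) in auto)

lemma defect_nonneg: "defect i \<omega> \<ge> 0"
  unfolding defect_def using h_pos \<epsilon> by auto

lemma total_defect_nonneg: "total_defect \<omega> \<ge> 0"
  unfolding total_defect_def by (intro sum_nonneg mult_nonneg_nonneg defect_nonneg) auto

lemma total_defect_measurable [measurable]: "total_defect \<in> borel_measurable M"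
  unfolding total_defect_def defect_def of_bool_def by measurable

text \<open>
  A bound that depends on neither the grid nor the path: it dominates the total defects along a sequence of
  ever finer grids.
\<close>

lemma total_defect_bound:
  "total_defect \<omega> \<le> T * (\<bar>\<mu>\<bar> * (2 * K + 1) / \<epsilon> + 2 * \<sigma>\<^sup>2 * (K + 1) powr (2 * p) / \<epsilon>\<^sup>2) + 2 * Q / \<epsilon>\<^sup>2"
proof -
  define b where "b = \<bar>\<mu>\<bar> * (2 * K + 1) / \<epsilon> + 2 * \<sigma>\<^sup>2 * (K + 1) powr (2 * p) / \<epsilon>\<^sup>2"
  have b: "b \<ge> 0" using K \<epsilon> by (simp add: b_def)
  have "of_bool (\<omega> \<in> A i) * defect i \<omega> \<le> h * b + 2 / \<epsilon>\<^sup>2 * (of_bool (\<omega> \<in> A i) * (h * (v i \<omega>)\<^sup>2))" for i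
  proof (cases "\<omega> \<in> A i")
    case True
    note ab = A_bounds[OF True]
    have 1: "\<bar>\<mu>\<bar> * \<bar>X (real i * h) \<omega> - Z i \<omega>\<bar> / \<epsilon> \<le> \<bar>\<mu>\<bar> * (2 * K + 1) / \<epsilon>"
      using ab \<epsilon> K by (intro divide_right_mono mult_left_mono) auto
    have z: "Z i \<omega> powr (2 * p) \<le> (K + 1) powr (2 * p)"
      using ab \<epsilon> p by (intro powr_mono2) auto
    have "\<bar>(v i \<omega>)\<^sup>2 - \<sigma>\<^sup>2 * Z i \<omega> powr (2 * p)\<bar> \<le> (v i \<omega>)\<^sup>2 + \<sigma>\<^sup>2 * Z i \<omega> powr (2 * p)"
    proof -
      have "0 \<le> (v i \<omega>)\<^sup>2" "0 \<le> \<sigma>\<^sup>2 * Z i \<omega> powr (2 * p)" by auto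
      then show ?thesis by linarith
    qed
    also have "\<dots> \<le> (v i \<omega>)\<^sup>2 + \<sigma>\<^sup>2 * (K + 1) powr (2 * p)" using z by (intro add_left_mono mult_left_mono) auto
    finally have 2: "2 * \<bar>(v i \<omega>)\<^sup>2 - \<sigma>\<^sup>2 * Z i \<omega> powr (2 * p)\<bar> / \<epsilon>\<^sup>2
        \<le> 2 * ((v i \<omega>)\<^sup>2 + \<sigma>\<^sup>2 * (K + 1) powr (2 * p)) / \<epsilon>\<^sup>2"
      by (intro divide_right_mono) auto
    have "defect i \<omega> \<le> h * (\<bar>\<mu>\<bar> * (2 * K + 1) / \<epsilon> + 2 * ((v i \<omega>)\<^sup>2 + \<sigma>\<^sup>2 * (K + 1) powr (2 * p)) / \<epsilon>\<^sup>2)"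
      unfolding defect_def using 1 2 h_pos by (intro mult_left_mono add_mono) auto
    also have "\<dots> = h * b + 2 / \<epsilon>\<^sup>2 * (h * (v i \<omega>)\<^sup>2)"
    proof -
      have "h * (g + 2 * (w + q) / k) = h * (g + 2 * q / k) + 2 / k * (h * w)" for g w q k :: real
        by (simp add: distrib_left add_divide_distrib)
      then show ?thesis by (simp only: b_def mult.assoc)
    qed
    finally show ?thesis using True by simp
  qed (use b h_pos in simp)
  then have "total_defect \<omega> \<le> (\<Sum>i<n. h * b + 2 / \<epsilon>\<^sup>2 * (of_bool (\<omega> \<in> A i) * (h * (v i \<omega>)\<^sup>2)))"
    unfolding total_defect_def by (rule sum_mono)
  also have "\<dots> = T * b + 2 / \<epsilon>\<^sup>2 * (\<Sum>i<n. of_bool (\<omega> \<in> A i) * (h * (v i \<omega>)\<^sup>2))"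
  proof -
    have "(\<Sum>i<n. h * b) = T * b" by (simp flip: mult.assoc add: nh)
    then show ?thesis by (simp only: sum.distrib sum_distrib_left[symmetric])
  qed
  also have "\<dots> \<le> T * b + 2 / \<epsilon>\<^sup>2 * Q"
    by (intro add_left_mono mult_left_mono stopped_v_sum) auto
  finally show ?thesis by (simp add: b_def)
qed

end

lemma (in prob_space) indep_set_scaled:
  assumes ind: "indep_set G (sets (vimage_algebra (space M) b borel))"
  shows "indep_set G (sets (vimage_algebra (space M) (\<lambda>\<omega>. b \<omega> / (c::real)) borel))"
proof -
  have "b \<in> borel_measurable (vimage_algebra (space M) b borel)"
    by (rule measurable_vimage_algebra1) simp
  then have m: "(\<lambda>\<omega>. b \<omega> / c) \<in> borel_measurable (vimage_algebra (space M) b borel)" by simp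
  have "sigma_sets (space (vimage_algebra (space M) b borel))
      {(\<lambda>\<omega>. b \<omega> / c) -` A \<inter> space (vimage_algebra (space M) b borel) |A. A \<in> sets borel}
     \<subseteq> sets (vimage_algebra (space M) b borel)"
    by (rule sets.sigma_sets_subset) (use measurable_sets[OF m] in auto)
  then have "sets (vimage_algebra (space M) (\<lambda>\<omega>. b \<omega> / c) borel) \<subseteq> sets (vimage_algebra (space M) b borel)"
    by (simp add: sets_vimage_algebra)
  then show ?thesis using ind unfolding indep_sets2_eq by blast
qed

context cev_scheme begin

definition noise :: "nat \<Rightarrow> 'a \<Rightarrow> real" where
  "noise i \<omega> = (B (real (Suc i) * h) \<omega> - B (real i * h) \<omega>) / sqrt h"

lemma noise_distributed: "distributed M lborel (noise i) std_normal_density"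
  and noise_indep: "indep_set (sets (F (real i * h))) (sets (vimage_algebra (space M) (noise i) borel))"
proof -
  have lt: "0 \<le> real i * h" "real i * h < real (Suc i) * h" using h_pos by (auto simp: distrib_right)
  have diff: "real (Suc i) * h - real i * h = h" by (simp add: distrib_right)
  have d: "distributed M lborel (\<lambda>\<omega>. B (real (Suc i) * h) \<omega> - B (real i * h) \<omega>)
      (normal_density 0 (sqrt (real (Suc i) * h - real i * h)))"
    and ind: "indep_set (sets (F (real i * h)))
      (sets (vimage_algebra (space M) (\<lambda>\<omega>. B (real (Suc i) * h) \<omega> - B (real i * h) \<omega>) borel))"
    using bm lt unfolding brownian_motion_def by blast+
  show "distributed M lborel (noise i) std_normal_density"
    using d normal_standard_normal_convert[of "sqrt h" "\<lambda>\<omega>. B (real (Suc i) * h) \<omega> - B (real i * h) \<omega>" 0] h_pos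
    unfolding noise_def diff by simp
  show "indep_set (sets (F (real i * h))) (sets (vimage_algebra (space M) (noise i) borel))"
    unfolding noise_def by (rule indep_set_scaled[OF ind])
qed

lemma Z_step:
  assumes "\<omega> \<in> A i"
  shows "Z (Suc i) \<omega> = Z i \<omega> + Z i \<omega> *
    (\<mu> * X (real i * h) \<omega> / Z i \<omega> * h + v i \<omega> / Z i \<omega> * sqrt h * noise i \<omega>)"
proof -
  have z: "Z i \<omega> \<noteq> 0" using A_bounds(2)[OF assms] \<epsilon> by simp
  have s: "sqrt h \<noteq> 0" using h_pos by simp
  have "Z i \<omega> * (\<mu> * X (real i * h) \<omega> / Z i \<omega> * h + v i \<omega> / Z i \<omega> * sqrt h * noise i \<omega>)
      = \<mu> * X (real i * h) \<omega> * h + v i \<omega> * (B (real (Suc i) * h) \<omega> - B (real i * h) \<omega>)"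
    using z s by (simp add: distrib_left noise_def)
  then show ?thesis unfolding Z_def by simp
qed

text \<open>
  The cubic noise term is \<open>\<bar>v\<bar> sqrt h\<close>, which is at most \<open>e\<close>, times \<open>h v\<^sup>2\<close>; the sum of the latter is
  bounded by the stopping rule. On \<open>A i\<close> the position is at least \<open>\<epsilon>\<close>, so the unweighted Taylor formula
  suffices.
\<close>

lemma scheme_step_error:
  assumes \<omega>: "\<omega> \<in> A i" and L: "L \<ge> 0"
  defines "b \<equiv> \<bar>\<mu>\<bar> * K / \<epsilon>"
  shows "step_error L 0 3 h (Z i \<omega>) (\<mu> * X (real i * h) \<omega> / Z i \<omega>) (v i \<omega> / Z i \<omega>)
    \<le> defect i \<omega> + h\<^sup>2 * (2 * b\<^sup>2 + 2 * L * b ^ 3 + \<alpha>\<^sup>2) + 2 * L / \<epsilon> ^ 3 * e * (h * (v i \<omega>)\<^sup>2)"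
proof -
  note ab = A_bounds[OF \<omega>]
  define z where "z = Z i \<omega>"
  define y where "y = X (real i * h) \<omega>"
  define w where "w = v i \<omega>"
  have z: "z > \<epsilon>" "z > 0" using ab \<epsilon> by (auto simp: z_def)
  have y: "0 \<le> y" "y \<le> K" using ab by (auto simp: y_def)
  have b: "b \<ge> 0" using K \<epsilon> by (simp add: b_def)
  have drift: "\<bar>\<mu> * y / z - \<mu>\<bar> \<le> \<bar>\<mu>\<bar> * \<bar>y - z\<bar> / \<epsilon>"
  proof -
    have "\<mu> * y / z - \<mu> = \<mu> * (y - z) / z" using z by (simp add: field_simps)
    then have "\<bar>\<mu> * y / z - \<mu>\<bar> = \<bar>\<mu>\<bar> * \<bar>y - z\<bar> / z" using z by (simp add: abs_mult)
    also have "\<dots> \<le> \<bar>\<mu>\<bar> * \<bar>y - z\<bar> / \<epsilon>" using z \<epsilon> by (intro divide_left_mono) auto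
    finally show ?thesis .
  qed
  have diffusion: "\<bar>(w / z)\<^sup>2 - \<sigma>\<^sup>2 * z powr (- r)\<bar> \<le> \<bar>w\<^sup>2 - \<sigma>\<^sup>2 * z powr (2 * p)\<bar> / \<epsilon>\<^sup>2"
  proof -
    have "z powr (- r) = z powr (2 * p) / z\<^sup>2"
      using z by (simp add: r_def powr_diff[symmetric] powr_numeral[symmetric] del: powr_numeral)
    then have "(w / z)\<^sup>2 - \<sigma>\<^sup>2 * z powr (- r) = (w\<^sup>2 - \<sigma>\<^sup>2 * z powr (2 * p)) / z\<^sup>2"
      by (simp add: power_divide diff_divide_distrib)
    then have "\<bar>(w / z)\<^sup>2 - \<sigma>\<^sup>2 * z powr (- r)\<bar> = \<bar>w\<^sup>2 - \<sigma>\<^sup>2 * z powr (2 * p)\<bar> / z\<^sup>2" by simp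
    also have "\<dots> \<le> \<bar>w\<^sup>2 - \<sigma>\<^sup>2 * z powr (2 * p)\<bar> / \<epsilon>\<^sup>2"
      using z \<epsilon> by (intro divide_left_mono power_mono mult_pos_pos zero_less_power) auto
    finally show ?thesis .
  qed
  have ratio: "\<bar>\<mu> * y / z\<bar> \<le> b"
  proof -
    have "\<bar>\<mu> * y / z\<bar> = \<bar>\<mu>\<bar> * y / z" using z y by (simp add: abs_mult)
    also have "\<dots> \<le> \<bar>\<mu>\<bar> * K / \<epsilon>" using z y \<epsilon> by (intro frac_le mult_left_mono) auto
    finally show ?thesis by (simp add: b_def)
  qed
  have "\<bar>\<mu> * y / z\<bar>\<^sup>2 \<le> b\<^sup>2" using ratio by (intro power_mono) auto
  then have sq: "(\<mu> * y / z)\<^sup>2 \<le> b\<^sup>2" by (simp only: power2_abs)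
  have cube1: "(\<bar>\<mu> * y / z\<bar> * h) ^ 3 \<le> b ^ 3 * h\<^sup>2"
  proof -
    have "(\<bar>\<mu> * y / z\<bar> * h) ^ 3 \<le> (b * h) ^ 3"
      using ratio h_pos by (intro power_mono mult_right_mono) auto
    also have "\<dots> = b ^ 3 * (h\<^sup>2 * h)" by (simp add: power_mult_distrib power2_eq_square power3_eq_cube)
    also have "\<dots> \<le> b ^ 3 * (h\<^sup>2 * 1)" using b h_le_1 h_pos by (intro mult_left_mono) auto
    finally show ?thesis by simp
  qed
  have cube2: "(\<bar>w / z\<bar> * sqrt h) ^ 3 \<le> e * (h * w\<^sup>2) / \<epsilon> ^ 3"
  proof -
    have w: "\<bar>w\<bar> \<le> c" using v_le[OF ab(1)] by (simp add: w_def)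
    have "(\<bar>w / z\<bar> * sqrt h) ^ 3 = (\<bar>w\<bar> * sqrt h) ^ 3 / z ^ 3"
      using z by (simp add: power_divide abs_divide)
    also have "\<dots> \<le> (\<bar>w\<bar> * sqrt h) ^ 3 / \<epsilon> ^ 3"
      using z \<epsilon> h_pos by (intro divide_left_mono power_mono mult_pos_pos zero_less_power) auto
    also have "\<dots> = (\<bar>w\<bar> * sqrt h) * (h * w\<^sup>2) / \<epsilon> ^ 3"
    proof -
      have "(\<bar>w\<bar> * sqrt h) ^ 3 = (\<bar>w\<bar> * sqrt h) * ((sqrt h * sqrt h) * (\<bar>w\<bar> * \<bar>w\<bar>))"
        by (simp only: power3_eq_cube mult_ac)
      also have "\<dots> = (\<bar>w\<bar> * sqrt h) * (h * w\<^sup>2)"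
        using h_pos by (simp add: power2_eq_square)
      finally show ?thesis by simp
    qed
    also have "\<dots> \<le> e * (h * w\<^sup>2) / \<epsilon> ^ 3"
    proof (intro divide_right_mono mult_right_mono)
      have "\<bar>w\<bar> * sqrt h \<le> c * sqrt h" using w h_pos by (intro mult_right_mono) auto
      then show "\<bar>w\<bar> * sqrt h \<le> e" using c_h by simp
    qed (use h_pos \<epsilon> in auto)
    finally show ?thesis .
  qed
  have m1: "min 1 (z powr (r * 0)) * ((\<bar>\<mu> * y / z\<bar> * h) ^ 3 + (\<bar>w / z\<bar> * sqrt h) ^ 3)
      \<le> 1 * (b ^ 3 * h\<^sup>2 + e * (h * w\<^sup>2) / \<epsilon> ^ 3)"
    using cube1 cube2 h_pos by (intro mult_mono add_mono) auto
  have "min 1 (z powr (r * 0)) * ((\<bar>\<mu> * y / z\<bar> * h) ^ 3 + (\<bar>w / z\<bar> * sqrt h) ^ 3)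
      + (\<bar>\<mu> * y / z\<bar> * h) ^ 3 + (\<bar>w / z\<bar> * sqrt h) ^ 3 \<le> 2 * (b ^ 3 * h\<^sup>2 + e * (h * w\<^sup>2) / \<epsilon> ^ 3)"
  proof -
    have "q1 + q2 + q3 \<le> 2 * (q4 + q5)" if "q1 \<le> 1 * (q4 + q5)" "q2 \<le> q4" "q3 \<le> q5" for q1 q2 q3 q4 q5 :: real
      using add_mono[OF that(1) add_mono[OF that(2,3)]] by (simp add: add.assoc)
    from this[OF m1 cube1 cube2] show ?thesis .
  qed
  note third = mult_left_mono[OF this L]
  have parts: "h * \<bar>\<mu> * y / z - \<mu>\<bar> \<le> h * (\<bar>\<mu>\<bar> * \<bar>y - z\<bar> / \<epsilon>)"
    "2 * h * \<bar>(w / z)\<^sup>2 - \<sigma>\<^sup>2 * z powr (- r)\<bar> \<le> 2 * h * (\<bar>w\<^sup>2 - \<sigma>\<^sup>2 * z powr (2 * p)\<bar> / \<epsilon>\<^sup>2)"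
    "2 * h\<^sup>2 * (\<mu> * y / z)\<^sup>2 \<le> 2 * h\<^sup>2 * b\<^sup>2"
    by (rule mult_left_mono[OF drift], use h_pos in simp, rule mult_left_mono[OF diffusion], use h_pos in simp,
        rule mult_left_mono[OF sq], simp)
  have "step_error L 0 3 h z (\<mu> * y / z) (w / z) \<le>
      h * (\<bar>\<mu>\<bar> * \<bar>y - z\<bar> / \<epsilon>) + 2 * h * (\<bar>w\<^sup>2 - \<sigma>\<^sup>2 * z powr (2 * p)\<bar> / \<epsilon>\<^sup>2) + 2 * h\<^sup>2 * b\<^sup>2
      + L * (2 * (b ^ 3 * h\<^sup>2 + e * (h * w\<^sup>2) / \<epsilon> ^ 3)) + (\<alpha> * h)\<^sup>2"
    unfolding step_error_def by (intro add_mono parts third order_refl)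
  also have "\<dots> = h * (\<bar>\<mu>\<bar> * \<bar>y - z\<bar> / \<epsilon> + 2 * \<bar>w\<^sup>2 - \<sigma>\<^sup>2 * z powr (2 * p)\<bar> / \<epsilon>\<^sup>2)
      + h\<^sup>2 * (2 * b\<^sup>2 + 2 * L * b ^ 3 + \<alpha>\<^sup>2) + 2 * L / \<epsilon> ^ 3 * e * (h * w\<^sup>2)"
  proof -
    have "h * a1 + 2 * h * (a2 / a3) + 2 * h\<^sup>2 * b2 + L * (2 * (b3 * h\<^sup>2 + q / a4)) + (\<alpha> * h)\<^sup>2
        = h * (a1 + 2 * a2 / a3) + h\<^sup>2 * (2 * b2 + 2 * L * b3 + \<alpha>\<^sup>2) + 2 * L / a4 * q"
      for a1 a2 a3 a4 b2 b3 q :: real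
      by (simp add: distrib_left power_mult_distrib mult_ac)
    then show ?thesis by (simp only: mult.assoc[of _ e])
  qed
  finally show ?thesis by (simp only: defect_def z_def y_def w_def)
qed

lemma scheme_expectation:
  fixes C :: real
  defines "L \<equiv> error_constant 3 C"
  defines "b \<equiv> \<bar>\<mu>\<bar> * K / \<epsilon>"
  assumes C: "Taylor_constant 0 3 C"
  shows "\<bar>expectation Y - \<phi> x\<bar> \<le> expectation total_defect
      + e * (T * (2 * b\<^sup>2 + 2 * L * b ^ 3 + \<alpha>\<^sup>2) + 2 * L / \<epsilon> ^ 3 * Q)"
    and "integrable M Y"
proof -
  have L: "L \<ge> 0" unfolding L_def using C by (intro error_constant_nonneg) (simp add: Taylor_constant_def)
  define Bq where "Bq = (\<lambda>i \<omega>. \<mu> * X (real i * h) \<omega> / Z i \<omega>)"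
  define Hq where "Hq = (\<lambda>i \<omega>. v i \<omega> / Z i \<omega>)"
  have BqF: "Bq i \<in> borel_measurable (F (real i * h))" and HqF: "Hq i \<in> borel_measurable (F (real i * h))" for i
    unfolding Bq_def Hq_def using X_F[of i] Z_F[of i] v_F[of i] by measurable
  define D where "D = max (\<epsilon> powr (- r)) (max b (c / \<epsilon>))"
  have bdd: "Z i \<omega> > 0 \<and> Z i \<omega> powr (- r) \<le> D \<and> \<bar>Bq i \<omega>\<bar> \<le> D \<and> \<bar>Hq i \<omega>\<bar> \<le> D" if "\<omega> \<in> A i" for i \<omega>
  proof -
    note ab = A_bounds[OF that]
    have "Z i \<omega> powr (- r) \<le> \<epsilon> powr (- r)" using ab \<epsilon> r by (intro powr_mono2') auto
    moreover have "\<bar>Bq i \<omega>\<bar> \<le> b"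
    proof -
      have "\<bar>Bq i \<omega>\<bar> = \<bar>\<mu>\<bar> * X (real i * h) \<omega> / Z i \<omega>" using ab \<epsilon> by (simp add: Bq_def abs_mult)
      also have "\<dots> \<le> b" unfolding b_def using ab \<epsilon> by (intro frac_le mult_left_mono) auto
      finally show ?thesis .
    qed
    moreover have "\<bar>Hq i \<omega>\<bar> \<le> c / \<epsilon>"
    proof -
      have "\<bar>Hq i \<omega>\<bar> = \<bar>v i \<omega>\<bar> / Z i \<omega>" using ab \<epsilon> by (simp add: Hq_def)
      also have "\<dots> \<le> c / \<epsilon>" using ab \<epsilon> v_le[OF ab(1), of i] abs_ge_zero[of "v i \<omega>"]
        by (intro frac_le) linarith+
      finally show ?thesis .
    qed
    ultimately show ?thesis using ab \<epsilon> by (simp add: D_def le_max_iff_disj)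
  qed
  have step: "Z (Suc i) \<omega> = Z i \<omega> + Z i \<omega> * (Bq i \<omega> * h + Hq i \<omega> * sqrt h * noise i \<omega>)" if "\<omega> \<in> A i" for i \<omega>
    using Z_step[OF that] by (simp only: Bq_def Hq_def)
  have Z0: "Z 0 \<omega> = x" for \<omega> by (simp add: Z_def)
  have Dyn: "\<bar>expectation Y - \<phi> x\<bar>
     \<le> (\<Sum>i<n. exp (- \<alpha> * h * real i) * expectation (\<lambda>\<omega>. indicator (A i) \<omega> * step_error L 0 3 h (Z i \<omega>) (Bq i \<omega>) (Hq i \<omega>)))"
    and Y_int: "integrable M Y"
    unfolding L_def Y_def stop_def
    by (rule discounted_Dynkin[OF C prob_space_axioms, where \<xi> = noise and G = "\<lambda>i. F (real i * h)" and D = D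
          and A = A and Z = Z and B = Bq and H = Hq and n = n and \<Delta> = h and x = x];
        (rule sub noise_indep noise_distributed A_F Z_F BqF HqF bdd h_pos A_decr Z0 step | assumption)+)+
  show "integrable M Y" by (rule Y_int)
  define k1 where "k1 = 2 * b\<^sup>2 + 2 * L * b ^ 3 + \<alpha>\<^sup>2"
  define k2 where "k2 = 2 * L / \<epsilon> ^ 3"
  have b: "b \<ge> 0" using K \<epsilon> by (simp add: b_def)
  have k: "k1 \<ge> 0" "k2 \<ge> 0" using L b \<epsilon> by (auto simp: k1_def k2_def)
  define W where "W = (\<lambda>i \<omega>. of_bool (\<omega> \<in> A i) * defect i \<omega> + h\<^sup>2 * k1 + k2 * e * (of_bool (\<omega> \<in> A i) * (h * (v i \<omega>)\<^sup>2)))"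
  have W_nonneg: "0 \<le> W i \<omega>" for i \<omega>
    unfolding W_def using k e h_pos defect_nonneg[of i \<omega>]
    by (intro add_nonneg_nonneg mult_nonneg_nonneg) auto
  have W_sum: "(\<Sum>i<n. W i \<omega>) = total_defect \<omega> + T * h * k1 + k2 * e * (\<Sum>i<n. of_bool (\<omega> \<in> A i) * (h * (v i \<omega>)\<^sup>2))" for \<omega>
  proof -
    have "(\<Sum>i<n. h\<^sup>2 * k1) = T * h * k1" by (simp flip: mult.assoc add: nh power2_eq_square)
    then show ?thesis by (simp only: W_def total_defect_def sum.distrib sum_distrib_left[symmetric])
  qed
  have W_M [measurable]: "W i \<in> borel_measurable M" for i
    unfolding W_def defect_def of_bool_def by measurable
  have sum_le: "(\<Sum>i<n. W i \<omega>) \<le> total_defect \<omega> + e * (T * k1 + k2 * Q)" for \<omega>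
  proof -
    have "T * h * k1 \<le> T * e * k1" using T h_le k by (intro mult_right_mono mult_left_mono) auto
    moreover have "k2 * e * (\<Sum>i<n. of_bool (\<omega> \<in> A i) * (h * (v i \<omega>)\<^sup>2)) \<le> k2 * e * Q"
      using k e by (intro mult_left_mono stopped_v_sum) auto
    ultimately show ?thesis unfolding W_sum by (simp add: distrib_left mult_ac)
  qed
  define top where "top = T * (\<bar>\<mu>\<bar> * (2 * K + 1) / \<epsilon> + 2 * \<sigma>\<^sup>2 * (K + 1) powr (2 * p) / \<epsilon>\<^sup>2) + 2 * Q / \<epsilon>\<^sup>2"
  have td_int: "integrable M total_defect"
    by (rule integrable_const_bound[where B = top])
      (use total_defect_nonneg total_defect_bound in \<open>auto simp: top_def\<close>)
  have W_int: "integrable M (W i)" if "i < n" for i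
  proof (rule integrable_const_bound[where B = "top + e * (T * k1 + k2 * Q)"])
    show "AE \<omega> in M. norm (W i \<omega>) \<le> top + e * (T * k1 + k2 * Q)"
    proof (intro AE_I2)
      fix \<omega>
      have "W i \<omega> \<le> (\<Sum>i<n. W i \<omega>)" using that W_nonneg by (intro member_le_sum) auto
      also have "\<dots> \<le> top + e * (T * k1 + k2 * Q)"
        using sum_le[of \<omega>] total_defect_bound[of \<omega>] by (simp add: top_def)
      finally show "norm (W i \<omega>) \<le> top + e * (T * k1 + k2 * Q)" using W_nonneg[of i \<omega>] by simp
    qed
  qed simp
  have one: "expectation (\<lambda>\<omega>. indicator (A i) \<omega> * step_error L 0 3 h (Z i \<omega>) (Bq i \<omega>) (Hq i \<omega>)) \<le> expectation (W i)"
    if "i < n" for i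
  proof (rule integral_mono'[OF W_int[OF that]])
    fix \<omega>
    show "0 \<le> W i \<omega>" by (rule W_nonneg)
    show "indicator (A i) \<omega> * step_error L 0 3 h (Z i \<omega>) (Bq i \<omega>) (Hq i \<omega>) \<le> W i \<omega>"
    proof (cases "\<omega> \<in> A i")
      case True
      from scheme_step_error[OF this L] show ?thesis
        using True by (simp add: W_def Bq_def Hq_def k1_def k2_def b_def)
    qed (use W_nonneg[of i \<omega>] in simp)
  qed
  have "(\<Sum>i<n. exp (- \<alpha> * h * real i) * expectation (\<lambda>\<omega>. indicator (A i) \<omega> * step_error L 0 3 h (Z i \<omega>) (Bq i \<omega>) (Hq i \<omega>)))
      \<le> (\<Sum>i<n. expectation (W i))"
  proof (intro sum_mono)
    fix i assume i: "i \<in> {..<n}"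
    have "0 \<le> \<alpha> * h * real i" using \<alpha>_pos h_pos by simp
    then have ex: "exp (- \<alpha> * h * real i) \<le> 1" by simp
    have "exp (- \<alpha> * h * real i) * expectation (\<lambda>\<omega>. indicator (A i) \<omega> * step_error L 0 3 h (Z i \<omega>) (Bq i \<omega>) (Hq i \<omega>))
       \<le> exp (- \<alpha> * h * real i) * expectation (W i)" using one i by (intro mult_left_mono) auto
    also have "\<dots> \<le> 1 * expectation (W i)"
      using ex W_nonneg by (intro mult_right_mono integral_nonneg) auto
    finally show "exp (- \<alpha> * h * real i) * expectation (\<lambda>\<omega>. indicator (A i) \<omega> * step_error L 0 3 h (Z i \<omega>) (Bq i \<omega>) (Hq i \<omega>))
       \<le> expectation (W i)" by simp
  qed
  also have "\<dots> = expectation (\<lambda>\<omega>. \<Sum>i<n. W i \<omega>)" using W_int by (simp add: Bochner_Integration.integral_sum)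
  also have "\<dots> \<le> expectation (\<lambda>\<omega>. total_defect \<omega> + e * (T * k1 + k2 * Q))"
    using W_int td_int sum_le by (intro integral_mono) auto
  also have "\<dots> = expectation total_defect + e * (T * k1 + k2 * Q)" using td_int by (simp add: prob_space)
  finally show "\<bar>expectation Y - \<phi> x\<bar> \<le> expectation total_defect
      + e * (T * (2 * b\<^sup>2 + 2 * L * b ^ 3 + \<alpha>\<^sup>2) + 2 * L / \<epsilon> ^ 3 * Q)"
    using Dyn by (simp add: k1_def k2_def)
qed

text \<open>
  The mean-square distance between \<open>v\<close> and the true coefficient is at most \<open>e\<close>. Differences of squares
  are handled by \<open>2 a b \<le> s a\<^sup>2 + b\<^sup>2 / s\<close> with \<open>s = sqrt e\<close>, which balances the two terms.
\<close>

lemma total_defect_le: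
  assumes \<omega>: "\<omega> \<in> space M" "\<omega> \<notin> Bad" and d: "\<And>i. i < n \<Longrightarrow> \<bar>X (real i * h) \<omega> - Z i \<omega>\<bar> \<le> d"
  shows "total_defect \<omega> \<le> T * (\<bar>\<mu>\<bar> / \<epsilon> + 4 * p * \<sigma>\<^sup>2 * (K + 1) powr (2 * p - 1) / \<epsilon>\<^sup>2) * d
     + sqrt e * (2 / \<epsilon>\<^sup>2 * (2 + T * (\<sigma>\<^sup>2 * K powr (2 * p))))"
proof -
  define s where "s = sqrt e"
  have s: "s > 0" "s * s = e" "s \<le> 1" using e by (auto simp: s_def)
  define Hv where "Hv = (\<lambda>i. \<sigma> * X (real i * h) \<omega> powr p)"
  define g where "g = \<bar>\<mu>\<bar> / \<epsilon> + 4 * p * \<sigma>\<^sup>2 * (K + 1) powr (2 * p - 1) / \<epsilon>\<^sup>2"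
  define N2 where "N2 = \<sigma>\<^sup>2 * K powr (2 * p)"
  have d_nn: "0 \<le> d" using d[OF n_pos] abs_ge_zero order_trans by blast
  have g_nn: "g \<ge> 0" unfolding g_def using \<epsilon> p by simp
  have N2_nn: "N2 \<ge> 0" by (simp add: N2_def)
  have one: "of_bool (\<omega> \<in> A i) * defect i \<omega>
      \<le> h * (g * d) + 2 / \<epsilon>\<^sup>2 * ((1 + 1 / s) * (h * (v i \<omega> - Hv i)\<^sup>2) + h * (s * N2))" if i: "i < n" for i
  proof (cases "\<omega> \<in> A i")
    case True
    note ab = A_bounds[OF True]
    define y where "y = X (real i * h) \<omega>"
    define z where "z = Z i \<omega>"
    define u where "u = v i \<omega> - Hv i"
    have y: "0 \<le> y" "y \<le> K" and z: "0 \<le> z" "z \<le> K + 1" using ab \<epsilon> by (auto simp: y_def z_def)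
    have yz: "\<bar>y - z\<bar> \<le> d" using d[OF i] by (simp add: y_def z_def)
    have Hv2: "(Hv i)\<^sup>2 = \<sigma>\<^sup>2 * y powr (2 * p)"
      by (simp add: Hv_def y_def power_mult_distrib power2_eq_square[of "_ powr _"] powr_add[symmetric])
    have Hv2_le: "(Hv i)\<^sup>2 \<le> N2" unfolding Hv2 N2_def using y p by (intro mult_left_mono powr_mono2) auto
    have young: "2 * \<bar>Hv i\<bar> * \<bar>u\<bar> \<le> s * (Hv i)\<^sup>2 + u\<^sup>2 / s"
    proof -
      have "0 \<le> (s * \<bar>Hv i\<bar> - \<bar>u\<bar>)\<^sup>2 / s" using s by simp
      also have "\<dots> = s * (Hv i)\<^sup>2 - 2 * \<bar>Hv i\<bar> * \<bar>u\<bar> + u\<^sup>2 / s"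
      proof -
        have "(s * a - b) * (s * a - b) / s = s * (a * a) - 2 * a * b + b * b / s" for a b
          using s(1) by (simp add: field_simps)
        from this[of "\<bar>Hv i\<bar>" "\<bar>u\<bar>"] show ?thesis by (simp add: power2_eq_square)
      qed
      finally show ?thesis by linarith
    qed
    have "(v i \<omega>)\<^sup>2 - (Hv i)\<^sup>2 = u\<^sup>2 + 2 * Hv i * u" by (simp add: u_def power2_eq_square algebra_simps)
    then have "\<bar>(v i \<omega>)\<^sup>2 - (Hv i)\<^sup>2\<bar> \<le> u\<^sup>2 + 2 * \<bar>Hv i\<bar> * \<bar>u\<bar>"
      using abs_triangle_ineq[of "u\<^sup>2" "2 * Hv i * u"] by (simp add: abs_mult)
    also have "\<dots> \<le> (1 + 1 / s) * u\<^sup>2 + s * N2"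
    proof -
      have "s * (Hv i)\<^sup>2 \<le> s * N2" using Hv2_le s by (intro mult_left_mono) auto
      then show ?thesis using young by (simp add: distrib_right)
    qed
    finally have dv: "\<bar>(v i \<omega>)\<^sup>2 - \<sigma>\<^sup>2 * y powr (2 * p)\<bar> \<le> (1 + 1 / s) * u\<^sup>2 + s * N2" by (simp only: Hv2)
    have dz: "\<bar>\<sigma>\<^sup>2 * y powr (2 * p) - \<sigma>\<^sup>2 * z powr (2 * p)\<bar> \<le> \<sigma>\<^sup>2 * (2 * p * (K + 1) powr (2 * p - 1) * d)"
    proof -
      have "\<bar>y powr (2 * p) - z powr (2 * p)\<bar> \<le> 2 * p * (K + 1) powr (2 * p - 1) * \<bar>y - z\<bar>"
        using y z p by (intro powr_diff_le) auto
      also have "\<dots> \<le> 2 * p * (K + 1) powr (2 * p - 1) * d" using yz p by (intro mult_left_mono) auto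
      finally have "\<sigma>\<^sup>2 * \<bar>y powr (2 * p) - z powr (2 * p)\<bar> \<le> \<sigma>\<^sup>2 * (2 * p * (K + 1) powr (2 * p - 1) * d)"
        by (intro mult_left_mono) auto
      then show ?thesis by (simp add: right_diff_distrib[symmetric] abs_mult)
    qed
    have dd: "\<bar>(v i \<omega>)\<^sup>2 - \<sigma>\<^sup>2 * z powr (2 * p)\<bar>
        \<le> (1 + 1 / s) * u\<^sup>2 + s * N2 + \<sigma>\<^sup>2 * (2 * p * (K + 1) powr (2 * p - 1) * d)"
      using dv dz by linarith
    have "\<bar>\<mu>\<bar> * \<bar>y - z\<bar> / \<epsilon> \<le> \<bar>\<mu>\<bar> * d / \<epsilon>" using yz \<epsilon> by (intro divide_right_mono mult_left_mono) auto
    moreover have "2 * \<bar>(v i \<omega>)\<^sup>2 - \<sigma>\<^sup>2 * z powr (2 * p)\<bar> / \<epsilon>\<^sup>2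
        \<le> 2 * ((1 + 1 / s) * u\<^sup>2 + s * N2 + \<sigma>\<^sup>2 * (2 * p * (K + 1) powr (2 * p - 1) * d)) / \<epsilon>\<^sup>2"
      using dd by (intro divide_right_mono mult_left_mono) auto
    ultimately have "defect i \<omega> \<le> h * (\<bar>\<mu>\<bar> * d / \<epsilon> +
        2 * ((1 + 1 / s) * u\<^sup>2 + s * N2 + \<sigma>\<^sup>2 * (2 * p * (K + 1) powr (2 * p - 1) * d)) / \<epsilon>\<^sup>2)"
      unfolding defect_def y_def[symmetric] z_def[symmetric] using h_pos by (intro mult_left_mono add_mono) auto
    also have "\<dots> = h * (g * d) + 2 / \<epsilon>\<^sup>2 * ((1 + 1 / s) * (h * u\<^sup>2) + h * (s * N2))"
    proof -
      have "h * (m * d / \<epsilon> + 2 * (u + q + k * (2 * p * l * d)) / j)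
          = h * ((m / \<epsilon> + 4 * p * k * l / j) * d) + 2 / j * (h * u + h * q)" for m u q k l j :: real
        by (simp add: distrib_left distrib_right add_divide_distrib mult_ac)
      from this[of "\<bar>\<mu>\<bar>" "(1 + 1 / s) * u\<^sup>2" "s * N2" "\<sigma>\<^sup>2" "(K + 1) powr (2 * p - 1)" "\<epsilon>\<^sup>2"]
      show ?thesis by (simp only: g_def mult.left_commute[of h "1 + 1 / s"])
    qed
    finally show ?thesis using True by (simp add: u_def)
  next
    case False
    have "0 \<le> (1 + 1 / s) * (h * (v i \<omega> - Hv i)\<^sup>2) + h * (s * N2)"
      using s h_pos N2_nn by (intro add_nonneg_nonneg mult_nonneg_nonneg) auto
    then show ?thesis using False h_pos g_nn d_nn by simp
  qed
  have "total_defect \<omega> \<le> (\<Sum>i<n. h * (g * d) + 2 / \<epsilon>\<^sup>2 * ((1 + 1 / s) * (h * (v i \<omega> - Hv i)\<^sup>2) + h * (s * N2)))"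
    unfolding total_defect_def using one by (intro sum_mono) auto
  also have "\<dots> = T * (g * d) + 2 / \<epsilon>\<^sup>2 * ((1 + 1 / s) * (\<Sum>i<n. h * (v i \<omega> - Hv i)\<^sup>2) + T * (s * N2))"
  proof -
    have "(\<Sum>i<n. h * (g * d)) = T * (g * d)" "(\<Sum>i<n. h * (s * N2)) = T * (s * N2)"
      by (simp_all flip: mult.assoc add: nh)
    then show ?thesis by (simp only: sum.distrib sum_distrib_left[symmetric])
  qed
  also have "\<dots> \<le> T * (g * d) + 2 / \<epsilon>\<^sup>2 * ((1 + 1 / s) * e + T * (s * N2))"
    using v_close[OF \<omega>] s by (intro add_left_mono mult_left_mono add_right_mono) (auto simp: Hv_def)
  finally have sum_bound: "total_defect \<omega> \<le> T * (g * d) + 2 / \<epsilon>\<^sup>2 * ((1 + 1 / s) * e + T * (s * N2))" .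
  have "(1 + 1 / s) * e \<le> 2 * s"
  proof -
    have "(1 + 1 / s) * e = s * s + s" using s(1) by (simp add: s(2)[symmetric] distrib_right)
    also have "\<dots> \<le> 1 * s + s" using s by (intro add_right_mono mult_right_mono) auto
    finally show ?thesis by simp
  qed
  then have "2 / \<epsilon>\<^sup>2 * ((1 + 1 / s) * e + T * (s * N2)) \<le> 2 / \<epsilon>\<^sup>2 * (2 * s + T * (s * N2))"
    by (intro mult_left_mono add_right_mono) auto
  with sum_bound have "total_defect \<omega> \<le> T * (g * d) + 2 / \<epsilon>\<^sup>2 * (2 * s + T * (s * N2))" by simp
  also have "\<dots> = T * g * d + s * (2 / \<epsilon>\<^sup>2 * (2 + T * N2))"
    by (simp add: distrib_left add_divide_distrib mult_ac)
  finally show ?thesis by (simp only: g_def s_def N2_def)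
qed

lemma scheme_close:
  assumes \<omega>: "\<omega> \<in> space M" "\<omega> \<notin> Bad"
    and eq: "\<And>t. t \<ge> 0 \<Longrightarrow> X t \<omega> = x + (LINT s:{0..t}|lborel. \<mu> * X s \<omega>) + I t \<omega>"
    and osc: "\<And>s t. 0 \<le> s \<Longrightarrow> s \<le> T \<Longrightarrow> 0 \<le> t \<Longrightarrow> t \<le> T \<Longrightarrow> \<bar>s - t\<bar> \<le> h \<Longrightarrow> \<bar>X s \<omega> - X t \<omega>\<bar> \<le> d"
    and i: "i \<le> n"
  shows "\<bar>X (real i * h) \<omega> - Z i \<omega>\<bar> \<le> T * \<bar>\<mu>\<bar> * d + e"
proof -
  have iT: "real i * h \<le> T" using grid_mono[OF i] nh by simp
  have d: "0 \<le> d" using osc[of 0 0] T h_pos by simp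
  have "continuous_on {0..} (\<lambda>t. X t \<omega>)" using X_cont \<omega> by (simp add: continuous_paths_def)
  then have c: "continuous_on {0..real i * h} (\<lambda>s. \<mu> * X s \<omega>)"
    by (intro continuous_intros continuous_on_subset[where s = "{0..}" and t = "{0..real i * h}"]) auto
  have "\<bar>(LINT s:{0..real i * h}|lborel. \<mu> * X s \<omega>) - (\<Sum>l<i. h * (\<mu> * X (real l * h) \<omega>))\<bar> \<le> real i * h * (\<bar>\<mu>\<bar> * d)"
  proof (rule left_Riemann_error[OF h_pos c])
    fix s t assume "0 \<le> s" "s \<le> real i * h" "0 \<le> t" "t \<le> real i * h" "\<bar>s - t\<bar> \<le> h"
    then have "\<bar>X s \<omega> - X t \<omega>\<bar> \<le> d" using iT by (intro osc) auto
    then have "\<bar>\<mu>\<bar> * \<bar>X s \<omega> - X t \<omega>\<bar> \<le> \<bar>\<mu>\<bar> * d" by (intro mult_left_mono) auto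
    then show "\<bar>\<mu> * X s \<omega> - \<mu> * X t \<omega>\<bar> \<le> \<bar>\<mu>\<bar> * d" by (simp add: right_diff_distrib[symmetric] abs_mult)
  qed
  also have "\<dots> \<le> T * (\<bar>\<mu>\<bar> * d)" using iT d by (intro mult_right_mono) auto
  finally have 1: "\<bar>(LINT s:{0..real i * h}|lborel. \<mu> * X s \<omega>) - (\<Sum>l<i. h * (\<mu> * X (real l * h) \<omega>))\<bar> \<le> T * \<bar>\<mu>\<bar> * d"
    by simp
  have "Z i \<omega> = x + (\<Sum>l<i. h * (\<mu> * X (real l * h) \<omega>))
      + (\<Sum>l<i. v l \<omega> * (B (real (Suc l) * h) \<omega> - B (real l * h) \<omega>))"
    unfolding Z_def by (simp add: sum.distrib mult_ac)
  then show ?thesis using eq[OF grid_nonneg[of i]] 1 I_close[OF \<omega> i] by linarith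
qed

text \<open>
  Under the hypotheses the bounds \<open>K\<close>, \<open>K + 1\<close> and \<open>Q\<close> are never the reason for stopping.
\<close>

lemma scheme_bracket:
  assumes \<omega>: "\<omega> \<in> space M" "\<omega> \<notin> Bad" and x: "2 * \<epsilon> < x" "X 0 \<omega> = x"
    and XK: "\<And>t. 0 \<le> t \<Longrightarrow> t \<le> T \<Longrightarrow> X t \<omega> \<le> K"
    and osc: "\<And>s t. 0 \<le> s \<Longrightarrow> s \<le> T \<Longrightarrow> 0 \<le> t \<Longrightarrow> t \<le> T \<Longrightarrow> \<bar>s - t\<bar> \<le> h \<Longrightarrow> \<bar>X s \<omega> - X t \<omega>\<bar> \<le> \<epsilon> / 4"
    and close: "\<And>i. i \<le> n \<Longrightarrow> \<bar>X (real i * h) \<omega> - Z i \<omega>\<bar> \<le> min (\<epsilon> / 4) 1"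
  shows "\<phi> \<epsilon> * discount \<alpha> (hitting_time 0 (\<lambda>t. X t \<omega>)) - exp (- \<alpha> * T) \<le> Y \<omega>"
    and "Y \<omega> \<le> discount \<alpha> (hitting_time (2 * \<epsilon>) (\<lambda>t. X t \<omega>)) + exp (- \<alpha> * T)"
proof -
  have cont: "continuous_on {0..} (\<lambda>t. X t \<omega>)" using X_cont \<omega> by (simp add: continuous_paths_def)
  define N where "N = stop \<omega>"
  have N_le: "N \<le> n" unfolding N_def stop_def by (rule Least_le) simp
  have N: "N = n \<or> \<omega> \<notin> A N" unfolding N_def stop_def by (rule LeastI[of _ n]) simp
  have before: "i < N \<Longrightarrow> \<omega> \<in> A i" for i
    unfolding N_def stop_def using not_less_Least[of i "\<lambda>i. i = n \<or> \<omega> \<notin> A i"] by blast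
  have XK': "X (real i * h) \<omega> \<le> K" if "i \<le> n" for i
    using XK[OF grid_nonneg[of i]] grid_mono[OF that] nh by simp
  have v_sum: "(\<Sum>l<n. h * (v l \<omega>)\<^sup>2) \<le> Q"
  proof -
    define Hv where "Hv = (\<lambda>i. \<sigma> * X (real i * h) \<omega> powr p)"
    have "h * (v l \<omega>)\<^sup>2 \<le> 2 * (h * (v l \<omega> - Hv l)\<^sup>2) + h * (2 * (\<sigma>\<^sup>2 * K powr (2 * p)))" if "l < n" for l
    proof -
      have "(Hv l)\<^sup>2 = \<sigma>\<^sup>2 * X (real l * h) \<omega> powr (2 * p)"
        by (simp add: Hv_def power_mult_distrib power2_eq_square[of "_ powr _"] powr_add[symmetric])
      also have "\<dots> \<le> \<sigma>\<^sup>2 * K powr (2 * p)"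
        using XK'[of l] that X_nonneg[OF grid_nonneg \<omega>(1)] p by (intro mult_left_mono powr_mono2) auto
      finally have H2: "(Hv l)\<^sup>2 \<le> \<sigma>\<^sup>2 * K powr (2 * p)" .
      have "0 \<le> (v l \<omega> - 2 * Hv l)\<^sup>2" by simp
      then have "(v l \<omega>)\<^sup>2 \<le> 2 * (v l \<omega> - Hv l)\<^sup>2 + 2 * (Hv l)\<^sup>2"
        by (simp add: power2_eq_square algebra_simps)
      then have "(v l \<omega>)\<^sup>2 \<le> 2 * (v l \<omega> - Hv l)\<^sup>2 + 2 * (\<sigma>\<^sup>2 * K powr (2 * p))" using H2 by linarith
      then have "h * (v l \<omega>)\<^sup>2 \<le> h * (2 * (v l \<omega> - Hv l)\<^sup>2 + 2 * (\<sigma>\<^sup>2 * K powr (2 * p)))"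
        using h_pos by (intro mult_left_mono) auto
      then show ?thesis by (simp add: distrib_left mult_ac)
    qed
    then have "(\<Sum>l<n. h * (v l \<omega>)\<^sup>2) \<le> (\<Sum>l<n. 2 * (h * (v l \<omega> - Hv l)\<^sup>2) + h * (2 * (\<sigma>\<^sup>2 * K powr (2 * p))))"
      by (intro sum_mono) auto
    also have "\<dots> = 2 * (\<Sum>l<n. h * (v l \<omega> - Hv l)\<^sup>2) + T * (2 * (\<sigma>\<^sup>2 * K powr (2 * p)))"
    proof -
      have "(\<Sum>l<n. h * (2 * (\<sigma>\<^sup>2 * K powr (2 * p)))) = T * (2 * (\<sigma>\<^sup>2 * K powr (2 * p)))"
        by (simp flip: mult.assoc add: nh)
      then show ?thesis by (simp only: sum.distrib sum_distrib_left[symmetric])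
    qed
    also have "\<dots> \<le> 2 * 1 + T * (2 * (\<sigma>\<^sup>2 * K powr (2 * p)))"
      using v_close[OF \<omega>] e by (simp add: Hv_def)
    finally show ?thesis by (simp add: Q_def)
  qed
  have okk: "ok l \<omega>" if "l < n" "Z l \<omega> > \<epsilon>" for l
  proof -
    have "(\<Sum>j\<le>l. h * (v j \<omega>)\<^sup>2) \<le> (\<Sum>j<n. h * (v j \<omega>)\<^sup>2)"
      using that h_pos by (intro sum_mono2) auto
    moreover have "X (real l * h) \<omega> \<le> K" using XK' that by simp
    moreover have "Z l \<omega> \<le> K + 1" using close[of l] that \<open>X (real l * h) \<omega> \<le> K\<close> by auto
    ultimately show ?thesis using that v_sum by (simp add: ok_def)
  qed
  have above: "Z i \<omega> > \<epsilon>" if "i < N" for i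
    using A_bounds(2)[OF before[OF that]] .
  have stop_cond: "N = n \<or> Z N \<omega> \<le> \<epsilon>"
  proof (rule ccontr)
    assume c: "\<not> (N = n \<or> Z N \<omega> \<le> \<epsilon>)"
    then have Nn: "N < n" "Z N \<omega> > \<epsilon>" using N_le by auto
    have "ok l \<omega>" if "l \<le> N" for l
      using okk[of l] above[of l] Nn that by (cases "l = N") auto
    then have "\<omega> \<in> A N" using \<omega> by (simp add: A_def)
    then show False using N c by simp
  qed
  have cl: "\<bar>X (real i * h) \<omega> - Z i \<omega>\<bar> \<le> \<epsilon> / 4" if "i \<le> n" for i using close[OF that] by simp
  note pb = path_bracket[where u = "\<lambda>t. X t \<omega>" and z = "\<lambda>i. Z i \<omega>" and h = h and k = n and T = T and n = N and \<epsilon> = \<epsilon> and x = x,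
      OF cont x(2) \<epsilon> x(1) h_pos nh N_le cl osc above stop_cond]
  show "\<phi> \<epsilon> * discount \<alpha> (hitting_time 0 (\<lambda>t. X t \<omega>)) - exp (- \<alpha> * T) \<le> Y \<omega>"
    unfolding Y_def N_def[symmetric] by (rule pb(1))
  show "Y \<omega> \<le> discount \<alpha> (hitting_time (2 * \<epsilon>) (\<lambda>t. X t \<omega>)) + exp (- \<alpha> * T)"
    unfolding Y_def N_def[symmetric] by (rule pb(2))
qed

end

text \<open>
  What a scheme of accuracy \<open>e\<close> provides: \<open>Y\<close> is the discounted value of \<open>\<phi>\<close> at the moment of
  stopping, \<open>D\<close> bounds the distance to the diffusion, and \<open>h\<close> is the step. All bounds are expressed
  by one constant \<open>C\<close> that depends on neither \<open>e\<close> nor the path.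
\<close>

definition (in cev_laplace) tracks ::
  "'a measure \<Rightarrow> (real \<Rightarrow> 'a \<Rightarrow> real) \<Rightarrow> (real \<Rightarrow> 'a \<Rightarrow> real) \<Rightarrow> real \<Rightarrow> real \<Rightarrow> real \<Rightarrow> real \<Rightarrow> real \<Rightarrow> real \<Rightarrow>
   ('a \<Rightarrow> real) \<Rightarrow> ('a \<Rightarrow> real) \<Rightarrow> 'a set \<Rightarrow> real \<Rightarrow> bool" where
  "tracks M X I x T \<epsilon> K C e Y D Bad h \<longleftrightarrow>
     Y \<in> borel_measurable M \<and> D \<in> borel_measurable M \<and> Bad \<in> sets M \<and> measure M Bad < e \<and> h \<le> e \<and>
     (\<forall>\<omega>. 0 \<le> Y \<omega> \<and> Y \<omega> \<le> 1) \<and> (\<forall>\<omega>. 0 \<le> D \<omega> \<and> D \<omega> \<le> C) \<and>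
     \<bar>(\<integral>\<omega>. Y \<omega> \<partial>M) - \<phi> x\<bar> \<le> (\<integral>\<omega>. D \<omega> \<partial>M) + C * e \<and>
     (\<forall>\<omega>\<in>space M - Bad. \<forall>d.
        (\<forall>t\<ge>0. X t \<omega> = x + (LINT s:{0..t}|lborel. \<mu> * X s \<omega>) + I t \<omega>) \<longrightarrow>
        (\<forall>s\<in>{0..T}. \<forall>t\<in>{0..T}. \<bar>s - t\<bar> \<le> h \<longrightarrow> \<bar>X s \<omega> - X t \<omega>\<bar> \<le> d) \<longrightarrow>
          D \<omega> \<le> C * (d + sqrt e) \<and>
          (X 0 \<omega> = x \<longrightarrow> (\<forall>t\<in>{0..T}. X t \<omega> \<le> K) \<longrightarrow> d \<le> \<epsilon> / 4 \<longrightarrow> T * \<bar>\<mu>\<bar> * d + e \<le> min (\<epsilon> / 4) 1 \<longrightarrow>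
            \<phi> \<epsilon> * discount \<alpha> (hitting_time 0 (\<lambda>t. X t \<omega>)) - exp (- \<alpha> * T) \<le> Y \<omega> \<and>
            Y \<omega> \<le> discount \<alpha> (hitting_time (2 * \<epsilon>) (\<lambda>t. X t \<omega>)) + exp (- \<alpha> * T)))"

lemma (in cev_scheme) scheme_tracks:
  fixes C0 G C4 C :: real
  defines "G \<equiv> T * (\<bar>\<mu>\<bar> / \<epsilon> + 4 * p * \<sigma>\<^sup>2 * (K + 1) powr (2 * p - 1) / \<epsilon>\<^sup>2)"
  defines "C4 \<equiv> 2 / \<epsilon>\<^sup>2 * (2 + T * (\<sigma>\<^sup>2 * K powr (2 * p)))"
  assumes C0: "Taylor_constant 0 3 C0"
    and C1: "T * (2 * (\<bar>\<mu>\<bar> * K / \<epsilon>)\<^sup>2 + 2 * error_constant 3 C0 * (\<bar>\<mu>\<bar> * K / \<epsilon>) ^ 3 + \<alpha>\<^sup>2)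
       + 2 * error_constant 3 C0 / \<epsilon> ^ 3 * (2 + 2 * T * (\<sigma>\<^sup>2 * K powr (2 * p))) \<le> C"
    and C2: "T * (\<bar>\<mu>\<bar> * (2 * K + 1) / \<epsilon> + 2 * \<sigma>\<^sup>2 * (K + 1) powr (2 * p) / \<epsilon>\<^sup>2) + 2 * (2 + 2 * T * (\<sigma>\<^sup>2 * K powr (2 * p))) / \<epsilon>\<^sup>2 \<le> C"
    and C3: "G * (T * \<bar>\<mu>\<bar>) \<le> C" "G + C4 \<le> C" and x: "2 * \<epsilon> < x"
  shows "tracks M X I x T \<epsilon> K C e Y total_defect Bad h"
proof -
  have exp_bound: "\<bar>expectation Y - \<phi> x\<bar> \<le> expectation total_defect
      + e * (T * (2 * (\<bar>\<mu>\<bar> * K / \<epsilon>)\<^sup>2 + 2 * error_constant 3 C0 * (\<bar>\<mu>\<bar> * K / \<epsilon>) ^ 3 + \<alpha>\<^sup>2)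
       + 2 * error_constant 3 C0 / \<epsilon> ^ 3 * Q)"
    and Y_int: "integrable M Y"
    by (rule scheme_expectation[OF C0])+
  have Y01: "0 \<le> Y \<omega> \<and> Y \<omega> \<le> 1" for \<omega>
  proof -
    have "0 \<le> \<alpha> * h * real (stop \<omega>)" using \<alpha>_pos h_pos by simp
    then have "exp (- \<alpha> * h * real (stop \<omega>)) \<le> 1" by simp
    then show ?thesis unfolding Y_def using \<phi>_nonneg[of "Z (stop \<omega>) \<omega>"] \<phi>_le_1[of "Z (stop \<omega>) \<omega>"]
      by (auto intro: mult_le_one)
  qed
  have G: "G \<ge> 0" unfolding G_def using T \<epsilon> p by simp
  have C4: "C4 \<ge> 0" unfolding C4_def using T by simp
  have s: "e \<le> sqrt e" "0 \<le> sqrt e"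
  proof -
    have "sqrt e * sqrt e \<le> 1 * sqrt e" using e by (intro mult_right_mono) auto
    then show "e \<le> sqrt e" using e by simp
  qed (use e in simp)
  have mean: "\<bar>expectation Y - \<phi> x\<bar> \<le> expectation total_defect + C * e"
  proof -
    have "e * (T * (2 * (\<bar>\<mu>\<bar> * K / \<epsilon>)\<^sup>2 + 2 * error_constant 3 C0 * (\<bar>\<mu>\<bar> * K / \<epsilon>) ^ 3 + \<alpha>\<^sup>2)
       + 2 * error_constant 3 C0 / \<epsilon> ^ 3 * Q) \<le> e * C"
      unfolding Q_def using C1 e by (intro mult_left_mono) auto
    from order_trans[OF exp_bound add_left_mono[OF this]] show ?thesis by (simp only: mult.commute[of e C])
  qed
  have path: "total_defect \<omega> \<le> C * (d + sqrt e) \<and>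
          (X 0 \<omega> = x \<longrightarrow> (\<forall>t\<in>{0..T}. X t \<omega> \<le> K) \<longrightarrow> d \<le> \<epsilon> / 4 \<longrightarrow> T * \<bar>\<mu>\<bar> * d + e \<le> min (\<epsilon> / 4) 1 \<longrightarrow>
            \<phi> \<epsilon> * discount \<alpha> (hitting_time 0 (\<lambda>t. X t \<omega>)) - exp (- \<alpha> * T) \<le> Y \<omega> \<and>
            Y \<omega> \<le> discount \<alpha> (hitting_time (2 * \<epsilon>) (\<lambda>t. X t \<omega>)) + exp (- \<alpha> * T))"
    if \<omega>: "\<omega> \<in> space M" "\<omega> \<notin> Bad"
      and all_eq: "\<forall>t\<ge>0. X t \<omega> = x + (LINT s:{0..t}|lborel. \<mu> * X s \<omega>) + I t \<omega>"
      and all_osc: "\<forall>s\<in>{0..T}. \<forall>t\<in>{0..T}. \<bar>s - t\<bar> \<le> h \<longrightarrow> \<bar>X s \<omega> - X t \<omega>\<bar> \<le> d" for \<omega> d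
  proof -
    note eq = all_eq[rule_format] and osc = all_osc[rule_format]
    have d: "0 \<le> d" using osc[of 0 0] T h_pos by simp
    have close: "\<bar>X (real i * h) \<omega> - Z i \<omega>\<bar> \<le> T * \<bar>\<mu>\<bar> * d + e" if "i \<le> n" for i
      by (rule scheme_close[OF \<omega> eq _ that]) (auto intro: osc)
    have "total_defect \<omega> \<le> G * (T * \<bar>\<mu>\<bar> * d + e) + sqrt e * C4"
      unfolding G_def C4_def by (rule total_defect_le[OF \<omega>]) (rule close, simp)
    also have "\<dots> = (G * (T * \<bar>\<mu>\<bar>)) * d + G * e + C4 * sqrt e" by (simp add: distrib_left mult_ac)
    also have "\<dots> \<le> C * d + G * sqrt e + C4 * sqrt e"
      using C3(1) d s G by (intro add_mono mult_right_mono mult_left_mono order_refl) auto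
    also have "\<dots> = C * d + (G + C4) * sqrt e" by (simp add: distrib_right)
    also have "\<dots> \<le> C * d + C * sqrt e" using C3(2) s by (intro add_left_mono mult_right_mono) auto
    finally have D: "total_defect \<omega> \<le> C * (d + sqrt e)" by (simp add: distrib_left)
    have "\<phi> \<epsilon> * discount \<alpha> (hitting_time 0 (\<lambda>t. X t \<omega>)) - exp (- \<alpha> * T) \<le> Y \<omega> \<and>
            Y \<omega> \<le> discount \<alpha> (hitting_time (2 * \<epsilon>) (\<lambda>t. X t \<omega>)) + exp (- \<alpha> * T)"
      if x0: "X 0 \<omega> = x" and XK: "\<forall>t\<in>{0..T}. X t \<omega> \<le> K" and d4: "d \<le> \<epsilon> / 4" and dm: "T * \<bar>\<mu>\<bar> * d + e \<le> min (\<epsilon> / 4) 1"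
    proof -
      have 1: "X t \<omega> \<le> K" if "0 \<le> t" "t \<le> T" for t using XK that by auto
      have 2: "\<bar>X s \<omega> - X t \<omega>\<bar> \<le> \<epsilon> / 4" if "0 \<le> s" "s \<le> T" "0 \<le> t" "t \<le> T" "\<bar>s - t\<bar> \<le> h" for s t
        using osc[of s t] that d4 by auto
      have 3: "\<bar>X (real i * h) \<omega> - Z i \<omega>\<bar> \<le> min (\<epsilon> / 4) 1" if "i \<le> n" for i
        using close[OF that] dm by linarith
      from scheme_bracket[OF \<omega> x x0 1 2 3] show ?thesis by blast
    qed
    then show ?thesis using D by blast
  qed
  show ?thesis
    unfolding tracks_def
  proof (intro conjI)
    show "Y \<in> borel_measurable M" using Y_int by (rule borel_measurable_integrable)
    show "\<bar>expectation Y - \<phi> x\<bar> \<le> expectation total_defect + C * e" by (rule mean)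
    have "total_defect \<omega> \<le> C" for \<omega>
      using order_trans[OF total_defect_bound[of \<omega>, unfolded Q_def] C2] .
    then show "\<forall>\<omega>. 0 \<le> total_defect \<omega> \<and> total_defect \<omega> \<le> C" using total_defect_nonneg by blast
  qed (rule total_defect_measurable Bad_events Bad_prob h_le allI[OF Y01]
      | (intro ballI allI impI, erule DiffE, rule path; assumption))+
qed

lemma (in cev_laplace) tracking_schemes:
  assumes uc: "usual_conditions M F" and bm: "brownian_motion M F B"
    and X: "adapted F X" "continuous_paths M X"
    and X_nonneg: "\<And>t \<omega>. t \<ge> 0 \<Longrightarrow> \<omega> \<in> space M \<Longrightarrow> 0 \<le> X t \<omega>"
    and I: "is_ito_integral M F B (\<lambda>t \<omega>. \<sigma> * X t \<omega> powr p) I"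
    and T: "T > 0" and \<epsilon>: "0 < \<epsilon>" "2 * \<epsilon> < x" and K: "K > 0"
  shows "\<exists>C\<ge>0. \<forall>e. 0 < e \<longrightarrow> e \<le> 1 \<longrightarrow> (\<exists>Y D Bad h. tracks M X I x T \<epsilon> K C e Y D Bad h)"
proof -
  obtain C0 where C0: "Taylor_constant 0 3 C0"
    using \<phi>_Taylor[of 0 3] by auto
  have H_adapted: "adapted F (\<lambda>t \<omega>. \<sigma> * X t \<omega> powr p)"
    using X(1) unfolding adapted_def by (auto intro!: borel_measurable_times powr_real_measurable)
  have H_cont: "continuous_paths M (\<lambda>t \<omega>. \<sigma> * X t \<omega> powr p)"
    unfolding continuous_paths_def
  proof
    fix \<omega> assume \<omega>: "\<omega> \<in> space M"
    have "continuous_on {0..} (\<lambda>t. X t \<omega>)" using X(2) \<omega> by (simp add: continuous_paths_def)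
    moreover have "\<forall>t\<in>{0..}. 0 \<le> X t \<omega> \<and> (X t \<omega> = 0 \<longrightarrow> 0 < p)" using X_nonneg \<omega> p by auto
    ultimately show "continuous_on {0..} (\<lambda>t. \<sigma> * X t \<omega> powr p)"
      by (intro continuous_on_mult continuous_on_const continuous_on_powr')
  qed
  have B: "adapted F B" "continuous_paths M B" using bm by (auto simp: brownian_motion_def)
  define c1 where "c1 = T * (2 * (\<bar>\<mu>\<bar> * K / \<epsilon>)\<^sup>2 + 2 * error_constant 3 C0 * (\<bar>\<mu>\<bar> * K / \<epsilon>) ^ 3 + \<alpha>\<^sup>2)
       + 2 * error_constant 3 C0 / \<epsilon> ^ 3 * (2 + 2 * T * (\<sigma>\<^sup>2 * K powr (2 * p)))"
  define c2 where "c2 = T * (\<bar>\<mu>\<bar> * (2 * K + 1) / \<epsilon> + 2 * \<sigma>\<^sup>2 * (K + 1) powr (2 * p) / \<epsilon>\<^sup>2) + 2 * (2 + 2 * T * (\<sigma>\<^sup>2 * K powr (2 * p))) / \<epsilon>\<^sup>2"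
  define g where "g = T * (\<bar>\<mu>\<bar> / \<epsilon> + 4 * p * \<sigma>\<^sup>2 * (K + 1) powr (2 * p - 1) / \<epsilon>\<^sup>2)"
  define c4 where "c4 = 2 / \<epsilon>\<^sup>2 * (2 + T * (\<sigma>\<^sup>2 * K powr (2 * p)))"
  define C where "C = max (max \<bar>c1\<bar> c2) (max (g * (T * \<bar>\<mu>\<bar>)) (g + c4))"
  have C: "c1 \<le> C" "c2 \<le> C" "g * (T * \<bar>\<mu>\<bar>) \<le> C" "g + c4 \<le> C" "C \<ge> 0" by (auto simp: C_def)
  have "\<exists>Y D Bad h. tracks M X I x T \<epsilon> K C e Y D Bad h" if e: "0 < e" "e \<le> 1" for e
  proof -
    from ito_grid_approximation[OF uc B H_adapted H_cont I T e(1)]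
    obtain n c v Bad where approx: "grid_approx M F B (\<lambda>t \<omega>. \<sigma> * X t \<omega> powr p) I T e n c v Bad" by blast
    interpret S: cev_scheme \<mu> \<sigma> p \<alpha> M F B X I x T \<epsilon> K e n c v Bad
      by unfold_locales (rule uc bm X X_nonneg T \<epsilon> K e approx | assumption)+
    from S.scheme_tracks[OF C0 C(1)[unfolded c1_def] C(2)[unfolded c2_def] C(3,4)[unfolded g_def c4_def] \<epsilon>(2)]
    show ?thesis by blast
  qed
  then show ?thesis using C(5) by blast
qed

section \<open>The Laplace transform for the diffusion\<close>

lemma uniform_oscillation:
  fixes u :: "real \<Rightarrow> real"
  assumes u: "continuous_on {0..T} u" and d: "d > 0" and h: "h \<longlonglongrightarrow> 0"
  shows "\<forall>\<^sub>F j in sequentially. \<forall>s\<in>{0..T}. \<forall>t\<in>{0..T}. \<bar>s - t\<bar> \<le> h j \<longrightarrow> \<bar>u s - u t\<bar> \<le> d"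
proof -
  have "uniformly_continuous_on {0..T} u" using u by (rule compact_uniformly_continuous) simp
  then obtain \<eta> where \<eta>: "\<eta> > 0" "\<And>s t. s \<in> {0..T} \<Longrightarrow> t \<in> {0..T} \<Longrightarrow> dist t s < \<eta> \<Longrightarrow> dist (u t) (u s) < d"
    using d unfolding uniformly_continuous_on_def by metis
  have "\<forall>\<^sub>F j in sequentially. h j < \<eta>" using h \<eta>(1) by (rule order_tendstoD(2))
  then show ?thesis
  proof eventually_elim
    case (elim j)
    show ?case
    proof (intro ballI impI)
      fix s t assume "s \<in> {0..T}" "t \<in> {0..T}" "\<bar>s - t\<bar> \<le> h j"
      then show "\<bar>u s - u t\<bar> \<le> d" using \<eta>(2)[of t s] elim by (simp add: dist_real_def)
    qed
  qed
qed

context cev_laplace begin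

text \<open>
  Errors \<open>e j\<close> with a finite sum make almost every path avoid the exceptional events from some
  index on (Borel-Cantelli). On such a path the mesh tends to 0, so uniform continuity makes the scheme follow
  the diffusion as closely as desired. Bounded convergence turns this into \<open>E Y\<^sub>j \<longlongrightarrow> \<phi> x\<close>.
\<close>

lemma diffusion_brackets_bounded:
  fixes M :: "'a measure"
  assumes uc: "usual_conditions M F" and bm: "brownian_motion M F B"
    and dif: "cev_diffusion M F B \<mu> \<sigma> p x X"
    and T: "T > 0" and \<epsilon>: "0 < \<epsilon>" "2 * \<epsilon> < x" and K: "K > 0"
  defines "E \<equiv> {\<omega> \<in> space M. \<forall>t\<in>test_times T. X t \<omega> \<le> K}"
  shows "(\<integral>\<omega>. \<phi> \<epsilon> * discount \<alpha> (hitting_time 0 (\<lambda>t. X t \<omega>)) - exp (- \<alpha> * T) \<partial>M) - measure M (space M - E) \<le> \<phi> x"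
    and "\<phi> x \<le> (\<integral>\<omega>. discount \<alpha> (hitting_time (2 * \<epsilon>) (\<lambda>t. X t \<omega>)) + exp (- \<alpha> * T) \<partial>M) + measure M (space M - E)"
proof -
  interpret prob_space M using uc by (simp add: usual_conditions_def)
  have X: "adapted F X" "continuous_paths M X" and X0: "AE \<omega> in M. X 0 \<omega> = x"
    and X_nonneg: "\<And>t \<omega>. t \<ge> 0 \<Longrightarrow> \<omega> \<in> space M \<Longrightarrow> 0 \<le> X t \<omega>"
    using dif by (auto simp: cev_diffusion_def sde_solution_def)
  obtain I where I: "is_ito_integral M F B (\<lambda>t \<omega>. \<sigma> * X t \<omega> powr p) I"
    and eq: "AE \<omega> in M. \<forall>t\<ge>0. X t \<omega> = x + (LINT s:{0..t}|lborel. \<mu> * X s \<omega>) + I t \<omega>"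
    using dif unfolding cev_diffusion_def sde_solution_def by blast
  note X_M [measurable] = adapted_measurable[OF uc X(1)]
  have cont: "continuous_on {0..} (\<lambda>t. X t \<omega>)" if "\<omega> \<in> space M" for \<omega>
    using X(2) that by (simp add: continuous_paths_def)
  have cont_T: "continuous_on {0..T} (\<lambda>t. X t \<omega>)" if "\<omega> \<in> space M" for \<omega>
    using cont[OF that] by (rule continuous_on_subset) auto
  have E_M: "E \<in> events"
  proof -
    have "E = space M \<inter> (\<Inter>t\<in>test_times T. {\<omega> \<in> space M. X t \<omega> \<le> K})" by (auto simp: E_def)
    also have "\<dots> \<in> events"
    proof (intro sets.Int sets.top sets.countable_INT')
      show "(\<lambda>t. {\<omega> \<in> space M. X t \<omega> \<le> K}) ` test_times T \<subseteq> events"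
      proof (rule image_subsetI)
        fix t assume "t \<in> test_times T"
        then have "t \<ge> 0" using test_times_subset[of T] T by auto
        then show "{\<omega> \<in> space M. X t \<omega> \<le> K} \<in> events" using X_M by measurable
      qed
    qed (rule countable_test_times | simp add: test_times_def)+
    finally show ?thesis .
  qed
  have E_bound: "X t \<omega> \<le> K" if "\<omega> \<in> E" "t \<in> {0..T}" for t \<omega>
    using exceeds_at_test_time[OF cont_T[of \<omega>] that(2), of K] that(1) by (force simp: E_def)
  from tracking_schemes[OF uc bm X X_nonneg I T \<epsilon> K]
  obtain C where C: "C \<ge> 0"
    and ex: "\<And>e. 0 < e \<Longrightarrow> e \<le> 1 \<Longrightarrow> \<exists>Y D Bad h. tracks M X I x T \<epsilon> K C e Y D Bad h" by blast
  define e where "e = (\<lambda>j. (1 / 2) ^ j :: real)"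
  have e: "0 < e j" "e j \<le> 1" for j by (auto simp: e_def power_le_one)
  have e_lim: "e \<longlonglongrightarrow> 0" unfolding e_def by (rule LIMSEQ_power_zero) simp
  have "\<forall>j. \<exists>Y D Bad h. tracks M X I x T \<epsilon> K C (e j) Y D Bad h" using ex e by blast
  then obtain Y D Bad h where tr: "\<And>j. tracks M X I x T \<epsilon> K C (e j) (Y j) (D j) (Bad j) (h j)" by metis
  have Y_M [measurable]: "Y j \<in> borel_measurable M" and D_M [measurable]: "D j \<in> borel_measurable M"
    and Bad_M: "Bad j \<in> events" and Bad_prob: "prob (Bad j) < e j" and h_le: "h j \<le> e j"
    and Y01: "0 \<le> Y j \<omega> \<and> Y j \<omega> \<le> 1" and D_bd: "0 \<le> D j \<omega>" "D j \<omega> \<le> C"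
    and mean: "\<bar>expectation (Y j) - \<phi> x\<bar> \<le> expectation (D j) + C * e j" for j \<omega>
    using tr[of j] unfolding tracks_def by blast+
  have path: "D j \<omega> \<le> C * (d + sqrt (e j)) \<and>
          (X 0 \<omega> = x \<longrightarrow> (\<forall>t\<in>{0..T}. X t \<omega> \<le> K) \<longrightarrow> d \<le> \<epsilon> / 4 \<longrightarrow> T * \<bar>\<mu>\<bar> * d + e j \<le> min (\<epsilon> / 4) 1 \<longrightarrow>
            \<phi> \<epsilon> * discount \<alpha> (hitting_time 0 (\<lambda>t. X t \<omega>)) - exp (- \<alpha> * T) \<le> Y j \<omega> \<and>
            Y j \<omega> \<le> discount \<alpha> (hitting_time (2 * \<epsilon>) (\<lambda>t. X t \<omega>)) + exp (- \<alpha> * T))"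
    if "\<omega> \<in> space M" "\<omega> \<notin> Bad j"
      "\<forall>t\<ge>0. X t \<omega> = x + (LINT s:{0..t}|lborel. \<mu> * X s \<omega>) + I t \<omega>"
      "\<forall>s\<in>{0..T}. \<forall>t\<in>{0..T}. \<bar>s - t\<bar> \<le> e j \<longrightarrow> \<bar>X s \<omega> - X t \<omega>\<bar> \<le> d" for j \<omega> d
  proof -
    have osc: "\<forall>s\<in>{0..T}. \<forall>t\<in>{0..T}. \<bar>s - t\<bar> \<le> h j \<longrightarrow> \<bar>X s \<omega> - X t \<omega>\<bar> \<le> d"
      using that(4) h_le[of j] order_trans by blast
    have "\<forall>\<omega>\<in>space M - Bad j. \<forall>d.
        (\<forall>t\<ge>0. X t \<omega> = x + (LINT s:{0..t}|lborel. \<mu> * X s \<omega>) + I t \<omega>) \<longrightarrow>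
        (\<forall>s\<in>{0..T}. \<forall>t\<in>{0..T}. \<bar>s - t\<bar> \<le> h j \<longrightarrow> \<bar>X s \<omega> - X t \<omega>\<bar> \<le> d) \<longrightarrow>
          D j \<omega> \<le> C * (d + sqrt (e j)) \<and>
          (X 0 \<omega> = x \<longrightarrow> (\<forall>t\<in>{0..T}. X t \<omega> \<le> K) \<longrightarrow> d \<le> \<epsilon> / 4 \<longrightarrow> T * \<bar>\<mu>\<bar> * d + e j \<le> min (\<epsilon> / 4) 1 \<longrightarrow>
            \<phi> \<epsilon> * discount \<alpha> (hitting_time 0 (\<lambda>t. X t \<omega>)) - exp (- \<alpha> * T) \<le> Y j \<omega> \<and>
            Y j \<omega> \<le> discount \<alpha> (hitting_time (2 * \<epsilon>) (\<lambda>t. X t \<omega>)) + exp (- \<alpha> * T))"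
      using tr[of j] unfolding tracks_def by (elim conjE)
    from this[rule_format, OF _ that(3)[rule_format] osc[rule_format]] show ?thesis using that(1,2) by blast
  qed
  have AE_good: "AE \<omega> in M. \<forall>\<^sub>F j in sequentially. \<omega> \<notin> Bad j"
  proof -
    have "summable (\<lambda>j. prob (Bad j))"
    proof (rule summable_comparison_test')
      show "summable e" unfolding e_def by (rule summable_geometric) simp
      show "norm (prob (Bad j)) \<le> e j" for j using Bad_prob[of j] by simp
    qed
    then have "AE \<omega> in M. \<forall>\<^sub>F j in sequentially. \<omega> \<in> space M - Bad j"
      using Bad_M by (intro borel_cantelli_AE1) (auto simp: less_top[symmetric])
    then show ?thesis by (auto elim: eventually_mono)
  qed
  have D_lim: "AE \<omega> in M. (\<lambda>j. D j \<omega>) \<longlonglongrightarrow> 0"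
    using AE_good eq AE_space
  proof eventually_elim
    case (elim \<omega>)
    show ?case
    proof (rule order_tendstoI)
      fix a :: real assume "a < 0"
      then show "\<forall>\<^sub>F j in sequentially. a < D j \<omega>" using D_bd(1) by (intro always_eventually allI) (rule less_le_trans)
    next
      fix a :: real assume a: "0 < a"
      define d where "d = a / (2 * (C + 1))"
      have d: "d > 0" using a C by (simp add: d_def)
      have "(\<lambda>j. sqrt (e j)) \<longlonglongrightarrow> sqrt 0" by (intro tendsto_real_sqrt e_lim)
      then have "\<forall>\<^sub>F j in sequentially. sqrt (e j) < d" using d by (intro order_tendstoD(2)) auto
      with elim(1) uniform_oscillation[OF cont_T[OF elim(3)] d e_lim]
      show "\<forall>\<^sub>F j in sequentially. D j \<omega> < a"
      proof eventually_elim
        case (elim j)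
        have "D j \<omega> \<le> C * (d + sqrt (e j))"
          using path[OF \<open>\<omega> \<in> space M\<close> elim(1) \<open>\<forall>t\<ge>0. X t \<omega> = x + (LINT s:{0..t}|lborel. \<mu> * X s \<omega>) + I t \<omega>\<close> elim(2)] by blast
        also have "\<dots> \<le> C * (d + d)" using elim(3) C by (intro mult_left_mono) auto
        also have "\<dots> < (C + 1) * (d + d)" using d by (intro mult_strict_right_mono) auto
        also have "\<dots> = a"
        proof -
          have "b * (a / (2 * b) + a / (2 * b)) = a" if "b \<noteq> 0" for b using that by (simp add: distrib_left)
          from this[of "C + 1"] show ?thesis using C by (simp add: d_def)
        qed
        finally show "D j \<omega> < a" .
      qed
    qed
  qed
  have "(\<lambda>j. expectation (D j)) \<longlonglongrightarrow> expectation (\<lambda>_. 0)"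
    by (rule integral_dominated_convergence[where w = "\<lambda>_. C"]) (use D_lim D_bd in auto)
  then have "(\<lambda>j. expectation (D j) + C * e j) \<longlonglongrightarrow> 0 + C * 0"
    by (intro tendsto_add tendsto_mult tendsto_const e_lim) simp
  then have "(\<lambda>j. expectation (D j) + C * e j) \<longlonglongrightarrow> 0" by simp
  then have "(\<lambda>j. expectation (Y j) - \<phi> x) \<longlonglongrightarrow> 0"
    by (rule Lim_null_comparison[rotated]) (use mean in \<open>simp add: always_eventually\<close>)
  then have Y_lim: "(\<lambda>j. expectation (Y j)) \<longlonglongrightarrow> \<phi> x" by (rule LIM_zero_cancel)
  define L where "L = (\<lambda>\<omega>. \<phi> \<epsilon> * discount \<alpha> (hitting_time 0 (\<lambda>t. X t \<omega>)) - exp (- \<alpha> * T))"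
  define U where "U = (\<lambda>\<omega>. discount \<alpha> (hitting_time (2 * \<epsilon>) (\<lambda>t. X t \<omega>)) + exp (- \<alpha> * T))"
  have hit_M: "(\<lambda>\<omega>. discount \<alpha> (hitting_time l (\<lambda>t. X t \<omega>))) \<in> borel_measurable M" for l
    by (rule measurable_compose[OF hitting_time_measurable discount_measurable]) (use X_M cont in auto)
  have LU_M: "L \<in> borel_measurable M" "U \<in> borel_measurable M"
    unfolding L_def U_def by (intro borel_measurable_diff borel_measurable_add borel_measurable_times borel_measurable_const hit_M)+
  have LU: "-1 \<le> L \<omega> \<and> L \<omega> \<le> 1 \<and> 0 \<le> U \<omega> \<and> U \<omega> \<le> 2" for \<omega>
  proof -
    have ex: "0 < exp (- \<alpha> * T)" "exp (- \<alpha> * T) \<le> 1" using \<alpha>_pos T by auto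
    have d: "0 \<le> discount \<alpha> t" "discount \<alpha> t \<le> 1" for t
      using discount_nonneg discount_le_1 \<alpha>_pos by auto
    have "0 \<le> \<phi> \<epsilon> * discount \<alpha> t" "\<phi> \<epsilon> * discount \<alpha> t \<le> 1" for t
      using d[of t] \<phi>_nonneg[of \<epsilon>] \<phi>_le_1[of \<epsilon>] by (auto intro: mult_le_one)
    then show ?thesis unfolding L_def U_def using ex d by (smt (verit))
  qed
  have ev: "AE \<omega> in M. \<omega> \<in> E \<longrightarrow> (\<forall>\<^sub>F j in sequentially. L \<omega> \<le> Y j \<omega> \<and> Y j \<omega> \<le> U \<omega>)"
    using AE_good eq X0 AE_space
  proof eventually_elim
    case (elim \<omega>)
    note el = elim
    show ?case
    proof
      assume "\<omega> \<in> E"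
      then have XK: "\<forall>t\<in>{0..T}. X t \<omega> \<le> K" using E_bound by blast
      (* With this m and d both the oscillation and the error of the scheme are below the
         thresholds of the bracketing. *)
      define m where "m = min (\<epsilon> / 8) (1 / 2)"
      define d where "d = min (\<epsilon> / 4) (m / (T * \<bar>\<mu>\<bar> + 1))"
      have m: "m > 0" using \<epsilon> by (simp add: m_def)
      have den: "T * \<bar>\<mu>\<bar> + 1 > 0" using T by (simp add: add_nonneg_pos)
      have d: "d > 0" using m den \<epsilon> by (simp add: d_def)
      have dm: "T * \<bar>\<mu>\<bar> * d \<le> m"
      proof -
        have "T * \<bar>\<mu>\<bar> * d \<le> (T * \<bar>\<mu>\<bar> + 1) * (m / (T * \<bar>\<mu>\<bar> + 1))"
          using T d by (intro mult_mono) (auto simp: d_def)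
        then show ?thesis using den by simp
      qed
      have "\<forall>\<^sub>F j in sequentially. e j < m" using e_lim m by (rule order_tendstoD(2))
      with el(1) uniform_oscillation[OF cont_T[OF el(4)] d e_lim]
      show "\<forall>\<^sub>F j in sequentially. L \<omega> \<le> Y j \<omega> \<and> Y j \<omega> \<le> U \<omega>"
      proof eventually_elim
        case (elim j)
        have "T * \<bar>\<mu>\<bar> * d + e j \<le> min (\<epsilon> / 4) 1" using dm elim(3) by (simp add: m_def)
        moreover have "d \<le> \<epsilon> / 4" unfolding d_def by (rule min.cobounded1)
        ultimately show "L \<omega> \<le> Y j \<omega> \<and> Y j \<omega> \<le> U \<omega>"
          using path[OF el(4) elim(1) el(2) elim(2)] el(3) XK unfolding L_def U_def by blast
      qed
    qed
  qed
  show "(\<integral>\<omega>. \<phi> \<epsilon> * discount \<alpha> (hitting_time 0 (\<lambda>t. X t \<omega>)) - exp (- \<alpha> * T) \<partial>M) - prob (space M - E) \<le> \<phi> x"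
    and "\<phi> x \<le> (\<integral>\<omega>. discount \<alpha> (hitting_time (2 * \<epsilon>) (\<lambda>t. X t \<omega>)) + exp (- \<alpha> * T) \<partial>M) + prob (space M - E)"
    using expectation_limit_bounds[OF Y_M Y01 Y_lim LU_M LU E_M ev] unfolding L_def U_def by blast+
qed

lemma diffusion_brackets:
  fixes M :: "'a measure"
  assumes uc: "usual_conditions M F" and bm: "brownian_motion M F B"
    and dif: "cev_diffusion M F B \<mu> \<sigma> p x X"
    and T: "T > 0" and \<epsilon>: "0 < \<epsilon>" "2 * \<epsilon> < x"
  shows "(\<integral>\<omega>. \<phi> \<epsilon> * discount \<alpha> (hitting_time 0 (\<lambda>t. X t \<omega>)) - exp (- \<alpha> * T) \<partial>M) \<le> \<phi> x"
    and "\<phi> x \<le> (\<integral>\<omega>. discount \<alpha> (hitting_time (2 * \<epsilon>) (\<lambda>t. X t \<omega>)) + exp (- \<alpha> * T) \<partial>M)"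
proof -
  interpret prob_space M using uc by (simp add: usual_conditions_def)
  have X: "adapted F X" "continuous_paths M X"
    using dif by (auto simp: cev_diffusion_def sde_solution_def)
  note X_M = adapted_measurable[OF uc X(1)]
  define E where "E = (\<lambda>k. {\<omega> \<in> space M. \<forall>t\<in>test_times T. X t \<omega> \<le> real (Suc k)})"
  have E_compl: "space M - E k = (\<Union>t\<in>test_times T. {\<omega> \<in> space M. X t \<omega> > real (Suc k)})" for k
    by (auto simp: E_def not_le)
  have lim: "(\<lambda>k. prob (space M - E k)) \<longlonglongrightarrow> 0"
  proof (rule prob_eventually_good)
    fix k
    show "space M - E k \<in> events"
      unfolding E_compl
    proof (rule sets.countable_UN')
      show "(\<lambda>t. {\<omega> \<in> space M. real (Suc k) < X t \<omega>}) ` test_times T \<subseteq> events"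
      proof (rule image_subsetI)
        fix t assume "t \<in> test_times T"
        then have "t \<ge> 0" using test_times_subset[of T] T by auto
        then show "{\<omega> \<in> space M. real (Suc k) < X t \<omega>} \<in> events" using X_M by measurable
      qed
    qed (rule countable_test_times)
  next
    fix \<omega> assume \<omega>: "\<omega> \<in> space M"
    have "continuous_on {0..T} (\<lambda>t. X t \<omega>)"
      using X(2) \<omega> unfolding continuous_paths_def by (auto intro: continuous_on_subset)
    then have "bounded ((\<lambda>t. X t \<omega>) ` {0..T})"
      by (intro compact_imp_bounded compact_continuous_image compact_Icc)
    then obtain b where "\<forall>t\<in>{0..T}. \<bar>X t \<omega>\<bar> \<le> b" by (auto simp: bounded_iff)
    then have b: "\<bar>X t \<omega>\<bar> \<le> b" if "t \<in> {0..T}" for t using that by blast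
    obtain k0 :: nat where k0: "b \<le> real k0" using real_arch_simple by blast
    have "\<omega> \<in> E k" if "k \<ge> k0" for k
      unfolding E_def
    proof (intro CollectI conjI ballI \<omega>)
      fix t assume "t \<in> test_times T"
      then have "t \<in> {0..T}" using test_times_subset[of T] T by auto
      from b[OF this] k0 that show "X t \<omega> \<le> real (Suc k)" by simp
    qed
    then show "\<forall>\<^sub>F k in sequentially. \<omega> \<notin> space M - E k"
      unfolding eventually_sequentially by blast
  qed
  show "(\<integral>\<omega>. \<phi> \<epsilon> * discount \<alpha> (hitting_time 0 (\<lambda>t. X t \<omega>)) - exp (- \<alpha> * T) \<partial>M) \<le> \<phi> x"
  proof (rule LIMSEQ_le_const2)
    show "(\<lambda>k. (\<integral>\<omega>. \<phi> \<epsilon> * discount \<alpha> (hitting_time 0 (\<lambda>t. X t \<omega>)) - exp (- \<alpha> * T) \<partial>M) - prob (space M - E k))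
      \<longlonglongrightarrow> (\<integral>\<omega>. \<phi> \<epsilon> * discount \<alpha> (hitting_time 0 (\<lambda>t. X t \<omega>)) - exp (- \<alpha> * T) \<partial>M)"
      using tendsto_diff[OF tendsto_const lim] by simp
    show "\<exists>N. \<forall>k\<ge>N. (\<integral>\<omega>. \<phi> \<epsilon> * discount \<alpha> (hitting_time 0 (\<lambda>t. X t \<omega>)) - exp (- \<alpha> * T) \<partial>M) - prob (space M - E k) \<le> \<phi> x"
      unfolding E_def by (intro exI allI impI diffusion_brackets_bounded[OF uc bm dif T \<epsilon>]) simp
  qed
  show "\<phi> x \<le> (\<integral>\<omega>. discount \<alpha> (hitting_time (2 * \<epsilon>) (\<lambda>t. X t \<omega>)) + exp (- \<alpha> * T) \<partial>M)"
  proof (rule LIMSEQ_le_const)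
    show "(\<lambda>k. (\<integral>\<omega>. discount \<alpha> (hitting_time (2 * \<epsilon>) (\<lambda>t. X t \<omega>)) + exp (- \<alpha> * T) \<partial>M) + prob (space M - E k))
      \<longlonglongrightarrow> (\<integral>\<omega>. discount \<alpha> (hitting_time (2 * \<epsilon>) (\<lambda>t. X t \<omega>)) + exp (- \<alpha> * T) \<partial>M)"
      using tendsto_add[OF tendsto_const lim] by simp
    show "\<exists>N. \<forall>k\<ge>N. \<phi> x \<le> (\<integral>\<omega>. discount \<alpha> (hitting_time (2 * \<epsilon>) (\<lambda>t. X t \<omega>)) + exp (- \<alpha> * T) \<partial>M) + prob (space M - E k)"
      unfolding E_def by (intro exI allI impI diffusion_brackets_bounded[OF uc bm dif T \<epsilon>]) simp
  qed
qed

lemma diffusion_discount: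
  fixes M :: "'a measure"
  assumes uc: "usual_conditions M F" and bm: "brownian_motion M F B"
    and dif: "cev_diffusion M F B \<mu> \<sigma> p x X" and x: "x > 0"
  shows "(\<integral>\<omega>. discount \<alpha> (hitting_time 0 (\<lambda>t. X t \<omega>)) \<partial>M) = \<phi> x"
proof -
  interpret prob_space M using uc by (simp add: usual_conditions_def)
  have X: "adapted F X" "continuous_paths M X" and X0: "AE \<omega> in M. X 0 \<omega> = x"
    and X_nonneg: "\<And>t \<omega>. t \<ge> 0 \<Longrightarrow> \<omega> \<in> space M \<Longrightarrow> 0 \<le> X t \<omega>"
    using dif by (auto simp: cev_diffusion_def sde_solution_def)
  note X_M = adapted_measurable[OF uc X(1)]
  have cont: "continuous_on {0..} (\<lambda>t. X t \<omega>)" if "\<omega> \<in> space M" for \<omega>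
    using X(2) that by (simp add: continuous_paths_def)
  have hit_M [measurable]: "(\<lambda>\<omega>. discount \<alpha> (hitting_time l (\<lambda>t. X t \<omega>))) \<in> borel_measurable M" for l
    by (rule measurable_compose[OF hitting_time_measurable discount_measurable]) (use X_M cont in auto)
  have d: "0 \<le> discount \<alpha> t" "discount \<alpha> t \<le> 1" for t
    using discount_nonneg discount_le_1 \<alpha>_pos by auto
  define \<epsilon> where "\<epsilon> = (\<lambda>n. (x / 3) / real (Suc n))"
  define T where "T = (\<lambda>n. real (Suc n))"
  have T: "T n > 0" for n by (simp add: T_def)
  have \<epsilon>: "0 < \<epsilon> n" "2 * \<epsilon> n < x" for n
  proof -
    show "0 < \<epsilon> n" using x by (simp add: \<epsilon>_def)
    have "\<epsilon> n \<le> (x / 3) / 1" unfolding \<epsilon>_def using x by (intro divide_left_mono) auto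
    then show "2 * \<epsilon> n < x" using x by simp
  qed
  have \<epsilon>_lim: "\<epsilon> \<longlonglongrightarrow> 0"
    unfolding \<epsilon>_def using LIMSEQ_Suc[OF lim_const_over_n[of "x / 3"]] by simp
  have e_lim: "(\<lambda>n. exp (- \<alpha> * T n)) \<longlonglongrightarrow> 0"
    unfolding T_def using \<alpha>_pos by real_asymp
  have ex: "0 < exp (- \<alpha> * T n)" "exp (- \<alpha> * T n) \<le> 1" for n using \<alpha>_pos T[of n] by auto
  have \<phi>_lim: "(\<lambda>n. \<phi> (\<epsilon> n)) \<longlonglongrightarrow> 1"
  proof -
    obtain C where C: "C \<ge> 0" "\<And>y. y > 0 \<Longrightarrow> 1 - \<phi> y \<le> C * y powr (r / 2)" using \<phi>_near_0 by blast
    have "(\<lambda>n. \<epsilon> n powr (r / 2)) \<longlonglongrightarrow> 0 powr (r / 2)"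
      using r \<epsilon> by (intro tendsto_powr' \<epsilon>_lim tendsto_const) (auto intro!: always_eventually less_imp_le)
    then have "(\<lambda>n. \<epsilon> n powr (r / 2)) \<longlonglongrightarrow> 0" using r by simp
    then have l: "(\<lambda>n. 1 - C * \<epsilon> n powr (r / 2)) \<longlonglongrightarrow> 1 - C * 0"
      by (intro tendsto_diff tendsto_mult tendsto_const)
    show ?thesis
    proof (rule tendsto_sandwich[OF _ _ _ tendsto_const])
      show "(\<lambda>n. 1 - C * \<epsilon> n powr (r / 2)) \<longlonglongrightarrow> 1" using l by simp
      show "\<forall>\<^sub>F n in sequentially. 1 - C * \<epsilon> n powr (r / 2) \<le> \<phi> (\<epsilon> n)"
      proof (intro always_eventually allI)
        fix n show "1 - C * \<epsilon> n powr (r / 2) \<le> \<phi> (\<epsilon> n)" using C(2)[OF \<epsilon>(1)[of n]] by linarith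
      qed
    qed (use \<phi>_le_1 in auto)
  qed
  have "(\<lambda>n. \<integral>\<omega>. \<phi> (\<epsilon> n) * discount \<alpha> (hitting_time 0 (\<lambda>t. X t \<omega>)) - exp (- \<alpha> * T n) \<partial>M)
     \<longlonglongrightarrow> (\<integral>\<omega>. 1 * discount \<alpha> (hitting_time 0 (\<lambda>t. X t \<omega>)) - 0 \<partial>M)"
  proof (rule integral_dominated_convergence[where w = "\<lambda>_. 1"])
    show "AE \<omega> in M. (\<lambda>n. \<phi> (\<epsilon> n) * discount \<alpha> (hitting_time 0 (\<lambda>t. X t \<omega>)) - exp (- \<alpha> * T n))
        \<longlonglongrightarrow> 1 * discount \<alpha> (hitting_time 0 (\<lambda>t. X t \<omega>)) - 0"
      by (intro AE_I2 tendsto_diff tendsto_mult tendsto_const \<phi>_lim e_lim)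
    fix n
    have "norm (\<phi> (\<epsilon> n) * discount \<alpha> t - exp (- \<alpha> * T n)) \<le> 1" for t
    proof -
      have "0 \<le> \<phi> (\<epsilon> n) * discount \<alpha> t" "\<phi> (\<epsilon> n) * discount \<alpha> t \<le> 1"
        using d[of t] \<phi>_nonneg[of "\<epsilon> n"] \<phi>_le_1[of "\<epsilon> n"] by (auto intro: mult_le_one)
      then show ?thesis unfolding real_norm_def using ex[of n] by linarith
    qed
    then show "AE \<omega> in M. norm (\<phi> (\<epsilon> n) * discount \<alpha> (hitting_time 0 (\<lambda>t. X t \<omega>)) - exp (- \<alpha> * T n)) \<le> 1" by simp
  qed (intro borel_measurable_diff borel_measurable_times borel_measurable_const hit_M integrable_const)+
  then have lower: "(\<integral>\<omega>. 1 * discount \<alpha> (hitting_time 0 (\<lambda>t. X t \<omega>)) - 0 \<partial>M) \<le> \<phi> x"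
    by (rule LIMSEQ_le_const2) (use diffusion_brackets(1)[OF uc bm dif T \<epsilon>] in blast)
  have "(\<lambda>n. \<integral>\<omega>. discount \<alpha> (hitting_time (2 * \<epsilon> n) (\<lambda>t. X t \<omega>)) + exp (- \<alpha> * T n) \<partial>M)
     \<longlonglongrightarrow> (\<integral>\<omega>. discount \<alpha> (hitting_time 0 (\<lambda>t. X t \<omega>)) + 0 \<partial>M)"
  proof (rule integral_dominated_convergence[where w = "\<lambda>_. 2"])
    show "AE \<omega> in M. (\<lambda>n. discount \<alpha> (hitting_time (2 * \<epsilon> n) (\<lambda>t. X t \<omega>)) + exp (- \<alpha> * T n))
        \<longlonglongrightarrow> discount \<alpha> (hitting_time 0 (\<lambda>t. X t \<omega>)) + 0"
      using X0 AE_space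
    proof eventually_elim
      case (elim \<omega>)
      have "(\<lambda>n. 2 * \<epsilon> n) \<longlonglongrightarrow> 2 * 0" by (intro tendsto_mult tendsto_const \<epsilon>_lim)
      then have "(\<lambda>n. discount \<alpha> (hitting_time (2 * \<epsilon> n) (\<lambda>t. X t \<omega>))) \<longlonglongrightarrow> discount \<alpha> (hitting_time 0 (\<lambda>t. X t \<omega>))"
        using cont[OF elim(2)] elim x X_nonneg \<alpha>_pos \<epsilon>(1)
        by (intro discount_hitting_time_tendsto) (auto intro: less_imp_le)
      then show ?case by (intro tendsto_add e_lim)
    qed
    fix n
    have "norm (discount \<alpha> t + exp (- \<alpha> * T n)) \<le> 2" for t
      unfolding real_norm_def using d[of t] ex[of n] by linarith
    then show "AE \<omega> in M. norm (discount \<alpha> (hitting_time (2 * \<epsilon> n) (\<lambda>t. X t \<omega>)) + exp (- \<alpha> * T n)) \<le> 2" by simp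
  qed (intro borel_measurable_add borel_measurable_const hit_M integrable_const)+
  then have upper: "\<phi> x \<le> (\<integral>\<omega>. discount \<alpha> (hitting_time 0 (\<lambda>t. X t \<omega>)) + 0 \<partial>M)"
    by (rule LIMSEQ_le_const) (use diffusion_brackets(2)[OF uc bm dif T \<epsilon>] in blast)
  from lower upper show ?thesis by simp
qed

end

section \<open>Weak convergence of the hitting times\<close>

theorem theorem2p1:
  fixes M :: "'a measure" and F :: "real \<Rightarrow> 'a measure"
    and B X :: "real \<Rightarrow> 'a \<Rightarrow> real"
    and N :: "'b measure" and \<xi> :: "nat \<Rightarrow> 'b \<Rightarrow> real"
    and \<mu> \<sigma> p x \<beta> :: real and f :: "ennreal \<Rightarrow> real"
  assumes "\<sigma> > 0" and "1 / 2 \<le> p" and "p < 1" and "x > 0"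
    and "usual_conditions M F" and "brownian_motion M F B"
    and "cev_diffusion M F B \<mu> \<sigma> p x X"
    and "prob_space N"
    and "prob_space.indep_vars N (\<lambda>_. borel) \<xi> {1..}"
    and "\<And>j. j \<ge> 1 \<Longrightarrow> distributed N lborel (\<xi> j) std_normal_density"
    and "0 < \<beta>" and "\<beta> < (1 / 2) / (1 - p)"
    and "continuous_map rho.mtopology euclideanreal f" and "bounded (range f)"
  shows "((\<lambda>\<delta>. \<integral>\<omega>. f (hitting_time (\<delta> powr \<beta>) (em_path \<mu> \<sigma> p x \<delta> (\<lambda>j. \<xi> j \<omega>))) \<partial>N)
            \<longlongrightarrow> (\<integral>\<omega>. f (hitting_time 0 (\<lambda>t. X t \<omega>)) \<partial>M)) (at_right 0)"
proof -
  note uc = \<open>usual_conditions M F\<close> and bm = \<open>brownian_motion M F B\<close> and dif = \<open>cev_diffusion M F B \<mu> \<sigma> p x X\<close>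
  define \<alpha>0 where "\<alpha>0 = 1 + 2 * \<bar>\<mu>\<bar>"
  (* The case distinction only makes the family measurable for non-positive step sizes. *)
  define \<tau> where "\<tau> = (\<lambda>\<delta> \<omega>. if \<delta> > 0 then hitting_time (\<delta> powr \<beta>) (em_path \<mu> \<sigma> p x \<delta> (\<lambda>j. \<xi> j \<omega>)) else \<top>)"
  have \<xi>_M: "\<xi> j \<in> borel_measurable N" if "j \<ge> 1" for j
    using distributed_measurable[OF assms(10)[OF that]] by simp
  have \<tau>_M: "\<tau> \<delta> \<in> borel_measurable N" for \<delta>
  proof (cases "\<delta> > 0")
    case True
    have "\<tau> \<delta> = (\<lambda>\<omega>. hitting_time (\<delta> powr \<beta>) (em_path \<mu> \<sigma> p x \<delta> (\<lambda>j. \<xi> j \<omega>)))" using True by (simp add: \<tau>_def)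
    then show ?thesis using em_hitting_time_measurable[OF True \<xi>_M] by simp
  qed (simp add: \<tau>_def)
  have \<tau>0_M: "(\<lambda>\<omega>. hitting_time 0 (\<lambda>t. X t \<omega>)) \<in> borel_measurable M"
  proof (rule hitting_time_measurable)
    show "X t \<in> borel_measurable M" if "t \<ge> 0" for t
      using dif that by (intro adapted_measurable[OF uc]) (auto simp: cev_diffusion_def sde_solution_def)
  qed (use dif in \<open>simp add: cev_diffusion_def sde_solution_def continuous_paths_def\<close>)
  have "((\<lambda>\<delta>. \<integral>\<omega>. f (\<tau> \<delta> \<omega>) \<partial>N) \<longlongrightarrow> (\<integral>\<omega>. f (hitting_time 0 (\<lambda>t. X t \<omega>)) \<partial>M)) (at_right 0)"
  proof (rule weak_convergence_via_discount[OF assms(8) _ \<tau>_M \<tau>0_M])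
    show "prob_space M" using uc by (simp add: usual_conditions_def)
    show "\<alpha>0 > 0" by (simp add: \<alpha>0_def add_pos_nonneg)
    fix n :: nat assume n: "n \<ge> 1"
    have "1 * \<alpha>0 \<le> real n * \<alpha>0" using n by (intro mult_right_mono) (auto simp: \<alpha>0_def)
    then interpret cev_laplace \<mu> \<sigma> p "real n * \<alpha>0"
      using assms(1-3) by unfold_locales (auto simp: \<alpha>0_def)
    have "((\<lambda>\<delta>. \<integral>\<omega>. discount (real n * \<alpha>0) (hitting_time (\<delta> powr \<beta>) (em_path \<mu> \<sigma> p x \<delta> (\<lambda>j. \<xi> j \<omega>))) \<partial>N)
        \<longlongrightarrow> \<phi> x) (at_right 0)"
      using assms by (intro em_discount_limit) auto
    moreover have "\<forall>\<^sub>F \<delta> in at_right 0. (\<integral>\<omega>. discount (real n * \<alpha>0) (hitting_time (\<delta> powr \<beta>) (em_path \<mu> \<sigma> p x \<delta> (\<lambda>j. \<xi> j \<omega>))) \<partial>N)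
        = (\<integral>\<omega>. discount (real n * \<alpha>0) (\<tau> \<delta> \<omega>) \<partial>N)"
      using eventually_at_right_less[of "0::real"] by eventually_elim (simp add: \<tau>_def)
    ultimately show "((\<lambda>\<delta>. \<integral>\<omega>. discount (real n * \<alpha>0) (\<tau> \<delta> \<omega>) \<partial>N)
        \<longlongrightarrow> (\<integral>\<omega>. discount (real n * \<alpha>0) (hitting_time 0 (\<lambda>t. X t \<omega>)) \<partial>M)) (at_right 0)"
      unfolding diffusion_discount[OF uc bm dif assms(4)] by (rule Lim_transform_eventually)
  qed (rule assms(13))
  moreover have "\<forall>\<^sub>F \<delta> in at_right 0. (\<integral>\<omega>. f (\<tau> \<delta> \<omega>) \<partial>N)
      = (\<integral>\<omega>. f (hitting_time (\<delta> powr \<beta>) (em_path \<mu> \<sigma> p x \<delta> (\<lambda>j. \<xi> j \<omega>))) \<partial>N)"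
    using eventually_at_right_less[of "0::real"] by eventually_elim (simp add: \<tau>_def)
  ultimately show ?thesis by (rule Lim_transform_eventually)
qed

end
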